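(* Consider $X=T^*S^1\times S^2$ with the product symplectic form $\omega=\omega_{T^*S^1}\oplus\omega_{S^2}$, $\int_{S^2}\omega_{S^2}=2$, and moment polytope $\Delta=\mathbb{R}\times[-1,1]$. The classification of toric fibres $T(x)=T(x_1,x_2)$, $x\in\operatorname{int}\Delta$, is given by $$\mathfrak{H}_x=\{(x_1+2kx_2,\pm x_2):k\in\mathbb{Z}\}.$$ Furthermore, all Hamiltonian monodromy groups $\mathcal{H}_{T(x)}$ are trivial, except for $x_2=0$, in which case $$\mathcal{H}_{T(x_1,0)}=\left\{\begin{pmatrix}1&0\\2k&\pm1\end{pmatrix}: k\in\mathbb{Z}\right\}.$$
   Context: $T^*S^1=S^1\times\mathbb{R}$, $S^1=\mathbb{R}/\mathbb{Z}$, carries the standard exact symplectic form with moment map the projection to $\mathbb{R}$; $S^2$ carries the area form of total area $2$ with moment map the height function normalized to have image $[-1,1]$ (generating the standard $S^1=\mathbb{R}/\mathbb{Z}$ rotation). $X$ carries the product toric structure with moment map $\mu:X\to\mathbb{R}^2$. For $x\in\operatorname{int}\Delta=\mathbb{R}\times(-1,1)$ the toric fibre is the Lagrangian torus $T(x)=\mu^{-1}(x)$, a free $T^2$-orbit, so $H_1(T(x);\mathbb{Z})=\mathbb{Z}^2$ canonically; matrices act on column vectors in the standard basis $e_1,e_2$. Write $T(x)\cong T(x')$ if a Hamiltonian diffeomorphism of $X$ (time-one map of a compactly supported time-dependent Hamiltonian) maps $T(x)$ to $T(x')$; $\mathfrak{H}_x=\{x'\in\operatorname{int}\Delta:T(x)\cong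 T(x')\}$. For a compact Lagrangian $L\subset X$, $\mathcal{H}_L=\{(\phi|_L)_*\in\operatorname{Aut}H_1(L;\mathbb{Z}):\phi\in\operatorname{Ham}(X,\omega),\ \phi(L)=L\}$. *)

theory Defs
  imports "HOL-Analysis.Analysis" "HOL-Homology.Homology" "HOL-Algebra.Bij"
begin

section \<open>Smooth functions\<close>

primrec C_k_on :: "nat \<Rightarrow> ('a::real_normed_vector \<Rightarrow> real) \<Rightarrow> 'a set \<Rightarrow> bool" where
  "C_k_on 0 f U \<longleftrightarrow> continuous_on U f"
| "C_k_on (Suc k) f U \<longleftrightarrow>
     (\<forall>x\<in>U. f differentiable (at x)) \<and>
     (\<forall>v. C_k_on k (\<lambda>x. frechet_derivative f (at x) v) U)"

text \<open>Only used for open sets.\<close>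
definition smooth_on :: "('a::real_normed_vector \<Rightarrow> real) \<Rightarrow> 'a set \<Rightarrow> bool" where
  "smooth_on f U \<longleftrightarrow> open U \<and> (\<forall>k. C_k_on k f U)"


section \<open>The symplectic manifold \<open>T\<^sup>*S\<^sup>1 \<times> S\<^sup>2\<close>\<close>

text \<open>The cotangent bundle of the circle \<open>\<real>/\<int>\<close> is \<open>S\<^sup>1 \<times> \<real>\<close>, with \<open>q mod \<int>\<close> represented by the
  unit complex number \<open>exp(2\<pi>iq)\<close>; the sphere is the unit sphere of \<open>\<real>\<^sup>3\<close>. Thus the manifold is a
  closed submanifold of a Euclidean space, and tangent vectors are vectors of that space.\<close>

type_synonym ambient = "complex \<times> real \<times> (real^3)"

definition TS1xS2 :: "ambient set" where
  "TS1xS2 = {(z, p, u). norm z = 1 \<and> norm u = 1}"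

fun tangent_space :: "ambient \<Rightarrow> ambient set" where
  "tangent_space (z, p, u) = {(a, r, v). z \<bullet> a = 0 \<and> u \<bullet> v = 0}"

text \<open>The form \<open>dq\<close> at \<open>z = exp(2\<pi>iq)\<close>; the unit vector tangent to the circle is \<open>\<i>z\<close>.\<close>
definition dq :: "complex \<Rightarrow> complex \<Rightarrow> real" where
  "dq z a = ((\<i> * z) \<bullet> a) / (2 * pi)"

text \<open>\<open>dq \<and> dp\<close>, the exact form \<open>- d(p dq)\<close>. With the convention \<open>\<omega>(X\<^sub>H, \<cdot>) = dH\<close> used below, \<open>p\<close>
  generates the rotation in the positive direction.\<close>
fun omega_TS1 :: "complex \<times> real \<Rightarrow> complex \<times> real \<Rightarrow> complex \<times> real \<Rightarrow> real" where
  "omega_TS1 (z, p) (a, r) (a', r') = dq z a * r' - dq z a' * r"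

text \<open>The Euclidean area form \<open>det(u, v, v')\<close> has total area \<open>4\<pi>\<close>; dividing by \<open>2\<pi>\<close> gives total
  area \<open>2\<close>.\<close>
definition omega_S2 :: "real^3 \<Rightarrow> real^3 \<Rightarrow> real^3 \<Rightarrow> real" where
  "omega_S2 u v v' = (u \<bullet> cross3 v v') / (2 * pi)"

fun omega :: "ambient \<Rightarrow> ambient \<Rightarrow> ambient \<Rightarrow> real" where
  "omega (z, p, u) (a, r, v) (a', r', v') =
     omega_TS1 (z, p) (a, r) (a', r') + omega_S2 u v v'"


section \<open>Hamiltonian diffeomorphisms\<close>

text \<open>The vector \<open>\<xi>\<close> is the value at \<open>y\<close> of the Hamiltonian vector field of a function with
  differential \<open>l\<close> at \<open>y\<close>. Only the restriction of \<open>l\<close> to the tangent space of \<open>TS1xS2\<close> matters.\<close>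
definition is_ham_vector :: "ambient \<Rightarrow> (ambient \<Rightarrow> real) \<Rightarrow> ambient \<Rightarrow> bool" where
  "is_ham_vector y l \<xi> \<longleftrightarrow>
     \<xi> \<in> tangent_space y \<and> (\<forall>w \<in> tangent_space y. omega y \<xi> w = l w)"

text \<open>As usual for closed submanifolds of a Euclidean space, a smooth function on \<open>[0,1] \<times> TS1xS2\<close> is
  given by a smooth function \<open>H\<close> on an open neighbourhood \<open>U\<close>. The support condition concerns the
  restriction to \<open>TS1xS2\<close> only.\<close>
definition admissible_hamiltonian :: "(real \<Rightarrow> ambient \<Rightarrow> real) \<Rightarrow> bool" where
  "admissible_hamiltonian H \<longleftrightarrow>
     (\<exists>U. {0..1} \<times> TS1xS2 \<subseteq> U \<and> smooth_on (\<lambda>(t, y). H t y) U) \<and>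
     (\<exists>K. compact K \<and> K \<subseteq> TS1xS2 \<and> (\<forall>t\<in>{0..1}. \<forall>y\<in>TS1xS2 - K. H t y = 0))"

text \<open>The values of \<open>\<phi>\<close> outside \<open>TS1xS2\<close> are irrelevant.\<close>
definition hamiltonian_diffeo :: "(ambient \<Rightarrow> ambient) \<Rightarrow> bool" where
  "hamiltonian_diffeo \<phi> \<longleftrightarrow>
     (\<exists>H. admissible_hamiltonian H \<and>
       (\<forall>x\<in>TS1xS2. \<exists>\<gamma>. \<gamma> 0 = x \<and> \<gamma> 1 = \<phi> x \<and>
         (\<forall>t\<in>{0..1}. \<gamma> t \<in> TS1xS2 \<and>
           (\<exists>\<xi>. is_ham_vector (\<gamma> t) (frechet_derivative (H t) (at (\<gamma> t))) \<xi> \<and>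
                (\<gamma> has_vector_derivative \<xi>) (at t within {0..1})))))"


section \<open>Toric structure\<close>

fun moment_map :: "ambient \<Rightarrow> real \<times> real" where
  "moment_map (z, p, u) = (p, u $ 3)"

definition Delta :: "(real \<times> real) set" where
  "Delta = UNIV \<times> {-1..1}"

text \<open>The action of \<open>(s mod \<int>, t mod \<int>) \<in> T\<^sup>2\<close>.\<close>
fun torus_act :: "real \<times> real \<Rightarrow> ambient \<Rightarrow> ambient" where
  "torus_act (s, t) (z, p, u) =
     (cis (2 * pi * s) * z, p,
      vector [cos (2 * pi * t) * u $ 1 - sin (2 * pi * t) * u $ 2,
              sin (2 * pi * t) * u $ 1 + cos (2 * pi * t) * u $ 2,
              u $ 3])"

definition toric_fibre :: "real \<times> real \<Rightarrow> ambient set" where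
  "toric_fibre x = {y \<in> TS1xS2. moment_map y = x}"

definition fibre_equiv :: "real \<times> real \<Rightarrow> real \<times> real \<Rightarrow> bool" where
  "fibre_equiv x x' \<longleftrightarrow> (\<exists>\<phi>. hamiltonian_diffeo \<phi> \<and> \<phi> ` toric_fibre x = toric_fibre x')"

definition frakH :: "real \<times> real \<Rightarrow> (real \<times> real) set" where
  "frakH x = {x' \<in> interior Delta. fibre_equiv x x'}"


section \<open>Hamiltonian monodromy\<close>

abbreviation H1 :: "ambient set \<Rightarrow> ambient chain set monoid" where
  "H1 L \<equiv> homology_group 1 (top_of_set L)"

text \<open>Automorphisms are extensional functions, as in \<open>AutoGroup\<close>.\<close>
definition ham_monodromy :: "ambient set \<Rightarrow> (ambient chain set \<Rightarrow> ambient chain set) set" where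
  "ham_monodromy L =
     {restrict (hom_induced 1 (top_of_set L) {} (top_of_set L) {} \<phi>) (carrier (H1 L)) | \<phi>.
        hamiltonian_diffeo \<phi> \<and> \<phi> ` L = L}"

text \<open>The identification of \<open>\<int>\<^sup>2 = H\<^sub>1(T\<^sup>2)\<close> with the first homology of a fibre induced by an orbit
  map of the free torus action; it does not depend on the base point, which is chosen explicitly.\<close>

definition base_point :: "real \<times> real \<Rightarrow> ambient" where
  "base_point x = (1, fst x, vector [sqrt (1 - (snd x)\<^sup>2), 0, snd x])"

text \<open>The coordinate \<open>\<sigma> 1\<close> parametrizes the standard 1-simplex by \<open>[0,1]\<close>, so for integral \<open>d\<close> this is the
  class of the loop \<open>t \<mapsto> td \<cdot> base point\<close>.\<close>
definition orbit_loop_class :: "real \<times> real \<Rightarrow> real \<times> real \<Rightarrow> ambient chain set" where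
  "orbit_loop_class x d =
     homologous_rel_set 1 (top_of_set (toric_fibre x)) {}
       (frag_of (\<lambda>\<sigma> \<in> standard_simplex 1. torus_act (\<sigma> 1 *\<^sub>R d) (base_point x)))"

definition lattice_to_H1 :: "real \<times> real \<Rightarrow> int^2 \<Rightarrow> ambient chain set" where
  "lattice_to_H1 x v =
     orbit_loop_class x (1, 0) [^]\<^bsub>H1 (toric_fibre x)\<^esub> (v $ 1)
       \<otimes>\<^bsub>H1 (toric_fibre x)\<^esub>
     orbit_loop_class x (0, 1) [^]\<^bsub>H1 (toric_fibre x)\<^esub> (v $ 2)"

text \<open>The endomorphism of the first homology of a fibre given by a matrix acting on columns.\<close>
definition matrix_on_H1 :: "real \<times> real \<Rightarrow> int^2^2 \<Rightarrow> (ambient chain set \<Rightarrow> ambient chain set)" where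
  "matrix_on_H1 x A =
     (\<lambda>c \<in> carrier (H1 (toric_fibre x)). lattice_to_H1 x (A *v inv_into UNIV (lattice_to_H1 x) c))"

end

theory Submission
  imports Defs
begin

text \<open>Let \<open>\<phi>\<^sub>t\<close> be a Hamiltonian isotopy with \<open>\<phi>\<^sub>1(T(x)) = T(x')\<close>. Each torus \<open>\<phi>\<^sub>t(T(x))\<close> is Lagrangian, so the
  complex determinant of its tangent planes does not vanish; normalized, it is a unit vector \<open>w\<close> tangent
  to the sphere, and \<open>(u, w, u \<times> w)\<close> is a frame along the torus. Three quantities of a loop in the torus
  do not change with \<open>t\<close>: its winding number around the circle; the integral of \<open>p dq\<close> plus the
  connection form \<open>w' \<bullet> (u \<times> w) / 2\<pi>\<close>, whose curvature is the area form; and the class of the frame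
  in \<open>\<pi>\<^sub>1(SO(3)) = \<int>/2\<close>. For the loop \<open>(a, b)\<close> in \<open>T(x)\<close> they are \<open>a\<close>, \<open>a x\<^sub>1 + b x\<^sub>2\<close> and \<open>b mod 2\<close>.
  Hence \<open>\<phi>\<^sub>1\<close> maps the class \<open>(1, 0)\<close> to \<open>(1, l)\<close> with \<open>l\<close> even and \<open>x\<^sub>1 = x'\<^sub>1 + l x'\<^sub>2\<close>, and \<open>(0, 1)\<close> to
  \<open>(0, d)\<close> with \<open>x\<^sub>2 = d x'\<^sub>2\<close>, where \<open>d = \<plusminus>1\<close>. All these cases are realized by half turns of the
  sphere about a horizontal axis that rotates \<open>k\<close> times as \<open>q\<close> runs through the circle.\<close>

subsection \<open>Smooth functions\<close>

text \<open>The area form of the sphere is not exact, so a loop has no action of its own. The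
  cotangent factor has trivial tangent bundle, hence the complex determinant of a Lagrangian plane
  is a vector tangent to the sphere; the unit field that it gives along the torus trivializes the
  tangent bundle of the sphere pulled back to the torus, and its connection form is a primitive of
  the area form there. For an isotopy generated by \<open>H\<close> the defect of invariance is the
  derivative of \<open>H\<close> along the loop, which integrates to zero. When
  \<open>x2 = 0\<close> the action says nothing about \<open>l\<close> and \<open>d\<close>:
  evenness of \<open>l\<close> then rests on the class of the frame, and \<open>d\<close> is a unit
  because the map is invertible on the fibre. The obstacle is regularity.
  \<open>hamiltonian_diffeo\<close> supplies one integral curve per point and no dependence on the
  point. The frame contains first derivatives of the flow in the torus directions, and its
  connection form differentiates once more, so two derivatives in the initial point are extracted
  from Gronwall estimates.\<close>

lemma C_k_on_cong:
  fixes f g :: "'a::real_normed_vector \<Rightarrow> real"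
  assumes "open U" "\<And>x. x \<in> U \<Longrightarrow> f x = g x"
  shows "C_k_on k f U \<longleftrightarrow> C_k_on k g U"
  using assms(2)
proof (induction k arbitrary: f g)
  case 0
  then show ?case by (auto cong: continuous_on_cong)
next
  case (Suc k)
  have d: "(f has_derivative D) (at x) \<longleftrightarrow> (g has_derivative D) (at x)" if "x \<in> U" for x D
    using has_derivative_transform_within_open[OF _ assms(1) that, of f D UNIV g]
      has_derivative_transform_within_open[OF _ assms(1) that, of g D UNIV f] Suc.prems by auto
  have "frechet_derivative f (at x) = frechet_derivative g (at x)" if "x \<in> U" for x
    unfolding frechet_derivative_def using d[OF that] by simp
  then have "C_k_on k (\<lambda>x. frechet_derivative f (at x) v) U \<longleftrightarrow>
      C_k_on k (\<lambda>x. frechet_derivative g (at x) v) U" for v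
    by (intro Suc.IH) auto
  moreover have "f differentiable (at x) \<longleftrightarrow> g differentiable (at x)" if "x \<in> U" for x
    using d[OF that] by (auto simp: differentiable_def)
  ultimately show ?case by auto
qed

text \<open>Allows any explicit derivative \<open>f'\<close> in place of
  \<open>frechet_derivative\<close>; the inductions for sums, products and inverses run on the
  formula for \<open>f'\<close>.\<close>

lemma C_k_on_SucI:
  fixes f :: "'a::real_normed_vector \<Rightarrow> real"
  assumes "open U" "\<And>x. x \<in> U \<Longrightarrow> (f has_derivative f' x) (at x)" "\<And>v. C_k_on k (\<lambda>x. f' x v) U"
  shows "C_k_on (Suc k) f U"
proof -
  have e: "frechet_derivative f (at x) = f' x" if "x \<in> U" for x
    using frechet_derivative_at[OF assms(2)[OF that]] by simp
  have "C_k_on k (\<lambda>x. frechet_derivative f (at x) v) U" for v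
    using C_k_on_cong[OF assms(1), of "\<lambda>x. frechet_derivative f (at x) v" "\<lambda>x. f' x v" k] e assms(3) by auto
  then show ?thesis using assms(2) by (auto simp: differentiable_def)
qed

lemma C_k_on_Suc_D:
  assumes "C_k_on (Suc k) f U"
  shows "x \<in> U \<Longrightarrow> (f has_derivative frechet_derivative f (at x)) (at x)"
    and "C_k_on k (\<lambda>x. frechet_derivative f (at x) v) U"
  using assms by (auto simp: frechet_derivative_works[symmetric])

lemma C_k_on_Suc_imp: "C_k_on (Suc k) f U \<Longrightarrow> C_k_on k f U"
proof (induction k arbitrary: f)
  case 0
  then show ?case
    by (auto intro!: differentiable_imp_continuous_on differentiable_at_imp_differentiable_on)
next
  case (Suc k)
  have "C_k_on k (\<lambda>x. frechet_derivative f (at x) v) U" for v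
    using Suc.IH Suc.prems C_k_on_Suc_D(2) by blast
  then show ?case using Suc.prems by auto
qed

lemma C_k_on_imp_continuous: "C_k_on k f U \<Longrightarrow> continuous_on U f"
proof (induction k)
  case (Suc k) then show ?case using C_k_on_Suc_imp by blast
qed auto

lemma C_k_on_const: "C_k_on k (\<lambda>x. c) U"
  by (induction k arbitrary: c) auto

lemma C_k_on_linear: "open U \<Longrightarrow> bounded_linear f \<Longrightarrow> C_k_on k f U"
proof (cases k)
  case 0
  assume "bounded_linear f" then show ?thesis using 0 by (auto intro: linear_continuous_on)
next
  case (Suc l)
  assume "open U" "bounded_linear f"
  then show ?thesis unfolding Suc
    by (intro C_k_on_SucI[of U f "\<lambda>_. f"]) (auto intro: bounded_linear_imp_has_derivative C_k_on_const)
qed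

lemma C_k_on_add:
  "open U \<Longrightarrow> C_k_on k f U \<Longrightarrow> C_k_on k g U \<Longrightarrow> C_k_on k (\<lambda>x. f x + g x) U"
proof (induction k arbitrary: f g)
  case 0
  then show ?case by (auto intro: continuous_intros)
next
  case (Suc k)
  show ?case
  proof (rule C_k_on_SucI[OF Suc.prems(1)])
    show "((\<lambda>x. f x + g x) has_derivative (\<lambda>v. frechet_derivative f (at x) v + frechet_derivative g (at x) v)) (at x)"
      if "x \<in> U" for x
      using that by (intro has_derivative_add C_k_on_Suc_D(1)[OF Suc.prems(2)] C_k_on_Suc_D(1)[OF Suc.prems(3)])
    show "C_k_on k (\<lambda>x. frechet_derivative f (at x) v + frechet_derivative g (at x) v) U" for v
      by (intro Suc.IH Suc.prems(1) C_k_on_Suc_D(2)[OF Suc.prems(2)] C_k_on_Suc_D(2)[OF Suc.prems(3)])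
  qed
qed

lemma C_k_on_mult:
  "open U \<Longrightarrow> C_k_on k f U \<Longrightarrow> C_k_on k g U \<Longrightarrow> C_k_on k (\<lambda>x. f x * g x) U"
proof (induction k arbitrary: f g)
  case 0
  then show ?case by (auto intro: continuous_intros)
next
  case (Suc k)
  show ?case
  proof (rule C_k_on_SucI[OF Suc.prems(1)])
    show "((\<lambda>x. f x * g x) has_derivative
        (\<lambda>v. f x * frechet_derivative g (at x) v + frechet_derivative f (at x) v * g x)) (at x)"
      if "x \<in> U" for x
      using that by (intro has_derivative_mult C_k_on_Suc_D(1)[OF Suc.prems(2)] C_k_on_Suc_D(1)[OF Suc.prems(3)])
    show "C_k_on k (\<lambda>x. f x * frechet_derivative g (at x) v + frechet_derivative f (at x) v * g x) U" for v
      by (intro C_k_on_add Suc.IH Suc.prems(1) C_k_on_Suc_D(2)[OF Suc.prems(2)] C_k_on_Suc_D(2)[OF Suc.prems(3)]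
          C_k_on_Suc_imp[OF Suc.prems(2)] C_k_on_Suc_imp[OF Suc.prems(3)])
  qed
qed

lemma C_k_on_inverse:
  "open U \<Longrightarrow> C_k_on k f U \<Longrightarrow> (\<And>x. x \<in> U \<Longrightarrow> f x \<noteq> 0) \<Longrightarrow> C_k_on k (\<lambda>x. inverse (f x)) U"
proof (induction k)
  case 0
  then show ?case by (auto intro: continuous_on_inverse)
next
  case (Suc k)
  have 1: "C_k_on k (\<lambda>x. inverse (f x)) U"
    by (rule Suc.IH) (use Suc.prems C_k_on_Suc_imp in auto)
  show ?case
  proof (rule C_k_on_SucI[OF Suc.prems(1)])
    show "((\<lambda>x. inverse (f x)) has_derivative
        (\<lambda>v. (- 1) * (inverse (f x) * frechet_derivative f (at x) v * inverse (f x)))) (at x)"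
      if "x \<in> U" for x
      using Deriv.has_derivative_inverse[OF Suc.prems(3)[OF that] C_k_on_Suc_D(1)[OF Suc.prems(2) that]]
      by simp
    show "C_k_on k (\<lambda>x. (- 1) * (inverse (f x) * frechet_derivative f (at x) v * inverse (f x))) U" for v
      by (intro C_k_on_mult 1 C_k_on_const Suc.prems(1) C_k_on_Suc_D(2)[OF Suc.prems(2)])
  qed
qed

text \<open>The class of such composites is closed under differentiation: the derivative in
  direction \<open>v\<close> is the derivative of \<open>f\<close> in the fixed direction
  \<open>L v\<close>, composed with the same affine map.\<close>

lemma C_k_on_affine_compose:
  fixes f :: "'b::real_normed_vector \<Rightarrow> real" and L :: "'a::real_normed_vector \<Rightarrow> 'b"
  assumes L: "bounded_linear L" and V: "open V" and VU: "\<And>x. x \<in> V \<Longrightarrow> L x + c \<in> U"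
  shows "C_k_on k f U \<Longrightarrow> C_k_on k (\<lambda>x. f (L x + c)) V"
proof (induction k arbitrary: f)
  case 0
  have "continuous_on V (\<lambda>x. L x + c)"
    using L by (intro continuous_intros linear_continuous_on)
  then show ?case using 0 VU by (auto intro: continuous_on_compose2)
next
  case (Suc k)
  show ?case
  proof (rule C_k_on_SucI[OF V])
    show "((\<lambda>x. f (L x + c)) has_derivative (\<lambda>v. frechet_derivative f (at (L x + c)) (L v))) (at x)"
      if "x \<in> V" for x
    proof -
      have "((\<lambda>x. L x + c) has_derivative L) (at x)"
        using L by (auto intro!: derivative_eq_intros bounded_linear_imp_has_derivative)
      from has_derivative_compose[OF this C_k_on_Suc_D(1)[OF Suc.prems VU[OF that]]]
      show ?thesis .
    qed
    show "C_k_on k (\<lambda>x. frechet_derivative f (at (L x + c)) (L v)) V" for v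
      by (rule Suc.IH[OF C_k_on_Suc_D(2)[OF Suc.prems]])
  qed
qed

lemma smooth_on_cong: "open U \<Longrightarrow> (\<And>x. x \<in> U \<Longrightarrow> f x = g x) \<Longrightarrow> smooth_on f U \<longleftrightarrow> smooth_on g U"
  unfolding smooth_on_def using C_k_on_cong[of U f g] by auto

lemma smooth_on_const: "open U \<Longrightarrow> smooth_on (\<lambda>x. c) U"
  and smooth_on_linear: "open U \<Longrightarrow> bounded_linear f \<Longrightarrow> smooth_on f U"
  and smooth_on_add: "smooth_on f U \<Longrightarrow> smooth_on g U \<Longrightarrow> smooth_on (\<lambda>x. f x + g x) U"
  and smooth_on_mult: "smooth_on f U \<Longrightarrow> smooth_on g U \<Longrightarrow> smooth_on (\<lambda>x. f x * g x) U"
  and smooth_on_inverse: "smooth_on f U \<Longrightarrow> (\<And>x. x \<in> U \<Longrightarrow> f x \<noteq> 0) \<Longrightarrow> smooth_on (\<lambda>x. inverse (f x)) U"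
  unfolding smooth_on_def
  by (auto intro: C_k_on_const C_k_on_linear C_k_on_add C_k_on_mult C_k_on_inverse)

lemma smooth_on_minus: "smooth_on f U \<Longrightarrow> smooth_on (\<lambda>x. - f x) U"
  using smooth_on_mult[OF smooth_on_const, of U f "-1"] by (auto simp: smooth_on_def)

lemma smooth_on_diff: "smooth_on f U \<Longrightarrow> smooth_on g U \<Longrightarrow> smooth_on (\<lambda>x. f x - g x) U"
  using smooth_on_add[OF _ smooth_on_minus, of f U g] by simp

lemma smooth_on_sum:
  "open U \<Longrightarrow> (\<And>i. i \<in> I \<Longrightarrow> smooth_on (f i) U) \<Longrightarrow> smooth_on (\<lambda>x. \<Sum>i\<in>I. f i x) U"
  by (induction I rule: infinite_finite_induct) (auto intro: smooth_on_const smooth_on_add)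

lemma smooth_on_affine_compose:
  assumes "smooth_on f U" "bounded_linear L" "open V" "\<And>x. x \<in> V \<Longrightarrow> L x + c \<in> U"
  shows "smooth_on (\<lambda>x. f (L x + c)) V"
  using assms C_k_on_affine_compose[of L V c U] unfolding smooth_on_def by auto

lemma smooth_on_linear_compose:
  assumes "smooth_on f U" "bounded_linear L" "open V" "\<And>x. x \<in> V \<Longrightarrow> L x \<in> U"
  shows "smooth_on (\<lambda>x. f (L x)) V"
  using smooth_on_affine_compose[of f U L V 0] assms by simp

lemma smooth_on_has_derivative:
  "smooth_on f U \<Longrightarrow> x \<in> U \<Longrightarrow> (f has_derivative frechet_derivative f (at x)) (at x)"
  unfolding smooth_on_def using C_k_on_Suc_D(1) by blast

lemma smooth_on_frechet_derivative:
  "smooth_on f U \<Longrightarrow> smooth_on (\<lambda>x. frechet_derivative f (at x) v) U"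
  unfolding smooth_on_def using C_k_on_Suc_D(2) by blast

lemma smooth_on_imp_continuous_on: "smooth_on f U \<Longrightarrow> continuous_on U f"
  unfolding smooth_on_def using C_k_on_imp_continuous by blast

subsection \<open>Cutoff functions\<close>

text \<open>For \<open>P = 1\<close> this is the classical flat function
  \<open>exp (- 1 / x)\<close>. The polynomial factor is carried along because the family is then
  closed under differentiation.\<close>

definition bump_poly :: "real poly \<Rightarrow> real \<Rightarrow> real" where
  "bump_poly P x = (if x > 0 then poly P (1 / x) * exp (- (1 / x)) else 0)"

lemma poly_exp_tendsto_0:
  fixes P :: "real poly"
  shows "((\<lambda>y. poly P y * exp (- y)) \<longlongrightarrow> 0) at_top"
proof -
  have "((\<lambda>y. \<Sum>i\<le>Polynomial.degree P. Polynomial.coeff P i * (y ^ i / exp y)) \<longlongrightarrow> (\<Sum>i\<le>Polynomial.degree P. Polynomial.coeff P i * 0)) at_top"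
    by (intro tendsto_intros tendsto_power_div_exp_0)
  then show ?thesis
    by (simp add: poly_altdef sum_distrib_right exp_minus divide_inverse mult.assoc)
qed

text \<open>This is the difference quotient at the origin. From the right, the substitution
  \<open>y = 1 / x\<close> turns the division by \<open>x\<close> into one more factor
  \<open>y\<close>, absorbed by \<open>pCons 0 P\<close>.\<close>

lemma bump_poly_over_x_tendsto: "((\<lambda>x. bump_poly P x / x) \<longlongrightarrow> 0) (at 0)"
proof -
  have "((\<lambda>y. poly (pCons 0 P) y * exp (- y)) \<longlongrightarrow> 0) at_top"
    by (rule poly_exp_tendsto_0)
  then have "((\<lambda>x. poly (pCons 0 P) (inverse x) * exp (- inverse x)) \<longlongrightarrow> 0) (at_right (0::real))"
    by (rule filterlim_compose[OF _ filterlim_inverse_at_top_right])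
  moreover have "\<forall>\<^sub>F x in at_right (0::real). poly (pCons 0 P) (inverse x) * exp (- inverse x) = bump_poly P x / x"
    unfolding eventually_at_right_field
    by (intro exI[of _ 1]) (auto simp: bump_poly_def divide_inverse)
  ultimately have r: "((\<lambda>x. bump_poly P x / x) \<longlongrightarrow> 0) (at_right 0)"
    by (rule Lim_transform_eventually)
  have "\<forall>\<^sub>F x in at_left (0::real). 0 = bump_poly P x / x"
    unfolding eventually_at_left_field
    by (intro exI[of _ "-1"]) (auto simp: bump_poly_def)
  then have l: "((\<lambda>x. bump_poly P x / x) \<longlongrightarrow> 0) (at_left 0)"
    by (rule Lim_transform_eventually[OF tendsto_const])
  show ?thesis using l r by (simp add: filterlim_at_split)
qed

text \<open>With \<open>y = 1 / x\<close> the derivative of \<open>poly P y * exp (- y)\<close> is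
  \<open>y^2 * (P - P')(y) * exp (- y)\<close>; the factor \<open>[:0,0,1:]\<close> is
  \<open>y^2\<close>.\<close>

lemma DERIV_bump_poly:
  "(bump_poly P has_real_derivative bump_poly ([:0,0,1:] * (P - pderiv P)) x) (at x)"
proof (cases "x = 0")
  case True
  have "((\<lambda>h. (bump_poly P (0 + h) - bump_poly P 0) / h) \<longlongrightarrow> 0) (at 0)"
    using bump_poly_over_x_tendsto[of P] by (simp add: bump_poly_def)
  then show ?thesis using True by (simp add: DERIV_def bump_poly_def)
next
  case False
  show ?thesis
  proof (cases "x > 0")
    case True
    have "((\<lambda>x. poly P (1 / x) * exp (- (1 / x))) has_real_derivative
        bump_poly ([:0,0,1:] * (P - pderiv P)) x) (at x)"
      using True
      by (auto intro!: derivative_eq_intros DERIV_chain'[OF _ poly_DERIV] simp: bump_poly_def field_simps power2_eq_square)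
    then show ?thesis
      by (rule has_field_derivative_transform_within[where d=x]) (use True in \<open>auto simp: bump_poly_def dist_real_def\<close>)
  next
    case neg: False
    have "((\<lambda>x. 0) has_real_derivative bump_poly ([:0,0,1:] * (P - pderiv P)) x) (at x)"
      using neg by (simp add: bump_poly_def)
    then show ?thesis
      by (rule has_field_derivative_transform_within[where d="-x"]) (use neg False in \<open>auto simp: bump_poly_def dist_real_def\<close>)
  qed
qed

lemma smooth_on_bump_poly: "smooth_on (bump_poly P) UNIV"
proof -
  have "C_k_on k (bump_poly P) UNIV" for k P
  proof (induction k arbitrary: P)
    case 0
    show ?case using DERIV_bump_poly
      by (auto intro!: continuous_at_imp_continuous_on dest: DERIV_isCont)
  next
    case (Suc k)
    show ?case
    proof (rule C_k_on_SucI)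
      show "(bump_poly P has_derivative (\<lambda>v. bump_poly ([:0,0,1:] * (P - pderiv P)) x * v)) (at x)" for x
        using DERIV_bump_poly by (simp add: has_field_derivative_def)
      show "C_k_on k (\<lambda>x. bump_poly ([:0,0,1:] * (P - pderiv P)) x * v) UNIV" for v
        by (intro C_k_on_mult Suc C_k_on_const) auto
    qed auto
  qed
  then show ?thesis by (simp add: smooth_on_def)
qed

definition smooth_step :: "real \<Rightarrow> real" where
  "smooth_step x = bump_poly 1 x * inverse (bump_poly 1 x + bump_poly 1 (1 - x))"

text \<open>The numbers \<open>x\<close> and \<open>1 - x\<close> are never both nonpositive, so one
  of the two summands is positive.\<close>

lemma smooth_step_denom: "bump_poly 1 x + bump_poly 1 (1 - x) > 0"
  by (auto simp: bump_poly_def add_pos_pos)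

lemma smooth_on_smooth_step: "smooth_on smooth_step UNIV"
proof -
  have "smooth_on (\<lambda>x. bump_poly 1 (- x + 1)) UNIV"
    by (rule smooth_on_affine_compose[OF smooth_on_bump_poly bounded_linear_minus[OF bounded_linear_ident]]) auto
  then have "smooth_on (\<lambda>x. bump_poly 1 x * inverse (bump_poly 1 x + bump_poly 1 (1 - x))) UNIV"
    using smooth_step_denom
    by (intro smooth_on_mult smooth_on_inverse smooth_on_add smooth_on_bump_poly) (auto simp: less_le)
  then show ?thesis
    by (simp add: smooth_step_def[abs_def])
qed

lemma smooth_step_eq_0: "x \<le> 0 \<Longrightarrow> smooth_step x = 0"
  by (simp add: smooth_step_def bump_poly_def)

lemma smooth_step_eq_1: "x \<ge> 1 \<Longrightarrow> smooth_step x = 1"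
  by (simp add: smooth_step_def bump_poly_def)

lemma smooth_step_DERIV: "(smooth_step has_real_derivative deriv smooth_step x) (at x)"
  using smooth_on_has_derivative[OF smooth_on_smooth_step, of x]
  by (simp add: DERIV_deriv_iff_real_differentiable differentiable_def) blast

lemma smooth_on_deriv_smooth_step: "smooth_on (deriv smooth_step) UNIV"
proof -
  have "frechet_derivative smooth_step (at x) 1 = deriv smooth_step x" for x
    using frechet_derivative_at[OF smooth_step_DERIV[of x, unfolded has_field_derivative_def]]
    by (metis mult.right_neutral)
  then show ?thesis
    using smooth_on_frechet_derivative[OF smooth_on_smooth_step, of 1] by simp
qed

text \<open>At the ends of the transition interval the function is constant on one side only; a
  one-sided derivative already determines \<open>D\<close>.\<close>

lemma deriv_eq_0_if_const_right:
  fixes f :: "real \<Rightarrow> real"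
  assumes "(f has_real_derivative D) (at x)" "\<And>y. y \<ge> x \<Longrightarrow> f y = c"
  shows "D = 0"
proof -
  have "(f has_real_derivative D) (at x within {x..})"
    using assms(1) by (rule has_field_derivative_at_within)
  moreover have "(f has_real_derivative 0) (at x within {x..})"
    by (rule has_field_derivative_transform_within[OF DERIV_const[of c], where d=1]) (use assms(2) in auto)
  moreover have "at x within {x..} \<noteq> bot" using at_within_Ici_at_right[of x] by simp
  ultimately show ?thesis
    by (metis has_field_derivative_unique)
qed

lemma deriv_smooth_step_eq_0: "x \<le> 0 \<or> x \<ge> 1 \<Longrightarrow> deriv smooth_step x = 0"
proof (elim disjE)
  assume "x \<ge> 1"
  show ?thesis
    by (rule deriv_eq_0_if_const_right[OF smooth_step_DERIV, of x 1]) (use \<open>x \<ge> 1\<close> smooth_step_eq_1 in auto)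
next
  assume x: "x \<le> 0"
  have "((\<lambda>y. smooth_step (- y)) has_real_derivative - deriv smooth_step x) (at (- x))"
  proof -
    have "(uminus has_real_derivative - 1) (at (- x))" by (auto intro!: derivative_eq_intros)
    from DERIV_chain'[OF this smooth_step_DERIV[of "- (- x)"]] show ?thesis by simp
  qed
  from deriv_eq_0_if_const_right[OF this, of 0] show ?thesis
    using x smooth_step_eq_0 by auto
qed

text \<open>The plateau value \<open>1 / 2\<close> makes the time-one rotation angle
  \<open>2 * pi * cutoff\<close> equal to \<open>pi\<close>, a half turn. The plateau reaches to
  \<open>R + 1\<close>, so that the derivative vanishes on all of
  \<open>\<bar>P\<bar> \<le> R\<close>, ends included.\<close>

definition cutoff :: "real \<Rightarrow> real \<Rightarrow> real" where
  "cutoff R P = smooth_step (R + 2 - P) * smooth_step (R + 2 + P) / 2"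

lemma smooth_on_cutoff: "smooth_on (cutoff R) UNIV"
proof -
  have "smooth_on (\<lambda>P. smooth_step (- P + (R + 2))) UNIV" "smooth_on (\<lambda>P. smooth_step (P + (R + 2))) UNIV"
    by (rule smooth_on_affine_compose[OF smooth_on_smooth_step]; auto intro: bounded_linear_minus bounded_linear_ident)+
  from smooth_on_mult[OF smooth_on_mult[OF this] smooth_on_const[of UNIV "1/2"]] show ?thesis
    by (simp add: cutoff_def[abs_def] algebra_simps)
qed

lemma cutoff_eq_half: "\<bar>P\<bar> \<le> R + 1 \<Longrightarrow> cutoff R P = 1 / 2"
  by (auto simp: cutoff_def smooth_step_eq_1)

lemma cutoff_eq_0: "\<bar>P\<bar> \<ge> R + 2 \<Longrightarrow> cutoff R P = 0"
  by (cases "P \<ge> 0") (auto simp: cutoff_def smooth_step_eq_0)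

lemma cutoff_DERIV: "(cutoff R has_real_derivative deriv (cutoff R) x) (at x)"
  using smooth_on_has_derivative[OF smooth_on_cutoff, of x]
  by (simp add: DERIV_deriv_iff_real_differentiable differentiable_def) blast

lemma deriv_cutoff_eq_0:
  assumes "\<bar>P\<bar> \<le> R"
  shows "deriv (cutoff R) P = 0"
proof -
  have "((\<lambda>_. 1/2) has_real_derivative 0) (at P)" by simp
  then have "(cutoff R has_real_derivative 0) (at P)"
    by (rule has_field_derivative_transform_within[where d=1]) (use assms in \<open>auto simp: cutoff_eq_half dist_real_def\<close>)
  then show ?thesis by (rule DERIV_imp_deriv)
qed

subsection \<open>Gronwall estimates and smooth vector fields\<close>

text \<open>The square of the norm is used because the norm is not differentiable at zero. The
  exponent comes from \<open>2 * (y \<bullet> y') \<le> 2 * C * |y|^2 + 2 * |y| * e\<close> and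
  \<open>2 * |y| * e \<le> |y|^2 + e^2\<close>; adding \<open>e^2\<close> under the exponential
  weight absorbs the inhomogeneous term.\<close>

lemma gronwall_square:
  fixes y :: "real \<Rightarrow> 'a::real_inner"
  assumes d: "\<And>t. t \<in> {0..T} \<Longrightarrow> (y has_vector_derivative y' t) (at t within {0..T})"
    and b: "\<And>t. t \<in> {0..T} \<Longrightarrow> norm (y' t) \<le> C * norm (y t) + e"
    and "0 \<le> C" "0 \<le> e" "0 \<le> T"
  shows "(norm (y T))\<^sup>2 \<le> exp ((2 * C + 1) * T) * ((norm (y 0))\<^sup>2 + e\<^sup>2)"
proof -
  define M where "M = 2 * C + 1"
  define g where "g t = exp (- (M * t)) * (y t \<bullet> y t + e\<^sup>2)" for t
  have gd: "(g has_real_derivative exp (- (M * t)) * (2 * (y t \<bullet> y' t) - M * (y t \<bullet> y t + e\<^sup>2))) (at t within {0..T})"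
    if "t \<in> {0..T}" for t
  proof -
    have "((\<lambda>t. y t \<bullet> y t) has_vector_derivative (y t \<bullet> y' t + y' t \<bullet> y t)) (at t within {0..T})"
      by (rule bounded_bilinear.has_vector_derivative[OF bounded_bilinear_inner d[OF that] d[OF that]])
    then have "((\<lambda>t. y t \<bullet> y t) has_real_derivative (2 * (y t \<bullet> y' t))) (at t within {0..T})"
      by (simp add: has_real_derivative_iff_has_vector_derivative inner_commute)
    then have 1: "((\<lambda>t. y t \<bullet> y t + e\<^sup>2) has_real_derivative 2 * (y t \<bullet> y' t) + 0) (at t within {0..T})"
      by (intro DERIV_add DERIV_const)
    have 2: "((\<lambda>t. exp (- (M * t))) has_real_derivative - M * exp (- (M * t))) (at t within {0..T})"
      by (auto intro!: derivative_eq_intros)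
    show ?thesis unfolding g_def
      using DERIV_mult[OF 2 1] by (simp add: algebra_simps)
  qed
  have le: "2 * (y t \<bullet> y' t) - M * (y t \<bullet> y t + e\<^sup>2) \<le> 0" if "t \<in> {0..T}" for t
  proof -
    have "y t \<bullet> y' t \<le> norm (y t) * norm (y' t)" by (rule norm_cauchy_schwarz)
    also have "\<dots> \<le> norm (y t) * (C * norm (y t) + e)"
      by (intro mult_left_mono b that) auto
    finally have 1: "2 * (y t \<bullet> y' t) \<le> 2 * C * (norm (y t))\<^sup>2 + 2 * norm (y t) * e"
      by (simp add: power2_eq_square algebra_simps)
    have 2: "2 * norm (y t) * e \<le> (norm (y t))\<^sup>2 + e\<^sup>2"
      by (rule sum_squares_bound)
    have 3: "0 \<le> 2 * C * e\<^sup>2" using assms(3) by simp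
    have "M * (y t \<bullet> y t + e\<^sup>2) = 2 * C * (norm (y t))\<^sup>2 + (norm (y t))\<^sup>2 + 2 * C * e\<^sup>2 + e\<^sup>2"
      by (simp add: M_def dot_square_norm algebra_simps)
    then show ?thesis using 1 2 3 by linarith
  qed
  have "g T \<le> g 0"
  proof (rule DERIV_nonpos_imp_decreasing_open[where f=g and a=0 and b=T])
    show "\<exists>y. (g has_real_derivative y) (at t) \<and> y \<le> 0" if t: "0 < t" "t < T" for t
    proof -
      have "t \<in> {0..T}" using t by simp
      with gd[OF this] at_within_Icc_at[OF t] mult_nonneg_nonpos[OF exp_ge_zero le[OF this], of "- (M * t)"]
      show ?thesis by metis
    qed
    show "continuous_on {0..T} g"
      by (rule DERIV_continuous_on[OF gd])
  qed (rule assms(5))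
  then have "exp (- (M * T)) * (y T \<bullet> y T + e\<^sup>2) \<le> y 0 \<bullet> y 0 + e\<^sup>2"
    by (simp add: g_def)
  then have "y T \<bullet> y T + e\<^sup>2 \<le> exp (M * T) * (y 0 \<bullet> y 0 + e\<^sup>2)"
    by (simp add: exp_minus field_simps)
  moreover have "y T \<bullet> y T \<le> y T \<bullet> y T + e\<^sup>2" by simp
  ultimately have "y T \<bullet> y T \<le> exp (M * T) * (y 0 \<bullet> y 0 + e\<^sup>2)" by (rule order_trans[rotated])
  then show ?thesis
    by (simp only: M_def dot_square_norm)
qed

lemma gronwall:
  fixes y :: "real \<Rightarrow> 'a::real_inner"
  assumes d: "\<And>t. t \<in> {0..1} \<Longrightarrow> (y has_vector_derivative y' t) (at t within {0..1})"
    and b: "\<And>t. t \<in> {0..1} \<Longrightarrow> norm (y' t) \<le> C * norm (y t) + e"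
    and "0 \<le> C" "0 \<le> e" "t \<in> {0..1}"
  shows "norm (y t) \<le> exp (2 * C + 1) * (norm (y 0) + e)"
proof -
  have "(norm (y t))\<^sup>2 \<le> exp ((2 * C + 1) * t) * ((norm (y 0))\<^sup>2 + e\<^sup>2)"
  proof (rule gronwall_square[where y'=y' and C=C])
    fix s assume s: "s \<in> {0..t}"
    then have s1: "s \<in> {0..1}" using assms(5) by auto
    show "(y has_vector_derivative y' s) (at s within {0..t})"
      by (rule has_vector_derivative_within_subset[OF d[OF s1]]) (use assms(5) in auto)
    show "norm (y' s) \<le> C * norm (y s) + e" by (rule b[OF s1])
  qed (use assms(3-5) in auto)
  also have "\<dots> \<le> exp (2 * C + 1) * (norm (y 0) + e)\<^sup>2"
  proof (rule mult_mono)
    have "(2 * C + 1) * t \<le> (2 * C + 1) * 1"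
      by (rule mult_left_mono) (use assms(3,5) in auto)
    then show "exp ((2 * C + 1) * t) \<le> exp (2 * C + 1)" by simp
    show "(norm (y 0))\<^sup>2 + e\<^sup>2 \<le> (norm (y 0) + e)\<^sup>2"
      using assms(4) by (simp add: power2_sum)
  qed auto
  \<comment> \<open>The factor is at least one, so squaring it only enlarges the bound and turns the
    right-hand side into a perfect square.\<close>
  also have "\<dots> \<le> (exp (2 * C + 1))\<^sup>2 * (norm (y 0) + e)\<^sup>2"
  proof (rule mult_right_mono)
    have "exp (2 * C + 1) * 1 \<le> exp (2 * C + 1) * exp (2 * C + 1)"
      by (rule mult_left_mono) (use assms(3) in auto)
    then show "exp (2 * C + 1) \<le> (exp (2 * C + 1))\<^sup>2" by (simp only: power2_eq_square mult_1_right)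
  qed auto
  finally have "(norm (y t))\<^sup>2 \<le> (exp (2 * C + 1) * (norm (y 0) + e))\<^sup>2"
    by (simp only: power_mult_distrib)
  then show ?thesis
    by (rule power2_le_imp_le) (use assms(4) in auto)
qed

text \<open>The estimate is applied to the time-reversed curve starting at \<open>T\<close>. This is
  the uniqueness statement behind injectivity of the flow and independence of its
  variations.\<close>

lemma gronwall_backward:
  fixes y :: "real \<Rightarrow> 'a::real_inner"
  assumes d: "\<And>t. t \<in> {0..1} \<Longrightarrow> (y has_vector_derivative y' t) (at t within {0..1})"
    and b: "\<And>t. t \<in> {0..1} \<Longrightarrow> norm (y' t) \<le> C * norm (y t)"
    and C: "0 \<le> C" and T: "T \<in> {0..1}" and y0: "y T = 0"
  shows "y 0 = 0"
proof -
  have "(norm (y (T - T)))\<^sup>2 \<le> exp ((2 * C + 1) * T) * ((norm (y (T - 0)))\<^sup>2 + 0\<^sup>2)"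
  proof (rule gronwall_square[where y="\<lambda>t. y (T - t)" and y'="\<lambda>t. - y' (T - t)" and C=C])
    fix s assume s: "s \<in> {0..T}"
    have "((\<lambda>t. T - t) has_vector_derivative - 1) (at s within {0..T})"
      by (auto intro!: derivative_eq_intros)
    moreover have "(y has_vector_derivative y' (T - s)) (at (T - s) within (\<lambda>t. T - t) ` {0..T})"
      by (rule has_vector_derivative_within_subset[OF d]) (use s T in auto)
    ultimately have "(y \<circ> (\<lambda>t. T - t) has_vector_derivative (- 1) *\<^sub>R y' (T - s)) (at s within {0..T})"
      by (rule vector_diff_chain_within)
    then show "((\<lambda>t. y (T - t)) has_vector_derivative - y' (T - s)) (at s within {0..T})"
      by (simp add: o_def)
    show "norm (- y' (T - s)) \<le> C * norm (y (T - s)) + 0"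
      using b[of "T - s"] s T by auto
  qed (use C T in auto)
  then show ?thesis using y0 by simp
qed

lemma vector_differentiable_bound:
  fixes f :: "real \<Rightarrow> 'a::real_normed_vector"
  assumes "convex S" "\<And>x. x \<in> S \<Longrightarrow> (f has_vector_derivative f' x) (at x within S)"
    "\<And>x. x \<in> S \<Longrightarrow> norm (f' x) \<le> B" "x \<in> S" "y \<in> S"
  shows "norm (f x - f y) \<le> B * norm (x - y)"
proof (rule differentiable_bound[OF assms(1) _ _ assms(4,5)])
  show "(f has_derivative (\<lambda>h. h *\<^sub>R f' x)) (at x within S)" if "x \<in> S" for x
    using assms(2)[OF that] by (simp add: has_vector_derivative_def)
  show "onorm (\<lambda>h. h *\<^sub>R f' x) \<le> B" if "x \<in> S" for x
  proof (rule onorm_le)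
    show "norm (h *\<^sub>R f' x) \<le> B * norm h" for h
      using mult_right_mono[OF assms(3)[OF that], of "\<bar>h\<bar>"] by (simp add: mult.commute)
  qed
qed

text \<open>\<open>smooth_on\<close> speaks of real-valued functions only, hence the
  components.\<close>

definition smooth_field :: "('b::real_normed_vector \<Rightarrow> 'a::euclidean_space) \<Rightarrow> 'b set \<Rightarrow> bool" where
  "smooth_field F U \<longleftrightarrow> (\<forall>b\<in>Basis. smooth_on (\<lambda>x. F x \<bullet> b) U)"

lemma smooth_field_has_derivative:
  fixes F :: "'b::real_normed_vector \<Rightarrow> 'a::euclidean_space"
  assumes "smooth_field F U" "x \<in> U"
  shows "(F has_derivative frechet_derivative F (at x)) (at x)"
    and "b \<in> Basis \<Longrightarrow> frechet_derivative F (at x) h \<bullet> b = frechet_derivative (\<lambda>x. F x \<bullet> b) (at x) h"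
proof -
  let ?D = "\<lambda>h. \<Sum>b\<in>Basis. frechet_derivative (\<lambda>x. F x \<bullet> b) (at x) h *\<^sub>R b"
  have i: "?D h \<bullet> b = frechet_derivative (\<lambda>x. F x \<bullet> b) (at x) h" if "b \<in> Basis" for b h
    using that by (simp add: inner_sum_left inner_Basis if_distrib sum.delta cong: if_cong)
  have "(F has_derivative ?D) (at x)"
    unfolding has_derivative_componentwise_within[of F ?D]
  proof
    fix b :: 'a assume "b \<in> Basis"
    then have "((\<lambda>x. F x \<bullet> b) has_derivative frechet_derivative (\<lambda>x. F x \<bullet> b) (at x)) (at x)"
      using assms by (intro smooth_on_has_derivative) (auto simp: smooth_field_def)
    then show "((\<lambda>x. F x \<bullet> b) has_derivative (\<lambda>h. ?D h \<bullet> b)) (at x)"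
      using \<open>b \<in> Basis\<close> i by simp
  qed
  then have e: "frechet_derivative F (at x) = ?D" and d: "(F has_derivative ?D) (at x)"
    using frechet_derivative_at[of F ?D x] by auto
  show "(F has_derivative frechet_derivative F (at x)) (at x)"
    unfolding e by (rule d)
  show "b \<in> Basis \<Longrightarrow> frechet_derivative F (at x) h \<bullet> b = frechet_derivative (\<lambda>x. F x \<bullet> b) (at x) h"
    unfolding e by (rule i)
qed

lemma smooth_field_continuous_on: "smooth_field F U \<Longrightarrow> continuous_on U F"
  by (rule continuous_on_componentwise[THEN iffD2])
    (auto simp: smooth_field_def intro: smooth_on_imp_continuous_on)

lemma smooth_field_derivative:
  fixes F :: "'b::real_normed_vector \<Rightarrow> 'a::euclidean_space"
  assumes "smooth_field F U"
  shows "smooth_field (\<lambda>x. frechet_derivative F (at x) v) U"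
  unfolding smooth_field_def
proof
  fix b :: 'a assume b: "b \<in> Basis"
  then have U: "open U" and s: "smooth_on (\<lambda>x. frechet_derivative (\<lambda>x. F x \<bullet> b) (at x) v) U"
    using assms smooth_on_frechet_derivative[of "\<lambda>x. F x \<bullet> b" U v]
    by (auto simp: smooth_field_def) (auto simp: smooth_on_def)
  show "smooth_on (\<lambda>x. frechet_derivative F (at x) v \<bullet> b) U"
    using smooth_on_cong[OF U, of "\<lambda>x. frechet_derivative F (at x) v \<bullet> b"]
      s smooth_field_has_derivative(2)[OF assms _ b] by auto
qed

text \<open>Reduces continuity and bounds of the derivative as an operator to its values on basis
  vectors, which are smooth fields in the point.\<close>

lemma derivative_eq_sum_Basis:
  assumes "(F has_derivative D) (at x)"
  shows "D h = (\<Sum>c\<in>Basis. (h \<bullet> c) *\<^sub>R D c)"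
proof -
  interpret bounded_linear D using assms has_derivative_bounded_linear by blast
  show ?thesis
    by (subst euclidean_representation[symmetric, of h]) (simp only: sum scaleR)
qed

lemma norm_sum_Basis_le:
  fixes D :: "'b::euclidean_space \<Rightarrow> 'a::real_normed_vector" and M :: real
  assumes "\<And>c. c \<in> Basis \<Longrightarrow> norm (D c) \<le> M"
  shows "norm (\<Sum>c\<in>Basis. (h \<bullet> c) *\<^sub>R D c) \<le> real DIM('b) * M * norm h"
proof -
  have "norm (\<Sum>c\<in>Basis. (h \<bullet> c) *\<^sub>R D c) \<le> (\<Sum>c\<in>(Basis::'b set). norm h * M)"
    by (rule order_trans[OF norm_sum sum_mono])
      (auto intro!: mult_mono assms Basis_le_norm)
  then show ?thesis by (simp add: mult_ac)
qed

lemma continuous_on_compact_bound_Basis: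
  fixes f :: "'b::euclidean_space \<Rightarrow> 'c::metric_space \<Rightarrow> 'a::real_normed_vector"
  assumes "compact S" "\<And>c. c \<in> Basis \<Longrightarrow> continuous_on S (f c)"
  obtains M where "0 \<le> M" "\<And>c x. c \<in> Basis \<Longrightarrow> x \<in> S \<Longrightarrow> norm (f c x) \<le> M"
proof -
  have "\<exists>m. \<forall>x\<in>S. norm (f c x) \<le> m" if "c \<in> Basis" for c
  proof -
    have "bounded (f c ` S)" using compact_continuous_image compact_imp_bounded assms that by metis
    then show ?thesis by (auto simp: bounded_iff)
  qed
  then obtain m where m: "\<And>c x. c \<in> Basis \<Longrightarrow> x \<in> S \<Longrightarrow> norm (f c x) \<le> m c" by metis
  show ?thesis
  proof (rule that[of "\<Sum>c\<in>Basis. \<bar>m c\<bar>"])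
    show "norm (f c x) \<le> (\<Sum>c\<in>Basis. \<bar>m c\<bar>)" if "c \<in> Basis" "x \<in> S" for c x
    proof -
      have "norm (f c x) \<le> \<bar>m c\<bar>" using m[OF that] by linarith
      also have "\<dots> \<le> (\<Sum>c\<in>Basis. \<bar>m c\<bar>)" using that by (intro member_le_sum) auto
      finally show ?thesis .
    qed
  qed (auto intro: sum_nonneg)
qed

text \<open>The compact set \<open>S\<close> will lie in a curved submanifold, so the segment
  between two of its points may leave it. Points at distance at most \<open>d\<close> have their
  segment in a compact neighbourhood inside \<open>U\<close>, where second derivatives are bounded;
  for points further apart the left side is bounded linearly in the distance and
  \<open>|y - x| > d\<close> makes the square dominate.\<close>

lemma smooth_field_taylor:
  fixes F :: "'b::euclidean_space \<Rightarrow> 'a::euclidean_space"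
  assumes F: "smooth_field F U" and U: "open U" and S: "compact S" "S \<subseteq> U"
  obtains C where "0 \<le> C"
    "\<And>x y. x \<in> S \<Longrightarrow> y \<in> S \<Longrightarrow> norm (F y - F x - frechet_derivative F (at x) (y - x)) \<le> C * (norm (y - x))\<^sup>2"
proof (cases "S = {}")
  case True
  then show ?thesis using that[of 0] by auto
next
  case False
  obtain d where d: "d > 0" and dU: "{x. infdist x S \<le> d} \<subseteq> U"
    using compact_in_open_separated[OF False S(1) U S(2)] by blast
  define S' where "S' = {x. infdist x S \<le> d}"
  have S': "compact S'" "S' \<subseteq> U" "S \<subseteq> S'"
    using compact_infdist_le[OF False S(1) d] dU d by (auto simp: S'_def)
  define D :: "'b \<Rightarrow> 'b \<Rightarrow> 'a" where "D c = (\<lambda>x. frechet_derivative F (at x) c)" for c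
  define D2 where "D2 c b = (\<lambda>x. frechet_derivative (D c) (at x) b)" for c b
  have Dsm: "smooth_field (D c) U" for c unfolding D_def by (rule smooth_field_derivative[OF F])
  have D2sm: "smooth_field (D2 c b) U" for c b unfolding D2_def by (rule smooth_field_derivative[OF Dsm])
  have cont: "continuous_on S' f" if "smooth_field f U" for f :: "'b \<Rightarrow> 'a"
    using smooth_field_continuous_on[OF that] continuous_on_subset S' by blast
  have "bounded (F ` S')" using compact_continuous_image[OF cont[OF F] S'(1)] compact_imp_bounded by blast
  then obtain M0 where M0: "\<And>x. x \<in> S' \<Longrightarrow> norm (F x) \<le> M0" by (auto simp: bounded_iff)
  obtain x0 where "x0 \<in> S" using False by auto
  then have M0p: "0 \<le> M0" using M0[of x0] S' norm_ge_zero order_trans by blast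
  obtain M1 :: real where M1p: "0 \<le> M1" and M1: "\<And>c x. c \<in> Basis \<Longrightarrow> x \<in> S' \<Longrightarrow> norm (D c x) \<le> M1"
    using continuous_on_compact_bound_Basis[OF S'(1), of D] cont[OF Dsm] by blast
  obtain m2 where m2p: "\<And>c. c \<in> Basis \<Longrightarrow> 0 \<le> m2 c" and m2: "\<And>c b x. c \<in> Basis \<Longrightarrow> b \<in> Basis \<Longrightarrow> x \<in> S' \<Longrightarrow> norm (D2 c b x) \<le> m2 c"
  proof -
    have "\<exists>m. 0 \<le> m \<and> (\<forall>b\<in>Basis. \<forall>x\<in>S'. norm (D2 c b x) \<le> m)" for c
      using continuous_on_compact_bound_Basis[OF S'(1), of "D2 c"] cont[OF D2sm] by metis
    then show ?thesis using that by metis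
  qed
  define n where "n = real DIM('b)"
  define M2 where "M2 = (\<Sum>c\<in>Basis. m2 c)"
  have M2: "norm (D2 c b x) \<le> M2" if "c \<in> Basis" "b \<in> Basis" "x \<in> S'" for c b x
    using m2[OF that] member_le_sum[of c Basis m2] m2p that unfolding M2_def by force
  have M2p: "0 \<le> M2" using m2p by (auto simp: M2_def intro: sum_nonneg)
  have n: "0 \<le> n" by (simp add: n_def)
  \<comment> \<open>The bracket serves pairs at distance greater than \<open>d\<close>, the last
    summand pairs at distance at most \<open>d\<close>.\<close>
  define C where "C = (2 * M0 / d\<^sup>2 + n * M1 / d) + n * (n * M2)"
  have DF: "frechet_derivative F (at x) h = (\<Sum>c\<in>Basis. (h \<bullet> c) *\<^sub>R D c x)" if "x \<in> U" for x h
    unfolding D_def by (rule derivative_eq_sum_Basis[OF smooth_field_has_derivative(1)[OF F that]])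
  have DF_le: "norm (frechet_derivative F (at x) h) \<le> n * M1 * norm h" if "x \<in> S'" for x h
    unfolding n_def using norm_sum_Basis_le[of "\<lambda>c. D c x" M1 h] M1 that DF[of x h] S'(2) by auto
  have D2_le: "norm (frechet_derivative (D c) (at x) h) \<le> n * M2 * norm h"
    if "x \<in> S'" "c \<in> Basis" for x h c
  proof -
    have "x \<in> U" using that S' by auto
    have "frechet_derivative (D c) (at x) h = (\<Sum>b\<in>Basis. (h \<bullet> b) *\<^sub>R D2 c b x)"
      unfolding D2_def by (rule derivative_eq_sum_Basis[OF smooth_field_has_derivative(1)[OF Dsm \<open>x \<in> U\<close>]])
    then show ?thesis unfolding n_def
      using norm_sum_Basis_le[of "\<lambda>b. D2 c b x" M2 h] M2 that by auto
  qed
  show ?thesis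
  proof (rule that[of C])
    show "0 \<le> C" using M0p M1p M2p n d by (simp add: C_def)
    fix x y assume x: "x \<in> S" and y: "y \<in> S"
    define h where "h = y - x"
    show "norm (F y - F x - frechet_derivative F (at x) (y - x)) \<le> C * (norm (y - x))\<^sup>2"
    proof (cases "norm h \<le> d")
      case True
      have seg: "x + s *\<^sub>R h \<in> S'" if "s \<in> {0..1}" for s
      proof -
        have "infdist (x + s *\<^sub>R h) S \<le> dist (x + s *\<^sub>R h) x" by (rule infdist_le[OF x])
        also have "\<dots> \<le> 1 * norm h" using that mult_right_mono[of s 1 "norm h"] by (simp add: dist_norm)
        finally show ?thesis using True by (simp add: S'_def)
      qed
      have D_diff: "norm (D c (x + s *\<^sub>R h) - D c x) \<le> n * M2 * norm h" if s: "s \<in> {0..1}" and c: "c \<in> Basis" for s c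
      proof -
        have "norm (D c (x + s *\<^sub>R h) - D c (x + 0 *\<^sub>R h)) \<le> n * M2 * norm h * norm (s - 0)"
        proof (rule vector_differentiable_bound[of "{0..1}" "\<lambda>s. D c (x + s *\<^sub>R h)"
              "\<lambda>s. frechet_derivative (D c) (at (x + s *\<^sub>R h)) h"])
          fix r :: real assume r: "r \<in> {0..1}"
          have "((\<lambda>r. x + r *\<^sub>R h) has_vector_derivative h) (at r within {0..1})"
            by (auto intro!: derivative_eq_intros)
          moreover have "(D c has_derivative frechet_derivative (D c) (at (x + r *\<^sub>R h))) (at (x + r *\<^sub>R h))"
            using seg[OF r] S' by (intro smooth_field_has_derivative(1)[OF Dsm]) auto
          ultimately show "((\<lambda>s. D c (x + s *\<^sub>R h)) has_vector_derivative
              frechet_derivative (D c) (at (x + r *\<^sub>R h)) h) (at r within {0..1})"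
            using vector_derivative_diff_chain_within[of "\<lambda>r. x + r *\<^sub>R h" h r "{0..1}" "D c"]
            by (auto simp: o_def intro: has_derivative_at_withinI)
          show "norm (frechet_derivative (D c) (at (x + r *\<^sub>R h)) h) \<le> n * M2 * norm h"
            by (rule D2_le[OF seg[OF r] c])
        qed (use s in auto)
        also have "\<dots> \<le> n * M2 * norm h * 1"
          using s n M2p by (intro mult_left_mono) auto
        finally show ?thesis by simp
      qed
      let ?L = "frechet_derivative F (at x)"
      have "norm ((F (x + 1 *\<^sub>R h) - 1 *\<^sub>R ?L h) - (F (x + 0 *\<^sub>R h) - 0 *\<^sub>R ?L h)) \<le> n * (n * M2 * norm h) * norm h * norm (1 - (0::real))"
      proof (rule vector_differentiable_bound[of "{0..1}" "\<lambda>s. F (x + s *\<^sub>R h) - s *\<^sub>R ?L h"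
            "\<lambda>s. frechet_derivative F (at (x + s *\<^sub>R h)) h - ?L h"])
        fix r :: real assume r: "r \<in> {0..1}"
        have 1: "((\<lambda>r. x + r *\<^sub>R h) has_vector_derivative h) (at r within {0..1})"
          by (auto intro!: derivative_eq_intros)
        have 2: "(F has_derivative frechet_derivative F (at (x + r *\<^sub>R h))) (at (x + r *\<^sub>R h))"
          using seg[OF r] S' by (intro smooth_field_has_derivative(1)[OF F]) auto
        have "((\<lambda>s. F (x + s *\<^sub>R h)) has_vector_derivative
            frechet_derivative F (at (x + r *\<^sub>R h)) h) (at r within {0..1})"
          using vector_derivative_diff_chain_within[OF 1, of F] 2
          by (auto simp: o_def intro: has_derivative_at_withinI)
        then show "((\<lambda>s. F (x + s *\<^sub>R h) - s *\<^sub>R ?L h) has_vector_derivative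
            frechet_derivative F (at (x + r *\<^sub>R h)) h - ?L h) (at r within {0..1})"
          by (auto intro!: derivative_eq_intros)
        have "frechet_derivative F (at (x + r *\<^sub>R h)) h - ?L h = (\<Sum>c\<in>Basis. (h \<bullet> c) *\<^sub>R (D c (x + r *\<^sub>R h) - D c x))"
          using DF[of x h] DF[of "x + r *\<^sub>R h" h] seg[OF r] S' x
          by (simp add: sum_subtractf scaleR_diff_right subset_eq)
        then show "norm (frechet_derivative F (at (x + r *\<^sub>R h)) h - ?L h) \<le> n * (n * M2 * norm h) * norm h"
          unfolding n_def using norm_sum_Basis_le[of "\<lambda>c. D c (x + r *\<^sub>R h) - D c x" _ h] D_diff[OF r]
          by (auto simp: n_def)
      qed auto
      then have "norm (F y - F x - ?L h) \<le> n * (n * M2) * (norm h)\<^sup>2"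
        by (simp add: h_def power2_eq_square algebra_simps)
      also have "\<dots> \<le> C * (norm h)\<^sup>2"
        using M0p M1p n d by (intro mult_right_mono) (auto simp: C_def)
      finally show ?thesis by (simp add: h_def)
    next
      case False
      then have h: "norm h / d \<ge> 1" "(norm h / d)\<^sup>2 \<ge> 1" using d by (auto simp: field_simps)
      have "norm (F y - F x - frechet_derivative F (at x) h) \<le> norm (F y) + norm (F x) + n * M1 * norm h"
        using DF_le[of x h] x S' norm_triangle_ineq4[of "F y - F x" "frechet_derivative F (at x) h"]
          norm_triangle_ineq4[of "F y" "F x"] by auto
      also have "\<dots> \<le> 2 * M0 * 1 + n * M1 * norm h * 1"
        using add_mono[OF M0[of y] M0[of x]] x y S' by (simp add: subset_eq)
      also have "\<dots> \<le> 2 * M0 * (norm h / d)\<^sup>2 + n * M1 * norm h * (norm h / d)"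
        using M0p M1p n h by (intro add_mono mult_left_mono) auto
      also have "\<dots> = (2 * M0 / d\<^sup>2 + n * M1 / d) * (norm h)\<^sup>2"
        using d by (simp add: field_simps power2_eq_square)
      also have "\<dots> \<le> C * (norm h)\<^sup>2"
        using n M2p by (intro mult_right_mono) (auto simp: C_def)
      finally show ?thesis by (simp add: h_def)
    qed
  qed
qed

lemma smooth_field_derivative_bound:
  fixes F :: "'b::euclidean_space \<Rightarrow> 'a::euclidean_space"
  assumes F: "smooth_field F U" and S: "compact S" "S \<subseteq> U"
  obtains C where "0 \<le> C" "\<And>x h. x \<in> S \<Longrightarrow> norm (frechet_derivative F (at x) h) \<le> C * norm h"
proof -
  have "continuous_on S (\<lambda>x. frechet_derivative F (at x) c)" for c
    using smooth_field_continuous_on[OF smooth_field_derivative[OF F]] S continuous_on_subset by blast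
  then obtain M where M: "0 \<le> M" "\<And>c x. c \<in> Basis \<Longrightarrow> x \<in> S \<Longrightarrow> norm (frechet_derivative F (at x) c) \<le> M"
    using continuous_on_compact_bound_Basis[OF S(1), of "\<lambda>c x. frechet_derivative F (at x) c"] by blast
  show ?thesis
  proof (rule that[of "real DIM('b) * M"])
    fix x h assume "x \<in> S"
    then have "x \<in> U" using S by auto
    then have "frechet_derivative F (at x) h = (\<Sum>c\<in>Basis. (h \<bullet> c) *\<^sub>R frechet_derivative F (at x) c)"
      by (rule derivative_eq_sum_Basis[OF smooth_field_has_derivative(1)[OF F]])
    then show "norm (frechet_derivative F (at x) h) \<le> real DIM('b) * M * norm h"
      using norm_sum_Basis_le[of "\<lambda>c. frechet_derivative F (at x) c" M h] M \<open>x \<in> S\<close> by auto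
  qed (use M in auto)
qed

subsection \<open>Differentiable dependence on parameters\<close>

text \<open>Models a parametrized set of integral curves of a time-dependent field inside a compact
  set that need not be convex. About the dependence on the parameter only continuity at time zero is
  assumed; everything else is derived.\<close>

locale flow_family =
  fixes F :: "real \<times> 'a::euclidean_space \<Rightarrow> 'a" and U :: "(real \<times> 'a) set" and K :: "'a set"
    and G :: "real \<Rightarrow> 'p::real_normed_vector \<Rightarrow> 'a"
  assumes openU: "open U" and smooth: "smooth_field F U"
    and compactK: "compact K" and KU: "{0..1} \<times> K \<subseteq> U"
    and inK: "\<And>t \<theta>. t \<in> {0..1} \<Longrightarrow> G t \<theta> \<in> K"
    and sol: "\<And>t \<theta>. t \<in> {0..1} \<Longrightarrow> ((\<lambda>t. G t \<theta>) has_vector_derivative F (t, G t \<theta>)) (at t within {0..1})"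
    and cont0: "continuous_on UNIV (G 0)"
begin

definition D :: "real \<Rightarrow> 'a \<Rightarrow> 'a \<Rightarrow> 'a" where
  "D t x h = frechet_derivative F (at (t, x)) (0, h)"

lemma compact_dom: "compact ({0..1::real} \<times> K)"
  by (intro compact_Times compactK) auto

lemma linear_D: "t \<in> {0..1} \<Longrightarrow> x \<in> K \<Longrightarrow> linear (D t x)"
proof -
  assume "t \<in> {0..1}" "x \<in> K"
  then have "(t, x) \<in> U" using KU by auto
  then interpret bounded_linear "frechet_derivative F (at (t, x))"
    using smooth_field_has_derivative(1)[OF smooth] has_derivative_bounded_linear by blast
  show ?thesis
    by (rule linearI) (simp_all add: D_def flip: add scaleR)
qed

lemma continuous_on_F: "continuous_on ({0..1} \<times> K) F"
  using smooth_field_continuous_on[OF smooth] KU continuous_on_subset by blast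

lemma continuous_on_D: "continuous_on (({0..1} \<times> K) \<times> UNIV) (\<lambda>(x, h). D (fst x) (snd x) h)"
proof -
  have 1: "D (fst x) (snd x) h = (\<Sum>c\<in>Basis. ((0, h) \<bullet> c) *\<^sub>R frechet_derivative F (at x) c)"
    if "x \<in> {0..1} \<times> K" for x h
  proof -
    have "x \<in> U" using that KU by auto
    then show ?thesis
      unfolding D_def by (simp add: derivative_eq_sum_Basis[OF smooth_field_has_derivative(1)[OF smooth], of x "(0, h)"])
  qed
  have 2: "continuous_on (({0..1} \<times> K) \<times> UNIV) (\<lambda>p. frechet_derivative F (at (fst p)) c)" for c
    by (rule continuous_on_compose2[OF smooth_field_continuous_on[OF smooth_field_derivative[OF smooth, of c]]])
      (use KU in \<open>auto intro!: continuous_intros\<close>)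
  have "continuous_on (({0..1} \<times> K) \<times> UNIV) (\<lambda>p. \<Sum>c\<in>Basis. ((0, snd p) \<bullet> c) *\<^sub>R frechet_derivative F (at (fst p)) c)"
    by (intro continuous_intros 2)
  then show ?thesis
    by (rule continuous_on_eq) (use 1 in auto)
qed

text \<open>As \<open>K\<close> may fail to be convex, the Lipschitz bound is read off from the
  Taylor bound: the quadratic term becomes linear because \<open>K\<close> is bounded.\<close>

lemma constants:
  obtains C where "0 \<le> C"
    "\<And>t x y. t \<in> {0..1} \<Longrightarrow> x \<in> K \<Longrightarrow> y \<in> K \<Longrightarrow> norm (F (t, y) - F (t, x)) \<le> C * norm (y - x)"
    "\<And>t x y. t \<in> {0..1} \<Longrightarrow> x \<in> K \<Longrightarrow> y \<in> K \<Longrightarrow> norm (F (t, y) - F (t, x) - D t x (y - x)) \<le> C * (norm (y - x))\<^sup>2"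
    "\<And>t x h. t \<in> {0..1} \<Longrightarrow> x \<in> K \<Longrightarrow> norm (D t x h) \<le> C * norm h"
    "\<And>t x. t \<in> {0..1} \<Longrightarrow> x \<in> K \<Longrightarrow> norm (F (t, x)) \<le> C"
proof -
  obtain C1 where C1: "0 \<le> C1" "\<And>x y. x \<in> {0..1} \<times> K \<Longrightarrow> y \<in> {0..1} \<times> K \<Longrightarrow>
      norm (F y - F x - frechet_derivative F (at x) (y - x)) \<le> C1 * (norm (y - x))\<^sup>2"
    using smooth_field_taylor[OF smooth openU compact_dom KU] by blast
  obtain C2 where C2: "0 \<le> C2" "\<And>x h. x \<in> {0..1} \<times> K \<Longrightarrow> norm (frechet_derivative F (at x) h) \<le> C2 * norm h"
    using smooth_field_derivative_bound[OF smooth compact_dom KU] by blast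
  have "bounded K" using compactK compact_imp_bounded by blast
  then obtain B where B: "\<And>x. x \<in> K \<Longrightarrow> norm x \<le> B" by (auto simp: bounded_iff)
  have "bounded (F ` ({0..1} \<times> K))"
    using compact_continuous_image[OF continuous_on_F compact_dom] compact_imp_bounded by blast
  then obtain C3 where C3: "\<And>x. x \<in> {0..1} \<times> K \<Longrightarrow> norm (F x) \<le> C3" unfolding bounded_iff by auto
  have T: "norm (F (t, y) - F (t, x) - D t x (y - x)) \<le> C1 * (norm (y - x))\<^sup>2" if "t \<in> {0..1}" "x \<in> K" "y \<in> K" for t x y
    using C1(2)[of "(t, x)" "(t, y)"] that by (simp add: D_def)
  have N: "norm (D t x h) \<le> C2 * norm h" if "t \<in> {0..1}" "x \<in> K" for t x h
    using C2(2)[of "(t, x)" "(0, h)"] that by (simp add: D_def)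
  define C where "C = C1 + C2 + C1 * (2 * \<bar>B\<bar>) + \<bar>C3\<bar>"
  have le: "C1 \<le> C" "C2 \<le> C" "C2 + C1 * (2 * \<bar>B\<bar>) \<le> C" "\<bar>C3\<bar> \<le> C" "0 \<le> C"
    using C1 C2 by (auto simp: C_def)
  have L: "norm (F (t, y) - F (t, x)) \<le> C * norm (y - x)" if "t \<in> {0..1}" "x \<in> K" "y \<in> K" for t x y
  proof -
    have "norm (y - x) \<le> 2 * \<bar>B\<bar>" using B[of x] B[of y] that norm_triangle_ineq4[of y x] by linarith
    then have "C1 * (norm (y - x))\<^sup>2 \<le> C1 * (2 * \<bar>B\<bar>) * norm (y - x)"
      unfolding power2_eq_square mult.assoc using C1(1)
      by (intro mult_left_mono) (simp_all add: mult_right_mono flip: mult.assoc)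
    moreover have "norm (F (t, y) - F (t, x)) \<le> norm (F (t, y) - F (t, x) - D t x (y - x)) + norm (D t x (y - x))"
      using norm_triangle_ineq[of "F (t, y) - F (t, x) - D t x (y - x)" "D t x (y - x)"] by simp
    ultimately have "norm (F (t, y) - F (t, x)) \<le> (C2 + C1 * (2 * \<bar>B\<bar>)) * norm (y - x)"
      using T[OF that] N[OF that(1,2), of "y - x"] by (simp add: algebra_simps)
    also have "\<dots> \<le> C * norm (y - x)" by (intro mult_right_mono le) auto
    finally show ?thesis .
  qed
  show ?thesis
  proof (rule that[of C, OF le(5) L])
    show "norm (F (t, y) - F (t, x) - D t x (y - x)) \<le> C * (norm (y - x))\<^sup>2" if "t \<in> {0..1}" "x \<in> K" "y \<in> K" for t x y
      using T[OF that] mult_right_mono[OF le(1), of "(norm (y - x))\<^sup>2"] by auto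
    show "norm (D t x h) \<le> C * norm h" if "t \<in> {0..1}" "x \<in> K" for t x h
      using N[OF that, of h] mult_right_mono[OF le(2), of "norm h"] by auto
    show "norm (F (t, x)) \<le> C" if "t \<in> {0..1}" "x \<in> K" for t x
      using C3[of "(t, x)"] that le(4) by auto
  qed
qed

text \<open>Gronwall controls the parameter through the initial values uniformly in time, and the
  bound on the field gives a Lipschitz estimate in time uniformly in the parameter; together they
  give joint continuity.\<close>

lemma G_continuous: "continuous_on ({0..1} \<times> UNIV) (\<lambda>(t, \<theta>). G t \<theta>)"
proof -
  obtain C where C: "0 \<le> C"
    "\<And>t x y. t \<in> {0..1} \<Longrightarrow> x \<in> K \<Longrightarrow> y \<in> K \<Longrightarrow> norm (F (t, y) - F (t, x)) \<le> C * norm (y - x)"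
    "\<And>t x. t \<in> {0..1} \<Longrightarrow> x \<in> K \<Longrightarrow> norm (F (t, x)) \<le> C"
    using constants by metis
  have 1: "norm (G t \<theta> - G t \<theta>') \<le> exp (2 * C + 1) * (norm (G 0 \<theta> - G 0 \<theta>') + 0)" if t: "t \<in> {0..1}" for t \<theta> \<theta>'
    by (rule gronwall[where y'="\<lambda>t. F (t, G t \<theta>) - F (t, G t \<theta>')" and y="\<lambda>t. G t \<theta> - G t \<theta>'"])
      (use C inK t in \<open>auto intro!: has_vector_derivative_diff sol\<close>)
  have 2: "norm (G t \<theta> - G t' \<theta>) \<le> C * norm (t - t')" if "t \<in> {0..1}" "t' \<in> {0..1}" for t t' \<theta>
    by (rule vector_differentiable_bound[where S="{0..1}", OF _ sol]) (use that C inK in auto)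
  show ?thesis
    unfolding continuous_on_def
  proof
    fix q :: "real \<times> 'p" assume q: "q \<in> {0..1} \<times> UNIV"
    obtain t \<theta> where q_eq: "q = (t, \<theta>)" by (cases q)
    have t: "t \<in> {0..1}" using q by (simp add: q_eq)
    have "((\<lambda>p. G (fst p) (snd p) - G t \<theta>) \<longlongrightarrow> 0) (at (t, \<theta>) within {0..1} \<times> UNIV)"
    proof (rule Lim_null_comparison)
      show "\<forall>\<^sub>F p in at (t, \<theta>) within {0..1} \<times> UNIV. norm (G (fst p) (snd p) - G t \<theta>) \<le>
          exp (2 * C + 1) * norm (G 0 (snd p) - G 0 \<theta>) + C * norm (fst p - t)"
        unfolding eventually_at_filter
      proof (rule always_eventually, intro allI impI)
        fix p :: "real \<times> 'p" assume "p \<in> {0..1} \<times> UNIV"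
        then have "fst p \<in> {0..1}" by auto
        then show "norm (G (fst p) (snd p) - G t \<theta>) \<le>
            exp (2 * C + 1) * norm (G 0 (snd p) - G 0 \<theta>) + C * norm (fst p - t)"
          using 1[of "fst p" "snd p" \<theta>] 2[of "fst p" t \<theta>] t
            norm_triangle_ineq[of "G (fst p) (snd p) - G (fst p) \<theta>" "G (fst p) \<theta> - G t \<theta>"] by auto
      qed
      have "((\<lambda>p. snd p) \<longlongrightarrow> \<theta>) (at (t, \<theta>) within {0..1} \<times> UNIV)"
        by (rule tendsto_eq_intros refl | simp)+
      moreover have "isCont (G 0) \<theta>" using cont0 by (simp add: continuous_on_eq_continuous_at)
      ultimately have "((\<lambda>p. G 0 (snd p)) \<longlongrightarrow> G 0 \<theta>) (at (t, \<theta>) within {0..1} \<times> UNIV)"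
        using isCont_tendsto_compose by blast
      then show "((\<lambda>p. exp (2 * C + 1) * norm (G 0 (snd p) - G 0 \<theta>) + C * norm (fst p - t)) \<longlongrightarrow> 0)
          (at (t, \<theta>) within {0..1} \<times> UNIV)"
        by (auto intro!: tendsto_eq_intros)
    qed
    from LIM_zero_cancel[OF this]
    show "((\<lambda>(t, \<theta>). G t \<theta>) \<longlongrightarrow> (case q of (t, \<theta>) \<Rightarrow> G t \<theta>)) (at q within {0..1} \<times> UNIV)"
      by (simp add: case_prod_beta' q_eq)
  qed
qed

text \<open>The difference quotients in the direction \<open>e\<close> solve the linearised equation up to an error
  of order \<open>h\<close>; by Gronwall they form a Cauchy family, so that the variational equation need not be
  solved beforehand.\<close>

theorem variation:
  assumes W0: "\<And>\<theta>. norm (W0 \<theta>) \<le> C0"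
    and quot0: "\<And>\<theta> h. \<bar>h\<bar> \<le> 1 \<Longrightarrow> norm (G 0 (\<theta> + h *\<^sub>R e) - G 0 \<theta> - h *\<^sub>R W0 \<theta>) \<le> C0 * h\<^sup>2"
  obtains W C1 where "\<And>\<theta>. W 0 \<theta> = W0 \<theta>"
    "continuous_on ({0..1} \<times> UNIV) (\<lambda>(t, \<theta>). W t \<theta>)"
    "\<And>t \<theta>. t \<in> {0..1} \<Longrightarrow> ((\<lambda>t. W t \<theta>) has_vector_derivative D t (G t \<theta>) (W t \<theta>)) (at t within {0..1})"
    "\<And>t \<theta>. t \<in> {0..1} \<Longrightarrow> norm (W t \<theta>) \<le> C1"
    "\<And>t \<theta> h. t \<in> {0..1} \<Longrightarrow> \<bar>h\<bar> \<le> 1 \<Longrightarrow> norm (G t (\<theta> + h *\<^sub>R e) - G t \<theta> - h *\<^sub>R W t \<theta>) \<le> C1 * h\<^sup>2"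
proof -
  have C0: "0 \<le> C0" using W0[of 0] norm_ge_zero order_trans by blast
  obtain C where C: "0 \<le> C"
    and lip: "\<And>t x y. t \<in> {0..1} \<Longrightarrow> x \<in> K \<Longrightarrow> y \<in> K \<Longrightarrow> norm (F (t, y) - F (t, x)) \<le> C * norm (y - x)"
    and tay: "\<And>t x y. t \<in> {0..1} \<Longrightarrow> x \<in> K \<Longrightarrow> y \<in> K \<Longrightarrow> norm (F (t, y) - F (t, x) - D t x (y - x)) \<le> C * (norm (y - x))\<^sup>2"
    and Dn: "\<And>t x h. t \<in> {0..1} \<Longrightarrow> x \<in> K \<Longrightarrow> norm (D t x h) \<le> C * norm h"
    using constants by metis
  define E where "E = exp (2 * C + 1)"
  have E: "0 < E" by (simp add: E_def)
  define C2 where "C2 = E * (2 * C0)"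
  have C2: "0 \<le> C2" using E C0 by (simp add: C2_def)
  have lipG: "norm (G t (\<theta> + h *\<^sub>R e) - G t \<theta>) \<le> C2 * \<bar>h\<bar>" if t: "t \<in> {0..1}" and h: "\<bar>h\<bar> \<le> 1" for t \<theta> h
  proof -
    have "norm (G t (\<theta> + h *\<^sub>R e) - G t \<theta>) \<le> exp (2 * C + 1) * (norm (G 0 (\<theta> + h *\<^sub>R e) - G 0 \<theta>) + 0)"
      by (rule gronwall[where y'="\<lambda>t. F (t, G t (\<theta> + h *\<^sub>R e)) - F (t, G t \<theta>)" and y="\<lambda>t. G t (\<theta> + h *\<^sub>R e) - G t \<theta>"])
        (use C lip inK t in \<open>auto intro!: has_vector_derivative_diff sol\<close>)
    moreover have "norm (G 0 (\<theta> + h *\<^sub>R e) - G 0 \<theta>) \<le> 2 * C0 * \<bar>h\<bar>"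
    proof -
      have "norm (G 0 (\<theta> + h *\<^sub>R e) - G 0 \<theta>) \<le> norm (G 0 (\<theta> + h *\<^sub>R e) - G 0 \<theta> - h *\<^sub>R W0 \<theta>) + norm (h *\<^sub>R W0 \<theta>)"
        using norm_triangle_ineq[of "G 0 (\<theta> + h *\<^sub>R e) - G 0 \<theta> - h *\<^sub>R W0 \<theta>" "h *\<^sub>R W0 \<theta>"] by simp
      also have "\<dots> \<le> C0 * h\<^sup>2 + \<bar>h\<bar> * C0"
        using quot0[OF h, of \<theta>] W0[of \<theta>] by (auto intro!: add_mono mult_left_mono)
      also have "C0 * h\<^sup>2 \<le> C0 * \<bar>h\<bar>"
        using h C0 mult_left_mono[OF h, of "\<bar>h\<bar>"] by (intro mult_left_mono) (auto simp: power2_eq_square abs_mult[symmetric])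
      finally show ?thesis by (simp add: algebra_simps)
    qed
    ultimately have "norm (G t (\<theta> + h *\<^sub>R e) - G t \<theta>) \<le> exp (2 * C + 1) * (2 * C0 * \<bar>h\<bar>)"
      by (smt (verit) mult_left_mono exp_ge_zero)
    then show ?thesis by (simp add: C2_def E_def mult.assoc)
  qed
  define Q where "Q h t \<theta> = (1 / h) *\<^sub>R (G t (\<theta> + h *\<^sub>R e) - G t \<theta>)" for h t \<theta>
  define Q' where "Q' h t \<theta> = (1 / h) *\<^sub>R (F (t, G t (\<theta> + h *\<^sub>R e)) - F (t, G t \<theta>))" for h t \<theta>
  define C4 where "C4 = C * C2\<^sup>2"
  have C4: "0 \<le> C4" using C by (simp add: C4_def)
  have Qd: "((\<lambda>t. Q h t \<theta>) has_vector_derivative Q' h t \<theta>) (at t within {0..1})" if "t \<in> {0..1}" for h t \<theta>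
    unfolding Q_def Q'_def
    by (intro bounded_linear.has_vector_derivative[OF bounded_linear_scaleR_right] has_vector_derivative_diff sol that)
  have Qb: "norm (Q h t \<theta>) \<le> C2" if "t \<in> {0..1}" "\<bar>h\<bar> \<le> 1" "h \<noteq> 0" for h t \<theta>
    using lipG[OF that(1,2), of \<theta>] that(3) by (simp add: Q_def divide_le_eq)
  \<comment> \<open>The Taylor remainder is quadratic in the displacement, the displacement is at
    most \<open>C2 * \<bar>h\<bar>\<close>, and dividing by \<open>h\<close> leaves one factor
    \<open>\<bar>h\<bar>\<close>.\<close>
  have Q'b: "norm (Q' h t \<theta> - D t (G t \<theta>) (Q h t \<theta>)) \<le> C4 * \<bar>h\<bar>" if t: "t \<in> {0..1}" "\<bar>h\<bar> \<le> 1" "h \<noteq> 0" for h t \<theta>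
  proof -
    let ?d = "G t (\<theta> + h *\<^sub>R e) - G t \<theta>"
    have "Q' h t \<theta> - D t (G t \<theta>) (Q h t \<theta>) = (1 / h) *\<^sub>R (F (t, G t (\<theta> + h *\<^sub>R e)) - F (t, G t \<theta>) - D t (G t \<theta>) ?d)"
      using linear_scale[OF linear_D[OF t(1) inK[OF t(1)]], of \<theta> "1 / h" ?d]
      by (simp add: Q_def Q'_def scaleR_diff_right)
    also have "norm \<dots> \<le> (1 / \<bar>h\<bar>) * (C * (norm ?d)\<^sup>2)"
      using tay[OF t(1) inK[OF t(1)] inK[OF t(1)], of "\<theta> + h *\<^sub>R e" \<theta>] t(3) by (simp add: divide_right_mono)
    also have "\<dots> \<le> (1 / \<bar>h\<bar>) * (C * (C2 * \<bar>h\<bar>)\<^sup>2)"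
      using lipG[OF t(1,2), of \<theta>] C by (intro mult_left_mono power_mono) auto
    also have "\<dots> = C4 * \<bar>h\<bar>"
      using t(3) by (simp add: C4_def power2_eq_square)
    finally show ?thesis .
  qed
  have Q0: "norm (Q h 0 \<theta> - W0 \<theta>) \<le> C0 * \<bar>h\<bar>" if "\<bar>h\<bar> \<le> 1" "h \<noteq> 0" for h \<theta>
  proof -
    have "Q h 0 \<theta> - W0 \<theta> = (1 / h) *\<^sub>R (G 0 (\<theta> + h *\<^sub>R e) - G 0 \<theta> - h *\<^sub>R W0 \<theta>)"
      using that by (simp add: Q_def scaleR_diff_right)
    also have "norm \<dots> \<le> (1 / \<bar>h\<bar>) * (C0 * h\<^sup>2)"
      using quot0[OF that(1), of \<theta>] that by (simp add: divide_right_mono)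
    also have "\<dots> = C0 * \<bar>h\<bar>" using that by (cases "h > 0") (auto simp: power2_eq_square)
    finally show ?thesis .
  qed
  define C3 where "C3 = E * (C0 + C4)"
  have C3: "0 \<le> C3" using E C0 C4 by (simp add: C3_def)
  have cauchy: "norm (Q h t \<theta> - Q k t \<theta>) \<le> C3 * (\<bar>h\<bar> + \<bar>k\<bar>)"
    if t: "t \<in> {0..1}" and h: "\<bar>h\<bar> \<le> 1" "h \<noteq> 0" and k: "\<bar>k\<bar> \<le> 1" "k \<noteq> 0" for h k t \<theta>
  proof -
    have "norm (Q h t \<theta> - Q k t \<theta>) \<le> exp (2 * C + 1) * (norm (Q h 0 \<theta> - Q k 0 \<theta>) + C4 * (\<bar>h\<bar> + \<bar>k\<bar>))"
    proof (rule gronwall[where y'="\<lambda>t. Q' h t \<theta> - Q' k t \<theta>" and y="\<lambda>t. Q h t \<theta> - Q k t \<theta>"])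
      show "((\<lambda>t. Q h t \<theta> - Q k t \<theta>) has_vector_derivative Q' h s \<theta> - Q' k s \<theta>) (at s within {0..1})" if "s \<in> {0..1}" for s
        by (intro has_vector_derivative_diff Qd that)
      show "norm (Q' h s \<theta> - Q' k s \<theta>) \<le> C * norm (Q h s \<theta> - Q k s \<theta>) + C4 * (\<bar>h\<bar> + \<bar>k\<bar>)" if s: "s \<in> {0..1}" for s
      proof -
        let ?L = "D s (G s \<theta>)"
        have "Q' h s \<theta> - Q' k s \<theta> = ?L (Q h s \<theta> - Q k s \<theta>) + (Q' h s \<theta> - ?L (Q h s \<theta>)) - (Q' k s \<theta> - ?L (Q k s \<theta>))"
          by (simp add: linear_diff[OF linear_D[OF s inK[OF s]]])
        moreover have "norm (a + b - c) \<le> norm a + norm b + norm c" for a b c :: 'a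
          using norm_triangle_ineq4[of "a + b" c] norm_triangle_ineq[of a b] by linarith
        ultimately have "norm (Q' h s \<theta> - Q' k s \<theta>) \<le> norm (?L (Q h s \<theta> - Q k s \<theta>)) +
            norm (Q' h s \<theta> - ?L (Q h s \<theta>)) + norm (Q' k s \<theta> - ?L (Q k s \<theta>))"
          by metis
        then show ?thesis
          using Dn[OF s inK[OF s], of \<theta> "Q h s \<theta> - Q k s \<theta>"] Q'b[OF s h, of \<theta>] Q'b[OF s k, of \<theta>]
          unfolding distrib_left by linarith
      qed
    qed (use C C4 t in auto)
    also have "\<dots> \<le> E * (C0 * (\<bar>h\<bar> + \<bar>k\<bar>) + C4 * (\<bar>h\<bar> + \<bar>k\<bar>))"
    proof -
      have "norm (Q h 0 \<theta> - Q k 0 \<theta>) \<le> C0 * (\<bar>h\<bar> + \<bar>k\<bar>)"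
        using norm_triangle_ineq4[of "Q h 0 \<theta> - W0 \<theta>" "Q k 0 \<theta> - W0 \<theta>"] Q0[OF h, of \<theta>] Q0[OF k, of \<theta>]
        unfolding distrib_left by simp
      then show ?thesis unfolding E_def by (intro mult_left_mono) auto
    qed
    also have "\<dots> = C3 * (\<bar>h\<bar> + \<bar>k\<bar>)" unfolding C3_def by (simp only: distrib_right distrib_left mult.assoc)
    finally show ?thesis .
  qed
  define \<eta> where "\<eta> n = 1 / real (Suc n)" for n
  have \<eta>: "\<bar>\<eta> n\<bar> \<le> 1" "\<eta> n \<noteq> 0" "0 < \<eta> n" for n by (auto simp: \<eta>_def)
  have \<eta>0: "\<eta> \<longlonglongrightarrow> 0" unfolding \<eta>_def using LIMSEQ_inverse_real_of_nat by (simp add: inverse_eq_divide)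
  define W where "W t \<theta> = lim (\<lambda>n. Q (\<eta> n) t \<theta>)" for t \<theta>
  have lim: "(\<lambda>n. Q (\<eta> n) t \<theta>) \<longlonglongrightarrow> W t \<theta>" if t: "t \<in> {0..1}" for t \<theta>
  proof -
    have "Cauchy (\<lambda>n. Q (\<eta> n) t \<theta>)"
    proof (rule metric_CauchyI)
      fix \<epsilon> :: real assume "\<epsilon> > 0"
      have "(\<lambda>n. C3 * (\<eta> n + \<eta> n)) \<longlonglongrightarrow> C3 * (0 + 0)" by (intro tendsto_intros \<eta>0)
      then have "\<forall>\<^sub>F n in sequentially. C3 * (\<eta> n + \<eta> n) < \<epsilon>"
        using \<open>\<epsilon> > 0\<close> order_tendstoD(2)[of _ "0::real"] by simp
      then obtain N where N: "C3 * (\<eta> N + \<eta> N) < \<epsilon>" by (auto simp: eventually_sequentially)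
      have "dist (Q (\<eta> m) t \<theta>) (Q (\<eta> n) t \<theta>) < \<epsilon>" if "m \<ge> N" "n \<ge> N" for m n
      proof -
        have "\<eta> m \<le> \<eta> N" "\<eta> n \<le> \<eta> N" using that by (auto simp: \<eta>_def frac_le)
        then have "C3 * (\<bar>\<eta> m\<bar> + \<bar>\<eta> n\<bar>) \<le> C3 * (\<eta> N + \<eta> N)"
          using C3 \<eta>(3)[of m] \<eta>(3)[of n] by (intro mult_left_mono) auto
        then show ?thesis using cauchy[OF t \<eta>(1,2) \<eta>(1,2), of m \<theta> n] N by (simp add: dist_norm)
      qed
      then show "\<exists>M. \<forall>m\<ge>M. \<forall>n\<ge>M. dist (Q (\<eta> m) t \<theta>) (Q (\<eta> n) t \<theta>) < \<epsilon>" by blast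
    qed
    then show ?thesis unfolding W_def by (simp add: Cauchy_convergent_iff convergent_LIMSEQ_iff)
  qed
  \<comment> \<open>The second step size in \<open>cauchy\<close> runs through \<open>\<eta>\<close>
    to zero. The rate is uniform in time and parameter, which later gives the equation for
    \<open>W\<close>, its continuity and the quadratic quotient bound.\<close>
  have QW: "norm (Q h t \<theta> - W t \<theta>) \<le> C3 * \<bar>h\<bar>" if t: "t \<in> {0..1}" and h: "\<bar>h\<bar> \<le> 1" "h \<noteq> 0" for h t \<theta>
  proof (rule LIMSEQ_le)
    show "(\<lambda>n. norm (Q h t \<theta> - Q (\<eta> n) t \<theta>)) \<longlonglongrightarrow> norm (Q h t \<theta> - W t \<theta>)"
      by (intro tendsto_intros lim t)
    show "(\<lambda>n. C3 * (\<bar>h\<bar> + \<bar>\<eta> n\<bar>)) \<longlonglongrightarrow> C3 * \<bar>h\<bar>"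
      by (rule tendsto_eq_intros \<eta>0 refl | simp)+
    show "\<exists>N. \<forall>n\<ge>N. norm (Q h t \<theta> - Q (\<eta> n) t \<theta>) \<le> C3 * (\<bar>h\<bar> + \<bar>\<eta> n\<bar>)"
      using cauchy[OF t h \<eta>(1,2)] by blast
  qed
  have W0eq: "W 0 \<theta> = W0 \<theta>" for \<theta>
  proof -
    have "(\<lambda>n. Q (\<eta> n) 0 \<theta> - W0 \<theta>) \<longlonglongrightarrow> 0"
    proof (rule Lim_null_comparison)
      show "\<forall>\<^sub>F n in sequentially. norm (Q (\<eta> n) 0 \<theta> - W0 \<theta>) \<le> C0 * \<bar>\<eta> n\<bar>"
        using Q0[OF \<eta>(1,2)] by simp
      show "(\<lambda>n. C0 * \<bar>\<eta> n\<bar>) \<longlonglongrightarrow> 0"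
        by (rule tendsto_eq_intros \<eta>0 refl | simp)+
    qed
    then have "(\<lambda>n. Q (\<eta> n) 0 \<theta>) \<longlonglongrightarrow> W0 \<theta>" by (rule LIM_zero_cancel)
    then show ?thesis using lim[of 0 \<theta>] LIMSEQ_unique by auto
  qed
  have Wb: "norm (W t \<theta>) \<le> C2" if t: "t \<in> {0..1}" for t \<theta>
    by (rule Lim_bounded[OF tendsto_norm[OF lim[OF t]], of 0]) (use Qb[OF t \<eta>(1,2)] in auto)
  have Wd: "((\<lambda>t. W t \<theta>) has_vector_derivative D t (G t \<theta>) (W t \<theta>)) (at t within {0..1})" if t: "t \<in> {0..1}" for t \<theta>
  proof -
    \<comment> \<open>Exchanging limit and time derivative requires uniform convergence of the
      derivatives \<open>Q'\<close>; their distance to the linearized field at \<open>W\<close> is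
      at most \<open>(C4 + C * C3) * \<eta> n\<close>.\<close>
    have "\<exists>g. \<forall>s\<in>{0..1}. (\<lambda>n. Q (\<eta> n) s \<theta>) \<longlonglongrightarrow> g s \<and> (g has_derivative (\<lambda>x. x *\<^sub>R D s (G s \<theta>) (W s \<theta>))) (at s within {0..1})"
    proof (rule has_derivative_sequence)
      show "((\<lambda>s. Q (\<eta> n) s \<theta>) has_derivative (\<lambda>x. x *\<^sub>R Q' (\<eta> n) s \<theta>)) (at s within {0..1})" if "s \<in> {0..1}" for n s
        using Qd[OF that] by (simp add: has_vector_derivative_def)
      show "(\<lambda>n. Q (\<eta> n) 0 \<theta>) \<longlonglongrightarrow> W 0 \<theta>" by (rule lim) auto
      fix \<epsilon> :: real assume "\<epsilon> > 0"
      have "(\<lambda>n. (C4 + C * C3) * \<eta> n) \<longlonglongrightarrow> (C4 + C * C3) * 0" by (intro tendsto_intros \<eta>0)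
      then have "\<forall>\<^sub>F n in sequentially. (C4 + C * C3) * \<eta> n < \<epsilon>"
        using \<open>\<epsilon> > 0\<close> order_tendstoD(2)[of _ "0::real"] by simp
      then show "\<forall>\<^sub>F n in sequentially. \<forall>s\<in>{0..1}. \<forall>h. norm (h *\<^sub>R Q' (\<eta> n) s \<theta> - h *\<^sub>R D s (G s \<theta>) (W s \<theta>)) \<le> \<epsilon> * norm h"
      proof (rule eventually_mono, safe)
        fix n s and h :: real assume n: "(C4 + C * C3) * \<eta> n < \<epsilon>" and s: "s \<in> {0..1::real}"
        have "D s (G s \<theta>) (Q (\<eta> n) s \<theta>) - D s (G s \<theta>) (W s \<theta>) = D s (G s \<theta>) (Q (\<eta> n) s \<theta> - W s \<theta>)"
          by (simp add: linear_diff[OF linear_D[OF s inK[OF s]]])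
        also have "norm \<dots> \<le> C * (C3 * \<bar>\<eta> n\<bar>)"
          by (rule order_trans[OF Dn[OF s inK[OF s]] mult_left_mono[OF QW[OF s \<eta>(1,2)] C]])
        finally have "norm (Q' (\<eta> n) s \<theta> - D s (G s \<theta>) (W s \<theta>)) \<le> C4 * \<bar>\<eta> n\<bar> + C * (C3 * \<bar>\<eta> n\<bar>)"
          using Q'b[OF s \<eta>(1,2), of n \<theta>] norm_triangle_ineq[of "Q' (\<eta> n) s \<theta> - D s (G s \<theta>) (Q (\<eta> n) s \<theta>)" "D s (G s \<theta>) (Q (\<eta> n) s \<theta>) - D s (G s \<theta>) (W s \<theta>)"]
          by simp
        also have "\<dots> \<le> \<epsilon>" using n \<eta>(3)[of n] by (simp add: algebra_simps)
        finally have "\<bar>h\<bar> * norm (Q' (\<eta> n) s \<theta> - D s (G s \<theta>) (W s \<theta>)) \<le> \<bar>h\<bar> * \<epsilon>"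
          by (rule mult_left_mono) auto
        then show "norm (h *\<^sub>R Q' (\<eta> n) s \<theta> - h *\<^sub>R D s (G s \<theta>) (W s \<theta>)) \<le> \<epsilon> * norm h"
          by (simp add: mult.commute flip: scaleR_diff_right)
      qed
    qed auto
    then obtain g where g: "\<And>s. s \<in> {0..1} \<Longrightarrow> (\<lambda>n. Q (\<eta> n) s \<theta>) \<longlonglongrightarrow> g s"
      "\<And>s. s \<in> {0..1} \<Longrightarrow> (g has_derivative (\<lambda>x. x *\<^sub>R D s (G s \<theta>) (W s \<theta>))) (at s within {0..1})" by blast
    have gW: "g s = W s \<theta>" if "s \<in> {0..1}" for s using LIMSEQ_unique[OF g(1)[OF that] lim[OF that]] .
    have "((\<lambda>t. W t \<theta>) has_derivative (\<lambda>x. x *\<^sub>R D t (G t \<theta>) (W t \<theta>))) (at t within {0..1})"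
      by (rule has_derivative_transform[OF t _ g(2)[OF t]]) (simp add: gW)
    then show ?thesis by (simp add: has_vector_derivative_def)
  qed
  have Wc: "continuous_on ({0..1} \<times> UNIV) (\<lambda>(t, \<theta>). W t \<theta>)"
  proof (rule uniform_limit_theorem[where f="\<lambda>n (t, \<theta>). Q (\<eta> n) t \<theta>" and F=sequentially])
    show "\<forall>\<^sub>F n in sequentially. continuous_on ({0..1} \<times> UNIV) (\<lambda>(t, \<theta>). Q (\<eta> n) t \<theta>)"
    proof (rule always_eventually, rule allI)
      fix n
      have "continuous_on ({0..1} \<times> UNIV) (\<lambda>p. (case (fst p, snd p + \<eta> n *\<^sub>R e) of (t, \<theta>) \<Rightarrow> G t \<theta>))"
        by (rule continuous_on_compose2[OF G_continuous]) (auto intro!: continuous_intros)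
      moreover have "continuous_on ({0..1} \<times> UNIV) (\<lambda>p. G (fst p) (snd p))"
        using G_continuous by (simp add: case_prod_beta')
      ultimately show "continuous_on ({0..1} \<times> UNIV) (\<lambda>(t, \<theta>). Q (\<eta> n) t \<theta>)"
        unfolding Q_def case_prod_beta' by (auto intro!: continuous_intros)
    qed
    show "uniform_limit ({0..1} \<times> UNIV) (\<lambda>n (t, \<theta>). Q (\<eta> n) t \<theta>) (\<lambda>(t, \<theta>). W t \<theta>) sequentially"
    proof (rule uniform_limitI)
      fix \<epsilon> :: real assume "\<epsilon> > 0"
      have "(\<lambda>n. C3 * \<eta> n) \<longlonglongrightarrow> C3 * 0" by (intro tendsto_intros \<eta>0)
      then have "\<forall>\<^sub>F n in sequentially. C3 * \<eta> n < \<epsilon>"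
        using \<open>\<epsilon> > 0\<close> order_tendstoD(2)[of _ "0::real"] by simp
      then show "\<forall>\<^sub>F n in sequentially. \<forall>p\<in>{0..1} \<times> UNIV. dist (case p of (t, \<theta>) \<Rightarrow> Q (\<eta> n) t \<theta>) (case p of (t, \<theta>) \<Rightarrow> W t \<theta>) < \<epsilon>"
      proof (rule eventually_mono, safe)
        fix n t \<theta> assume "C3 * \<eta> n < \<epsilon>" "t \<in> {0..1::real}"
        then show "dist (Q (\<eta> n) t \<theta>) (W t \<theta>) < \<epsilon>"
          using QW[of t "\<eta> n" \<theta>] \<eta>[of n] by (simp add: dist_norm)
      qed
    qed
  qed auto
  have quot: "norm (G t (\<theta> + h *\<^sub>R e) - G t \<theta> - h *\<^sub>R W t \<theta>) \<le> C3 * h\<^sup>2" if t: "t \<in> {0..1}" and h: "\<bar>h\<bar> \<le> 1" for t \<theta> h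
  proof (cases "h = 0")
    case False
    have "G t (\<theta> + h *\<^sub>R e) - G t \<theta> - h *\<^sub>R W t \<theta> = h *\<^sub>R (Q h t \<theta> - W t \<theta>)"
      using False by (simp add: Q_def scaleR_diff_right)
    also have "norm \<dots> \<le> \<bar>h\<bar> * (C3 * \<bar>h\<bar>)"
      using QW[OF t h False, of \<theta>] by (simp add: mult_left_mono)
    also have "\<dots> = C3 * h\<^sup>2" by (simp add: power2_eq_square)
    finally show ?thesis .
  qed simp
  show ?thesis
  proof (rule that[of W "C2 + C3", OF W0eq Wc Wd])
    show "norm (W t \<theta>) \<le> C2 + C3" if "t \<in> {0..1}" for t \<theta> using Wb[OF that, of \<theta>] C3 by linarith
    show "norm (G t (\<theta> + h *\<^sub>R e) - G t \<theta> - h *\<^sub>R W t \<theta>) \<le> (C2 + C3) * h\<^sup>2" if "t \<in> {0..1}" "\<bar>h\<bar> \<le> 1" for t \<theta> h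
      using quot[OF that, of \<theta>] mult_right_mono[of C3 "C2 + C3" "h\<^sup>2"] C2 by auto
  qed
qed

end

section \<open>Orthonormal frames in three-space and the curvature of the sphere\<close>

lemma bounded_bilinear_cross3: "bounded_bilinear (cross3 :: real^3 \<Rightarrow> _)"
  using bilinear_conv_bounded_bilinear bilinear_cross by blast

context
  fixes u w n :: "real^3"
  assumes u: "u \<bullet> u = 1" and w: "w \<bullet> w = 1" and uw: "u \<bullet> w = 0" and n_def: "n = cross3 u w"
begin

lemma frame_cross: "cross3 n u = w" "cross3 n w = - u" "cross3 u n = - w" "cross3 w n = u"
    "cross3 w u = - n" "cross3 u w = n"
  and frame_inner: "n \<bullet> n = 1" "u \<bullet> n = 0" "w \<bullet> n = 0" "n \<bullet> u = 0" "n \<bullet> w = 0"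
proof -
  have un: "cross3 u n = - w" unfolding n_def Lagrange using u uw by simp
  then show "cross3 u n = - w" "cross3 n u = w" using cross_skew[of n u] by simp_all
  have wn: "cross3 w n = u" unfolding n_def Lagrange using w uw by (simp add: inner_commute)
  then show "cross3 w n = u" "cross3 n w = - u" using cross_skew[of n w] by simp_all
  show "cross3 u w = n" "cross3 w u = - n" using n_def cross_skew[of w u] by simp_all
  show "u \<bullet> n = 0" "w \<bullet> n = 0" "n \<bullet> u = 0" "n \<bullet> w = 0"
    unfolding n_def by (simp_all add: dot_cross_self)
  have "(norm n)\<^sup>2 = 1"
    using norm_cross_dot[of u w] u w uw unfolding n_def by (simp add: norm_eq_sqrt_inner)
  then show "n \<bullet> n = 1" by (simp add: dot_square_norm)
qed

lemma frame_expand: "x = (x \<bullet> u) *\<^sub>R u + (x \<bullet> w) *\<^sub>R w + (x \<bullet> n) *\<^sub>R n"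
proof -
  have "cross3 n (cross3 x n) = cross3 n ((x \<bullet> w) *\<^sub>R u - (x \<bullet> u) *\<^sub>R w)"
    unfolding n_def by (simp only: Lagrange)
  also have "\<dots> = (x \<bullet> w) *\<^sub>R w + (x \<bullet> u) *\<^sub>R u"
    by (simp add: Cross3.right_diff_distrib cross_mult_right frame_cross)
  finally have "(x \<bullet> w) *\<^sub>R w + (x \<bullet> u) *\<^sub>R u = x - (x \<bullet> n) *\<^sub>R n"
    by (simp add: Lagrange frame_inner inner_commute)
  then show ?thesis by (simp add: algebra_simps)
qed

text \<open>Structure equation of the sphere: the left side is the exterior derivative of the
  connection form \<open>w' \<bullet> cross3 u w\<close> after the mixed second derivatives have
  cancelled. In the frame the connection coefficients \<open>a\<close> and \<open>b\<close> drop
  out, leaving the \<open>u\<close> components of \<open>ws\<close> and \<open>wt\<close>, which are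
  minus the \<open>w\<close> components of \<open>us\<close> and \<open>ut\<close>.\<close>

lemma frame_curvature:
  assumes "u \<bullet> us = 0" "u \<bullet> ut = 0" "w \<bullet> ws = 0" "w \<bullet> wt = 0"
    and "us \<bullet> w + u \<bullet> ws = 0" "ut \<bullet> w + u \<bullet> wt = 0"
  shows "ws \<bullet> (cross3 ut w + cross3 u wt) - wt \<bullet> (cross3 us w + cross3 u ws) = u \<bullet> cross3 us ut"
proof -
  define a b x1 y1 x2 y2 where "a = ws \<bullet> n" "b = wt \<bullet> n" "x1 = us \<bullet> w" "y1 = us \<bullet> n" "x2 = ut \<bullet> w" "y2 = ut \<bullet> n"
  have us: "us = x1 *\<^sub>R w + y1 *\<^sub>R n" and ut: "ut = x2 *\<^sub>R w + y2 *\<^sub>R n"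
    using frame_expand[of us] frame_expand[of ut] assms(1,2)
    by (simp_all add: a_b_x1_y1_x2_y2_def inner_commute)
  have "ws \<bullet> u = - x1" "wt \<bullet> u = - x2" "ws \<bullet> w = 0" "wt \<bullet> w = 0"
    using assms by (simp_all add: a_b_x1_y1_x2_y2_def inner_commute)
  then have ws: "ws = (- x1) *\<^sub>R u + a *\<^sub>R n" and wt: "wt = (- x2) *\<^sub>R u + b *\<^sub>R n"
    using frame_expand[of ws] frame_expand[of wt]
    by (simp_all add: a_b_x1_y1_x2_y2_def)
  have X: "cross3 (x *\<^sub>R w + y *\<^sub>R n) w + cross3 u ((- x) *\<^sub>R u + c *\<^sub>R n) = (- y) *\<^sub>R u + (- c) *\<^sub>R w" for x y c
    by (simp only: cross_add_left cross_add_right cross_mult_left cross_mult_right frame_cross cross_refl) simp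
  have A: "u \<bullet> cross3 us ut = x1 * y2 - x2 * y1"
    unfolding us ut
    by (simp only: cross_add_left cross_add_right cross_mult_left cross_mult_right frame_cross cross_refl)
      (simp add: inner_diff_right u mult.commute)
  have B: "((- x) *\<^sub>R u + c *\<^sub>R n) \<bullet> ((- y) *\<^sub>R u + d *\<^sub>R w) = x * y" for x c y d
    by (simp only: inner_add_left inner_add_right inner_scaleR_left inner_scaleR_right u uw frame_inner) simp
  have "cross3 ut w + cross3 u wt = (- y2) *\<^sub>R u + (- b) *\<^sub>R w"
      "cross3 us w + cross3 u ws = (- y1) *\<^sub>R u + (- a) *\<^sub>R w"
    unfolding us ut ws wt by (rule X)+
  moreover have "ws \<bullet> ((- y2) *\<^sub>R u + (- b) *\<^sub>R w) = x1 * y2" "wt \<bullet> ((- y1) *\<^sub>R u + (- a) *\<^sub>R w) = x2 * y1"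
    unfolding ws wt by (rule B)+
  ultimately show ?thesis using A by simp
qed

end

subsection \<open>Two-parameter families of class \<open>C\<^sup>1\<close> with mixed derivative\<close>

definition strip_continuous :: "(real \<Rightarrow> real \<Rightarrow> 'a::topological_space) \<Rightarrow> bool" where
  "strip_continuous f \<longleftrightarrow> continuous_on ({0..1} \<times> UNIV) (\<lambda>x. f (fst x) (snd x))"

text \<open>Both first derivatives exist, and the mixed derivative taken in either order is the same
  function \<open>fm\<close>. Variation of a flow along a line of parameters produces exactly this,
  with \<open>t\<close> restricted to \<open>{0..1}\<close> and \<open>s\<close> on the whole
  line.\<close>

definition C11 :: "(real \<Rightarrow> real \<Rightarrow> 'a::real_normed_vector) \<Rightarrow> (real \<Rightarrow> real \<Rightarrow> 'a) \<Rightarrow> (real \<Rightarrow> real \<Rightarrow> 'a)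
    \<Rightarrow> (real \<Rightarrow> real \<Rightarrow> 'a) \<Rightarrow> bool" where
  "C11 f ft fs fm \<longleftrightarrow>
    (\<forall>t\<in>{0..1}. \<forall>s. ((\<lambda>t. f t s) has_vector_derivative ft t s) (at t within {0..1}) \<and>
       ((\<lambda>s. f t s) has_vector_derivative fs t s) (at s) \<and>
       ((\<lambda>s. ft t s) has_vector_derivative fm t s) (at s) \<and>
       ((\<lambda>t. fs t s) has_vector_derivative fm t s) (at t within {0..1})) \<and>
    strip_continuous f \<and> strip_continuous ft \<and> strip_continuous fs \<and> strip_continuous fm"

lemma C11I:
  assumes "\<And>t s. t \<in> {0..1} \<Longrightarrow> ((\<lambda>t. f t s) has_vector_derivative ft t s) (at t within {0..1})"
    "\<And>t s. t \<in> {0..1} \<Longrightarrow> ((\<lambda>s. f t s) has_vector_derivative fs t s) (at s)"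
    "\<And>t s. t \<in> {0..1} \<Longrightarrow> ((\<lambda>s. ft t s) has_vector_derivative fm t s) (at s)"
    "\<And>t s. t \<in> {0..1} \<Longrightarrow> ((\<lambda>t. fs t s) has_vector_derivative fm t s) (at t within {0..1})"
    "strip_continuous f" "strip_continuous ft" "strip_continuous fs" "strip_continuous fm"
  shows "C11 f ft fs fm"
  using assms by (auto simp: C11_def)

lemma C11_deriv:
  assumes "C11 f ft fs fm" "t \<in> {0..1}"
  shows "((\<lambda>t. f t s) has_vector_derivative ft t s) (at t within {0..1})"
    "((\<lambda>s. f t s) has_vector_derivative fs t s) (at s)"
    "((\<lambda>s. ft t s) has_vector_derivative fm t s) (at s)"
    "((\<lambda>t. fs t s) has_vector_derivative fm t s) (at t within {0..1})"
  using assms by (auto simp: C11_def)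

lemma C11_cont:
  assumes "C11 f ft fs fm"
  shows "strip_continuous f" "strip_continuous ft" "strip_continuous fs" "strip_continuous fm"
  using assms by (auto simp: C11_def)

lemma strip_continuous_bilinear:
  assumes "bounded_bilinear h" "strip_continuous f" "strip_continuous g"
  shows "strip_continuous (\<lambda>t s. h (f t s) (g t s))"
  using assms bounded_bilinear.continuous_on unfolding strip_continuous_def by blast

lemma strip_continuous_add:
  fixes f g :: "real \<Rightarrow> real \<Rightarrow> 'a::real_normed_vector"
  assumes "strip_continuous f" "strip_continuous g"
  shows "strip_continuous (\<lambda>t s. f t s + g t s)"
  using assms unfolding strip_continuous_def by (intro continuous_intros)

lemma strip_continuous_diff:
  fixes f g :: "real \<Rightarrow> real \<Rightarrow> 'a::real_normed_vector"
  assumes "strip_continuous f" "strip_continuous g"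
  shows "strip_continuous (\<lambda>t s. f t s - g t s)"
  using assms unfolding strip_continuous_def by (intro continuous_intros)

lemma strip_continuous_mult:
  fixes f g :: "real \<Rightarrow> real \<Rightarrow> real"
  assumes "strip_continuous f" "strip_continuous g"
  shows "strip_continuous (\<lambda>t s. f t s * g t s)"
  using assms unfolding strip_continuous_def by (intro continuous_intros)

lemma strip_continuous_linear:
  assumes "bounded_linear L" "strip_continuous f"
  shows "strip_continuous (\<lambda>t s. L (f t s))"
  using assms bounded_linear.continuous_on unfolding strip_continuous_def by blast

lemma strip_continuous_compose:
  assumes "continuous_on V g" "strip_continuous f" "\<And>t s. t \<in> {0..1} \<Longrightarrow> f t s \<in> V"
  shows "strip_continuous (\<lambda>t s. g (f t s))"
  using assms(2,3) unfolding strip_continuous_def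
  by (intro continuous_on_compose2[OF assms(1)]) auto

lemma C11_linear:
  assumes L: "bounded_linear L" and f: "C11 f ft fs fm"
  shows "C11 (\<lambda>t s. L (f t s)) (\<lambda>t s. L (ft t s)) (\<lambda>t s. L (fs t s)) (\<lambda>t s. L (fm t s))"
  by (rule C11I; intro bounded_linear.has_vector_derivative[OF L] strip_continuous_linear[OF L]
      C11_deriv[OF f] C11_cont[OF f]; assumption)

lemma C11_bilinear:
  assumes h: "bounded_bilinear h" and f: "C11 f ft fs fm" and g: "C11 g gt gs gm"
  shows "C11 (\<lambda>t s. h (f t s) (g t s)) (\<lambda>t s. h (f t s) (gt t s) + h (ft t s) (g t s))
    (\<lambda>t s. h (f t s) (gs t s) + h (fs t s) (g t s))
    (\<lambda>t s. (h (f t s) (gm t s) + h (fs t s) (gt t s)) + (h (ft t s) (gs t s) + h (fm t s) (g t s)))"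
proof (rule C11I)
  note d = bounded_bilinear.has_vector_derivative[OF h]
  fix t s :: real assume t: "t \<in> {0..1}"
  note F = C11_deriv[OF f t, of s] and G = C11_deriv[OF g t, of s]
  show "((\<lambda>t. h (f t s) (g t s)) has_vector_derivative h (f t s) (gt t s) + h (ft t s) (g t s)) (at t within {0..1})"
    by (rule d[OF F(1) G(1)])
  show "((\<lambda>s. h (f t s) (g t s)) has_vector_derivative h (f t s) (gs t s) + h (fs t s) (g t s)) (at s)"
    by (rule d[OF F(2) G(2)])
  show "((\<lambda>s. h (f t s) (gt t s) + h (ft t s) (g t s)) has_vector_derivative
      (h (f t s) (gm t s) + h (fs t s) (gt t s)) + (h (ft t s) (gs t s) + h (fm t s) (g t s))) (at s)"
    by (rule has_vector_derivative_add[OF d[OF F(2) G(3)] d[OF F(3) G(2)]])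
  have "((\<lambda>t. h (f t s) (gs t s) + h (fs t s) (g t s)) has_vector_derivative
      (h (f t s) (gm t s) + h (ft t s) (gs t s)) + (h (fs t s) (gt t s) + h (fm t s) (g t s))) (at t within {0..1})"
    by (rule has_vector_derivative_add[OF d[OF F(1) G(4)] d[OF F(4) G(1)]])
  then show "((\<lambda>t. h (f t s) (gs t s) + h (fs t s) (g t s)) has_vector_derivative
      (h (f t s) (gm t s) + h (fs t s) (gt t s)) + (h (ft t s) (gs t s) + h (fm t s) (g t s))) (at t within {0..1})"
    by (simp add: algebra_simps)
qed (intro strip_continuous_add strip_continuous_bilinear[OF h] C11_cont[OF f] C11_cont[OF g])+

lemma C11_add:
  assumes f: "C11 f ft fs fm" and g: "C11 g gt gs gm"
  shows "C11 (\<lambda>t s. f t s + g t s) (\<lambda>t s. ft t s + gt t s) (\<lambda>t s. fs t s + gs t s) (\<lambda>t s. fm t s + gm t s)"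
  by (rule C11I; intro has_vector_derivative_add strip_continuous_add
      C11_deriv[OF f] C11_cont[OF f] C11_deriv[OF g] C11_cont[OF g]; assumption)

lemma C11_diff:
  assumes f: "C11 f ft fs fm" and g: "C11 g gt gs gm"
  shows "C11 (\<lambda>t s. f t s - g t s) (\<lambda>t s. ft t s - gt t s) (\<lambda>t s. fs t s - gs t s) (\<lambda>t s. fm t s - gm t s)"
  by (rule C11I; intro has_vector_derivative_diff strip_continuous_diff
      C11_deriv[OF f] C11_cont[OF f] C11_deriv[OF g] C11_cont[OF g]; assumption)

lemma C11_real_compose:
  fixes f :: "real \<Rightarrow> real \<Rightarrow> real"
  assumes f: "C11 f ft fs fm" and V: "\<And>t s. t \<in> {0..1} \<Longrightarrow> f t s \<in> V"
    and g: "\<And>x. x \<in> V \<Longrightarrow> (g has_real_derivative g' x) (at x)"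
    and g': "\<And>x. x \<in> V \<Longrightarrow> (g' has_real_derivative g'' x) (at x)" and g'': "continuous_on V g''"
  shows "C11 (\<lambda>t s. g (f t s)) (\<lambda>t s. g' (f t s) * ft t s) (\<lambda>t s. g' (f t s) * fs t s)
    (\<lambda>t s. g' (f t s) * fm t s + (g'' (f t s) * fs t s) * ft t s)"
proof (rule C11I)
  have c: "((\<lambda>x. G (\<phi> x)) has_vector_derivative D * \<phi>') (at x within S)"
    if "(G has_real_derivative D) (at (\<phi> x))" "(\<phi> has_vector_derivative \<phi>') (at x within S)"
    for G :: "real \<Rightarrow> real" and D \<phi> \<phi>' x S
    using DERIV_chain2[of G D \<phi> x \<phi>' S] that by (simp add: has_real_derivative_iff_has_vector_derivative)
  note m = has_vector_derivative_mult
  fix t s :: real assume t: "t \<in> {0..1}"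
  note F = C11_deriv[OF f t, of s]
  show "((\<lambda>t. g (f t s)) has_vector_derivative g' (f t s) * ft t s) (at t within {0..1})"
    by (rule c[OF g[OF V[OF t]] F(1)])
  show "((\<lambda>s. g (f t s)) has_vector_derivative g' (f t s) * fs t s) (at s)"
    by (rule c[OF g[OF V[OF t]] F(2)])
  show "((\<lambda>s. g' (f t s) * ft t s) has_vector_derivative g' (f t s) * fm t s + (g'' (f t s) * fs t s) * ft t s) (at s)"
    by (rule m[OF c[OF g'[OF V[OF t]] F(2)] F(3)])
  show "((\<lambda>t. g' (f t s) * fs t s) has_vector_derivative g' (f t s) * fm t s + (g'' (f t s) * fs t s) * ft t s) (at t within {0..1})"
    using m[OF c[OF g'[OF V[OF t]] F(1)] F(4)] by (simp only: mult.assoc mult.commute[of "ft t s" "fs t s"])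
next
  have gc: "continuous_on V g"
    by (rule continuous_at_imp_continuous_on) (use DERIV_isCont[OF g] in blast)
  have g'c: "continuous_on V g'"
    by (rule continuous_at_imp_continuous_on) (use DERIV_isCont[OF g'] in blast)
  have 1: "strip_continuous (\<lambda>t s. g (f t s))"
    by (rule strip_continuous_compose[OF gc C11_cont(1)[OF f] V])
  have 3: "strip_continuous (\<lambda>t s. g' (f t s))"
    by (rule strip_continuous_compose[OF g'c C11_cont(1)[OF f] V])
  have 2: "strip_continuous (\<lambda>t s. g'' (f t s))"
    by (rule strip_continuous_compose[OF g'' C11_cont(1)[OF f] V])
  show "strip_continuous (\<lambda>t s. g (f t s))" by (rule 1)
  show "strip_continuous (\<lambda>t s. g' (f t s) * ft t s)" "strip_continuous (\<lambda>t s. g' (f t s) * fs t s)"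
    "strip_continuous (\<lambda>t s. g' (f t s) * fm t s + (g'' (f t s) * fs t s) * ft t s)"
    by (intro strip_continuous_add strip_continuous_mult 3 2 C11_cont[OF f])+
qed

text \<open>The time derivative within \<open>{0..1}\<close> is unique even at the end points, so
  equal functions of time have equal derivatives there.\<close>

lemma C11_periodic_t:
  assumes "C11 f ft fs fm" "\<And>t. t \<in> {0..1} \<Longrightarrow> f t 1 = f t 0" "t \<in> {0..1}"
  shows "ft t 1 = ft t 0"
proof (rule vector_derivative_unique_within_closed_interval[of 0 1 t "\<lambda>t. f t 0"])
  show "((\<lambda>t. f t 0) has_vector_derivative ft t 1) (at t within cbox 0 1)"
    using has_vector_derivative_transform[OF assms(3) _ C11_deriv(1)[OF assms(1,3), of 1]] assms(2) by simp
  show "((\<lambda>t. f t 0) has_vector_derivative ft t 0) (at t within cbox 0 1)"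
    using C11_deriv(1)[OF assms(1,3), of 0] by simp
qed (use assms in auto)

lemma C11_constant_derivs:
  assumes "C11 f ft fs fm" "\<And>t s. t \<in> {0..1} \<Longrightarrow> f t s = c" "t \<in> {0..1}"
  shows "ft t s = 0" "fs t s = 0"
proof -
  show "ft t s = 0"
  proof (rule vector_derivative_unique_within_closed_interval[of 0 1 t "\<lambda>t. c"])
    show "((\<lambda>t. c) has_vector_derivative ft t s) (at t within cbox 0 1)"
      using has_vector_derivative_transform[OF assms(3) _ C11_deriv(1)[OF assms(1,3), of s]] assms(2) by simp
  qed (use assms in auto)
  have "(\<lambda>s. f t s) = (\<lambda>s. c)" using assms by auto
  then show "fs t s = 0"
    using C11_deriv(2)[OF assms(1,3), of s] vector_derivative_unique_at[of "\<lambda>s. c" "fs t s" s 0] by simp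
qed

text \<open>The common derivative \<open>r\<close> says that the one-form \<open>a ds + b dt\<close>
  is closed; periodicity of \<open>b\<close> cancels the two vertical sides in Stokes' theorem. It
  is carried out as differentiation under the integral followed by the fundamental theorem in
  \<open>s\<close>.\<close>

lemma loop_integral_constant:
  fixes a b r :: "real \<Rightarrow> real \<Rightarrow> real"
  assumes a: "\<And>t s. t \<in> {0..1} \<Longrightarrow> ((\<lambda>t. a t s) has_vector_derivative r t s) (at t within {0..1})"
    and b: "\<And>t s. t \<in> {0..1} \<Longrightarrow> ((\<lambda>s. b t s) has_vector_derivative r t s) (at s)"
    and ac: "strip_continuous a" and rc: "strip_continuous r"
    and per: "\<And>t. t \<in> {0..1} \<Longrightarrow> b t 1 = b t 0"
  shows "integral {0..1} (a 1) = integral {0..1} (a 0)"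
proof -
  have "((\<lambda>t. integral (cbox 0 1) (a t)) has_vector_derivative integral (cbox 0 1) (r t)) (at t within {0..1})"
    if t: "t \<in> {0..1}" for t
  proof (rule leibniz_rule_vector_derivative)
    show "a x integrable_on cbox 0 1" if "x \<in> {0..1}" for x
    proof -
      have "continuous_on {0..1} (\<lambda>s. a (fst (x, s)) (snd (x, s)))"
        using ac that unfolding strip_continuous_def
        by (rule_tac continuous_on_compose2[of _ "\<lambda>x. a (fst x) (snd x)"]) (auto intro!: continuous_intros)
      then show ?thesis using integrable_continuous_real by simp
    qed
    show "continuous_on ({0..1} \<times> cbox 0 1) (\<lambda>(t, s). r t s)"
      using rc unfolding strip_continuous_def case_prod_beta' by (rule continuous_on_subset) auto
  qed (use a t in auto)
  moreover have "integral (cbox 0 1) (r t) = 0" if t: "t \<in> {0..1}" for t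
  proof -
    have "(r t has_integral (b t 1 - b t 0)) {0..1}"
      by (rule fundamental_theorem_of_calculus) (auto intro: has_vector_derivative_at_within b t)
    then show ?thesis using per[OF t] by auto
  qed
  ultimately have "((\<lambda>t. integral (cbox 0 1) (a t)) has_vector_derivative 0) (at t within {0..1})" if "t \<in> {0..1}" for t
    using that by metis
  then obtain c where "\<And>t. t \<in> {0..1} \<Longrightarrow> integral (cbox 0 1) (a t) = c"
    using has_vector_derivative_zero_constant[of "{0..1}" "\<lambda>t. integral (cbox 0 1) (a t)"] by auto
  from this[of 0] this[of 1] show ?thesis by simp
qed

section \<open>Winding number and action of a framed family of loops\<close>

lemma dq_bilinear: "bounded_bilinear dq"
proof -
  have "bounded_linear (\<lambda>z::complex. (1 / (2 * pi)) *\<^sub>R (\<i> * z))"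
    by (intro bounded_linear_scaleR_right[THEN bounded_linear_compose] bounded_linear_mult_right)
  from bounded_bilinear.comp1[OF bounded_bilinear_inner this]
  have "bounded_bilinear (\<lambda>z a. ((1 / (2 * pi)) *\<^sub>R (\<i> * z)) \<bullet> a)" .
  moreover have "(\<lambda>z a. ((1 / (2 * pi)) *\<^sub>R (\<i> * z)) \<bullet> a) = dq"
    by (intro ext) (simp add: dq_def inner_scaleR_left)
  ultimately show ?thesis by simp
qed

text \<open>The tangent line of the circle is spanned by \<open>\<i> * z\<close>. Two tangent
  vectors are parallel, and rotating one by a right angle makes them orthogonal; the first claim
  therefore removes the term that arises when the base point in \<open>dq\<close> is
  differentiated.\<close>

lemma dq_tangent:
  assumes "norm z = 1" "z \<bullet> a = 0" "z \<bullet> b = 0"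
  shows "dq a b = 0" "a = (2 * pi * dq z a) *\<^sub>R (\<i> * z)"
proof -
  have n: "Re z * Re z + Im z * Im z = 1"
    using assms(1) by (metis cmod_power2 power2_eq_square power_one)
  define c where "c a = - Im z * Re a + Re z * Im a" for a
  have *: "Re a = - (c a * Im z)" "Im a = c a * Re z" if "z \<bullet> a = 0" for a
  proof -
    have a: "Im z * Im a = - (Re z * Re a)" using that by (simp add: inner_complex_def)
    have "- (c a * Im z) = Im z * Im z * Re a - Re z * (Im z * Im a)" by (simp add: c_def algebra_simps)
    also have "\<dots> = (Re z * Re z + Im z * Im z) * Re a" unfolding a by (simp add: algebra_simps)
    finally show "Re a = - (c a * Im z)" by (simp add: n)
    have a: "Re z * Re a = - (Im z * Im a)" using that by (simp add: inner_complex_def)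
    have "c a * Re z = Re z * Re z * Im a - Im z * (Re z * Re a)" by (simp add: c_def algebra_simps)
    also have "\<dots> = (Re z * Re z + Im z * Im z) * Im a" unfolding a by (simp add: algebra_simps)
    finally show "Im a = c a * Re z" by (simp add: n)
  qed
  have "2 * pi * dq z a = c a" by (simp add: dq_def inner_complex_def c_def)
  then show "a = (2 * pi * dq z a) *\<^sub>R (\<i> * z)" using *[OF assms(2)] by (simp add: complex_eq_iff)
  have "- Im a * Re b + Re a * Im b = 0"
    unfolding *(1)[OF assms(2)] *(2)[OF assms(2)] *(1)[OF assms(3)] *(2)[OF assms(3)] by simp
  then show "dq a b = 0" by (simp add: dq_def inner_complex_def)
qed

text \<open>The field \<open>w\<close> completes \<open>u\<close> to an orthonormal frame. The
  function \<open>h\<close> stands for the Hamiltonian along the loops: its derivative along a loop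
  is \<open>omega\<close> of the time velocity and the loop velocity, which is the exactness of the
  isotopy.\<close>

locale framed_loop_family =
  fixes z zt zs zm :: "real \<Rightarrow> real \<Rightarrow> complex" and p pt ps pm :: "real \<Rightarrow> real \<Rightarrow> real"
    and u ut us um w wt ws wm :: "real \<Rightarrow> real \<Rightarrow> real^3" and h :: "real \<Rightarrow> real \<Rightarrow> real"
  assumes z: "C11 z zt zs zm" and p: "C11 p pt ps pm" and u: "C11 u ut us um" and w: "C11 w wt ws wm"
    and per: "\<And>t. t \<in> {0..1} \<Longrightarrow> z t 1 = z t 0 \<and> p t 1 = p t 0 \<and> u t 1 = u t 0 \<and> w t 1 = w t 0 \<and> h t 1 = h t 0"
    and norm_z: "\<And>t s. t \<in> {0..1} \<Longrightarrow> z t s \<bullet> z t s = 1"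
    and norm_u: "\<And>t s. t \<in> {0..1} \<Longrightarrow> u t s \<bullet> u t s = 1"
    and norm_w: "\<And>t s. t \<in> {0..1} \<Longrightarrow> w t s \<bullet> w t s = 1"
    and uw: "\<And>t s. t \<in> {0..1} \<Longrightarrow> u t s \<bullet> w t s = 0"
    and h: "\<And>t s. t \<in> {0..1} \<Longrightarrow> ((\<lambda>s. h t s) has_vector_derivative
        omega (z t s, p t s, u t s) (zt t s, pt t s, ut t s) (zs t s, ps t s, us t s)) (at s)"
begin

lemma orth:
  assumes "t \<in> {0..1}"
  shows "z t s \<bullet> zt t s = 0" "z t s \<bullet> zs t s = 0" "u t s \<bullet> ut t s = 0" "u t s \<bullet> us t s = 0"
    "w t s \<bullet> wt t s = 0" "w t s \<bullet> ws t s = 0" "us t s \<bullet> w t s + u t s \<bullet> ws t s = 0"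
    "ut t s \<bullet> w t s + u t s \<bullet> wt t s = 0"
  using C11_constant_derivs[OF C11_bilinear[OF bounded_bilinear_inner z z] norm_z assms, of s]
    C11_constant_derivs[OF C11_bilinear[OF bounded_bilinear_inner u u] norm_u assms, of s]
    C11_constant_derivs[OF C11_bilinear[OF bounded_bilinear_inner w w] norm_w assms, of s]
    C11_constant_derivs[OF C11_bilinear[OF bounded_bilinear_inner u w] uw assms, of s]
  by (simp_all add: inner_commute)

text \<open>Closedness of \<open>dq\<close> along the circle: both partial derivatives reduce to
  \<open>dq\<close> of the mixed derivative.\<close>

lemma winding_constant: "integral {0..1} (\<lambda>s. dq (z 1 s) (zs 1 s)) = integral {0..1} (\<lambda>s. dq (z 0 s) (zs 0 s))"
proof (rule loop_integral_constant[where a="\<lambda>t s. dq (z t s) (zs t s)" and b="\<lambda>t s. dq (z t s) (zt t s)"])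
  note d = bounded_bilinear.has_vector_derivative[OF dq_bilinear]
  note c = strip_continuous_bilinear[OF dq_bilinear]
  fix t s :: real assume t: "t \<in> {0..1}"
  have n: "norm (z t s) = 1" using norm_z[OF t, of s] by (simp add: norm_eq_sqrt_inner)
  show "((\<lambda>t. dq (z t s) (zs t s)) has_vector_derivative dq (z t s) (zm t s)) (at t within {0..1})"
    using d[OF C11_deriv(1)[OF z t, of s] C11_deriv(4)[OF z t, of s]] dq_tangent(1)[OF n orth(1,2)[OF t]] by simp
  show "((\<lambda>s. dq (z t s) (zt t s)) has_vector_derivative dq (z t s) (zm t s)) (at s)"
    using d[OF C11_deriv(2)[OF z t, of s] C11_deriv(3)[OF z t, of s]] dq_tangent(1)[OF n orth(2,1)[OF t]] by simp
next
  show "strip_continuous (\<lambda>t s. dq (z t s) (zs t s))" "strip_continuous (\<lambda>t s. dq (z t s) (zm t s))"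
    by (intro strip_continuous_bilinear[OF dq_bilinear] C11_cont[OF z])+
  show "dq (z t 1) (zt t 1) = dq (z t 0) (zt t 0)" if "t \<in> {0..1}" for t
    using C11_periodic_t[OF z _ that] per that by simp
qed

text \<open>The form \<open>p dq\<close> plus the connection form is, up to sign, a primitive of
  \<open>omega\<close> along the family. So the time derivative of \<open>a\<close> differs from the
  loop derivative of its companion by \<open>omega\<close> of the two velocities; that is the
  derivative of \<open>h\<close>, hence \<open>h\<close> is subtracted in \<open>b\<close>.\<close>

theorem action_constant:
  defines "a \<equiv> \<lambda>t s. p t s * dq (z t s) (zs t s) + ws t s \<bullet> cross3 (u t s) (w t s) / (2 * pi)"
  shows "integral {0..1} (a 1) = integral {0..1} (a 0)"
proof -
  define b where "b t s = p t s * dq (z t s) (zt t s) + wt t s \<bullet> cross3 (u t s) (w t s) / (2 * pi) - h t s" for t s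
  define r where "r t s = p t s * dq (z t s) (zm t s) + pt t s * dq (z t s) (zs t s) +
      (ws t s \<bullet> (cross3 (u t s) (wt t s) + cross3 (ut t s) (w t s)) + wm t s \<bullet> cross3 (u t s) (w t s)) / (2 * pi)" for t s
  note di = bounded_bilinear.has_vector_derivative
  note dd = bounded_linear.has_vector_derivative[OF bounded_linear_divide]
  show ?thesis
  proof (rule loop_integral_constant[where b=b and r=r])
    fix t s :: real assume t: "t \<in> {0..1}"
    have n: "norm (z t s) = 1" using norm_z[OF t, of s] by (simp add: norm_eq_sqrt_inner)
    have "((\<lambda>t. a t s) has_vector_derivative (p t s * (dq (z t s) (zm t s) + dq (zt t s) (zs t s)) + pt t s * dq (z t s) (zs t s) +
      (ws t s \<bullet> (cross3 (u t s) (wt t s) + cross3 (ut t s) (w t s)) + wm t s \<bullet> cross3 (u t s) (w t s)) / (2 * pi))) (at t within {0..1})"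
      unfolding a_def
      by (intro has_vector_derivative_add dd di[OF bounded_bilinear_mult] di[OF dq_bilinear]
          di[OF bounded_bilinear_inner] di[OF bounded_bilinear_cross3] C11_deriv[OF z t] C11_deriv[OF p t] C11_deriv[OF u t] C11_deriv[OF w t])
    then show "((\<lambda>t. a t s) has_vector_derivative r t s) (at t within {0..1})"
      unfolding r_def using dq_tangent(1)[OF n orth(1,2)[OF t]] by simp
    let ?om = "omega (z t s, p t s, u t s) (zt t s, pt t s, ut t s) (zs t s, ps t s, us t s)"
    let ?b' = "p t s * (dq (z t s) (zm t s) + dq (zs t s) (zt t s)) + ps t s * dq (z t s) (zt t s) +
      (wt t s \<bullet> (cross3 (u t s) (ws t s) + cross3 (us t s) (w t s)) + wm t s \<bullet> cross3 (u t s) (w t s)) / (2 * pi) - ?om"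
    have "(b t has_vector_derivative ?b') (at s)"
      unfolding b_def
      by (intro has_vector_derivative_diff has_vector_derivative_add dd di[OF bounded_bilinear_mult] di[OF dq_bilinear]
          di[OF bounded_bilinear_inner] di[OF bounded_bilinear_cross3] C11_deriv[OF z t] C11_deriv[OF p t] C11_deriv[OF u t] C11_deriv[OF w t] h[OF t])
    moreover have "?b' = r t s"
      if "dq (zs t s) (zt t s) = 0"
    proof -
      have "ws t s \<bullet> (cross3 (ut t s) (w t s) + cross3 (u t s) (wt t s)) - wt t s \<bullet> (cross3 (us t s) (w t s) + cross3 (u t s) (ws t s)) =
          u t s \<bullet> cross3 (us t s) (ut t s)"
        by (rule frame_curvature[OF norm_u[OF t] norm_w[OF t] uw[OF t] refl])
          (use orth[OF t, of s] in auto)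
      moreover have "u t s \<bullet> cross3 (ut t s) (us t s) = - (u t s \<bullet> cross3 (us t s) (ut t s))"
        using cross_skew[of "ut t s" "us t s"] by simp
      ultimately      have e: "u t s \<bullet> cross3 (ut t s) (us t s) = wt t s \<bullet> (cross3 (u t s) (ws t s) + cross3 (us t s) (w t s)) -
          ws t s \<bullet> (cross3 (u t s) (wt t s) + cross3 (ut t s) (w t s))"
        by (simp add: add.commute)
      show ?thesis
        unfolding r_def omega.simps omega_TS1.simps omega_S2_def e that
        by (simp add: diff_divide_distrib add_divide_distrib)
    qed
    ultimately show "(b t has_vector_derivative r t s) (at s)"
      using dq_tangent(1)[OF n orth(2,1)[OF t]] by simp
  next
    show "strip_continuous a" "strip_continuous r"
      unfolding a_def r_def
      by (intro strip_continuous_add strip_continuous_mult strip_continuous_bilinear[OF dq_bilinear]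
          strip_continuous_linear[OF bounded_linear_divide] strip_continuous_bilinear[OF bounded_bilinear_inner]
          strip_continuous_bilinear[OF bounded_bilinear_cross3] C11_cont[OF z] C11_cont[OF p] C11_cont[OF u] C11_cont[OF w])+
    show "b t 1 = b t 0" if "t \<in> {0..1}" for t
      unfolding b_def using C11_periodic_t[OF z _ that] C11_periodic_t[OF w _ that] per that by simp
  qed
qed

end

subsection \<open>Spinors and the fundamental group of the rotation group\<close>

text \<open>The double cover \<open>SU(2) \<rightarrow> SO(3)\<close> in the guise of spinors: nonzero vectors of \<open>\<complex>\<^sup>2\<close> up to sign
  correspond to nonzero null vectors of \<open>\<complex>\<^sup>3\<close>.\<close>

definition null_cone :: "(complex \<times> complex \<times> complex) set" where
  "null_cone = {(f, g, h). h\<^sup>2 = f * g \<and> (f, g) \<noteq> (0, 0)}"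

fun spinor_map :: "complex \<times> complex \<Rightarrow> complex \<times> complex \<times> complex" where
  "spinor_map (a, b) = (a\<^sup>2, b\<^sup>2, a * b)"

lemma spinor_map_eq: "spinor_map x = ((fst x)\<^sup>2, (snd x)\<^sup>2, fst x * snd x)"
  by (cases x) simp

text \<open>The squares fix each coordinate up to sign, and the product \<open>a * b\<close> couples
  the two signs.\<close>

lemma spinor_map_eq_iff:
  assumes "spinor_map x = spinor_map y"
  shows "y = x \<or> y = - x"
proof -
  obtain a b c d where [simp]: "x = (a, b)" "y = (c, d)" by (cases x, cases y)
  have e: "a\<^sup>2 = c\<^sup>2" "b\<^sup>2 = d\<^sup>2" "a * b = c * d" using assms by auto
  show ?thesis
  proof (cases "a = 0")
    case True
    then show ?thesis using e by (auto simp: power2_eq_iff)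
  next
    case False
    then show ?thesis using e by (auto simp: power2_eq_iff)
  qed
qed

declare spinor_map.simps [simp del]

lemma neg_neq: "x \<noteq> 0 \<Longrightarrow> x \<noteq> - x" for x :: "'a::real_inner"
  by (metis inner_minus_right inner_eq_zero_iff equal_neg_zero)

text \<open>The local clause of \<open>covering_space\<close> at the point \<open>y0\<close>, named
  because it is proved in two symmetric charts.\<close>

definition spinor_covered :: "complex \<times> complex \<times> complex \<Rightarrow> bool" where
  "spinor_covered y0 \<longleftrightarrow> (\<exists>T. y0 \<in> T \<and> openin (top_of_set null_cone) T \<and>
    (\<exists>v. \<Union>v = (- {0}) \<inter> spinor_map -` T \<and> (\<forall>u\<in>v. openin (top_of_set (- {0})) u) \<and> pairwise disjnt v \<and>
      (\<forall>u\<in>v. \<exists>q. homeomorphism u T spinor_map q)))"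

text \<open>Stated abstractly to serve both coordinates: \<open>A\<close> is a coordinate that does
  not vanish over \<open>y0\<close>, \<open>F\<close> its square read off in the cone,
  \<open>B\<close> the other coordinate. On a disc around \<open>F y0\<close> there is a continuous
  square root \<open>r\<close>; the two sheets are \<open>A = r\<close> and \<open>A = - r\<close>,
  and on each of them \<open>B\<close> is recovered as the third coordinate divided by
  \<open>A\<close>.\<close>

lemma spinor_evenly_covered:
  fixes A B :: "complex \<times> complex \<Rightarrow> complex" and F :: "complex \<times> complex \<times> complex \<Rightarrow> complex"
  assumes cA: "continuous_on UNIV A" and cF: "continuous_on UNIV F"
    and cmk: "continuous_on UNIV (\<lambda>(a, b). mk a b)"
    and A: "\<And>a b. A (mk a b) = a" and B: "\<And>a b. B (mk a b) = b" and mk: "\<And>x. mk (A x) (B x) = x"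
    and FA: "\<And>x. F (spinor_map x) = (A x)\<^sup>2" and hAB: "\<And>x. snd (snd (spinor_map x)) = A x * B x"
    and mk0: "\<And>a b. a \<noteq> 0 \<Longrightarrow> mk a b \<noteq> 0"
    and det: "\<And>y y'. y \<in> null_cone \<Longrightarrow> y' \<in> null_cone \<Longrightarrow> F y = F y' \<Longrightarrow> F y \<noteq> 0 \<Longrightarrow> snd (snd y) = snd (snd y') \<Longrightarrow> y = y'"
    and im: "\<And>x. x \<noteq> 0 \<Longrightarrow> spinor_map x \<in> null_cone"
    and y0: "y0 \<in> null_cone" "F y0 \<noteq> 0"
  shows "spinor_covered y0"
proof -
  \<comment> \<open>The radius equals the distance of the centre from zero, so the open disc avoids
    zero and is still convex.\<close>
  define D where "D = ball (F y0) (norm (F y0))"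
  have D0: "f \<noteq> 0" if "f \<in> D" for f using that by (auto simp: D_def dist_norm)
  have "contractible D" unfolding D_def by (rule convex_imp_contractible) simp
  then obtain r where rc: "continuous_on D r" and r: "\<And>f. f \<in> D \<Longrightarrow> f = (r f)\<^sup>2"
    using continuous_sqrt_on_contractible[of D "\<lambda>x. x"] D0 by (auto intro: continuous_on_id)
  have r0: "r f \<noteq> 0" if "f \<in> D" for f using r[OF that] D0[OF that] by auto
  define T where "T = null_cone \<inter> F -` D"
  define W where "W \<sigma> = {x. (A x)\<^sup>2 \<in> D \<and> A x = \<sigma> * r ((A x)\<^sup>2)}" for \<sigma> :: complex
  define q where "q \<sigma> y = mk (\<sigma> * r (F y)) (snd (snd y) / (\<sigma> * r (F y)))" for \<sigma> y
  have cs: "continuous_on S spinor_map" for S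
    unfolding spinor_map_eq[abs_def] by (intro continuous_intros)
  have A0: "A x \<noteq> 0" if "(A x)\<^sup>2 \<in> D" for x using D0[OF that] by auto
  have x0: "x \<noteq> 0" if "(A x)\<^sup>2 \<in> D" for x using mk0[OF A0[OF that], of "B x"] mk by simp
  have split: "A x = 1 * r ((A x)\<^sup>2) \<or> A x = - 1 * r ((A x)\<^sup>2)" if "(A x)\<^sup>2 \<in> D" for x
    using r[OF that] by (auto simp: power2_eq_iff)
  have openD: "open {x. (A x)\<^sup>2 \<in> D}"
    using open_vimage[of D "\<lambda>x. (A x)\<^sup>2"] cA by (auto simp: D_def vimage_def intro!: continuous_intros)
  have openW: "open (W \<sigma>)" if \<sigma>: "\<sigma> = 1 \<or> \<sigma> = - 1" for \<sigma>
  proof -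
    have c: "continuous_on {x. (A x)\<^sup>2 \<in> D} (\<lambda>x. norm (A x + \<sigma> * r ((A x)\<^sup>2)) - norm (A x - \<sigma> * r ((A x)\<^sup>2)))"
      using continuous_on_subset[OF cA] by (intro continuous_intros continuous_on_compose2[OF rc]) auto
    \<comment> \<open>Since \<open>A x\<close> is one of two opposite nonzero values, the equation
      selecting the sheet is equivalent to a strict inequality between the distances to them, which
      is an open condition.\<close>
    have "W \<sigma> = {x \<in> {x. (A x)\<^sup>2 \<in> D}. norm (A x + \<sigma> * r ((A x)\<^sup>2)) - norm (A x - \<sigma> * r ((A x)\<^sup>2)) \<in> {0<..}}"
    proof -
      have "A x = \<sigma> * r ((A x)\<^sup>2) \<longleftrightarrow> norm (A x - \<sigma> * r ((A x)\<^sup>2)) < norm (A x + \<sigma> * r ((A x)\<^sup>2))"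
        if x: "(A x)\<^sup>2 \<in> D" for x
      proof -
        define R where "R = r ((A x)\<^sup>2)"
        have "R \<noteq> 0" "A x = R \<or> A x = - R" using r0[OF x] split[OF x] by (auto simp: R_def)
        moreover have "R + R \<noteq> 0" using \<open>R \<noteq> 0\<close> by (metis mult_2 mult_eq_0_iff zero_neq_numeral)
        ultimately show ?thesis using \<sigma> neg_neq[of R] unfolding R_def[symmetric] by auto
      qed
      then show ?thesis unfolding W_def by auto
    qed
    then show ?thesis
      using continuous_open_preimage[OF c openD, of "{0<..}"] by (simp add: vimage_def Int_def conj_commute)
  qed
  have homeo: "homeomorphism (W \<sigma>) T spinor_map (q \<sigma>)" if \<sigma>: "\<sigma> = 1 \<or> \<sigma> = - 1" for \<sigma>
  proof (rule homeomorphismI)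
    show "continuous_on (W \<sigma>) spinor_map" by (rule cs)
    have "continuous_on T (\<lambda>y. (\<lambda>(a, b). mk a b) (\<sigma> * r (F y), snd (snd y) / (\<sigma> * r (F y))))"
      using continuous_on_subset[OF cF, of T] r0 \<sigma>
      by (intro continuous_on_compose2[OF cmk] continuous_intros continuous_on_compose2[OF rc]) (auto simp: T_def)
    then show "continuous_on T (q \<sigma>)" by (simp add: q_def[abs_def])
    show "spinor_map ` W \<sigma> \<subseteq> T"
    proof (rule image_subsetI)
      fix x assume "x \<in> W \<sigma>"
      then have "(A x)\<^sup>2 \<in> D" by (simp add: W_def)
      then show "spinor_map x \<in> T" using x0[of x] im[of x] by (simp add: T_def FA)
    qed
    have sq: "\<sigma>\<^sup>2 = 1" "\<sigma> \<noteq> 0" using \<sigma> by auto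
    have Aq: "A (q \<sigma> y) = \<sigma> * r (F y)" "(A (q \<sigma> y))\<^sup>2 = F y" if "y \<in> T" for y
      using that r[of "F y"] sq by (auto simp: T_def q_def A power_mult_distrib)
    show "q \<sigma> ` T \<subseteq> W \<sigma>" using Aq by (auto simp: T_def W_def)
    show "q \<sigma> (spinor_map x) = x" if "x \<in> W \<sigma>" for x
    proof -
      have "q \<sigma> (spinor_map x) = mk (A x) (B x)"
        using that A0[of x] by (auto simp: q_def FA hAB W_def)
      then show ?thesis by (simp add: mk)
    qed
    show "spinor_map (q \<sigma> y) = y" if "y \<in> T" for y
    proof (rule det)
      have y: "y \<in> null_cone" "F y \<in> D" using that by (auto simp: T_def)
      show "spinor_map (q \<sigma> y) \<in> null_cone" using im x0[of "q \<sigma> y"] Aq[OF that] y by simp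
      show "y \<in> null_cone" "F (spinor_map (q \<sigma> y)) = F y" "F (spinor_map (q \<sigma> y)) \<noteq> 0"
        using y D0 Aq[OF that] by (auto simp: FA)
      have "A (q \<sigma> y) * B (q \<sigma> y) = snd (snd y)"
        using r0[OF y(2)] sq by (simp add: q_def A B)
      then show "snd (snd (spinor_map (q \<sigma> y))) = snd (snd y)" by (simp add: hAB)
    qed
  qed
  have disj: "disjnt (W 1) (W (- 1))"
  proof -
    have False if x: "x \<in> W 1" "x \<in> W (- 1)" for x
    proof -
      have "(A x)\<^sup>2 \<in> D" "A x = - A x" using x by (auto simp: W_def)
      then show False using A0[of x] by simp
    qed
    then show ?thesis by (auto simp: disjnt_def)
  qed
  have W0: "W \<sigma> \<subseteq> - {0}" for \<sigma> unfolding W_def using x0 by blast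
  show ?thesis
    unfolding spinor_covered_def
  proof (intro exI[of _ T] exI[of _ "{W 1, W (- 1)}"] conjI ballI)
    show "y0 \<in> T" using y0 by (auto simp: T_def D_def)
    have "openin (top_of_set null_cone) (null_cone \<inter> F -` D)"
      by (rule continuous_openin_preimage_gen[OF continuous_on_subset[OF cF]]) (auto simp: D_def)
    then show "openin (top_of_set null_cone) T" by (simp add: T_def)
    show "\<Union> {W 1, W (- 1)} = - {0} \<inter> spinor_map -` T"
    proof
      show "\<Union> {W 1, W (- 1)} \<subseteq> - {0} \<inter> spinor_map -` T"
      proof
        fix x assume "x \<in> \<Union> {W 1, W (- 1)}"
        then have "(A x)\<^sup>2 \<in> D" unfolding W_def by blast
        then show "x \<in> - {0} \<inter> spinor_map -` T" using x0[of x] im[of x] by (simp add: T_def FA)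
      qed
      show "- {0} \<inter> spinor_map -` T \<subseteq> \<Union> {W 1, W (- 1)}"
      proof
        fix x assume "x \<in> - {0} \<inter> spinor_map -` T"
        then have "(A x)\<^sup>2 \<in> D" by (simp add: T_def FA)
        then show "x \<in> \<Union> {W 1, W (- 1)}" using split[of x] unfolding W_def by blast
      qed
    qed
    show "openin (top_of_set (- {0})) u" if "u \<in> {W 1, W (- 1)}" for u
      using that W0 openW by (auto intro!: open_subset)
    show "pairwise disjnt {W 1, W (- 1)}"
      using disj by (auto simp: pairwise_def disjnt_sym)
    show "\<exists>q. homeomorphism u T spinor_map q" if "u \<in> {W 1, W (- 1)}" for u
      using that homeo by auto
  qed
qed

text \<open>On the cone one of the first two coordinates is nonzero, and this coordinate selects the
  chart. Surjectivity takes a complex square root of it and divides.\<close>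

lemma covering_space_spinor_map: "covering_space (- {0}) spinor_map null_cone"
  unfolding covering_space_def
proof (intro conjI ballI)
  show "continuous_on (- {0}) spinor_map"
    unfolding spinor_map_eq[abs_def] by (intro continuous_intros)
  have im: "spinor_map x \<in> null_cone" if "x \<noteq> 0" for x
  proof -
    obtain a b where x: "x = (a, b)" by (cases x)
    have "a \<noteq> 0 \<or> b \<noteq> 0" using that by (auto simp: x prod_eq_iff)
    then show ?thesis by (simp add: x spinor_map.simps null_cone_def power_mult_distrib)
  qed
  have onto: "y \<in> spinor_map ` (- {0})" if "y \<in> null_cone" for y
  proof -
    obtain f g h where y: "y = (f, g, h)" by (cases y)
    have e: "h\<^sup>2 = f * g" "f \<noteq> 0 \<or> g \<noteq> 0" using that by (auto simp: null_cone_def y)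
    show ?thesis
    proof (cases "f = 0")
      case True
      then have "y = spinor_map (0, csqrt g)" using e by (simp add: y spinor_map.simps)
      moreover have "(0, csqrt g) \<in> - {0}" using e True by (auto simp: prod_eq_iff)
      ultimately show ?thesis by (rule image_eqI)
    next
      case False
      then have "y = spinor_map (csqrt f, h / csqrt f)" using e by (simp add: y spinor_map.simps power_divide)
      moreover have "(csqrt f, h / csqrt f) \<in> - {0}" using False by (auto simp: prod_eq_iff)
      ultimately show ?thesis by (rule image_eqI)
    qed
  qed
  show "spinor_map ` (- {0}) = null_cone"
    using im onto by (intro equalityI subsetI) blast+
  fix y assume y: "y \<in> null_cone"
  then have "fst y \<noteq> 0 \<or> fst (snd y) \<noteq> 0" by (auto simp: null_cone_def)
  then have "spinor_covered y"
  proof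
    assume "fst y \<noteq> 0"
    show ?thesis
    proof (rule spinor_evenly_covered[where A=fst and B=snd and F="fst" and mk="Pair"])
      show "continuous_on UNIV (fst :: complex \<times> complex \<Rightarrow> complex)" by (intro continuous_intros)
      show "continuous_on UNIV (fst :: complex \<times> complex \<times> complex \<Rightarrow> complex)" by (intro continuous_intros)
      show "continuous_on UNIV (\<lambda>(a, b). ((a, b) :: complex \<times> complex))"
        unfolding case_prod_beta' by (intro continuous_intros)
      show "z = z'" if "z \<in> null_cone" "z' \<in> null_cone" "(fst) z = (fst) z'" "(fst) z \<noteq> 0" "snd (snd z) = snd (snd z')"
        for z z' :: "complex \<times> complex \<times> complex"
      proof -
        obtain f g h f' g' h' where "z = (f, g, h)" "z' = (f', g', h')" by (cases z, cases z')
        then show ?thesis using that by (simp add: null_cone_def)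
      qed
      show "spinor_map x \<in> null_cone" if "x \<noteq> 0" for x by (rule im[OF that])
      show "y \<in> null_cone" by (rule y)
      show "(fst) y \<noteq> 0" using \<open>fst y \<noteq> 0\<close> by simp
      show "(a, b) \<noteq> 0" if "a \<noteq> 0" for a b :: complex using that by (auto simp: prod_eq_iff)
    qed (simp_all add: spinor_map_eq)
  next
    assume "fst (snd y) \<noteq> 0"
    show ?thesis
    proof (rule spinor_evenly_covered[where A=snd and B=fst and F="\<lambda>y. fst (snd y)" and mk="\<lambda>a b. (b, a)"])
      show "continuous_on UNIV (snd :: complex \<times> complex \<Rightarrow> complex)" by (intro continuous_intros)
      show "continuous_on UNIV ((\<lambda>y. fst (snd y)) :: complex \<times> complex \<times> complex \<Rightarrow> complex)" by (intro continuous_intros)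
      show "continuous_on UNIV (\<lambda>(a, b). ((b, a) :: complex \<times> complex))"
        unfolding case_prod_beta' by (intro continuous_intros)
      show "z = z'" if "z \<in> null_cone" "z' \<in> null_cone" "(\<lambda>y. fst (snd y)) z = (\<lambda>y. fst (snd y)) z'" "(\<lambda>y. fst (snd y)) z \<noteq> 0" "snd (snd z) = snd (snd z')"
        for z z' :: "complex \<times> complex \<times> complex"
      proof -
        obtain f g h f' g' h' where "z = (f, g, h)" "z' = (f', g', h')" by (cases z, cases z')
        then show ?thesis using that by (simp add: null_cone_def)
      qed
      show "spinor_map x \<in> null_cone" if "x \<noteq> 0" for x by (rule im[OF that])
      show "y \<in> null_cone" by (rule y)
      show "(\<lambda>y. fst (snd y)) y \<noteq> 0" using \<open>fst (snd y) \<noteq> 0\<close> by simp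
      show "(b, a) \<noteq> 0" if "a \<noteq> 0" for a b :: complex using that by (auto simp: prod_eq_iff)
    qed (simp_all add: spinor_map_eq)
  qed
  then show "\<exists>T. y \<in> T \<and> openin (top_of_set null_cone) T \<and>
    (\<exists>v. \<Union>v = (- {0}) \<inter> spinor_map -` T \<and> (\<forall>u\<in>v. openin (top_of_set (- {0})) u) \<and> pairwise disjnt v \<and>
      (\<forall>u\<in>v. \<exists>q. homeomorphism u T spinor_map q))"
    by (simp only: spinor_covered_def)
qed

text \<open>Two lifts of one path agree up to sign at every parameter, so their inner product is
  plus or minus a positive number; it never vanishes and hence keeps its sign.\<close>

lemma spinor_lift_sign:
  fixes x y :: "real \<Rightarrow> complex \<times> complex"
  assumes c: "continuous_on {0..1} x" "continuous_on {0..1} y"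
    and n0: "\<And>s. s \<in> {0..1} \<Longrightarrow> x s \<noteq> 0" and e: "\<And>s. s \<in> {0..1} \<Longrightarrow> spinor_map (x s) = spinor_map (y s)"
  shows "x 1 = y 1 \<longleftrightarrow> x 0 = y 0"
proof -
  define d where "d s = x s \<bullet> y s" for s
  have dc: "continuous_on {0..1} d" unfolding d_def by (intro continuous_intros c)
  have y: "y s = x s \<or> y s = - x s" if "s \<in> {0..1}" for s using spinor_map_eq_iff[OF e[OF that]] .
  have d0: "d s \<noteq> 0" if "s \<in> {0..1}" for s using y[OF that] n0[OF that] by (auto simp: d_def)
  have dpos: "x s = y s \<longleftrightarrow> d s > 0" if "s \<in> {0..1}" for s
  proof -
    have "x s \<bullet> x s > 0" using n0[OF that] by simp
    moreover have "x s \<noteq> - x s" using neg_neq[OF n0[OF that]] .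
    ultimately show ?thesis
    proof (cases "y s = x s")
      case True
      with \<open>x s \<bullet> x s > 0\<close> show ?thesis by (simp add: d_def)
    next
      case False
      then have "y s = - x s" using y[OF that] by blast
      then have "d s = - (x s \<bullet> x s)" by (simp add: d_def)
      with \<open>x s \<bullet> x s > 0\<close> False show ?thesis by (metis less_minus_iff neg_0_less_iff_less not_less_iff_gr_or_eq)
    qed
  qed
  have "connected (d ` {0..1})" by (rule connected_continuous_image[OF dc]) simp
  moreover have "0 \<notin> d ` {0..1}" using d0 by auto
  ultimately have "d 0 > 0 \<longleftrightarrow> d 1 > 0"
    using connectedD_interval[of "d ` {0..1}" "d 0" "d 1" 0] connectedD_interval[of "d ` {0..1}" "d 1" "d 0" 0]
    by (meson atLeastAtMost_iff imageI less_eq_real_def linorder_not_le order_refl zero_le_one)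
  then show ?thesis using dpos by simp
qed

text \<open>The rotation by \<open>\<phi> s\<close> lifts to the diagonal action with half the
  angle. After \<open>b\<close> full turns the half angle is \<open>pi * b\<close>, which acts on
  the spinor by the sign of the parity of \<open>b\<close>.\<close>

lemma spinor_rotation_sign:
  fixes x :: "real \<Rightarrow> complex \<times> complex" and \<phi> :: "real \<Rightarrow> real" and b :: int
  assumes c: "continuous_on {0..1} x" and \<phi>: "continuous_on {0..1} \<phi>" "\<phi> 0 = 0" "\<phi> 1 = 2 * pi * of_int b"
    and n0: "\<And>s. s \<in> {0..1} \<Longrightarrow> x s \<noteq> 0"
    and e: "\<And>s. s \<in> {0..1} \<Longrightarrow> spinor_map (x s) =
      (case spinor_map (x 0) of (f, g, h) \<Rightarrow> (cis (- \<phi> s) * f, cis (\<phi> s) * g, h))"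
  shows "x 1 = x 0 \<longleftrightarrow> even b"
proof -
  define y where "y s = (cis (- \<phi> s / 2) * fst (x 0), cis (\<phi> s / 2) * snd (x 0))" for s
  have "continuous_on {0..1} y" unfolding y_def by (intro continuous_intros \<phi>(1) continuous_on_cis) auto
  moreover have "spinor_map (x s) = spinor_map (y s)" if "s \<in> {0..1}" for s
  proof -
    have h: "(cis (x / 2))\<^sup>2 = cis x" for x by (simp only: Complex.DeMoivre) simp
    have p: "cis (- \<phi> s / 2) * fst (x 0) * (cis (\<phi> s / 2) * snd (x 0)) = fst (x 0) * snd (x 0)"
    proof -
      have "cis (- \<phi> s / 2) * fst (x 0) * (cis (\<phi> s / 2) * snd (x 0)) = cis (- \<phi> s / 2) * cis (\<phi> s / 2) * (fst (x 0) * snd (x 0))"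
        by (simp only: mult_ac)
      then show ?thesis by (simp add: cis_mult)
    qed
    show ?thesis
      unfolding e[OF that] unfolding spinor_map_eq y_def fst_conv snd_conv power_mult_distrib h p by simp
  qed
  ultimately have 1: "x 1 = y 1 \<longleftrightarrow> x 0 = y 0" using spinor_lift_sign[OF c _ n0] by blast
  have "y 0 = x 0" by (simp add: y_def \<phi>(2))
  then have xy: "x 1 = y 1" using 1 by simp
  have n: "x 0 \<noteq> 0" using n0 by simp
  show ?thesis
  proof (cases "even b")
    case True
    then obtain k where "b = 2 * k" by blast
    then have "cis (\<phi> 1 / 2) = 1" "cis (- \<phi> 1 / 2) = 1"
      using cis_multiple_2pi[of "of_int k"] cis_multiple_2pi[of "- of_int k"] by (simp_all add: \<phi>(3) mult.commute mult.left_commute)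
    then show ?thesis using xy True by (simp add: y_def)
  next
    case False
    then obtain k where b: "b = 2 * k + 1" by (auto elim: oddE)
    have "\<phi> 1 / 2 = 2 * pi * of_int k + pi" "- \<phi> 1 / 2 = 2 * pi * of_int (- k) + - pi"
      by (simp_all add: \<phi>(3) b field_simps)
    moreover have "cis (2 * pi * of_int k) = 1" "cis (2 * pi * of_int (- k)) = 1"
      by (rule cis_multiple_2pi; simp)+
    ultimately have "cis (\<phi> 1 / 2) = - 1" "cis (- \<phi> 1 / 2) = - 1"
      by (simp_all only: cis_mult[symmetric] cis_pi) (simp_all add: cis.ctr complex_eq_iff)
    then have "y 1 = - x 0" by (simp add: y_def uminus_prod_def)
    moreover have "- x 0 \<noteq> x 0" using neg_neq[OF n] by simp
    ultimately show ?thesis using xy False by simp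
  qed
qed

text \<open>The homotopy lifts to spinors on the whole square. By \<open>per\<close> the edges
  \<open>s = 0\<close> and \<open>s = 1\<close> are lifts of the same path, so whether they agree or
  are opposite does not change with \<open>t\<close>; at both ends this is the parity of the number
  of turns.\<close>

theorem homotopy_parity:
  fixes Z :: "real \<times> real \<Rightarrow> complex \<times> complex \<times> complex" and \<phi>0 \<phi>1 :: "real \<Rightarrow> real" and b b' :: int
  assumes Z: "continuous_on ({0..1} \<times> {0..1}) Z" "\<And>x. x \<in> {0..1} \<times> {0..1} \<Longrightarrow> Z x \<in> null_cone"
    and per: "\<And>t. t \<in> {0..1} \<Longrightarrow> Z (t, 1) = Z (t, 0)"
    and \<phi>0: "continuous_on {0..1} \<phi>0" "\<phi>0 0 = 0" "\<phi>0 1 = 2 * pi * of_int b"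
    and \<phi>1: "continuous_on {0..1} \<phi>1" "\<phi>1 0 = 0" "\<phi>1 1 = 2 * pi * of_int b'"
    and e0: "\<And>s. s \<in> {0..1} \<Longrightarrow> Z (0, s) = (case Z (0, 0) of (f, g, h) \<Rightarrow> (cis (- \<phi>0 s) * f, cis (\<phi>0 s) * g, h))"
    and e1: "\<And>s. s \<in> {0..1} \<Longrightarrow> Z (1, s) = (case Z (1, 0) of (f, g, h) \<Rightarrow> (cis (- \<phi>1 s) * f, cis (\<phi>1 s) * g, h))"
  shows "even b \<longleftrightarrow> even b'"
proof -
  have cv: "convex ({0..1::real} \<times> {0..1::real})" by (intro convex_Times) auto
  obtain X where Xc: "continuous_on ({0..1} \<times> {0..1}) X" and X0: "X \<in> {0..1} \<times> {0..1} \<rightarrow> - {0}"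
    and X: "\<And>x. x \<in> {0..1} \<times> {0..1} \<Longrightarrow> spinor_map (X x) = Z x"
    by (rule covering_space_lift[OF covering_space_spinor_map convex_imp_simply_connected[OF cv]
          convex_imp_locally_path_connected[OF cv] Z(1)]) (use Z(2) in auto)
  have n0: "X (t, s) \<noteq> 0" if "t \<in> {0..1}" "s \<in> {0..1}" for t s using X0 that by (auto simp: Pi_iff)
  have cs: "continuous_on {0..1} (\<lambda>s. X (t, s))" "continuous_on {0..1} (\<lambda>s. X (s, t))" if "t \<in> {0..1}" for t
    by (rule continuous_on_compose2[OF Xc]; use that in \<open>auto intro!: continuous_intros\<close>)+
  have "X (0, 1) = X (0, 0) \<longleftrightarrow> even b"
  proof (rule spinor_rotation_sign[OF cs(1) \<phi>0])
    fix s :: real assume s: "s \<in> {0..1}"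
    show "X (0, s) \<noteq> 0" using n0 s by simp
    have "spinor_map (X (0, s)) = Z (0, s)" "spinor_map (X (0, 0)) = Z (0, 0)" using X s by auto
    then show "spinor_map (X (0, s)) = (case spinor_map (X (0, 0)) of (f, g, h) \<Rightarrow> (cis (- \<phi>0 s) * f, cis (\<phi>0 s) * g, h))"
      by (simp only: e0[OF s])
  qed simp
  moreover have "X (1, 1) = X (1, 0) \<longleftrightarrow> even b'"
  proof (rule spinor_rotation_sign[OF cs(1) \<phi>1])
    fix s :: real assume s: "s \<in> {0..1}"
    show "X (1, s) \<noteq> 0" using n0 s by simp
    have "spinor_map (X (1, s)) = Z (1, s)" "spinor_map (X (1, 0)) = Z (1, 0)" using X s by auto
    then show "spinor_map (X (1, s)) = (case spinor_map (X (1, 0)) of (f, g, h) \<Rightarrow> (cis (- \<phi>1 s) * f, cis (\<phi>1 s) * g, h))"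
      by (simp only: e1[OF s])
  qed simp
  moreover have "X (1, 1) = X (1, 0) \<longleftrightarrow> X (0, 1) = X (0, 0)"
    by (rule spinor_lift_sign[of "\<lambda>t. X (t, 1)" "\<lambda>t. X (t, 0)"]) (simp_all add: cs(2) n0 X per)
  ultimately show ?thesis by simp
qed

subsection \<open>Lifts and first homology of a toric fibre\<close>

lemma real3_eqI: "x $ 1 = y $ 1 \<Longrightarrow> x $ 2 = y $ 2 \<Longrightarrow> x $ 3 = y $ 3 \<Longrightarrow> x = (y :: real^3)"
  by (simp add: vec_eq_iff forall_3)

lemma norm_real3: "norm (x :: real^3) = sqrt ((x $ 1)\<^sup>2 + (x $ 2)\<^sup>2 + (x $ 3)\<^sup>2)"
  by (simp add: norm_eq_sqrt_inner inner_vec_def sum_3 power2_eq_square)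

lemma torus_act_base_point:
  "torus_act \<theta> (base_point x) = (cis (2 * pi * fst \<theta>), fst x,
     vector [cos (2 * pi * snd \<theta>) * sqrt (1 - (snd x)\<^sup>2), sin (2 * pi * snd \<theta>) * sqrt (1 - (snd x)\<^sup>2), snd x])"
  by (cases \<theta>) (simp add: base_point_def)

context
  fixes x :: "real \<times> real"
begin

definition torus_pt :: "real \<times> real \<Rightarrow> ambient" where
  "torus_pt \<theta> = torus_act \<theta> (base_point x)"

definition fibre_radius :: real where
  "fibre_radius = sqrt (1 - (snd x)\<^sup>2)"

context
  assumes x: "\<bar>snd x\<bar> < 1"
begin

lemma fibre_radius: "fibre_radius > 0" "fibre_radius\<^sup>2 = 1 - (snd x)\<^sup>2"
proof -
  have "(snd x)\<^sup>2 < 1" using x by (simp add: abs_square_less_1)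
  then show "fibre_radius > 0" "fibre_radius\<^sup>2 = 1 - (snd x)\<^sup>2" by (simp_all add: fibre_radius_def)
qed

lemma torus_pt_eq: "torus_pt \<theta> = (cis (2 * pi * fst \<theta>), fst x,
     vector [cos (2 * pi * snd \<theta>) * fibre_radius, sin (2 * pi * snd \<theta>) * fibre_radius, snd x])"
  by (simp add: torus_pt_def torus_act_base_point fibre_radius_def)

lemma torus_pt_in: "torus_pt \<theta> \<in> toric_fibre x"
proof -
  have "(cos (2 * pi * snd \<theta>) * fibre_radius)\<^sup>2 + (sin (2 * pi * snd \<theta>) * fibre_radius)\<^sup>2 + (snd x)\<^sup>2 =
      ((cos (2 * pi * snd \<theta>))\<^sup>2 + (sin (2 * pi * snd \<theta>))\<^sup>2) * fibre_radius\<^sup>2 + (snd x)\<^sup>2"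
    by (simp only: power_mult_distrib distrib_right)
  also have "\<dots> = 1" by (simp add: fibre_radius)
  finally show ?thesis by (simp add: torus_pt_eq toric_fibre_def TS1xS2_def norm_real3)
qed

lemma continuous_vector3:
  fixes f g h :: "'a::topological_space \<Rightarrow> real"
  assumes "continuous_on S f" "continuous_on S g" "continuous_on S h"
  shows "continuous_on S (\<lambda>s. vector [f s, g s, h s] :: real^3)"
proof -
  have "continuous_on S (\<lambda>s. \<chi> i. if i = 1 then f s else if i = 2 then g s else h s :: real^3)"
  proof (rule continuous_on_vec_lambda)
    show "continuous_on S (\<lambda>s. if i = 1 then f s else if i = 2 then g s else h s)" for i :: 3
      using assms by (cases "i = 1"; cases "i = 2") simp_all
  qed
  moreover have "(\<chi> i. if i = 1 then f s else if i = 2 then g s else h s) = (vector [f s, g s, h s] :: real^3)" for s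
    by (simp add: vec_eq_iff forall_3)
  ultimately show ?thesis by simp
qed

lemma torus_pt_continuous: "continuous_on S torus_pt"
  unfolding torus_pt_eq[abs_def] by (intro continuous_intros continuous_vector3 continuous_on_cis)

lemma torus_pt_eq_iff: "torus_pt a = torus_pt b \<longleftrightarrow> fst a - fst b \<in> \<int> \<and> snd a - snd b \<in> \<int>"
proof -
  have *: "cos (2 * pi * s) = cos (2 * pi * t) \<and> sin (2 * pi * s) = sin (2 * pi * t) \<longleftrightarrow> s - t \<in> \<int>" for s t
  proof
    assume "cos (2 * pi * s) = cos (2 * pi * t) \<and> sin (2 * pi * s) = sin (2 * pi * t)"
    then obtain n :: int where "2 * pi * s = 2 * pi * t + 2 * pi * n"
      using sin_cos_eq_iff[of "2 * pi * s" "2 * pi * t"] by blast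
    then have "2 * pi * (s - t) = 2 * pi * n" by (simp add: algebra_simps)
    then have "s - t = n" by simp
    then show "s - t \<in> \<int>" by simp
  next
    assume "s - t \<in> \<int>"
    then obtain n :: int where "s - t = n" by (auto elim: Ints_cases)
    then have "s = t + n" by simp
    then have "2 * pi * s = 2 * pi * t + 2 * pi * n" by (simp only: distrib_left)
    then show "cos (2 * pi * s) = cos (2 * pi * t) \<and> sin (2 * pi * s) = sin (2 * pi * t)"
      using sin_cos_eq_iff[of "2 * pi * s" "2 * pi * t"] by blast
  qed
  have "torus_pt a = torus_pt b \<longleftrightarrow> (cos (2 * pi * fst a) = cos (2 * pi * fst b) \<and> sin (2 * pi * fst a) = sin (2 * pi * fst b)) \<and>
      (cos (2 * pi * snd a) = cos (2 * pi * snd b) \<and> sin (2 * pi * snd a) = sin (2 * pi * snd b))"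
    using fibre_radius(1) by (auto simp: torus_pt_eq complex_eq_iff vec_eq_iff forall_3)
  then show ?thesis using * by simp
qed

text \<open>Both the circle coordinate and the horizontal part of the sphere coordinate are nonzero
  complex functions of constant modulus; continuous logarithms on the contractible domain have the
  lifted angles as imaginary parts.\<close>

lemma torus_pt_lift:
  fixes f :: "'a::real_normed_vector \<Rightarrow> ambient"
  assumes f: "continuous_on S f" and S: "contractible S" and L: "\<And>s. s \<in> S \<Longrightarrow> f s \<in> toric_fibre x"
  obtains F where "continuous_on S F" "\<And>s. s \<in> S \<Longrightarrow> torus_pt (F s) = f s"
proof -
  define z where "z s = fst (f s)" for s
  define u where "u s = snd (snd (f s))" for s
  define w where "w s = Complex (u s $ 1) (u s $ 2)" for s
  have fL: "norm (z s) = 1" "(u s $ 1)\<^sup>2 + (u s $ 2)\<^sup>2 + (u s $ 3)\<^sup>2 = 1" "f s = (z s, fst x, u s)" "u s $ 3 = snd x"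
    if "s \<in> S" for s
  proof -
    obtain a b c where e: "f s = (a, b, c)" by (cases "f s")
    show "norm (z s) = 1" "(u s $ 1)\<^sup>2 + (u s $ 2)\<^sup>2 + (u s $ 3)\<^sup>2 = 1" "f s = (z s, fst x, u s)" "u s $ 3 = snd x"
      using L[OF that] by (auto simp: e toric_fibre_def TS1xS2_def norm_real3 z_def u_def)
  qed
  have "continuous_on S z" "continuous_on S u" unfolding z_def u_def by (intro continuous_intros f)+
  then have cont: "continuous_on S z" "continuous_on S w"
    unfolding w_def Complex_eq by (auto intro!: continuous_intros)
  have w: "norm (w s) = fibre_radius" if "s \<in> S" for s
  proof -
    have "(u s $ 1)\<^sup>2 + (u s $ 2)\<^sup>2 = fibre_radius\<^sup>2" using fL[OF that] by (simp add: fibre_radius)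
    then show ?thesis using fibre_radius(1) by (simp add: w_def cmod_def)
  qed
  obtain g1 where g1: "continuous_on S g1" "\<And>s. s \<in> S \<Longrightarrow> z s = exp (g1 s)"
    using continuous_logarithm_on_contractible[OF cont(1) S] fL(1) by (metis norm_zero zero_neq_one)
  obtain g2 where g2: "continuous_on S g2" "\<And>s. s \<in> S \<Longrightarrow> w s = exp (g2 s)"
    using continuous_logarithm_on_contractible[OF cont(2) S] w fibre_radius(1) by (metis norm_zero less_irrefl)
  show ?thesis
  proof (rule that[of "\<lambda>s. (Im (g1 s) / (2 * pi), Im (g2 s) / (2 * pi))"])
    show "continuous_on S (\<lambda>s. (Im (g1 s) / (2 * pi), Im (g2 s) / (2 * pi)))"
      by (intro continuous_intros g1 g2) auto
    fix s assume s: "s \<in> S"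
    have 1: "z s = cis (Im (g1 s))"
    proof -
      have "exp (Re (g1 s)) = 1" using fL(1)[OF s] by (simp add: g1(2)[OF s])
      then show ?thesis by (simp add: g1(2)[OF s] exp_eq_polar)
    qed
    have 2: "w s = fibre_radius * cis (Im (g2 s))"
    proof -
      have "exp (Re (g2 s)) = fibre_radius" using w[OF s] by (simp add: g2(2)[OF s])
      then show ?thesis by (simp add: g2(2)[OF s] exp_eq_polar)
    qed
    then have "u s $ 1 = fibre_radius * cos (Im (g2 s))" "u s $ 2 = fibre_radius * sin (Im (g2 s))"
      by (simp_all add: w_def complex_eq_iff)
    then have "u s = vector [cos (Im (g2 s)) * fibre_radius, sin (Im (g2 s)) * fibre_radius, snd x]"
      using fL(4)[OF s] by (intro real3_eqI) (simp_all add: mult.commute)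
    then show "torus_pt (Im (g1 s) / (2 * pi), Im (g2 s) / (2 * pi)) = f s"
      using 1 fL(3)[OF s] by (simp add: torus_pt_eq)
  qed
qed

lemma torus_pt_surj:
  assumes "y \<in> toric_fibre x"
  obtains \<theta> where "torus_pt \<theta> = y"
  using torus_pt_lift[of "{0::real}" "\<lambda>_. y"] assms by (metis continuous_on_const contractible_sing insertI1)

lemma torus_pt_image: "range torus_pt = toric_fibre x"
  using torus_pt_in torus_pt_surj by blast

section \<open>Singular one-chains of a toric fibre\<close>

abbreviation fibre_top :: "ambient topology" where "fibre_top \<equiv> top_of_set (toric_fibre x)"

definition path_simplex :: "(real \<Rightarrow> 'a) \<Rightarrow> (nat \<Rightarrow> real) \<Rightarrow> 'a" where
  "path_simplex F = (\<lambda>\<sigma> \<in> standard_simplex 1. F (\<sigma> 1))"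

definition point_simplex :: "'a \<Rightarrow> (nat \<Rightarrow> real) \<Rightarrow> 'a" where
  "point_simplex y = (\<lambda>\<sigma> \<in> standard_simplex 0. y)"

lemma standard_simplex_1_bounds: "\<sigma> \<in> standard_simplex 1 \<Longrightarrow> \<sigma> 1 \<in> {0..1}"
  by (auto simp: standard_simplex_def)

lemma singular_simplex_path:
  fixes F :: "real \<Rightarrow> 'a::topological_space"
  assumes "continuous_on {0..1} F" "F ` {0..1} \<subseteq> S"
  shows "singular_simplex 1 (top_of_set S) (path_simplex F)"
proof -
  have "continuous_map (subtopology (powertop_real UNIV) (standard_simplex 1)) (top_of_set {0..1}) (\<lambda>\<sigma>. \<sigma> (1::nat))"
    using standard_simplex_1_bounds
    by (auto simp: continuous_map_in_subtopology intro!: continuous_map_from_subtopology continuous_map_product_projection)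
  moreover have "continuous_map (top_of_set {0..1}) (top_of_set S) F"
    using assms by (simp add: image_subset_iff_funcset)
  ultimately have "continuous_map (subtopology (powertop_real UNIV) (standard_simplex 1)) (top_of_set S) (F \<circ> (\<lambda>\<sigma>. \<sigma> 1))"
    by (rule continuous_map_compose)
  then have "continuous_map (subtopology (powertop_real UNIV) (standard_simplex 1)) (top_of_set S) (path_simplex F)"
    by (rule continuous_map_eq) (auto simp: path_simplex_def)
  then show ?thesis by (simp add: singular_simplex_def path_simplex_def)
qed

lemma chain_boundary_path: "chain_boundary 1 (frag_of (path_simplex F)) = frag_of (point_simplex (F 1)) - frag_of (point_simplex (F 0))"
proof -
  have "singular_face 1 0 (path_simplex F) = point_simplex (F 1)"
    using simplical_face_in_standard_simplex[of 1 0]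
    by (auto simp: singular_face_def path_simplex_def point_simplex_def fun_eq_iff simplical_face_def standard_simplex_0 restrict_def)
  moreover have "singular_face 1 1 (path_simplex F) = point_simplex (F 0)"
    using simplical_face_in_standard_simplex[of 1 1]
    by (auto simp: singular_face_def path_simplex_def point_simplex_def fun_eq_iff simplical_face_def standard_simplex_0 restrict_def)
  ultimately show ?thesis by (simp add: chain_boundary_of)
qed

lemma chain_map_path: "chain_map 1 g (frag_of (path_simplex F)) = frag_of (path_simplex (g \<circ> F))"
proof -
  have "simplex_map 1 g (path_simplex F) = path_simplex (g \<circ> F)"
    by (auto simp: simplex_map_def path_simplex_def fun_eq_iff restrict_def)
  then show ?thesis by (simp only: chain_map_of)
qed

text \<open>The plane is contractible, and in degree one reduced and ordinary homology
  coincide.\<close>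

lemma cycle_in_plane_is_boundary:
  assumes "singular_chain 1 (euclidean :: (real \<times> real) topology) c" "chain_boundary 1 c = 0"
  shows "singular_relboundary 1 (euclidean :: (real \<times> real) topology) {} c"
proof -
  let ?E = "euclidean :: (real \<times> real) topology"
  have "contractible (UNIV :: (real \<times> real) set)" by (rule convex_imp_contractible) simp
  then have "contractible_space ?E" using contractible_space_top_of_set[of "UNIV :: (real \<times> real) set"] by simp
  then have "trivial_group (reduced_homology_group 1 ?E)" by (rule trivial_reduced_homology_group_contractible_space)
  then have "trivial_group (homology_group (int 1) ?E)" by (simp add: un_reduced_homology_group)
  then have t: "carrier (homology_group (int 1) ?E) = {singular_relboundary_set 1 ?E {}}"
    using one_relative_homology_group[of 1 ?E "{}"] by (auto simp: trivial_group_def)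
  have "singular_relcycle 1 ?E {} c" using assms by (simp add: singular_cycle)
  then have "homologous_rel_set 1 ?E {} c \<in> carrier (homology_group (int 1) ?E)"
    unfolding carrier_relative_homology_group by blast
  then show ?thesis unfolding t by (simp add: homologous_rel_set_eq_relboundary)
qed

definition segment :: "real \<times> real \<Rightarrow> real \<Rightarrow> real \<times> real" where
  "segment a s = s *\<^sub>R a"

text \<open>Used also for \<open>a\<close> outside the lattice, where it is an open path from the
  base point to \<open>torus_pt a\<close>, the image of a straight segment.\<close>

definition loop_chain :: "real \<times> real \<Rightarrow> ambient chain" where
  "loop_chain a = frag_of (path_simplex (torus_pt \<circ> segment a))"

lemma continuous_map_T: "continuous_map euclidean fibre_top torus_pt"
  using torus_pt_continuous[of UNIV] torus_pt_in by (auto simp: continuous_map_in_subtopology image_subset_iff_funcset)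

text \<open>In the plane the path and the two segments from the origin to its ends form a cycle,
  which bounds there; \<open>torus_pt\<close> carries the bounding chain to the fibre.\<close>

lemma path_homologous:
  assumes F: "continuous_on {0..1} F"
  shows "homologous_rel 1 fibre_top {} (frag_of (path_simplex (torus_pt \<circ> F))) (loop_chain (F 1) - loop_chain (F 0))"
proof -
  let ?c = "frag_of (path_simplex F) - (frag_of (path_simplex (segment (F 1))) - frag_of (path_simplex (segment (F 0))))"
  have s: "singular_chain 1 (euclidean :: (real \<times> real) topology) (frag_of (path_simplex G))" if "continuous_on {0..1} G" for G
    using singular_simplex_path[OF that, of UNIV] by (simp add: singular_chain_of)
  have l: "continuous_on {0..1} (segment a)" for a unfolding segment_def[abs_def] by (intro continuous_intros)
  have "singular_chain 1 (euclidean :: (real \<times> real) topology) ?c" by (intro singular_chain_diff s F l)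
  moreover have "chain_boundary 1 ?c = 0"
    by (simp only: chain_boundary_diff chain_boundary_path) (simp add: segment_def)
  ultimately have "singular_relboundary 1 (euclidean :: (real \<times> real) topology) {} ?c"
    by (rule cycle_in_plane_is_boundary)
  then have "singular_relboundary 1 fibre_top {} (chain_map 1 torus_pt ?c)"
    by (rule singular_relboundary_chain_map[OF _ continuous_map_T]) simp
  then show ?thesis
    unfolding homologous_rel_def loop_chain_def by (simp only: chain_map_diff chain_map_path)
qed

definition int_lattice :: "(real \<times> real) set" where
  "int_lattice = \<int> \<times> \<int>"

lemma zero_lattice [simp]: "0 \<in> int_lattice"
  by (simp add: int_lattice_def mem_Times_iff)

lemma torus_pt_lattice: "k \<in> int_lattice \<Longrightarrow> torus_pt (k + a) = torus_pt a"
  by (auto simp: torus_pt_eq_iff int_lattice_def)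

text \<open>The segment from \<open>k\<close> to \<open>k + a\<close> projects to the same path as
  the segment from the origin to \<open>a\<close>, because \<open>k\<close> is a period of
  \<open>torus_pt\<close>.\<close>

lemma loop_add:
  assumes "k \<in> int_lattice"
  shows "homologous_rel 1 fibre_top {} (loop_chain (k + a)) (loop_chain k + loop_chain a)"
proof -
  let ?F = "\<lambda>s. k + segment a s"
  have "continuous_on {0..1} ?F" unfolding segment_def by (intro continuous_intros)
  from path_homologous[OF this]
  have "homologous_rel 1 fibre_top {} (frag_of (path_simplex (torus_pt \<circ> ?F))) (loop_chain (k + a) - loop_chain k)" by (simp add: segment_def)
  moreover have "torus_pt \<circ> ?F = torus_pt \<circ> segment a" using torus_pt_lattice[OF assms] by (simp add: fun_eq_iff)
  ultimately have "homologous_rel 1 fibre_top {} (loop_chain a) (loop_chain (k + a) - loop_chain k)" by (simp add: loop_chain_def)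
  from homologous_rel_add[OF this homologous_rel_refl[of 1 fibre_top "{}" "loop_chain k"]]
  show ?thesis by (subst homologous_rel_sym) (simp add: add.commute)
qed

lemma loop_diff:
  assumes "k \<in> int_lattice" "l \<in> int_lattice"
  shows "homologous_rel 1 fibre_top {} (loop_chain (k - l)) (loop_chain k - loop_chain l)"
proof -
  have "homologous_rel 1 fibre_top {} (loop_chain (l + (k - l))) (loop_chain l + loop_chain (k - l))"
    by (rule loop_add[OF assms(2)])
  from homologous_rel_diff[OF this homologous_rel_refl[of 1 fibre_top "{}" "loop_chain l"]]
  show ?thesis by (subst homologous_rel_sym) (simp add: add.commute)
qed

lemma closed_path_homologous:
  assumes F: "continuous_on {0..1} F" and d: "F 1 - F 0 \<in> int_lattice"
  shows "homologous_rel 1 fibre_top {} (frag_of (path_simplex (torus_pt \<circ> F))) (loop_chain (F 1 - F 0))"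
proof -
  have "homologous_rel 1 fibre_top {} (loop_chain ((F 1 - F 0) + F 0)) (loop_chain (F 1 - F 0) + loop_chain (F 0))"
    by (rule loop_add[OF d])
  from homologous_rel_diff[OF this homologous_rel_refl[of 1 fibre_top "{}" "loop_chain (F 0)"]]
  have "homologous_rel 1 fibre_top {} (loop_chain (F 1) - loop_chain (F 0)) (loop_chain (F 1 - F 0))" by simp
  then show ?thesis using homologous_rel_trans path_homologous[OF F] by blast
qed

lemma singular_simplex_1_path:
  assumes "singular_simplex 1 fibre_top \<sigma>"
  obtains f where "continuous_on {0..1} f" "f ` {0..1} \<subseteq> toric_fibre x" "\<sigma> = path_simplex f"
proof -
  define e where "e s = (\<lambda>j::nat. if j = 0 then 1 - s else if j = 1 then s else 0)" for s :: real
  have ein: "e s \<in> standard_simplex 1" if "s \<in> {0..1}" for s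
    using that by (auto simp: standard_simplex_def e_def numeral_2_eq_2)
  have "continuous_map euclideanreal (powertop_real UNIV) e"
    unfolding continuous_map_componentwise_UNIV
  proof
    fix k :: nat
    consider "k = 0" | "k = 1" | "k \<noteq> 0" "k \<noteq> 1" by blast
    then show "continuous_map euclideanreal euclideanreal (\<lambda>s. e s k)"
      by cases (auto simp: e_def intro!: continuous_intros)
  qed
  then have "continuous_map (top_of_set {0..1}) (subtopology (powertop_real UNIV) (standard_simplex 1)) e"
    using ein by (auto simp: continuous_map_in_subtopology intro: continuous_map_from_subtopology)
  moreover have "continuous_map (subtopology (powertop_real UNIV) (standard_simplex 1)) fibre_top \<sigma>"
    using assms by (simp add: singular_simplex_def)
  ultimately have c: "continuous_map (top_of_set {0..1}) fibre_top (\<sigma> \<circ> e)" by (rule continuous_map_compose)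
  show ?thesis
  proof (rule that[of "\<sigma> \<circ> e"])
    show "continuous_on {0..1} (\<sigma> \<circ> e)" "(\<sigma> \<circ> e) ` {0..1} \<subseteq> toric_fibre x"
      using c by (auto simp: continuous_map_in_subtopology)
    show "\<sigma> = path_simplex (\<sigma> \<circ> e)"
    proof
      fix y
      show "\<sigma> y = path_simplex (\<sigma> \<circ> e) y"
      proof (cases "y \<in> standard_simplex 1")
        case True
        then have "y = e (y 1)"
          by (auto simp: standard_simplex_def e_def fun_eq_iff numeral_2_eq_2)
        then show ?thesis using True by (simp add: path_simplex_def)
      next
        case False
        then show ?thesis using assms by (simp add: path_simplex_def singular_simplex_def extensional_def)
      qed
    qed
  qed
qed

text \<open>Chosen point by point, without continuity. It fixes for every point of the fibre one
  path joining it to the base point.\<close>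

definition wlift :: "ambient \<Rightarrow> real \<times> real" where
  "wlift y = (SOME \<theta>. torus_pt \<theta> = y)"

lemma torus_pt_wlift: "y \<in> toric_fibre x \<Longrightarrow> torus_pt (wlift y) = y"
  unfolding wlift_def by (rule someI_ex) (use torus_pt_surj in blast)

text \<open>Joining the end points of a simplex to the base point turns every chain into a sum of loops.\<close>

definition closing :: "ambient chain \<Rightarrow> ambient chain" where
  "closing = frag_extend (\<lambda>\<rho>. loop_chain (wlift (\<rho> (\<lambda>j. if j = 0 then 1 else 0))))"

lemma closing_point: "closing (frag_of (point_simplex y)) = loop_chain (wlift y)"
  by (simp add: closing_def point_simplex_def standard_simplex_0)

text \<open>Induction over chains passes through single simplices, which are not cycles, so the
  claim carries the correction \<open>closing (chain_boundary 1 c)\<close>. It is additive in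
  \<open>c\<close> and vanishes on cycles.\<close>

lemma chain_homologous_loop:
  assumes "singular_chain 1 fibre_top c"
  shows "\<exists>d\<in>int_lattice. homologous_rel 1 fibre_top {} c (loop_chain d + closing (chain_boundary 1 c))"
  using assms unfolding singular_chain_def
proof (induction c rule: frag_induction)
  case zero
  \<comment> \<open>The constant loop \<open>loop_chain 0\<close> is a nonzero chain; it is only
    homologous to zero.\<close>
  have "homologous_rel 1 fibre_top {} (loop_chain (0 - 0)) (loop_chain 0 - loop_chain 0)" by (rule loop_diff) auto
  then have "homologous_rel 1 fibre_top {} 0 (loop_chain 0 + closing (chain_boundary 1 0))"
    by (subst homologous_rel_sym) (simp add: closing_def)
  then show ?case by (intro bexI[of _ 0]) auto
next
  case (one \<sigma>)
  then obtain f where f: "continuous_on {0..1} f" "f ` {0..1} \<subseteq> toric_fibre x" and \<sigma>: "\<sigma> = path_simplex f"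
    using singular_simplex_1_path by blast
  obtain F where F: "continuous_on {0..1} F" "\<And>s. s \<in> {0..1} \<Longrightarrow> torus_pt (F s) = f s"
    using torus_pt_lift[OF f(1) convex_imp_contractible] f(2) by (metis convex_real_interval(5) image_subset_iff)
  have \<sigma>F: "\<sigma> = path_simplex (torus_pt \<circ> F)"
    unfolding \<sigma> path_simplex_def using F(2) standard_simplex_1_bounds by (auto simp: restrict_def fun_eq_iff)
  \<comment> \<open>The lift \<open>F\<close> and the chosen lift \<open>wlift\<close> lie over the
    same point, so their difference is a lattice vector; the difference of its two end values is the
    loop attached to the simplex.\<close>
  define k where "k s = F s - wlift (f s)" for s
  have k: "k s \<in> int_lattice" if "s \<in> {0..1}" for s
  proof -
    have "f s \<in> toric_fibre x" using f(2) that by blast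
    then have "torus_pt (F s) = torus_pt (wlift (f s))" using F(2)[OF that] torus_pt_wlift by simp
    then show ?thesis by (auto simp: torus_pt_eq_iff k_def int_lattice_def mem_Times_iff)
  qed
  have 1: "homologous_rel 1 fibre_top {} (loop_chain (F s)) (loop_chain (k s) + loop_chain (wlift (f s)))" if "s \<in> {0..1}" for s
    using loop_add[OF k[OF that], of "wlift (f s)"] by (simp add: k_def)
  let ?w = "loop_chain (wlift (f 1)) - loop_chain (wlift (f 0))"
  have "homologous_rel 1 fibre_top {} (loop_chain (F 1) - loop_chain (F 0)) ((loop_chain (k 1) + loop_chain (wlift (f 1))) - (loop_chain (k 0) + loop_chain (wlift (f 0))))"
    by (intro homologous_rel_diff 1) auto
  also have "(loop_chain (k 1) + loop_chain (wlift (f 1))) - (loop_chain (k 0) + loop_chain (wlift (f 0))) = (loop_chain (k 1) - loop_chain (k 0)) + ?w"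
    by (rule add_diff_add)
  finally have h2: "homologous_rel 1 fibre_top {} (loop_chain (F 1) - loop_chain (F 0)) ((loop_chain (k 1) - loop_chain (k 0)) + ?w)" .
  have "homologous_rel 1 fibre_top {} (loop_chain (k 1) - loop_chain (k 0)) (loop_chain (k 1 - k 0))"
    by (subst homologous_rel_sym) (intro loop_diff k, auto)
  then have h3: "homologous_rel 1 fibre_top {} ((loop_chain (k 1) - loop_chain (k 0)) + ?w) (loop_chain (k 1 - k 0) + ?w)"
    by (rule homologous_rel_add) (rule homologous_rel_refl)
  have h1: "homologous_rel 1 fibre_top {} (frag_of \<sigma>) (loop_chain (F 1) - loop_chain (F 0))"
    unfolding \<sigma>F by (rule path_homologous[OF F(1)])
  have "homologous_rel 1 fibre_top {} (frag_of \<sigma>) (loop_chain (k 1 - k 0) + ?w)"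
    by (rule homologous_rel_trans[OF h3 homologous_rel_trans[OF h2 h1]])
  moreover have "closing (chain_boundary 1 (frag_of \<sigma>)) = loop_chain (wlift (f 1)) - loop_chain (wlift (f 0))"
    unfolding \<sigma> chain_boundary_path using closing_point by (simp add: closing_def frag_extend_diff)
  moreover have "k 1 - k 0 \<in> int_lattice" using k[of 0] k[of 1] by (auto simp: int_lattice_def mem_Times_iff)
  ultimately show ?case by metis
next
  case (diff a b)
  then obtain d d' where d: "d \<in> int_lattice" "d' \<in> int_lattice"
    and h: "homologous_rel 1 fibre_top {} a (loop_chain d + closing (chain_boundary 1 a))" "homologous_rel 1 fibre_top {} b (loop_chain d' + closing (chain_boundary 1 b))"
    by blast
  have 1: "homologous_rel 1 fibre_top {} (a - b) ((loop_chain d + closing (chain_boundary 1 a)) - (loop_chain d' + closing (chain_boundary 1 b)))"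
    by (rule homologous_rel_diff[OF h])
  have 2: "(loop_chain d + closing (chain_boundary 1 a)) - (loop_chain d' + closing (chain_boundary 1 b)) = (loop_chain d - loop_chain d') + closing (chain_boundary 1 (a - b))"
    by (simp add: chain_boundary_diff closing_def frag_extend_diff)
  have 3: "homologous_rel 1 fibre_top {} ((loop_chain d - loop_chain d') + closing (chain_boundary 1 (a - b))) (loop_chain (d - d') + closing (chain_boundary 1 (a - b)))"
    by (intro homologous_rel_add homologous_rel_refl) (subst homologous_rel_sym, rule loop_diff[OF d])
  have "d - d' \<in> int_lattice" using d by (auto simp: int_lattice_def mem_Times_iff)
  then show ?case using homologous_rel_trans[OF 3 1[unfolded 2]] by blast
qed

abbreviation homology_cls :: "ambient chain \<Rightarrow> ambient chain set" where
  "homology_cls \<equiv> homologous_rel_set 1 fibre_top {}"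

lemma loop_cycle:
  assumes "d \<in> int_lattice"
  shows "singular_relcycle 1 fibre_top {} (loop_chain d)"
proof -
  have "continuous_on {0..1} (torus_pt \<circ> segment d)"
    unfolding segment_def[abs_def] o_def by (rule continuous_on_compose2[OF torus_pt_continuous[of UNIV]]) (auto intro!: continuous_intros)
  then have "singular_chain 1 fibre_top (loop_chain d)"
    unfolding loop_chain_def singular_chain_of by (rule singular_simplex_path) (auto simp: torus_pt_in)
  moreover have "chain_boundary 1 (loop_chain d) = 0"
    using torus_pt_lattice[OF assms, of 0] unfolding loop_chain_def chain_boundary_path by (simp add: segment_def)
  ultimately show ?thesis by (simp add: singular_cycle)
qed

lemma hcls_mult:
  assumes "singular_relcycle 1 fibre_top {} a" "singular_relcycle 1 fibre_top {} b"
  shows "homology_cls a \<otimes>\<^bsub>H1 (toric_fibre x)\<^esub> homology_cls b = homology_cls (a + b)"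
proof -
  have "(\<lambda>a. r_coset (relcycle_group 1 fibre_top {}) (singular_relboundary_set 1 fibre_top {}) a) \<in>
      hom (relcycle_group 1 fibre_top {}) (relcycle_group 1 fibre_top {} Mod singular_relboundary_set 1 fibre_top {})"
    by (rule normal.r_coset_hom_Mod[OF normal_subgroup_singular_relboundary_relcycle])
  then have "homology_cls \<in> hom (relcycle_group 1 fibre_top {}) (H1 (toric_fibre x))"
    using nontrivial_relative_homology_group[of 1 fibre_top "{}"] by (simp add: right_coset_singular_relboundary)
  then show ?thesis using assms by (simp add: hom_def Pi_iff carrier_relcycle_group)
qed

definition loop_class :: "real \<times> real \<Rightarrow> ambient chain set" where
  "loop_class d = homology_cls (loop_chain d)"

lemma orbit_loop_class_eq: "orbit_loop_class x d = loop_class d"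
  by (simp add: orbit_loop_class_def loop_class_def loop_chain_def path_simplex_def torus_pt_def segment_def o_def)

lemma cls_carrier: "d \<in> int_lattice \<Longrightarrow> loop_class d \<in> carrier (H1 (toric_fibre x))"
  using carrier_relative_homology_group[of 1 fibre_top "{}"] loop_cycle by (auto simp: loop_class_def)

lemma cls_add:
  assumes "d \<in> int_lattice" "d' \<in> int_lattice"
  shows "loop_class (d + d') = loop_class d \<otimes>\<^bsub>H1 (toric_fibre x)\<^esub> loop_class d'"
proof -
  have "homology_cls (loop_chain (d + d')) = homology_cls (loop_chain d + loop_chain d')"
    unfolding homologous_rel_set_eq by (rule loop_add[OF assms(1)])
  then show ?thesis
    unfolding loop_class_def hcls_mult[OF loop_cycle[OF assms(1)] loop_cycle[OF assms(2)]] .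
qed

lemma cls_scale:
  assumes d: "d \<in> int_lattice"
  shows "loop_class (of_int n *\<^sub>R d) = loop_class d [^]\<^bsub>H1 (toric_fibre x)\<^esub> n"
proof -
  interpret G: group "H1 (toric_fibre x)" by simp
  have L: "of_int n *\<^sub>R d \<in> int_lattice" for n :: int using d by (auto simp: int_lattice_def)
  have "loop_class 0 \<otimes>\<^bsub>H1 (toric_fibre x)\<^esub> loop_class 0 = loop_class 0" using cls_add[of 0 0] by simp
  then have 0: "loop_class 0 = \<one>\<^bsub>H1 (toric_fibre x)\<^esub>" using cls_carrier[of 0] G.l_cancel_one' by auto
  have s: "loop_class (of_int (n + 1) *\<^sub>R d) = loop_class (of_int n *\<^sub>R d) \<otimes>\<^bsub>H1 (toric_fibre x)\<^esub> loop_class d" for n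
    using cls_add[OF L d] by (simp add: algebra_simps)
  have p: "loop_class d [^]\<^bsub>H1 (toric_fibre x)\<^esub> (n + 1) = loop_class d [^]\<^bsub>H1 (toric_fibre x)\<^esub> n \<otimes>\<^bsub>H1 (toric_fibre x)\<^esub> loop_class d" for n :: int
    using G.int_pow_mult[OF cls_carrier[OF d], of n 1] G.int_pow_1[OF cls_carrier[OF d]] by simp
  show ?thesis
  proof (induction n rule: int_induct[where k=0])
    case base
    show ?case using 0 by simp
  next
    case (step1 i)
    then show ?case using s[of i] p[of i] by simp
  next
    case (step2 i)
    have "loop_class (of_int (i - 1) *\<^sub>R d) \<otimes>\<^bsub>H1 (toric_fibre x)\<^esub> loop_class d = loop_class d [^]\<^bsub>H1 (toric_fibre x)\<^esub> (i - 1) \<otimes>\<^bsub>H1 (toric_fibre x)\<^esub> loop_class d"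
      using s[of "i - 1"] p[of "i - 1"] step2 by simp
    then show ?case
      using G.right_cancel[OF cls_carrier[OF d] cls_carrier[OF L] G.int_pow_closed[OF cls_carrier[OF d]]] by blast
  qed
qed

lemma lattice_to_H1_eq: "lattice_to_H1 x v = loop_class (of_int (v $ 1), of_int (v $ 2))"
proof -
  have "lattice_to_H1 x v = loop_class (of_int (v $ 1) *\<^sub>R (1, 0)) \<otimes>\<^bsub>H1 (toric_fibre x)\<^esub> loop_class (of_int (v $ 2) *\<^sub>R (0, 1))"
    unfolding lattice_to_H1_def orbit_loop_class_eq by (subst (1 2) cls_scale) (auto simp: int_lattice_def)
  also have "\<dots> = loop_class (of_int (v $ 1) *\<^sub>R (1, 0) + of_int (v $ 2) *\<^sub>R (0, 1))"
    by (rule cls_add[symmetric]) (auto simp: int_lattice_def)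
  finally show ?thesis by simp
qed

text \<open>For a cycle the correction term in \<open>chain_homologous_loop\<close> is
  \<open>closing 0\<close>, which is zero, so every class is that of a loop with lattice
  displacement.\<close>

lemma lattice_to_H1_surj: "c \<in> carrier (H1 (toric_fibre x)) \<Longrightarrow> c \<in> range (lattice_to_H1 x)"
proof -
  assume "c \<in> carrier (H1 (toric_fibre x))"
  then obtain a where a: "singular_relcycle 1 fibre_top {} a" "c = homology_cls a"
    using carrier_relative_homology_group[of 1 fibre_top "{}"] by auto
  then have "singular_chain 1 fibre_top a" "chain_boundary 1 a = 0" by (auto simp: singular_cycle)
  then obtain d where d: "d \<in> int_lattice" "homologous_rel 1 fibre_top {} a (loop_chain d)"
    using chain_homologous_loop[of a] by (auto simp: closing_def)
  then have "c = loop_class d" unfolding a(2) loop_class_def homologous_rel_set_eq by blast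
  moreover obtain m n :: int where "d = (of_int m, of_int n)" using d(1) by (auto simp: int_lattice_def elim!: Ints_cases)
  ultimately have "c = lattice_to_H1 x (vector [m, n])" by (simp add: lattice_to_H1_eq)
  then show ?thesis by blast
qed

text \<open>The image of the straight loop is the projection of the path \<open>F\<close>, and a
  closed path is homologous to the straight loop with the same displacement.\<close>

lemma hom_induced_cls:
  assumes \<phi>: "continuous_on (toric_fibre x) \<phi>" "\<phi> ` toric_fibre x \<subseteq> toric_fibre x"
    and F: "continuous_on {0..1} F" "\<And>s. s \<in> {0..1} \<Longrightarrow> \<phi> (torus_pt (s *\<^sub>R d)) = torus_pt (F s)"
    and d: "d \<in> int_lattice" "F 1 - F 0 \<in> int_lattice"
  shows "hom_induced 1 fibre_top {} fibre_top {} \<phi> (loop_class d) = loop_class (F 1 - F 0)"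
proof -
  have c: "continuous_map fibre_top fibre_top \<phi>" using \<phi> by (auto simp: continuous_map_in_subtopology image_subset_iff_funcset)
  have "hom_induced (int 1) fibre_top {} fibre_top {} \<phi> (loop_class d) = homology_cls (chain_map 1 \<phi> (loop_chain d))"
    unfolding loop_class_def by (rule hom_induced_chain_map[OF c _ loop_cycle[OF d(1)]]) simp
  also have "chain_map 1 \<phi> (loop_chain d) = frag_of (path_simplex (torus_pt \<circ> F))"
  proof -
    have "path_simplex (\<phi> \<circ> (torus_pt \<circ> segment d)) = path_simplex (torus_pt \<circ> F)"
      unfolding path_simplex_def using F(2) standard_simplex_1_bounds by (auto simp: restrict_def fun_eq_iff segment_def)
    then show ?thesis unfolding loop_chain_def chain_map_path by simp
  qed
  also have "homology_cls \<dots> = loop_class (F 1 - F 0)"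
    unfolding loop_class_def homologous_rel_set_eq by (rule closed_path_homologous[OF F(1) d(2)])
  finally show ?thesis by simp
qed

theorem hom_induced_toric_fibre:
  fixes A :: "int^2^2"
  assumes \<phi>: "continuous_on (toric_fibre x) \<phi>" "\<phi> ` toric_fibre x \<subseteq> toric_fibre x"
    and F: "continuous_on {0..1} F" "\<And>s. s \<in> {0..1} \<Longrightarrow> \<phi> (torus_pt (s, 0)) = torus_pt (F s)"
    and G: "continuous_on {0..1} G" "\<And>s. s \<in> {0..1} \<Longrightarrow> \<phi> (torus_pt (0, s)) = torus_pt (G s)"
    and F1: "F 1 - F 0 = (of_int (A $ 1 $ 1), of_int (A $ 2 $ 1))"
    and G1: "G 1 - G 0 = (of_int (A $ 1 $ 2), of_int (A $ 2 $ 2))"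
  shows "restrict (hom_induced 1 fibre_top {} fibre_top {} \<phi>) (carrier (H1 (toric_fibre x))) = matrix_on_H1 x A"
proof -
  let ?h = "hom_induced 1 fibre_top {} fibre_top {} \<phi>"
  have e: "?h (loop_class (1, 0)) = loop_class (F 1 - F 0)" "?h (loop_class (0, 1)) = loop_class (G 1 - G 0)"
    by (rule hom_induced_cls[OF \<phi> F(1)] hom_induced_cls[OF \<phi> G(1)]; use F(2) G(2) in \<open>auto simp: F1 G1 int_lattice_def\<close>)+
  have hom: "?h \<in> hom (H1 (toric_fibre x)) (H1 (toric_fibre x))" by (rule hom_induced_empty_hom)
  have "?h (lattice_to_H1 x v) = lattice_to_H1 x (A *v v)" for v
  proof -
    let ?a = "(of_int (A $ 1 $ 1), of_int (A $ 2 $ 1)) :: real \<times> real" and ?b = "(of_int (A $ 1 $ 2), of_int (A $ 2 $ 2)) :: real \<times> real"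
    have L: "(1, 0) \<in> int_lattice" "(0, 1) \<in> int_lattice" "?a \<in> int_lattice" "?b \<in> int_lattice" by (auto simp: int_lattice_def)
    have "?h (lattice_to_H1 x v) = ?h (loop_class (1, 0) [^]\<^bsub>H1 (toric_fibre x)\<^esub> (v $ 1)) \<otimes>\<^bsub>H1 (toric_fibre x)\<^esub>
        ?h (loop_class (0, 1) [^]\<^bsub>H1 (toric_fibre x)\<^esub> (v $ 2))"
      unfolding lattice_to_H1_def orbit_loop_class_eq
      by (rule hom_mult[OF hom]) (auto intro!: group.int_pow_closed cls_carrier L)
    also have "\<dots> = loop_class ?a [^]\<^bsub>H1 (toric_fibre x)\<^esub> (v $ 1) \<otimes>\<^bsub>H1 (toric_fibre x)\<^esub> loop_class ?b [^]\<^bsub>H1 (toric_fibre x)\<^esub> (v $ 2)"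
      using hom_int_pow[OF hom cls_carrier[OF L(1)]] hom_int_pow[OF hom cls_carrier[OF L(2)]] by (simp add: e F1 G1)
    also have "\<dots> = loop_class (of_int (v $ 1) *\<^sub>R ?a + of_int (v $ 2) *\<^sub>R ?b)"
      unfolding cls_scale[OF L(3), symmetric] cls_scale[OF L(4), symmetric]
      by (rule cls_add[symmetric]) (auto simp: int_lattice_def)
    also have "\<dots> = lattice_to_H1 x (A *v v)"
      by (simp add: lattice_to_H1_eq matrix_vector_mult_def sum_2 mult.commute)
    finally show ?thesis .
  qed
  \<comment> \<open>The value of \<open>inv_into\<close> is some preimage under the surjection
    \<open>lattice_to_H1\<close>, which is enough to recover the class \<open>c\<close>
    itself.\<close>
  then show ?thesis
    unfolding matrix_on_H1_def
    by (intro restrict_ext) (metis f_inv_into_f lattice_to_H1_surj)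
qed

lemma matrix_on_H1_id: "matrix_on_H1 x (mat 1) = \<one>\<^bsub>AutoGroup (H1 (toric_fibre x))\<^esub>"
proof -
  have "lattice_to_H1 x (mat 1 *v inv_into UNIV (lattice_to_H1 x) c) = c" if "c \<in> carrier (H1 (toric_fibre x))" for c
    using f_inv_into_f[OF lattice_to_H1_surj[OF that]] by simp
  then show ?thesis
    unfolding matrix_on_H1_def AutoGroup_def BijGroup_def by (auto simp: restrict_def fun_eq_iff)
qed

end

end

subsection \<open>Autonomous flows and their concatenation\<close>

text \<open>Time-one maps of Hamiltonians that do not depend on time and are smooth on the whole
  ambient space; their flows can be sped up by a factor depending on time, which makes concatenation
  possible.\<close>

definition autonomous_diffeo :: "(ambient \<Rightarrow> real) \<Rightarrow> (ambient \<Rightarrow> ambient) \<Rightarrow> bool" where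
  "autonomous_diffeo H \<phi> \<longleftrightarrow> smooth_on H UNIV \<and>
     (\<exists>K. compact K \<and> K \<subseteq> TS1xS2 \<and> (\<forall>y\<in>TS1xS2 - K. H y = 0)) \<and>
     (\<forall>x\<in>TS1xS2. \<exists>\<gamma>. \<gamma> 0 = x \<and> \<gamma> 1 = \<phi> x \<and>
         (\<forall>t\<in>{0..1}. \<gamma> t \<in> TS1xS2 \<and>
           (\<exists>\<xi>. is_ham_vector (\<gamma> t) (frechet_derivative H (at (\<gamma> t))) \<xi> \<and>
                (\<gamma> has_vector_derivative \<xi>) (at t within {0..1}))))"

lemma dq_scaleR: "dq z (c *\<^sub>R a) = c * dq z a"
  by (simp add: dq_def)

lemma is_ham_vector_scaleR:
  assumes "is_ham_vector y l \<xi>"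
  shows "is_ham_vector y (\<lambda>w. c * l w) (c *\<^sub>R \<xi>)"
proof -
  obtain z p u where y: "y = (z, p, u)" by (cases y)
  obtain a r v where \<xi>: "\<xi> = (a, r, v)" by (cases \<xi>)
  have "omega y (c *\<^sub>R \<xi>) w = c * omega y \<xi> w" for w
    by (cases w) (simp add: y \<xi> dq_scaleR omega_S2_def cross_mult_left algebra_simps)
  then show ?thesis
    using assms by (auto simp: is_ham_vector_def y \<xi>)
qed

lemma smooth_on_fst_real:
  fixes g :: "real \<Rightarrow> real"
  assumes "smooth_on g UNIV"
  shows "smooth_on (\<lambda>x :: real \<times> 'a::real_normed_vector. g (c * fst x + d)) UNIV"
  by (rule smooth_on_affine_compose[OF assms, where L="\<lambda>x. c * fst x"])
    (auto intro!: bounded_linear_const_mult bounded_linear_fst)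

lemma smooth_on_snd:
  fixes H :: "'a::real_normed_vector \<Rightarrow> real"
  assumes "smooth_on H UNIV"
  shows "smooth_on (\<lambda>x :: real \<times> 'a. H (snd x)) UNIV"
  by (rule smooth_on_linear_compose[OF assms bounded_linear_snd]) auto

lemma smooth_step_range: "smooth_step s \<in> {0..1}"
proof -
  have "bump_poly 1 s \<ge> 0" "bump_poly 1 (1 - s) \<ge> 0" by (auto simp: bump_poly_def)
  then show ?thesis using smooth_step_denom[of s]
    by (auto simp: smooth_step_def divide_inverse[symmetric] divide_le_eq)
qed

text \<open>For \<open>d = 0\<close> the flow is run through during the first half of the time
  interval, for \<open>d = - 1\<close> during the second half; the curve rests otherwise because
  \<open>smooth_step\<close> is constant outside \<open>{0..1}\<close>.\<close>

lemma reparametrized_solution: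
  assumes \<gamma>: "\<forall>t\<in>{0..1}. \<gamma> t \<in> TS1xS2 \<and>
           (\<exists>\<xi>. is_ham_vector (\<gamma> t) (frechet_derivative H (at (\<gamma> t))) \<xi> \<and>
                (\<gamma> has_vector_derivative \<xi>) (at t within {0..1}))"
  shows "\<exists>\<xi>. is_ham_vector (\<gamma> (smooth_step (2 * t + d))) (frechet_derivative H (at (\<gamma> (smooth_step (2 * t + d))))) \<xi> \<and>
     ((\<lambda>t. \<gamma> (smooth_step (2 * t + d))) has_vector_derivative (2 * deriv smooth_step (2 * t + d)) *\<^sub>R \<xi>) (at t within S)"
proof -
  define b where "b t = smooth_step (2 * t + d)" for t
  obtain \<xi> where \<xi>: "is_ham_vector (\<gamma> (b t)) (frechet_derivative H (at (\<gamma> (b t)))) \<xi>"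
    "(\<gamma> has_vector_derivative \<xi>) (at (b t) within {0..1})"
    using \<gamma> smooth_step_range unfolding b_def by blast
  have "(b has_real_derivative 2 * deriv smooth_step (2 * t + d)) (at t within S)"
    unfolding b_def by (rule DERIV_chain2[OF smooth_step_DERIV, THEN DERIV_cong])
      (auto intro!: derivative_eq_intros)
  then have "(b has_vector_derivative 2 * deriv smooth_step (2 * t + d)) (at t within S)"
    by (simp add: has_real_derivative_iff_has_vector_derivative)
  moreover have "(\<gamma> has_vector_derivative \<xi>) (at (b t) within b ` S)"
    by (rule has_vector_derivative_within_subset[OF \<xi>(2)]) (use smooth_step_range in \<open>auto simp: b_def\<close>)
  ultimately have "(\<gamma> \<circ> b has_vector_derivative (2 * deriv smooth_step (2 * t + d)) *\<^sub>R \<xi>) (at t within S)"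
    by (rule vector_diff_chain_within)
  then show ?thesis using \<xi>(1) unfolding o_def b_def by blast
qed

text \<open>The two Hamiltonians are switched on one after the other by smooth factors of time, so
  that their sum is smooth in time and generates the concatenated flow.\<close>

lemma hamiltonian_diffeo_compose:
  assumes Ha: "autonomous_diffeo Ha \<phi>1" and Hb: "autonomous_diffeo Hb \<phi>2"
  shows "hamiltonian_diffeo (\<phi>2 \<circ> \<phi>1)"
proof -
  \<comment> \<open>The factor is the derivative of \<open>smooth_step (2 * t)\<close>, by which the
    velocity of the reparametrized curve is multiplied; it is zero from \<open>t = 1 / 2\<close> on,
    and \<open>d\<close> is zero up to that time.\<close>
  define c where "c t = 2 * deriv smooth_step (2 * t + 0)" for t
  define d where "d t = 2 * deriv smooth_step (2 * t + (- 1))" for t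
  define H where "H t y = c t * Ha y + d t * Hb y" for t y
  have cd: "c t = 0 \<or> d t = 0" "t \<ge> 1 / 2 \<Longrightarrow> c t = 0" "t \<le> 1 / 2 \<Longrightarrow> d t = 0" for t
    using deriv_smooth_step_eq_0[of "2 * t"] deriv_smooth_step_eq_0[of "2 * t + (- 1)"]
    by (cases "t \<ge> 1 / 2"; auto simp: c_def d_def)+
  have sm: "smooth_on Ha UNIV" "smooth_on Hb UNIV" using Ha Hb by (auto simp: autonomous_diffeo_def)
  have "smooth_on (\<lambda>x :: real \<times> ambient. 2 * deriv smooth_step (2 * fst x + 0) * Ha (snd x) + 2 * deriv smooth_step (2 * fst x + (- 1)) * Hb (snd x)) UNIV"
    by (intro smooth_on_add smooth_on_mult smooth_on_snd sm smooth_on_fst_real smooth_on_deriv_smooth_step smooth_on_const) auto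
  then have 1: "smooth_on (\<lambda>(t, y). H t y) UNIV" by (simp add: H_def c_def d_def case_prod_beta')
  obtain K1 K2 where K: "compact K1" "K1 \<subseteq> TS1xS2" "\<forall>y\<in>TS1xS2 - K1. Ha y = 0"
    "compact K2" "K2 \<subseteq> TS1xS2" "\<forall>y\<in>TS1xS2 - K2. Hb y = 0"
    using Ha Hb unfolding autonomous_diffeo_def by blast
  have "compact (K1 \<union> K2) \<and> K1 \<union> K2 \<subseteq> TS1xS2 \<and> (\<forall>t\<in>{0..1}. \<forall>y\<in>TS1xS2 - (K1 \<union> K2). H t y = 0)"
    using K by (auto simp: H_def)
  with 1 have adm: "admissible_hamiltonian H" unfolding admissible_hamiltonian_def by blast
  have fd: "frechet_derivative (H t) (at y) = (\<lambda>w. c t * frechet_derivative Ha (at y) w + d t * frechet_derivative Hb (at y) w)" for t y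
    unfolding H_def
    by (rule frechet_derivative_at[symmetric])
      (intro has_derivative_add has_derivative_mult_right smooth_on_has_derivative[OF sm(1)] smooth_on_has_derivative[OF sm(2)] UNIV_I)
  show ?thesis
    unfolding hamiltonian_diffeo_def
  proof (rule exI[of _ H], intro conjI ballI)
    show "admissible_hamiltonian H" by (rule adm)
  next
    fix x assume x: "x \<in> TS1xS2"
    obtain \<gamma>1 where \<gamma>1: "\<gamma>1 0 = x" "\<gamma>1 1 = \<phi>1 x" and s1: "\<forall>t\<in>{0..1}. \<gamma>1 t \<in> TS1xS2 \<and>
           (\<exists>\<xi>. is_ham_vector (\<gamma>1 t) (frechet_derivative Ha (at (\<gamma>1 t))) \<xi> \<and> (\<gamma>1 has_vector_derivative \<xi>) (at t within {0..1}))"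
      using Ha x unfolding autonomous_diffeo_def by blast
    have "\<phi>1 x \<in> TS1xS2" using s1 \<gamma>1 by (metis atLeastAtMost_iff order_refl zero_le_one)
    then obtain \<gamma>2 where \<gamma>2: "\<gamma>2 0 = \<phi>1 x" "\<gamma>2 1 = \<phi>2 (\<phi>1 x)" and s2: "\<forall>t\<in>{0..1}. \<gamma>2 t \<in> TS1xS2 \<and>
           (\<exists>\<xi>. is_ham_vector (\<gamma>2 t) (frechet_derivative Hb (at (\<gamma>2 t))) \<xi> \<and> (\<gamma>2 has_vector_derivative \<xi>) (at t within {0..1}))"
      using Hb unfolding autonomous_diffeo_def by blast
    \<comment> \<open>At every time at least one of the two summands rests at \<open>\<phi>1 x\<close>.\<close>
    define \<gamma> where "\<gamma> t = \<gamma>1 (smooth_step (2 * t + 0)) + \<gamma>2 (smooth_step (2 * t + (- 1))) - \<phi>1 x" for t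
    have early: "\<gamma> t = \<gamma>1 (smooth_step (2 * t + 0))" if "t \<le> 1 / 2" for t
      using that by (simp add: \<gamma>_def smooth_step_eq_0 \<gamma>2)
    have late: "\<gamma> t = \<gamma>2 (smooth_step (2 * t + (- 1)))" if "t \<ge> 1 / 2" for t
      using that by (simp add: \<gamma>_def smooth_step_eq_1 \<gamma>1)
    show "\<exists>\<gamma>. \<gamma> 0 = x \<and> \<gamma> 1 = (\<phi>2 \<circ> \<phi>1) x \<and> (\<forall>t\<in>{0..1}. \<gamma> t \<in> TS1xS2 \<and>
           (\<exists>\<xi>. is_ham_vector (\<gamma> t) (frechet_derivative (H t) (at (\<gamma> t))) \<xi> \<and> (\<gamma> has_vector_derivative \<xi>) (at t within {0..1})))"
    proof (intro exI[of _ \<gamma>] conjI ballI)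
      show "\<gamma> 0 = x" using early[of 0] \<gamma>1 by (simp add: smooth_step_eq_0)
      show "\<gamma> 1 = (\<phi>2 \<circ> \<phi>1) x" using late[of 1] \<gamma>2 by (simp add: smooth_step_eq_1)
      fix t :: real assume t: "t \<in> {0..1}"
      show "\<gamma> t \<in> TS1xS2"
        using early[of t] late[of t] s1 s2 smooth_step_range by (cases "t \<le> 1 / 2") auto
      obtain \<xi>1 where \<xi>1: "is_ham_vector (\<gamma>1 (smooth_step (2 * t + 0))) (frechet_derivative Ha (at (\<gamma>1 (smooth_step (2 * t + 0))))) \<xi>1"
        "((\<lambda>t. \<gamma>1 (smooth_step (2 * t + 0))) has_vector_derivative c t *\<^sub>R \<xi>1) (at t within {0..1})"
        using reparametrized_solution[OF s1, of t 0] unfolding c_def by blast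
      obtain \<xi>2 where \<xi>2: "is_ham_vector (\<gamma>2 (smooth_step (2 * t + (- 1)))) (frechet_derivative Hb (at (\<gamma>2 (smooth_step (2 * t + (- 1)))))) \<xi>2"
        "((\<lambda>t. \<gamma>2 (smooth_step (2 * t + (- 1)))) has_vector_derivative d t *\<^sub>R \<xi>2) (at t within {0..1})"
        using reparametrized_solution[OF s2, of t "- 1"] unfolding d_def by blast
      have der: "(\<gamma> has_vector_derivative c t *\<^sub>R \<xi>1 + d t *\<^sub>R \<xi>2) (at t within {0..1})"
        unfolding \<gamma>_def using has_vector_derivative_diff[OF has_vector_derivative_add[OF \<xi>1(2) \<xi>2(2)] has_vector_derivative_const[of "\<phi>1 x"]] by simp
      have "is_ham_vector (\<gamma> t) (frechet_derivative (H t) (at (\<gamma> t))) (c t *\<^sub>R \<xi>1 + d t *\<^sub>R \<xi>2)"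
      proof (cases "t \<le> 1 / 2")
        case True
        then have "d t = 0" using cd by simp
        then show ?thesis using is_ham_vector_scaleR[OF \<xi>1(1), of "c t"] by (simp add: fd early[OF True])
      next
        case False
        then have "c t = 0" "t \<ge> 1 / 2" using cd by simp_all
        then show ?thesis using is_ham_vector_scaleR[OF \<xi>2(1), of "d t"] by (simp add: fd late)
      qed
      with der show "\<exists>\<xi>. is_ham_vector (\<gamma> t) (frechet_derivative (H t) (at (\<gamma> t))) \<xi> \<and> (\<gamma> has_vector_derivative \<xi>) (at t within {0..1})"
        by blast
    qed
  qed
qed

lemma autonomous_diffeo_id: "autonomous_diffeo (\<lambda>y. 0) (\<lambda>y. y)"
  unfolding autonomous_diffeo_def
proof (intro conjI ballI)
  show "\<exists>K. compact K \<and> K \<subseteq> TS1xS2 \<and> (\<forall>y\<in>TS1xS2 - K. (0::real) = 0)" by (intro exI[of _ "{}"]) auto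
  fix x assume x: "x \<in> TS1xS2"
  have "is_ham_vector x (frechet_derivative (\<lambda>y. 0) (at x)) 0"
    by (cases x) (auto simp: is_ham_vector_def zero_prod_def frechet_derivative_const dq_def omega_S2_def)
  then show "\<exists>\<gamma>. \<gamma> 0 = x \<and> \<gamma> 1 = x \<and> (\<forall>t\<in>{0..1}. \<gamma> t \<in> TS1xS2 \<and>
        (\<exists>\<xi>. is_ham_vector (\<gamma> t) (frechet_derivative (\<lambda>y. 0) (at (\<gamma> t))) \<xi> \<and> (\<gamma> has_vector_derivative \<xi>) (at t within {0..1})))"
    using x by (intro exI[of _ "\<lambda>t. x"] conjI ballI exI[of _ 0] has_vector_derivative_const) auto
qed (simp add: smooth_on_const)

lemma hamiltonian_diffeo_autonomous: "autonomous_diffeo H \<phi> \<Longrightarrow> hamiltonian_diffeo \<phi>"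
  using hamiltonian_diffeo_compose[OF autonomous_diffeo_id] by (simp add: o_def)

subsection \<open>Half turns of the sphere about a rotating horizontal axis\<close>

text \<open>Negative powers are written with the conjugate. On the unit circle this is the usual
  power, and it is polynomial in the real coordinates, hence smooth on the whole ambient
  space.\<close>

definition cpow :: "int \<Rightarrow> complex \<Rightarrow> complex" where
  "cpow k z = (if k \<ge> 0 then z ^ nat k else cnj z ^ nat (- k))"

lemma cpow_cis: "cpow k (cis a) = cis (of_int k * a)"
  by (simp add: cpow_def cis_cnj Complex.DeMoivre)

lemma norm_cpow: "norm z = 1 \<Longrightarrow> norm (cpow k z) = 1"
  by (simp add: cpow_def norm_power)

text \<open>On the unit circle the derivative is evaluated only in the tangent direction
  \<open>\<i> * z\<close>, where both signs of \<open>k\<close> give one formula.\<close>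

lemma cpow_has_derivative:
  obtains D where "(cpow k has_derivative D) (at z)" "norm z = 1 \<Longrightarrow> D (\<i> * z) = of_int k * \<i> * cpow k z"
proof (cases "k \<ge> 0")
  case True
  have e: "cpow k = (\<lambda>z::complex. z ^ nat k)" using True by (simp add: cpow_def fun_eq_iff)
  have "((\<lambda>z::complex. z ^ nat k) has_derivative (\<lambda>a. of_nat (nat k) * a * z ^ (nat k - 1))) (at z)"
    by (rule has_derivative_power[OF has_derivative_ident])
  moreover have "of_nat (nat k) * (\<i> * z) * z ^ (nat k - 1) = of_int k * \<i> * z ^ nat k"
  proof -
    obtain n where n: "k = int n" using True nonneg_int_cases by blast
    have e: "nat k = n" "(of_int k :: complex) = of_nat n" using n by simp_all
    show ?thesis unfolding e by (cases n) (simp_all add: mult_ac)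
  qed
  ultimately show ?thesis using that by (simp add: e)
next
  case False
  have e: "cpow k = (\<lambda>z. cnj z ^ nat (- k))" using False by (simp add: cpow_def fun_eq_iff)
  have "((\<lambda>z. cnj z ^ nat (- k)) has_derivative (\<lambda>a. of_nat (nat (- k)) * cnj a * cnj z ^ (nat (- k) - 1))) (at z)"
    by (rule has_derivative_power[OF bounded_linear_imp_has_derivative[OF bounded_linear_cnj]])
  moreover have "of_nat (nat (- k)) * cnj (\<i> * z) * cnj z ^ (nat (- k) - 1) = of_int k * \<i> * cnj z ^ nat (- k)"
  proof -
    obtain n where n: "k = - int n" using False by (metis int_cases2 of_nat_0_le_iff)
    have e: "nat (- k) = n" "(of_int k :: complex) = - of_nat n" using n by simp_all
    show ?thesis unfolding e by (cases n) (simp_all add: algebra_simps)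
  qed
  ultimately show ?thesis using that by (simp add: e)
qed

definition vec_of :: "complex \<Rightarrow> real \<Rightarrow> real^3" where
  "vec_of w h = vector [Re w, Im w, h]"

lemma vec_of_nth [simp]: "vec_of w h $ 1 = Re w" "vec_of w h $ 2 = Im w" "vec_of w h $ 3 = h"
  by (simp_all add: vec_of_def)

fun hor :: "ambient \<Rightarrow> complex" where
  "hor (z, p, u) = Complex (u $ 1) (u $ 2)"

text \<open>In the coordinates \<open>(q, p + k u\<^sub>3, R(-2 \<pi> k q) u)\<close> this is the Hamiltonian \<open>f(p) u\<^sub>1\<close>; where the
  cutoff \<open>f\<close> equals \<open>1/2\<close>, its time-one map is the half turn about the first axis.\<close>

fun turn_hamiltonian :: "int \<Rightarrow> real \<Rightarrow> ambient \<Rightarrow> real" where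
  "turn_hamiltonian k R (z, p, u) =
     cutoff R (p + of_int k * u $ 3) * (u $ 1 * Re (cpow k z) + u $ 2 * Im (cpow k z))"

text \<open>Explicit solution of Hamilton's equations. The horizontal part of \<open>u\<close> in
  the frame turned by \<open>cpow k z\<close> is \<open>v\<close>; the quantities \<open>P\<close>
  and \<open>Re v\<close> are conserved, the pair of \<open>Im v\<close> and \<open>u $ 3\<close>
  rotates with angular speed \<open>\<Omega>\<close>, and \<open>z\<close> rotates with speed
  \<open>2 * pi\<close> times the derivative of the cutoff times \<open>Re v\<close>.\<close>

fun turn_flow :: "int \<Rightarrow> real \<Rightarrow> real \<Rightarrow> ambient \<Rightarrow> ambient" where
  "turn_flow k R t (z, p, u) =
     (let P = p + of_int k * u $ 3; v = Complex (u $ 1) (u $ 2) * cnj (cpow k z);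
          \<Omega> = 2 * pi * cutoff R P; a = cos (\<Omega> * t) * Im v - sin (\<Omega> * t) * u $ 3;
          b = sin (\<Omega> * t) * Im v + cos (\<Omega> * t) * u $ 3; y = cis (2 * pi * deriv (cutoff R) P * Re v * t) * z
      in (y, P - of_int k * b, vec_of (Complex (Re v) a * cpow k y) b))"

lemma Re_Im_power_smooth: "smooth_on (\<lambda>y::ambient. Re (fst y ^ n)) UNIV \<and> smooth_on (\<lambda>y::ambient. Im (fst y ^ n)) UNIV"
proof (induction n)
  case 0
  show ?case by (simp add: smooth_on_const)
next
  case (Suc n)
  have "smooth_on (\<lambda>y::ambient. Re (fst y)) UNIV" "smooth_on (\<lambda>y::ambient. Im (fst y)) UNIV"
    by (auto intro!: smooth_on_linear bounded_linear_compose[OF bounded_linear_Re] bounded_linear_compose[OF bounded_linear_Im] bounded_linear_fst)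
  then show ?case using Suc by (auto intro!: smooth_on_add smooth_on_diff smooth_on_mult)
qed

lemma cpow_smooth: "smooth_on (\<lambda>y::ambient. Re (cpow k (fst y))) UNIV" "smooth_on (\<lambda>y::ambient. Im (cpow k (fst y))) UNIV"
  using Re_Im_power_smooth[of "nat k"] Re_Im_power_smooth[of "nat (- k)"]
  by (cases "k \<ge> 0"; auto simp: cpow_def simp flip: complex_cnj_power intro: smooth_on_minus)+

lemma turn_hamiltonian_eq: "turn_hamiltonian k R = (\<lambda>y. cutoff R (fst (snd y) + of_int k * snd (snd y) $ 3) *
    (snd (snd y) $ 1 * Re (cpow k (fst y)) + snd (snd y) $ 2 * Im (cpow k (fst y))))"
  by (auto simp: fun_eq_iff)

lemma bounded_linear_u: "bounded_linear (\<lambda>y::ambient. snd (snd y) $ i)"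
  by (intro bounded_linear_compose[OF bounded_linear_vec_nth] bounded_linear_compose[OF bounded_linear_snd] bounded_linear_snd)

lemma bounded_linear_p: "bounded_linear (\<lambda>y::ambient. fst (snd y))"
  by (intro bounded_linear_compose[OF bounded_linear_fst] bounded_linear_snd)

lemma turn_hamiltonian_smooth: "smooth_on (turn_hamiltonian k R) UNIV"
  unfolding turn_hamiltonian_eq
  by (intro smooth_on_mult smooth_on_add cpow_smooth smooth_on_linear bounded_linear_u open_UNIV
      smooth_on_linear_compose[OF smooth_on_cutoff] bounded_linear_add bounded_linear_p bounded_linear_const_mult) auto

lemma closed_TS1xS2: "closed TS1xS2"
proof -
  have "TS1xS2 = {y. norm (fst y) = 1} \<inter> {y. norm (snd (snd y)) = 1}"
    by (auto simp: TS1xS2_def)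
  show ?thesis
    unfolding \<open>TS1xS2 = _\<close> by (intro closed_Int closed_Collect_eq continuous_intros)
qed

lemma compact_momentum_bounded: "compact {y \<in> TS1xS2. \<bar>fst (snd y)\<bar> \<le> B}"
proof -
  have "{y \<in> TS1xS2. \<bar>fst (snd y)\<bar> \<le> B} = TS1xS2 \<inter> (cball 0 1 \<times> {-B..B} \<times> cball 0 1)"
    by (auto simp: TS1xS2_def abs_le_iff)
  moreover have "compact (cball (0::complex) 1 \<times> {-B..B} \<times> cball (0::real^3) 1)"
    by (intro compact_Times compact_cball compact_Icc)
  ultimately show ?thesis
    using closed_Int_compact[OF closed_TS1xS2] by simp
qed

lemma norm_vec_of: "norm (vec_of w h) = sqrt ((norm w)\<^sup>2 + h\<^sup>2)"
  by (simp add: norm_real3 cmod_power2)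

text \<open>Here \<open>W\<close> and \<open>V\<close> are the horizontal coordinates of
  \<open>u\<close> in the turned frame. On the sphere a function with ambient gradient
  \<open>g\<close> has Hamiltonian vector \<open>(2 * pi) *\<^sub>R cross3 g u\<close>, with the
  factor coming from the normalization of the area; the vector in the formula is the gradient of
  \<open>turn_hamiltonian\<close> in \<open>u\<close>.\<close>

lemma turn_hamiltonian_vector:
  fixes z :: complex and p :: real and u :: "real^3" and k :: int
  assumes z: "norm z = 1" and u: "norm u = 1"
  defines "P \<equiv> p + of_int k * u $ 3" and "C \<equiv> Re (cpow k z)" and "S \<equiv> Im (cpow k z)"
  defines "W \<equiv> u $ 1 * C + u $ 2 * S" and "V \<equiv> u $ 2 * C - u $ 1 * S"
  shows "is_ham_vector (z, p, u) (frechet_derivative (turn_hamiltonian k R) (at (z, p, u)))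
    ((2 * pi * deriv (cutoff R) P * W) *\<^sub>R (\<i> * z), - 2 * pi * cutoff R P * of_int k * V,
     (2 * pi) *\<^sub>R cross3 (vector [cutoff R P * C, cutoff R P * S, deriv (cutoff R) P * of_int k * W]) u)"
proof -
  obtain D where D: "(cpow k has_derivative D) (at z)" and Dz: "D (\<i> * z) = of_int k * \<i> * cpow k z"
    using cpow_has_derivative[of k z] z by metis
  interpret D: bounded_linear D using D has_derivative_bounded_linear by blast
  define f f' where "f = cutoff R P" and "f' = deriv (cutoff R) P"
  let ?y = "(z, p, u)"
  have 1: "((\<lambda>y::ambient. cutoff R (fst (snd y) + of_int k * snd (snd y) $ 3)) has_derivative
      (\<lambda>w. f' * (fst (snd w) + of_int k * snd (snd w) $ 3))) (at ?y)"
  proof -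
    have "((\<lambda>y::ambient. fst (snd y) + of_int k * snd (snd y) $ 3) has_derivative
        (\<lambda>w. fst (snd w) + of_int k * snd (snd w) $ 3)) (at ?y)"
      by (intro bounded_linear_imp_has_derivative bounded_linear_add bounded_linear_p bounded_linear_const_mult bounded_linear_u)
    moreover have "(cutoff R has_derivative (\<lambda>x. f' * x)) (at (fst (snd ?y) + of_int k * snd (snd ?y) $ 3))"
      using cutoff_DERIV[of R P] by (simp add: has_field_derivative_def f'_def P_def)
    ultimately show ?thesis by (rule has_derivative_compose)
  qed
  have 2: "((\<lambda>y::ambient. cpow k (fst y)) has_derivative (\<lambda>w. D (fst w))) (at ?y)"
    using has_derivative_compose[OF bounded_linear_imp_has_derivative[OF bounded_linear_fst], of "cpow k" D ?y UNIV] D by simp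
  have u_der: "((\<lambda>y::ambient. snd (snd y) $ i) has_derivative (\<lambda>w. snd (snd w) $ i)) (at ?y)" for i
    by (rule bounded_linear_imp_has_derivative[OF bounded_linear_u])
  have "(turn_hamiltonian k R has_derivative
     (\<lambda>w. f * ((u $ 1 * Re (D (fst w)) + snd (snd w) $ 1 * C) + (u $ 2 * Im (D (fst w)) + snd (snd w) $ 2 * S))
        + f' * (fst (snd w) + of_int k * snd (snd w) $ 3) * W)) (at ?y)"
    unfolding turn_hamiltonian_eq
    using has_derivative_mult[OF 1 has_derivative_add[OF has_derivative_mult[OF u_der[of 1] bounded_linear.has_derivative[OF bounded_linear_Re 2]]
          has_derivative_mult[OF u_der[of 2] bounded_linear.has_derivative[OF bounded_linear_Im 2]]]]
    by (simp add: f_def P_def W_def C_def S_def)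
  from frechet_derivative_at[OF this]
  have fd: "frechet_derivative (turn_hamiltonian k R) (at ?y) (a, r, v) =
      f * ((u $ 1 * Re (D a) + v $ 1 * C) + (u $ 2 * Im (D a) + v $ 2 * S)) + f' * (r + of_int k * v $ 3) * W" for a r v
    by (simp add: fun_eq_iff)
  let ?h = "vector [f * C, f * S, f' * of_int k * W] :: real^3"
  show ?thesis
    unfolding is_ham_vector_def f_def[symmetric] f'_def[symmetric]
  proof (intro conjI ballI)
    have "z \<bullet> (\<i> * z) = 0" by (simp add: inner_complex_def)
    then show "((2 * pi * f' * W) *\<^sub>R (\<i> * z), - 2 * pi * f * of_int k * V, (2 * pi) *\<^sub>R cross3 ?h u) \<in> tangent_space ?y"
      by (simp add: dot_cross_self)
    fix w assume "w \<in> tangent_space ?y"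
    then obtain a r v where w: "w = (a, r, v)" and t: "z \<bullet> a = 0" "u \<bullet> v = 0" by (cases w) auto
    define \<alpha> where "\<alpha> = 2 * pi * dq z a"
    have a: "a = \<alpha> *\<^sub>R (\<i> * z)" using dq_tangent(2)[OF z t(1) t(1)] by (simp add: \<alpha>_def)
    have Da: "D a = \<alpha> *\<^sub>R (of_int k * \<i> * cpow k z)" by (simp add: a D.scaleR Dz)
    have "Re (D a) = - \<alpha> * of_int k * S" "Im (D a) = \<alpha> * of_int k * C" unfolding Da by (simp_all add: C_def S_def)
    then have rhs: "frechet_derivative (turn_hamiltonian k R) (at ?y) w =
        \<alpha> * f * of_int k * V + f * (v $ 1 * C + v $ 2 * S) + f' * (r + of_int k * v $ 3) * W"
      unfolding w fd V_def by (simp add: algebra_simps)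
    have "(\<i> * z) \<bullet> (\<i> * z) = 1"
    proof -
      have "norm (\<i> * z) = 1" using z by (simp add: norm_mult)
      then show ?thesis by (simp add: dot_square_norm)
    qed
    then have dz: "dq z ((2 * pi * f' * W) *\<^sub>R (\<i> * z)) = f' * W" by (simp add: dq_def)
    have dza: "dq z a = \<alpha> / (2 * pi)" by (simp add: \<alpha>_def)
    \<comment> \<open>For \<open>v\<close> orthogonal to the unit vector \<open>u\<close> the double
      cross product paired with \<open>u\<close> returns \<open>v \<bullet> ?h\<close>, which is the
      differential in the sphere direction.\<close>
    have "cross3 (cross3 ?h u) v = (v \<bullet> ?h) *\<^sub>R u - (v \<bullet> u) *\<^sub>R ?h"
      using cross_skew[of "cross3 ?h u" v] Lagrange[of v ?h u] by simp
    moreover have "u \<bullet> u = 1" using u by (simp add: dot_square_norm)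
    ultimately have "u \<bullet> cross3 (cross3 ?h u) v = v \<bullet> ?h" using t(2) by (simp add: inner_diff_right inner_commute)
    also have "\<dots> = v $ 1 * (f * C) + v $ 2 * (f * S) + v $ 3 * (f' * of_int k * W)" by (simp add: inner_vec_def sum_3)
    finally have "omega_S2 u ((2 * pi) *\<^sub>R cross3 ?h u) v = v $ 1 * (f * C) + v $ 2 * (f * S) + v $ 3 * (f' * of_int k * W)"
      by (simp add: omega_S2_def cross_mult_left)
    then show "omega ?y ((2 * pi * f' * W) *\<^sub>R (\<i> * z), - 2 * pi * f * of_int k * V, (2 * pi) *\<^sub>R cross3 ?h u) w =
        frechet_derivative (turn_hamiltonian k R) (at ?y) w"
      unfolding rhs unfolding w omega.simps omega_TS1.simps dz dza by (simp add: algebra_simps)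
  qed
qed

lemma has_vector_derivative_vec_of:
  assumes "(w has_vector_derivative w') (at t within S)" "(h has_vector_derivative h') (at t within S)"
  shows "((\<lambda>t. vec_of (w t) (h t)) has_vector_derivative vec_of w' h') (at t within S)"
proof -
  have e: "vec_of a b = Re a *\<^sub>R axis 1 1 + Im a *\<^sub>R axis 2 1 + b *\<^sub>R axis 3 1" for a b
    by (simp add: vec_eq_iff forall_3 axis_def)
  note d = bounded_linear.has_vector_derivative
  show ?thesis
    unfolding e
    by (intro has_vector_derivative_add d[OF bounded_linear_scaleR_left] d[OF bounded_linear_Re] d[OF bounded_linear_Im] assms)
qed

lemma cis_has_vector_derivative:
  "((\<lambda>t. cis (c * t)) has_vector_derivative c *\<^sub>R (\<i> * cis (c * t))) (at t within S)"
proof -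
  have e: "cis (c * t) = exp (t *\<^sub>R (\<i> * of_real c))" for t
    by (simp add: cis_conv_exp scaleR_conv_of_real mult_ac)
  have "((\<lambda>t. exp (t *\<^sub>R (\<i> * of_real c))) has_vector_derivative exp (t *\<^sub>R (\<i> * of_real c)) * (\<i> * of_real c)) (at t within S)"
    by (rule exp_scaleR_has_vector_derivative_right)
  then show ?thesis unfolding e by (simp add: scaleR_conv_of_real mult_ac)
qed

text \<open>Along the explicit curve \<open>P\<close> and \<open>Re v\<close> keep their initial
  values, so the coefficients \<open>f\<close>, \<open>f'\<close> and \<open>Re v\<close> of the
  Hamiltonian vector are constant in time and the equation reduces to uniform rotations.\<close>

lemma autonomous_diffeo_turn: "autonomous_diffeo (turn_hamiltonian k R) (turn_flow k R 1)"
  unfolding autonomous_diffeo_def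
proof (intro conjI ballI)
  show "smooth_on (turn_hamiltonian k R) UNIV" by (rule turn_hamiltonian_smooth)
  show "\<exists>K. compact K \<and> K \<subseteq> TS1xS2 \<and> (\<forall>y\<in>TS1xS2 - K. turn_hamiltonian k R y = 0)"
  proof (intro exI conjI ballI)
    \<comment> \<open>The height \<open>u $ 3\<close> is at most one in absolute value, so
      \<open>\<bar>p\<bar> > ?B\<close> forces \<open>\<bar>P\<bar> \<ge> R + 2\<close>, where the
      cutoff vanishes.\<close>
    let ?B = "R + 2 + \<bar>of_int k\<bar>"
    show "compact {y \<in> TS1xS2. \<bar>fst (snd y)\<bar> \<le> ?B}" by (rule compact_momentum_bounded)
    fix y assume y: "y \<in> TS1xS2 - {y \<in> TS1xS2. \<bar>fst (snd y)\<bar> \<le> ?B}"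
    obtain z p u where e: "y = (z, p, u)" by (cases y)
    have "\<bar>u $ 3\<bar> \<le> 1" using component_le_norm_cart[of u 3] y by (simp add: e TS1xS2_def)
    then have "\<bar>of_int k * u $ 3\<bar> \<le> \<bar>of_int k\<bar>" by (simp add: abs_mult mult_left_le)
    moreover have "\<bar>p\<bar> > ?B" using y by (auto simp: e)
    ultimately have "\<bar>p + of_int k * u $ 3\<bar> \<ge> R + 2" by linarith
    then show "turn_hamiltonian k R y = 0" by (simp add: e cutoff_eq_0)
  qed auto
  fix x assume x: "x \<in> TS1xS2"
  obtain z p u where e: "x = (z, p, u)" by (cases x)
  have z: "norm z = 1" and u: "norm u = 1" using x by (auto simp: e TS1xS2_def)
  define P v where "P = p + of_int k * u $ 3" and "v = Complex (u $ 1) (u $ 2) * cnj (cpow k z)"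
  define f f' where "f = cutoff R P" and "f' = deriv (cutoff R) P"
  define a where "a t = cos (2 * pi * f * t) * Im v - sin (2 * pi * f * t) * u $ 3" for t
  define b where "b t = sin (2 * pi * f * t) * Im v + cos (2 * pi * f * t) * u $ 3" for t
  define y where "y t = cis (2 * pi * f' * Re v * t) * z" for t
  define c where "c t = cpow k (y t)" for t
  define w where "w t = Complex (Re v) (a t) * c t" for t
  have fl: "turn_flow k R t x = (y t, P - of_int k * b t, vec_of (w t) (b t))" for t
    by (simp add: e Let_def P_def v_def f_def f'_def a_def b_def y_def c_def w_def)
  have nz: "norm (cpow k z) = 1" by (rule norm_cpow[OF z])
  have cc: "cpow k z * cnj (cpow k z) = 1" using nz by (simp add: complex_norm_square[symmetric])
  have ny: "norm (y t) = 1" and nc: "norm (c t) = 1" for t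
    using norm_cpow[of "y t" k] z by (auto simp: y_def c_def norm_mult)
  have nu: "(Re v)\<^sup>2 + (a t)\<^sup>2 + (b t)\<^sup>2 = 1" for t
  proof -
    have "(a t)\<^sup>2 + (b t)\<^sup>2 = ((cos (2 * pi * f * t))\<^sup>2 + (sin (2 * pi * f * t))\<^sup>2) * ((Im v)\<^sup>2 + (u $ 3)\<^sup>2)"
    proof -
      have "(c * X - s * Y)\<^sup>2 + (s * X + c * Y)\<^sup>2 = (c\<^sup>2 + s\<^sup>2) * (X\<^sup>2 + Y\<^sup>2)" for c s X Y :: real
        by (simp add: power2_eq_square algebra_simps)
      then show ?thesis unfolding a_def b_def .
    qed
    moreover have "(Re v)\<^sup>2 + (Im v)\<^sup>2 = (norm v)\<^sup>2" by (simp add: cmod_power2)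
    moreover have "(norm v)\<^sup>2 = (u $ 1)\<^sup>2 + (u $ 2)\<^sup>2" using nz by (simp add: v_def norm_mult cmod_power2)
    moreover have "(u $ 1)\<^sup>2 + (u $ 2)\<^sup>2 + (u $ 3)\<^sup>2 = 1" using u by (simp add: norm_real3)
    ultimately show ?thesis by simp
  qed
  have inX: "turn_flow k R t x \<in> TS1xS2" for t
  proof -
    have "(norm (w t))\<^sup>2 = (Re v)\<^sup>2 + (a t)\<^sup>2" using nc[of t] by (simp add: w_def norm_mult cmod_power2)
    then have "norm (vec_of (w t) (b t)) = 1" using nu[of t] by (simp add: norm_vec_of)
    then show ?thesis using ny by (simp add: fl TS1xS2_def)
  qed
  have start: "turn_flow k R 0 x = x"
  proof -
    have "Complex (Re v) (Im v) * cpow k z = Complex (u $ 1) (u $ 2)"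
      unfolding complex_surj v_def using cc by (metis mult.assoc mult.commute mult.right_neutral)
    then show ?thesis
      unfolding fl by (simp add: e w_def a_def b_def y_def c_def P_def) (intro real3_eqI, simp_all)
  qed
  show "\<exists>\<gamma>. \<gamma> 0 = x \<and> \<gamma> 1 = turn_flow k R 1 x \<and> (\<forall>t\<in>{0..1}. \<gamma> t \<in> TS1xS2 \<and>
        (\<exists>\<xi>. is_ham_vector (\<gamma> t) (frechet_derivative (turn_hamiltonian k R) (at (\<gamma> t))) \<xi> \<and> (\<gamma> has_vector_derivative \<xi>) (at t within {0..1})))"
  proof (rule exI[of _ "\<lambda>t. turn_flow k R t x"], intro conjI ballI)
    show "turn_flow k R 0 x = x" by (rule start)
    show "turn_flow k R t x \<in> TS1xS2" for t by (rule inX)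
    fix t :: real
    define C S where "C = Re (c t)" and "S = Im (c t)"
    have CS: "C * C + S * S = 1" using nc[of t] unfolding C_def S_def by (metis cmod_power2 power2_eq_square power_one)
    have u1: "Re (w t) = Re v * C - a t * S" and u2: "Im (w t) = Re v * S + a t * C"
      by (simp_all add: w_def C_def S_def)
    have W: "vec_of (w t) (b t) $ 1 * Re (cpow k (y t)) + vec_of (w t) (b t) $ 2 * Im (cpow k (y t)) = Re v"
    proof -
      have "(Re v * C - a t * S) * C + (Re v * S + a t * C) * S = Re v * (C * C + S * S)" by (simp add: algebra_simps)
      then show ?thesis using CS by (simp add: u1 u2 flip: c_def C_def S_def)
    qed
    have V: "vec_of (w t) (b t) $ 2 * Re (cpow k (y t)) - vec_of (w t) (b t) $ 1 * Im (cpow k (y t)) = a t"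
    proof -
      have "(Re v * S + a t * C) * C - (Re v * C - a t * S) * S = a t * (C * C + S * S)" by (simp add: algebra_simps)
      then show ?thesis using CS by (simp add: u1 u2 flip: c_def C_def S_def)
    qed
    have PP: "(P - of_int k * b t) + of_int k * vec_of (w t) (b t) $ 3 = P" by simp
    let ?\<xi> = "((2 * pi * f' * Re v) *\<^sub>R (\<i> * y t), - 2 * pi * f * of_int k * a t,
        (2 * pi) *\<^sub>R cross3 (vector [f * C, f * S, f' * of_int k * Re v]) (vec_of (w t) (b t)))"
    have nv: "norm (vec_of (w t) (b t)) = 1" using inX[of t] by (simp add: fl TS1xS2_def)
    have ham: "is_ham_vector (turn_flow k R t x) (frechet_derivative (turn_hamiltonian k R) (at (turn_flow k R t x))) ?\<xi>"
      using turn_hamiltonian_vector[OF ny[of t] nv, of "P - of_int k * b t" k R]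
      unfolding PP W V fl unfolding f_def f'_def C_def S_def c_def .
    have ya: "(y has_vector_derivative (2 * pi * f' * Re v) *\<^sub>R (\<i> * y t)) (at t within {0..1})"
    proof -
      have "((\<lambda>t. cis (2 * pi * f' * Re v * t)) has_vector_derivative (2 * pi * f' * Re v) *\<^sub>R (\<i> * cis (2 * pi * f' * Re v * t))) (at t within {0..1})"
        by (rule cis_has_vector_derivative)
      from has_vector_derivative_mult_left[OF this, of z] show ?thesis
        unfolding y_def by (simp only: mult_scaleR_left mult.assoc)
    qed
    obtain D where D: "(cpow k has_derivative D) (at (y t))" and Dz: "D (\<i> * y t) = of_int k * \<i> * c t"
      using cpow_has_derivative[of k "y t"] ny unfolding c_def by metis
    interpret D: bounded_linear D using D has_derivative_bounded_linear by blast
    have cd: "(c has_vector_derivative (2 * pi * f' * Re v * of_int k) *\<^sub>R (\<i> * c t)) (at t within {0..1})"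
    proof -
      have E: "D ((2 * pi * f' * Re v) *\<^sub>R (\<i> * y t)) = (2 * pi * f' * Re v * of_int k) *\<^sub>R (\<i> * c t)"
        unfolding D.scaleR Dz by (simp add: scaleR_conv_of_real mult_ac)
      have "cpow k \<circ> y = c" by (simp add: fun_eq_iff c_def)
      then show ?thesis
        using vector_derivative_diff_chain_within[OF ya has_derivative_at_withinI[OF D]] unfolding E by simp
    qed
    have ad: "(a has_vector_derivative - (2 * pi * f) * b t) (at t within {0..1})"
      unfolding a_def b_def has_real_derivative_iff_has_vector_derivative[symmetric]
      by (auto intro!: derivative_eq_intros simp: algebra_simps)
    have bd: "(b has_vector_derivative (2 * pi * f) * a t) (at t within {0..1})"
      unfolding a_def b_def has_real_derivative_iff_has_vector_derivative[symmetric]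
      by (auto intro!: derivative_eq_intros simp: algebra_simps)
    have "((\<lambda>t. complex_of_real (Re v) + \<i> * complex_of_real (a t)) has_vector_derivative \<i> * complex_of_real (- (2 * pi * f) * b t)) (at t within {0..1})"
      using has_vector_derivative_add[OF has_vector_derivative_const has_vector_derivative_mult_right[OF has_vector_derivative_of_real[OF ad[folded has_real_derivative_iff_has_vector_derivative]]]] by simp
    then have Cd: "((\<lambda>t. Complex (Re v) (a t)) has_vector_derivative Complex 0 (- (2 * pi * f) * b t)) (at t within {0..1})"
      by (simp add: Complex_eq)
    have wd: "(w has_vector_derivative Complex (Re v) (a t) * ((2 * pi * f' * Re v * of_int k) *\<^sub>R (\<i> * c t)) + Complex 0 (- (2 * pi * f) * b t) * c t) (at t within {0..1})"
      unfolding w_def by (rule has_vector_derivative_mult[OF Cd cd])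
    have "((\<lambda>t. (y t, P - of_int k * b t, vec_of (w t) (b t))) has_vector_derivative
       ((2 * pi * f' * Re v) *\<^sub>R (\<i> * y t), 0 - of_int k * ((2 * pi * f) * a t),
        vec_of (Complex (Re v) (a t) * ((2 * pi * f' * Re v * of_int k) *\<^sub>R (\<i> * c t)) + Complex 0 (- (2 * pi * f) * b t) * c t) ((2 * pi * f) * a t))) (at t within {0..1})"
      by (intro has_vector_derivative_Pair has_vector_derivative_diff has_vector_derivative_const has_vector_derivative_vec_of ya wd bd has_vector_derivative_mult_right)
    moreover have "vec_of (Complex (Re v) (a t) * ((2 * pi * f' * Re v * of_int k) *\<^sub>R (\<i> * c t)) + Complex 0 (- (2 * pi * f) * b t) * c t) ((2 * pi * f) * a t) =
        (2 * pi) *\<^sub>R cross3 (vector [f * C, f * S, f' * of_int k * Re v]) (vec_of (w t) (b t))"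
    proof (rule real3_eqI)
      have "f * C * Im (w t) - f * S * Re (w t) = f * a t * (C * C + S * S)" unfolding u1 u2 by (simp add: algebra_simps)
      then show "vec_of (Complex (Re v) (a t) * ((2 * pi * f' * Re v * of_int k) *\<^sub>R (\<i> * c t)) + Complex 0 (- (2 * pi * f) * b t) * c t) ((2 * pi * f) * a t) $ 3 =
        ((2 * pi) *\<^sub>R cross3 (vector [f * C, f * S, f' * of_int k * Re v]) (vec_of (w t) (b t))) $ 3"
        using CS by (simp add: cross_components mult.commute mult.left_commute)
    qed (simp_all add: cross_components u1 u2 algebra_simps flip: C_def S_def)
    ultimately have "((\<lambda>t. turn_flow k R t x) has_vector_derivative ?\<xi>) (at t within {0..1})"
      unfolding fl by (simp add: mult_ac)
    with ham show "\<exists>\<xi>. is_ham_vector (turn_flow k R t x) (frechet_derivative (turn_hamiltonian k R) (at (turn_flow k R t x))) \<xi> \<and>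
        ((\<lambda>t. turn_flow k R t x) has_vector_derivative \<xi>) (at t within {0..1})"
      by blast
  qed simp
qed

text \<open>On the plateau the angle at time one is \<open>pi\<close>: \<open>Im v\<close> and the
  height change sign, \<open>Re v\<close> stays. The derivative of the cutoff is zero there, so
  \<open>z\<close> does not move, and conservation of \<open>P\<close> shifts the momentum by
  \<open>2 * of_int k * x2\<close>.\<close>

lemma turn_flow_torus_pt:
  assumes "\<bar>x1 + of_int k * x2\<bar> \<le> R"
  shows "turn_flow k R 1 (torus_pt (x1, x2) (s, t)) = torus_pt (x1 + 2 * of_int k * x2, - x2) (s, 2 * of_int k * s - t)"
proof -
  let ?r = "sqrt (1 - x2\<^sup>2)"
  define \<alpha> where "\<alpha> = 2 * pi * t - of_int k * (2 * pi * s)"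
  have "Complex (cos (2 * pi * t) * ?r) (sin (2 * pi * t) * ?r) = ?r * cis (2 * pi * t)"
    by (simp add: complex_eq_iff)
  then have v: "Complex (cos (2 * pi * t) * ?r) (sin (2 * pi * t) * ?r) * cnj (cpow k (cis (2 * pi * s))) = ?r * cis \<alpha>"
    by (simp add: cpow_cis cis_cnj cis_mult mult.assoc \<alpha>_def)
  have "Complex (?r * cos \<alpha>) (- (?r * sin \<alpha>)) = ?r * cis (- \<alpha>)" by (simp add: complex_eq_iff)
  moreover have "- \<alpha> + of_int k * (2 * pi * s) = 2 * pi * (2 * of_int k * s - t)" by (simp add: \<alpha>_def algebra_simps)
  ultimately have w: "Complex (?r * cos \<alpha>) (- (?r * sin \<alpha>)) * cpow k (cis (2 * pi * s)) = ?r * cis (2 * pi * (2 * of_int k * s - t))"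
    by (simp add: cpow_cis cis_mult mult.assoc)
  have half: "cutoff R (x1 + of_int k * x2) = 1 / 2" "deriv (cutoff R) (x1 + of_int k * x2) = 0"
    using assms by (auto simp: cutoff_eq_half deriv_cutoff_eq_0)
  show ?thesis
    unfolding torus_pt_def torus_act_base_point fst_conv snd_conv turn_flow.simps Let_def vector_3 v half
    using w by (simp add: complex_eq_iff vec_of_def mult.commute[of "sqrt _"])
qed

subsection \<open>The second variation\<close>

context flow_family
begin

lemma G_lipschitz:
  obtains E where "\<And>t \<theta> \<theta>'. t \<in> {0..1} \<Longrightarrow> norm (G t \<theta> - G t \<theta>') \<le> E * norm (G 0 \<theta> - G 0 \<theta>')"
proof -
  obtain C where C: "0 \<le> C"
    "\<And>t x y. t \<in> {0..1} \<Longrightarrow> x \<in> K \<Longrightarrow> y \<in> K \<Longrightarrow> norm (F (t, y) - F (t, x)) \<le> C * norm (y - x)"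
    using constants by metis
  have "norm (G t \<theta> - G t \<theta>') \<le> exp (2 * C + 1) * (norm (G 0 \<theta> - G 0 \<theta>') + 0)" if t: "t \<in> {0..1}" for t \<theta> \<theta>'
    by (rule gronwall[where y'="\<lambda>t. F (t, G t \<theta>) - F (t, G t \<theta>')" and y="\<lambda>t. G t \<theta> - G t \<theta>'"])
      (use C inK t in \<open>auto intro!: has_vector_derivative_diff sol\<close>)
  then have "norm (G t \<theta> - G t \<theta>') \<le> exp (2 * C + 1) * norm (G 0 \<theta> - G 0 \<theta>')" if "t \<in> {0..1}" for t \<theta> \<theta>'
    using that by (simp only: add_0_right)
  then show ?thesis by (rule that)
qed

text \<open>The difference of two curves satisfies a linear differential inequality, so if it
  vanishes at time \<open>t\<close> it vanishes at time zero.\<close>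

lemma G_injective:
  assumes "t \<in> {0..1}" "G t \<theta> = G t \<theta>'"
  shows "G 0 \<theta> = G 0 \<theta>'"
proof -
  obtain C where C: "0 \<le> C"
    "\<And>t x y. t \<in> {0..1} \<Longrightarrow> x \<in> K \<Longrightarrow> y \<in> K \<Longrightarrow> norm (F (t, y) - F (t, x)) \<le> C * norm (y - x)"
    using constants by metis
  have "G 0 \<theta> - G 0 \<theta>' = 0"
    by (rule gronwall_backward[where y'="\<lambda>t. F (t, G t \<theta>) - F (t, G t \<theta>')" and y="\<lambda>t. G t \<theta> - G t \<theta>'" and T=t and C=C])
      (use C inK assms in \<open>auto intro!: has_vector_derivative_diff sol\<close>)
  then show ?thesis by simp
qed

lemma variation_zero_backward:
  assumes W: "\<And>t. t \<in> {0..1} \<Longrightarrow> (W has_vector_derivative D t (G t \<theta>) (W t)) (at t within {0..1})"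
    and "t \<in> {0..1}" "W t = 0"
  shows "W 0 = 0"
proof -
  obtain C where C: "0 \<le> C" "\<And>t x h. t \<in> {0..1} \<Longrightarrow> x \<in> K \<Longrightarrow> norm (D t x h) \<le> C * norm h"
    using constants by metis
  show ?thesis
    by (rule gronwall_backward[where y'="\<lambda>t. D t (G t \<theta>) (W t)" and T=t and C=C])
      (use C inK assms in auto)
qed

lemma F_has_derivative_D:
  assumes "t \<in> {0..1}" "x \<in> K"
  shows "((\<lambda>x. F (t, x)) has_derivative D t x) (at x)"
proof -
  have "(t, x) \<in> U" using assms KU by auto
  from smooth_field_has_derivative(1)[OF smooth this]
  have "(F has_derivative frechet_derivative F (at (t, x))) (at (t, x))" .
  moreover have "((\<lambda>x. (t, x)) has_derivative (\<lambda>h. (0, h))) (at x)"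
    by (auto intro!: derivative_eq_intros)
  ultimately show ?thesis
    using has_derivative_compose[of "\<lambda>x. (t, x)" "\<lambda>h. (0, h)" x UNIV F] by (simp add: D_def[abs_def])
qed

lemma quotient_imp_derivative:
  fixes f :: "real \<Rightarrow> 'b::real_normed_vector"
  assumes "\<And>h. \<bar>h\<bar> \<le> 1 \<Longrightarrow> norm (f (s + h) - f s - h *\<^sub>R w) \<le> C * h\<^sup>2"
  shows "(f has_vector_derivative w) (at s)"
  unfolding has_vector_derivative_def has_derivative_at
proof (intro conjI)
  show "bounded_linear (\<lambda>x. x *\<^sub>R w)" by (rule bounded_linear_scaleR_left)
  show "(\<lambda>h. norm (f (s + h) - f s - h *\<^sub>R w) / norm h) \<midarrow>0\<rightarrow> 0"
  proof (rule Lim_null_comparison)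
    have "\<bar>norm (f (s + h) - f s - h *\<^sub>R w) / norm h\<bar> \<le> C * \<bar>h\<bar>" if "h \<noteq> 0" "\<bar>h\<bar> < 1" for h
    proof -
      have "norm (f (s + h) - f s - h *\<^sub>R w) \<le> C * \<bar>h\<bar> * \<bar>h\<bar>"
        using assms[of h] that by (simp add: power2_eq_square mult.assoc)
      then show ?thesis using that by (simp add: divide_le_eq)
    qed
    then show "\<forall>\<^sub>F h in at 0. norm (norm (f (s + h) - f s - h *\<^sub>R w) / norm h) \<le> C * \<bar>h\<bar>"
      unfolding eventually_at by (intro exI[of _ 1]) (auto simp: dist_norm)
    show "(\<lambda>h. C * \<bar>h\<bar>) \<midarrow>0\<rightarrow> 0" by (rule tendsto_eq_intros refl | simp)+
  qed
qed

text \<open>The two mixed derivatives agree by the variational equation: differentiating the field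
  along the line gives \<open>D\<close> applied to \<open>W\<close>, and this is the time derivative
  of \<open>W\<close>.\<close>

lemma C11_line:
  assumes Wc: "continuous_on ({0..1} \<times> UNIV) (\<lambda>(t, \<theta>). W t \<theta>)"
    and Wd: "\<And>t \<theta>. t \<in> {0..1} \<Longrightarrow> ((\<lambda>t. W t \<theta>) has_vector_derivative D t (G t \<theta>) (W t \<theta>)) (at t within {0..1})"
    and Wq: "\<And>t \<theta> h. t \<in> {0..1} \<Longrightarrow> \<bar>h\<bar> \<le> 1 \<Longrightarrow> norm (G t (\<theta> + h *\<^sub>R e) - G t \<theta> - h *\<^sub>R W t \<theta>) \<le> C1 * h\<^sup>2"
  shows "C11 (\<lambda>t s. G t (\<theta> + s *\<^sub>R e)) (\<lambda>t s. F (t, G t (\<theta> + s *\<^sub>R e))) (\<lambda>t s. W t (\<theta> + s *\<^sub>R e))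
    (\<lambda>t s. D t (G t (\<theta> + s *\<^sub>R e)) (W t (\<theta> + s *\<^sub>R e)))"
proof (rule C11I)
  fix t s :: real assume t: "t \<in> {0..1}"
  show "((\<lambda>t. G t (\<theta> + s *\<^sub>R e)) has_vector_derivative F (t, G t (\<theta> + s *\<^sub>R e))) (at t within {0..1})" by (rule sol[OF t])
  show 1: "((\<lambda>s. G t (\<theta> + s *\<^sub>R e)) has_vector_derivative W t (\<theta> + s *\<^sub>R e)) (at s)"
    by (rule quotient_imp_derivative[where C=C1]) (use Wq[OF t, of _ "\<theta> + s *\<^sub>R e"] in \<open>simp add: scaleR_add_left add.assoc\<close>)
  show "((\<lambda>s. F (t, G t (\<theta> + s *\<^sub>R e))) has_vector_derivative D t (G t (\<theta> + s *\<^sub>R e)) (W t (\<theta> + s *\<^sub>R e))) (at s)"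
    using vector_derivative_diff_chain_within[OF 1 has_derivative_at_withinI[OF F_has_derivative_D[OF t inK[OF t]]]]
    by (simp add: o_def)
  show "((\<lambda>t. W t (\<theta> + s *\<^sub>R e)) has_vector_derivative D t (G t (\<theta> + s *\<^sub>R e)) (W t (\<theta> + s *\<^sub>R e))) (at t within {0..1})" by (rule Wd[OF t])
next
  have c: "continuous_on ({0..1} \<times> UNIV) (\<lambda>x :: real \<times> real. (fst x, \<theta> + snd x *\<^sub>R e))" by (intro continuous_intros)
  have m: "(\<lambda>x :: real \<times> real. (fst x, \<theta> + snd x *\<^sub>R e)) ` ({0..1} \<times> UNIV) \<subseteq> {0..1} \<times> UNIV" by auto
  have Gc: "continuous_on ({0..1} \<times> UNIV) (\<lambda>x :: real \<times> real. G (fst x) (\<theta> + snd x *\<^sub>R e))"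
    using continuous_on_compose2[OF G_continuous c m] by simp
  have Wc': "continuous_on ({0..1} \<times> UNIV) (\<lambda>x :: real \<times> real. W (fst x) (\<theta> + snd x *\<^sub>R e))"
    using continuous_on_compose2[OF Wc c m] by simp
  show "strip_continuous (\<lambda>t s. G t (\<theta> + s *\<^sub>R e))" "strip_continuous (\<lambda>t s. W t (\<theta> + s *\<^sub>R e))"
    using Gc Wc' by (simp_all add: strip_continuous_def)
  show "strip_continuous (\<lambda>t s. F (t, G t (\<theta> + s *\<^sub>R e)))"
    unfolding strip_continuous_def
    by (rule continuous_on_compose2[OF continuous_on_F]) (use inK in \<open>auto intro!: continuous_intros Gc\<close>)
  have "continuous_on ({0..1} \<times> UNIV) (\<lambda>x. (\<lambda>(x, h). D (fst x) (snd x) h) ((fst x, G (fst x) (\<theta> + snd x *\<^sub>R e)), W (fst x) (\<theta> + snd x *\<^sub>R e)))"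
    by (rule continuous_on_compose2[OF continuous_on_D]) (use inK in \<open>auto intro!: continuous_intros Gc Wc'\<close>)
  then show "strip_continuous (\<lambda>t s. D t (G t (\<theta> + s *\<^sub>R e)) (W t (\<theta> + s *\<^sub>R e)))"
    unfolding strip_continuous_def by simp
qed

end

lemma smooth_field_Pair:
  assumes "smooth_field f U" "smooth_field g U"
  shows "smooth_field (\<lambda>x. (f x, g x)) U"
  using assms by (auto simp: smooth_field_def Basis_prod_def)

lemma smooth_field_real: "smooth_on f U \<Longrightarrow> smooth_field f U"
  by (simp add: smooth_field_def)

lemma smooth_field_complex: "smooth_on (\<lambda>x. Re (f x)) U \<Longrightarrow> smooth_on (\<lambda>x. Im (f x)) U \<Longrightarrow> smooth_field f U"
  by (simp add: smooth_field_def Basis_complex_def inner_complex_def)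

lemma smooth_field_real3: "(\<And>i. smooth_on (\<lambda>x. f x $ i) U) \<Longrightarrow> smooth_field f U" for f :: "'a::real_normed_vector \<Rightarrow> real^3"
  by (auto simp: smooth_field_def Basis_vec_def inner_axis)

lemma smooth_field_linear_compose:
  assumes "smooth_field f U" "bounded_linear L" "open V" "\<And>x. x \<in> V \<Longrightarrow> L x \<in> U"
  shows "smooth_field (\<lambda>x. f (L x)) V"
  using assms smooth_on_linear_compose[OF _ assms(2-4)] unfolding smooth_field_def by blast

lemma open_extended_domain:
  fixes U :: "(real \<times> 'a::euclidean_space) set"
  assumes "open U"
  shows "open {x :: real \<times> 'a \<times> 'a \<times> 'a. (fst x, fst (snd x)) \<in> U}"
  using open_vimage[OF assms, of "\<lambda>x :: real \<times> 'a \<times> 'a \<times> 'a. (fst x, fst (snd x))"]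
  by (simp add: vimage_def continuous_on_Pair continuous_on_fst continuous_on_snd continuous_on_id)

text \<open>The linearization is a finite sum of coordinates of \<open>L x\<close> times partial
  derivatives of \<open>F\<close>, so smoothness in point and vector together follows from
  products.\<close>

lemma smooth_field_linearized:
  fixes F :: "real \<times> 'a::euclidean_space \<Rightarrow> 'a" and L :: "real \<times> 'a \<times> 'a \<times> 'a \<Rightarrow> 'a"
  assumes F: "smooth_field F U" and U: "open U" and L: "bounded_linear L"
  shows "smooth_field (\<lambda>x. frechet_derivative F (at (fst x, fst (snd x))) (0, L x)) {x. (fst x, fst (snd x)) \<in> U}"
    (is "smooth_field ?f ?V")
proof -
  have V: "open ?V" by (rule open_extended_domain[OF U])
  have pr: "bounded_linear (\<lambda>x :: real \<times> 'a \<times> 'a \<times> 'a. (fst x, fst (snd x)))"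
    by (intro bounded_linear_Pair bounded_linear_fst bounded_linear_compose[OF bounded_linear_fst] bounded_linear_snd)
  have "smooth_on (\<lambda>x. ?f x \<bullet> b) ?V" if b: "b \<in> Basis" for b
  proof -
    have sm: "smooth_on (\<lambda>x. \<Sum>c\<in>Basis. ((0, L x) \<bullet> c) * (frechet_derivative F (at (fst x, fst (snd x))) c \<bullet> b)) ?V"
    proof (intro smooth_on_sum smooth_on_mult V)
      fix c :: "real \<times> 'a" assume "c \<in> Basis"
      have "bounded_linear (\<lambda>x. (0, L x) \<bullet> c)"
        by (intro bounded_linear_compose[OF bounded_linear_inner_left] bounded_linear_Pair L bounded_linear_zero)
      then show "smooth_on (\<lambda>x. (0, L x) \<bullet> c) ?V" by (rule smooth_on_linear[OF V])
      have "smooth_on (\<lambda>x. frechet_derivative F (at x) c \<bullet> b) U"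
        using smooth_field_derivative[OF F, of c] b by (simp add: smooth_field_def)
      from smooth_on_linear_compose[OF this pr V]
      show "smooth_on (\<lambda>x. frechet_derivative F (at (fst x, fst (snd x))) c \<bullet> b) ?V" by simp
    qed
    have eq: "?f x \<bullet> b = (\<Sum>c\<in>Basis. ((0, L x) \<bullet> c) * (frechet_derivative F (at (fst x, fst (snd x))) c \<bullet> b))" if "x \<in> ?V" for x
    proof -
      have "(fst x, fst (snd x)) \<in> U" using that by simp
      then show ?thesis
        using derivative_eq_sum_Basis[OF smooth_field_has_derivative(1)[OF F], of "(fst x, fst (snd x))" "(0, L x)"]
        by (simp add: inner_sum_left)
    qed
    show ?thesis by (rule smooth_on_cong[OF V, THEN iffD2, OF eq sm])
  qed
  then show ?thesis by (simp add: smooth_field_def)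
qed

text \<open>The curve together with two of its variations solves the equation of the extended field, so a
  second application of the theorem on variations yields second derivatives.\<close>

theorem (in flow_family) second_variation:
  assumes W1: "continuous_on ({0..1} \<times> UNIV) (\<lambda>(t, \<theta>). W1 t \<theta>)"
    "\<And>t \<theta>. t \<in> {0..1} \<Longrightarrow> ((\<lambda>t. W1 t \<theta>) has_vector_derivative D t (G t \<theta>) (W1 t \<theta>)) (at t within {0..1})"
    "\<And>t \<theta>. t \<in> {0..1} \<Longrightarrow> norm (W1 t \<theta>) \<le> C1"
    and W2: "continuous_on ({0..1} \<times> UNIV) (\<lambda>(t, \<theta>). W2 t \<theta>)"
    "\<And>t \<theta>. t \<in> {0..1} \<Longrightarrow> ((\<lambda>t. W2 t \<theta>) has_vector_derivative D t (G t \<theta>) (W2 t \<theta>)) (at t within {0..1})"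
    "\<And>t \<theta>. t \<in> {0..1} \<Longrightarrow> norm (W2 t \<theta>) \<le> C2"
  shows "flow_family (\<lambda>x. (F (fst x, fst (snd x)), frechet_derivative F (at (fst x, fst (snd x))) (0, fst (snd (snd x))),
      frechet_derivative F (at (fst x, fst (snd x))) (0, snd (snd (snd x))))) {x. (fst x, fst (snd x)) \<in> U}
    (K \<times> cball 0 C1 \<times> cball 0 C2) (\<lambda>t \<theta>. (G t \<theta>, W1 t \<theta>, W2 t \<theta>))"
proof
  show "open {x :: real \<times> 'a \<times> 'a \<times> 'a. (fst x, fst (snd x)) \<in> U}" by (rule open_extended_domain[OF openU])
  have pr: "bounded_linear (\<lambda>x :: real \<times> 'a \<times> 'a \<times> 'a. (fst x, fst (snd x)))"
    by (intro bounded_linear_Pair bounded_linear_fst bounded_linear_compose[OF bounded_linear_fst] bounded_linear_snd)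
  show "smooth_field (\<lambda>x. (F (fst x, fst (snd x)), frechet_derivative F (at (fst x, fst (snd x))) (0, fst (snd (snd x))),
      frechet_derivative F (at (fst x, fst (snd x))) (0, snd (snd (snd x))))) {x. (fst x, fst (snd x)) \<in> U}"
    by (intro smooth_field_Pair smooth_field_linearized[OF smooth openU] smooth_field_linear_compose[OF smooth pr open_extended_domain[OF openU]]
        bounded_linear_compose[OF bounded_linear_fst] bounded_linear_compose[OF bounded_linear_snd] bounded_linear_snd) auto
  show "compact (K \<times> cball (0::'a) C1 \<times> cball (0::'a) C2)" by (intro compact_Times compactK) auto
  show "{0..1} \<times> K \<times> cball (0::'a) C1 \<times> cball (0::'a) C2 \<subseteq> {x. (fst x, fst (snd x)) \<in> U}" using KU by auto
  show "(G t \<theta>, W1 t \<theta>, W2 t \<theta>) \<in> K \<times> cball 0 C1 \<times> cball 0 C2" if "t \<in> {0..1}" for t \<theta>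
    using inK W1(3) W2(3) that by auto
  show "((\<lambda>t. (G t \<theta>, W1 t \<theta>, W2 t \<theta>)) has_vector_derivative
      (F (fst (t, G t \<theta>, W1 t \<theta>, W2 t \<theta>), fst (snd (t, G t \<theta>, W1 t \<theta>, W2 t \<theta>))),
       frechet_derivative F (at (fst (t, G t \<theta>, W1 t \<theta>, W2 t \<theta>), fst (snd (t, G t \<theta>, W1 t \<theta>, W2 t \<theta>)))) (0, fst (snd (snd (t, G t \<theta>, W1 t \<theta>, W2 t \<theta>)))),
       frechet_derivative F (at (fst (t, G t \<theta>, W1 t \<theta>, W2 t \<theta>), fst (snd (t, G t \<theta>, W1 t \<theta>, W2 t \<theta>)))) (0, snd (snd (snd (t, G t \<theta>, W1 t \<theta>, W2 t \<theta>)))))) (at t within {0..1})"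
    if "t \<in> {0..1}" for t \<theta>
    using has_vector_derivative_Pair[OF sol[OF that] has_vector_derivative_Pair[OF W1(2)[OF that] W2(2)[OF that]]]
    by (simp add: D_def)
  have c: "continuous_on UNIV (\<lambda>\<theta>. W 0 \<theta>)" if "continuous_on ({0..1} \<times> UNIV) (\<lambda>(t, \<theta>). W t \<theta>)" for W :: "real \<Rightarrow> 'p \<Rightarrow> 'a"
  proof -
    have 1: "continuous_on UNIV (\<lambda>\<theta> :: 'p. (0::real, \<theta>))" by (intro continuous_intros)
    have 2: "range (\<lambda>\<theta> :: 'p. (0::real, \<theta>)) \<subseteq> {0..1} \<times> UNIV" by auto
    show ?thesis using continuous_on_compose2[OF that 1 2] by simp
  qed
  show "continuous_on UNIV (\<lambda>\<theta>. (G 0 \<theta>, W1 0 \<theta>, W2 0 \<theta>))"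
    by (intro continuous_on_Pair cont0 c W1(1) W2(1))
qed

subsection \<open>Symmetry of mixed partial derivatives\<close>

text \<open>The increment of \<open>f\<close> in the second variable is the integral of
  \<open>f2\<close>. Differentiating under the integral expresses \<open>f1\<close> as an integral
  of the continuous function \<open>f21\<close>, and differentiating in the upper limit returns
  \<open>f21\<close>.\<close>

lemma mixed_partials:
  fixes f f1 f2 f12 f21 :: "real \<Rightarrow> real \<Rightarrow> 'a::euclidean_space"
  assumes 1: "\<And>a b. ((\<lambda>a. f a b) has_vector_derivative f1 a b) (at a)"
    and 2: "\<And>a b. ((\<lambda>b. f a b) has_vector_derivative f2 a b) (at b)"
    and 12: "\<And>a b. ((\<lambda>b. f1 a b) has_vector_derivative f12 a b) (at b)"
    and 21: "\<And>a b. ((\<lambda>a. f2 a b) has_vector_derivative f21 a b) (at a)"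
    and c: "continuous_on UNIV (\<lambda>x. f21 (fst x) (snd x))"
  shows "f12 a b = f21 a b"
proof -
  \<comment> \<open>The integration interval runs from \<open>b - 1\<close> to \<open>b + 1\<close>,
    so that \<open>b\<close> is an interior point.\<close>
  define c0 where "c0 = b - 1"
  have int: "(f2 a has_integral f a y - f a c0) {c0..y}" if "c0 \<le> y" for a y
    by (rule fundamental_theorem_of_calculus[OF that]) (rule has_vector_derivative_at_within[OF 2])
  have cont21: "continuous_on S (\<lambda>x. f21 (g x) (h x))" if "continuous_on S g" "continuous_on S h" for S :: "'z::topological_space set" and g h
    using continuous_on_compose2[OF c continuous_on_Pair[OF that]] by simp
  have eq: "f1 a y = f1 a c0 + integral {c0..y} (f21 a)" if y: "c0 \<le> y" for y
  proof -
    have "((\<lambda>a. integral (cbox c0 y) (f2 a)) has_vector_derivative integral (cbox c0 y) (f21 a)) (at a within UNIV)"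
    proof (rule leibniz_rule_vector_derivative)
      show "((\<lambda>x. f2 x t) has_vector_derivative f21 x t) (at x within UNIV)" for x t by (rule 21)
      show "f2 x integrable_on cbox c0 y" for x using int[OF y] by auto
      show "continuous_on (UNIV \<times> cbox c0 y) (\<lambda>(x, t). f21 x t)"
        unfolding case_prod_beta' by (rule continuous_on_subset[OF c]) auto
    qed auto
    moreover have "(\<lambda>a. integral (cbox c0 y) (f2 a)) = (\<lambda>a. f a y - f a c0)"
      using int[OF y] by (auto intro!: integral_unique)
    ultimately have "((\<lambda>a. f a y - f a c0) has_vector_derivative integral {c0..y} (f21 a)) (at a)" by simp
    from vector_derivative_unique_at[OF has_vector_derivative_diff[OF 1 1] this]
    show ?thesis by (simp add: algebra_simps)
  qed
  have "((\<lambda>y. integral {c0..y} (f21 a)) has_vector_derivative f21 a b) (at b within {c0..b + 1})"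
    by (rule integral_has_vector_derivative) (auto simp: c0_def intro!: cont21 continuous_intros)
  then have "((\<lambda>y. f1 a c0 + integral {c0..y} (f21 a)) has_vector_derivative 0 + f21 a b) (at b within {c0..b + 1})"
    by (rule has_vector_derivative_add[OF has_vector_derivative_const])
  then have 3: "((\<lambda>y. f1 a c0 + integral {c0..y} (f21 a)) has_vector_derivative f21 a b) (at b within {c0..b + 1})"
    by (simp only: add_0_left)
  have b: "c0 < b + 1" "b \<in> {c0..b + 1}" by (simp_all add: c0_def)
  have "((\<lambda>y. f1 a y) has_vector_derivative f21 a b) (at b within {c0..b + 1})"
    by (rule has_vector_derivative_transform[OF b(2) _ 3]) (rule eq, simp)
  moreover have "((\<lambda>y. f1 a y) has_vector_derivative f12 a b) (at b within {c0..b + 1})"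
    by (rule has_vector_derivative_at_within[OF 12])
  ultimately show ?thesis
    using vector_derivative_unique_within_closed_interval[of c0 "b + 1" b "\<lambda>y. f1 a y"] b by simp
qed

subsection \<open>The torus as an initial condition\<close>

definition unit_circle :: "real \<Rightarrow> complex" where
  "unit_circle s = cis (2 * pi * s)"

lemma unit_circle_deriv: "(unit_circle has_vector_derivative (2 * pi) *\<^sub>R (\<i> * unit_circle s)) (at s within S)"
  unfolding unit_circle_def by (rule cis_has_vector_derivative)

lemma norm_unit_circle [simp]: "norm (unit_circle s) = 1"
  by (simp add: unit_circle_def)

text \<open>The derivative is Lipschitz with constant \<open>(2 * pi)^2\<close>. A quadratic bound
  of this kind is what \<open>variation\<close> asks of the initial condition.\<close>

lemma unit_circle_quotient:
  "norm (unit_circle (s + h) - unit_circle s - h *\<^sub>R ((2 * pi) *\<^sub>R (\<i> * unit_circle s))) \<le> (2 * pi)\<^sup>2 * h\<^sup>2"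
proof -
  let ?d = "\<lambda>s. (2 * pi) *\<^sub>R (\<i> * unit_circle s)"
  have lip: "norm (unit_circle r - unit_circle s) \<le> 2 * pi * norm (r - s)" for r
    by (rule vector_differentiable_bound[where S=UNIV, OF _ unit_circle_deriv]) (auto simp: norm_mult)
  have "norm (unit_circle (s + h) - unit_circle s - (s + h - s) *\<^sub>R ?d s) \<le> norm (s + h - s) * ((2 * pi)\<^sup>2 * \<bar>h\<bar>)"
  proof (rule vector_differentiable_bound_linearization[where S="closed_segment s (s + h)"])
    show "(unit_circle has_vector_derivative ?d r) (at r within closed_segment s (s + h))" for r
      by (rule unit_circle_deriv)
    show "norm (?d r - ?d s) \<le> (2 * pi)\<^sup>2 * \<bar>h\<bar>" if "r \<in> closed_segment s (s + h)" for r
    proof -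
      have rs: "norm (r - s) \<le> \<bar>h\<bar>" using that by (auto simp: closed_segment_eq_real_ivl split: if_splits)
      have "norm (?d r - ?d s) = 2 * pi * norm (unit_circle r - unit_circle s)"
        by (simp add: norm_mult flip: scaleR_diff_right right_diff_distrib)
      also have "\<dots> \<le> 2 * pi * (2 * pi * norm (r - s))" by (intro mult_left_mono lip) simp
      also have "\<dots> \<le> 2 * pi * (2 * pi * \<bar>h\<bar>)" by (intro mult_left_mono rs) simp_all
      finally show ?thesis by (simp only: power2_eq_square mult.assoc)
    qed
  qed auto
  then show ?thesis by (simp add: power2_eq_square mult_ac)
qed

lemma norm_vec_of_0 [simp]: "norm (vec_of w 0) = norm w"
  by (simp add: norm_vec_of)

lemma torus_pt_unit_circle:
  "torus_pt x \<theta> = (unit_circle (fst \<theta>), fst x, vec_of (fibre_radius x *\<^sub>R unit_circle (snd \<theta>)) (snd x))"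
  by (simp add: torus_pt_def torus_act_base_point fibre_radius_def unit_circle_def vec_of_def scaleR_conv_of_real mult.commute)

definition torus_d1 :: "real \<times> real \<Rightarrow> ambient" where
  "torus_d1 \<theta> = ((2 * pi) *\<^sub>R (\<i> * unit_circle (fst \<theta>)), 0, 0)"

definition torus_d2 :: "real \<times> real \<Rightarrow> real \<times> real \<Rightarrow> ambient" where
  "torus_d2 x \<theta> = (0, 0, vec_of (fibre_radius x *\<^sub>R ((2 * pi) *\<^sub>R (\<i> * unit_circle (snd \<theta>)))) 0)"

lemma torus_quotient1:
  "norm (torus_pt x (\<theta> + h *\<^sub>R (1, 0)) - torus_pt x \<theta> - h *\<^sub>R torus_d1 \<theta>) \<le> (2 * pi)\<^sup>2 * h\<^sup>2"
  using unit_circle_quotient[of "fst \<theta>" h] by (simp add: torus_pt_unit_circle torus_d1_def norm_Pair)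

lemma torus_quotient2:
  "norm (torus_pt x (\<theta> + h *\<^sub>R (0, 1)) - torus_pt x \<theta> - h *\<^sub>R torus_d2 x \<theta>) \<le> \<bar>fibre_radius x\<bar> * (2 * pi)\<^sup>2 * h\<^sup>2"
proof -
  let ?\<delta> = "unit_circle (snd \<theta> + h) - unit_circle (snd \<theta>) - h *\<^sub>R ((2 * pi) *\<^sub>R (\<i> * unit_circle (snd \<theta>)))"
  have "vec_of (fibre_radius x *\<^sub>R unit_circle (snd \<theta> + h)) (snd x) - vec_of (fibre_radius x *\<^sub>R unit_circle (snd \<theta>)) (snd x)
      - h *\<^sub>R vec_of (fibre_radius x *\<^sub>R ((2 * pi) *\<^sub>R (\<i> * unit_circle (snd \<theta>)))) 0 = vec_of (fibre_radius x *\<^sub>R ?\<delta>) 0"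
    by (simp add: vec_eq_iff forall_3 algebra_simps)
  then have "norm (torus_pt x (\<theta> + h *\<^sub>R (0, 1)) - torus_pt x \<theta> - h *\<^sub>R torus_d2 x \<theta>) = \<bar>fibre_radius x\<bar> * norm ?\<delta>"
    by (simp add: torus_pt_unit_circle torus_d2_def norm_Pair)
  also have "\<dots> \<le> \<bar>fibre_radius x\<bar> * ((2 * pi)\<^sup>2 * h\<^sup>2)" by (intro mult_left_mono unit_circle_quotient) simp
  finally show ?thesis by (simp only: mult.assoc)
qed

text \<open>Initial data for the second variation: the derivative of the first tangent field in its
  own direction. In the other direction that field is constant.\<close>

lemma torus_d1_quotient:
  "norm (torus_d1 (\<theta> + h *\<^sub>R (1, 0)) - torus_d1 \<theta> - h *\<^sub>R (- (2 * pi)\<^sup>2 *\<^sub>R unit_circle (fst \<theta>), 0, 0)) \<le> (2 * pi) * (2 * pi)\<^sup>2 * h\<^sup>2"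
proof -
  let ?\<delta> = "unit_circle (fst \<theta> + h) - unit_circle (fst \<theta>) - h *\<^sub>R ((2 * pi) *\<^sub>R (\<i> * unit_circle (fst \<theta>)))"
  have "torus_d1 (\<theta> + h *\<^sub>R (1, 0)) - torus_d1 \<theta> - h *\<^sub>R (- (2 * pi)\<^sup>2 *\<^sub>R unit_circle (fst \<theta>), 0, 0) = ((2 * pi) *\<^sub>R (\<i> * ?\<delta>), 0, 0)"
    by (simp add: torus_d1_def complex_eq_iff power2_eq_square algebra_simps)
  then have "norm (torus_d1 (\<theta> + h *\<^sub>R (1, 0)) - torus_d1 \<theta> - h *\<^sub>R (- (2 * pi)\<^sup>2 *\<^sub>R unit_circle (fst \<theta>), 0, 0)) = (2 * pi) * norm ?\<delta>"
    by (simp only:) (simp add: norm_Pair norm_mult)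
  also have "\<dots> \<le> (2 * pi) * ((2 * pi)\<^sup>2 * h\<^sup>2)" by (intro mult_left_mono unit_circle_quotient) simp
  finally show ?thesis by (simp only: mult.assoc)
qed

lemma torus_d2_quotient:
  "norm (torus_d2 x (\<theta> + h *\<^sub>R (0, 1)) - torus_d2 x \<theta> - h *\<^sub>R (0, 0, vec_of (fibre_radius x *\<^sub>R (- (2 * pi)\<^sup>2 *\<^sub>R unit_circle (snd \<theta>))) 0))
    \<le> \<bar>fibre_radius x\<bar> * ((2 * pi) * (2 * pi)\<^sup>2) * h\<^sup>2"
proof -
  let ?\<delta> = "unit_circle (snd \<theta> + h) - unit_circle (snd \<theta>) - h *\<^sub>R ((2 * pi) *\<^sub>R (\<i> * unit_circle (snd \<theta>)))"
  have "torus_d2 x (\<theta> + h *\<^sub>R (0, 1)) - torus_d2 x \<theta> - h *\<^sub>R (0, 0, vec_of (fibre_radius x *\<^sub>R (- (2 * pi)\<^sup>2 *\<^sub>R unit_circle (snd \<theta>))) 0)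
      = (0, 0, vec_of (fibre_radius x *\<^sub>R ((2 * pi) *\<^sub>R (\<i> * ?\<delta>))) 0)"
    by (simp add: torus_d2_def vec_eq_iff forall_3 power2_eq_square algebra_simps)
  then have "norm (torus_d2 x (\<theta> + h *\<^sub>R (0, 1)) - torus_d2 x \<theta> - h *\<^sub>R (0, 0, vec_of (fibre_radius x *\<^sub>R (- (2 * pi)\<^sup>2 *\<^sub>R unit_circle (snd \<theta>))) 0))
      = \<bar>fibre_radius x\<bar> * ((2 * pi) * norm ?\<delta>)"
    by (simp only:) (simp add: norm_Pair norm_mult abs_mult)
  also have "\<dots> \<le> \<bar>fibre_radius x\<bar> * ((2 * pi) * ((2 * pi)\<^sup>2 * h\<^sup>2))" by (intro mult_left_mono unit_circle_quotient) simp_all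
  finally show ?thesis by (simp only: mult.assoc)
qed

lemma norm_ambient: "norm ((a, 0, 0) :: ambient) = norm a" "norm ((0, 0, v) :: ambient) = norm v"
  by (simp_all add: norm_Pair)

lemma norm_Pair_le_add: "norm (a, b) \<le> norm a + norm b"
  using norm_Pair_le by blast

subsection \<open>The Hamiltonian vector field\<close>

text \<open>Nondegeneracy made explicit: pairing with the momentum direction, with
  \<open>\<i> * z\<close> and with vectors tangent to the sphere determines the three components
  from values of \<open>l\<close> at ambient vectors.\<close>

lemma ham_vector_unique:
  assumes hv: "is_ham_vector (z, p, u) l \<xi>" and l: "linear l" and z: "norm z = 1" and u: "norm u = 1"
  shows "\<xi> = ((2 * pi * l (0, 1, 0)) *\<^sub>R (\<i> * z), - 2 * pi * l (\<i> * z, 0, 0),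
     (2 * pi) *\<^sub>R cross3 (vector [l (0, 0, axis 1 1), l (0, 0, axis 2 1), l (0, 0, axis 3 1)]) u)"
proof -
  obtain a r v where \<xi>: "\<xi> = (a, r, v)" by (cases \<xi>)
  have t: "z \<bullet> a = 0" "u \<bullet> v = 0" using hv by (auto simp: is_ham_vector_def \<xi>)
  have eq: "dq z a * r' - dq z a' * r + omega_S2 u v v' = l (a', r', v')" if "z \<bullet> a' = 0" "u \<bullet> v' = 0" for a' r' v'
    using hv that by (auto simp: is_ham_vector_def \<xi>)
  have dq0: "dq z 0 = 0" by (simp add: dq_def)
  have s0: "omega_S2 u v 0 = 0" by (simp add: omega_S2_def)
  have "dq z a = l (0, 1, 0)" using eq[of 0 0 1] by (simp add: dq0 s0)
  then have a: "a = (2 * pi * l (0, 1, 0)) *\<^sub>R (\<i> * z)" using dq_tangent(2)[OF z t(1) t(1)] by simp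
  have "(\<i> * z) \<bullet> (\<i> * z) = 1"
  proof -
    have "norm (\<i> * z) = 1" using z by (simp add: norm_mult)
    then show ?thesis by (simp add: dot_square_norm)
  qed
  then have "dq z (\<i> * z) = 1 / (2 * pi)" by (simp add: dq_def)
  moreover have "z \<bullet> (\<i> * z) = 0" by (simp add: inner_complex_def)
  ultimately have "- (r / (2 * pi)) = l (\<i> * z, 0, 0)" using eq[of "\<i> * z" 0 0] by (simp add: s0)
  then have r: "r = - 2 * pi * l (\<i> * z, 0, 0)" by (simp add: field_simps)
  define h :: "real^3" where "h = vector [l (0, 0, axis 1 1), l (0, 0, axis 2 1), l (0, 0, axis 3 1)]"
  have lh: "l (0, 0, v') = h \<bullet> v'" for v' :: "real^3"
  proof -
    have "v' = v' $ 1 *\<^sub>R axis 1 1 + v' $ 2 *\<^sub>R axis 2 1 + v' $ 3 *\<^sub>R axis 3 1"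
      by (simp add: vec_eq_iff forall_3 axis_def)
    then have "(0, 0, v') = v' $ 1 *\<^sub>R (0, 0, axis 1 1) + v' $ 2 *\<^sub>R (0, 0, axis 2 1) + v' $ 3 *\<^sub>R ((0::complex), (0::real), axis 3 1)"
      by simp
    then have "l (0, 0, v') = v' $ 1 * l (0, 0, axis 1 1) + v' $ 2 * l (0, 0, axis 2 1) + v' $ 3 * l (0, 0, axis 3 1)"
      by (metis linear_add[OF l] linear_scale[OF l] real_scaleR_def)
    then show ?thesis by (simp add: h_def inner_vec_def sum_3 mult.commute)
  qed
  have key: "(cross3 u v - (2 * pi) *\<^sub>R h) \<bullet> v' = 0" if "u \<bullet> v' = 0" for v'
  proof -
    have "u \<bullet> cross3 v v' = 2 * pi * (h \<bullet> v')"
      using eq[of 0 v' 0] that by (simp add: dq0 lh omega_S2_def field_simps)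
    moreover have "cross3 u v \<bullet> v' = u \<bullet> cross3 v v'" using cross_triple[of u v v'] by (simp only: inner_commute[of u])
    ultimately show ?thesis by (simp add: inner_diff_left)
  qed
  \<comment> \<open>By \<open>key\<close> the vector is orthogonal to the tangent plane of the
    sphere, hence parallel to \<open>u\<close>, so its cross product with \<open>u\<close>
    vanishes.\<close>
  have "cross3 u (cross3 u v - (2 * pi) *\<^sub>R h) \<bullet> e = 0" for e
  proof -
    have "cross3 u (cross3 u v - (2 * pi) *\<^sub>R h) \<bullet> e = (cross3 u v - (2 * pi) *\<^sub>R h) \<bullet> cross3 e u"
      using cross_triple[of u "cross3 u v - (2 * pi) *\<^sub>R h" e] cross_triple[of "cross3 u v - (2 * pi) *\<^sub>R h" e u]
        cross_triple[of e u "cross3 u v - (2 * pi) *\<^sub>R h"] by (simp add: inner_commute)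
    also have "\<dots> = 0" by (rule key) (simp add: dot_cross_self)
    finally show ?thesis .
  qed
  then have "cross3 u (cross3 u v - (2 * pi) *\<^sub>R h) = 0" by (metis inner_eq_zero_iff)
  then have "cross3 u (cross3 u v) = (2 * pi) *\<^sub>R cross3 u h" by (simp add: Cross3.right_diff_distrib cross_mult_right)
  moreover have "cross3 u (cross3 u v) = - v"
    using u t(2) by (simp add: Lagrange dot_square_norm)
  moreover have "cross3 u h = - cross3 h u" by (rule cross_skew)
  ultimately have "v = (2 * pi) *\<^sub>R cross3 h u" by simp
  then show ?thesis unfolding \<xi> a r h_def by simp
qed

text \<open>The data of a Hamiltonian isotopy with one chosen integral curve
  \<open>\<gamma> y\<close> per point. As the circle and the sphere are compact, the support is
  controlled by a bound \<open>M\<close> on the momentum.\<close>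

locale ham_setup =
  fixes H :: "real \<Rightarrow> ambient \<Rightarrow> real" and \<phi> :: "ambient \<Rightarrow> ambient" and U :: "(real \<times> ambient) set"
    and x :: "real \<times> real" and \<gamma> :: "ambient \<Rightarrow> real \<Rightarrow> ambient" and M :: real
  assumes XU: "{0..1} \<times> TS1xS2 \<subseteq> U" and smooth: "smooth_on (\<lambda>(t, y). H t y) U"
    and M: "\<And>t y. t \<in> {0..1} \<Longrightarrow> y \<in> TS1xS2 \<Longrightarrow> \<bar>fst (snd y)\<bar> > M \<Longrightarrow> H t y = 0"
    and x: "\<bar>snd x\<bar> < 1"
    and \<gamma>01: "\<And>y. y \<in> TS1xS2 \<Longrightarrow> \<gamma> y 0 = y" "\<And>y. y \<in> TS1xS2 \<Longrightarrow> \<gamma> y 1 = \<phi> y"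
    and \<gamma>in: "\<And>y t. y \<in> TS1xS2 \<Longrightarrow> t \<in> {0..1} \<Longrightarrow> \<gamma> y t \<in> TS1xS2"
    and \<gamma>: "\<And>y t. y \<in> TS1xS2 \<Longrightarrow> t \<in> {0..1} \<Longrightarrow>
           \<exists>\<xi>. is_ham_vector (\<gamma> y t) (frechet_derivative (H t) (at (\<gamma> y t))) \<xi> \<and>
                ((\<lambda>t. \<gamma> y t) has_vector_derivative \<xi>) (at t within {0..1})"
begin

definition HH :: "real \<times> ambient \<Rightarrow> real" where
  "HH q = H (fst q) (snd q)"

lemma smooth_HH: "smooth_on HH U" and openU: "open U"
  using smooth by (simp_all add: HH_def[abs_def] case_prod_beta' smooth_on_def)

definition dH :: "real \<times> ambient \<Rightarrow> ambient \<Rightarrow> real" where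
  "dH q v = frechet_derivative HH (at q) (0, v)"

lemma HH_has_derivative:
  assumes "(t, y) \<in> U"
  shows "((\<lambda>y. H t y) has_derivative dH (t, y)) (at y)"
proof -
  have "(HH has_derivative frechet_derivative HH (at (t, y))) (at (t, y))"
    by (rule smooth_on_has_derivative[OF smooth_HH assms])
  moreover have "((\<lambda>y. (t, y)) has_derivative (\<lambda>h. (0, h))) (at y)"
    by (auto intro!: derivative_eq_intros)
  ultimately show ?thesis
    using has_derivative_compose[of "\<lambda>y. (t, y)" "\<lambda>h. (0, h)" y UNIV HH]
    by (simp add: dH_def[abs_def] HH_def)
qed

lemma frechet_H: "(t, y) \<in> U \<Longrightarrow> frechet_derivative (H t) (at y) = dH (t, y)"
  using frechet_derivative_at[OF HH_has_derivative] by simp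

lemma linear_dH: "(t, y) \<in> U \<Longrightarrow> linear (dH (t, y))"
  using has_derivative_bounded_linear[OF HH_has_derivative] bounded_linear.linear by blast

text \<open>The formula of \<open>ham_vector_unique\<close> read on the whole neighbourhood
  \<open>U\<close>, which turns the Hamiltonian vector into an ambient field. The vector
  \<open>\<i> * z\<close> is expanded in \<open>1\<close> and \<open>\<i>\<close> so that the
  derivative is evaluated at constant vectors only and smoothness is immediate.\<close>

definition hv :: "real \<times> ambient \<Rightarrow> ambient" where
  "hv q = ((2 * pi * dH q (0, 1, 0)) *\<^sub>R (\<i> * fst (snd q)),
     - 2 * pi * (Re (\<i> * fst (snd q)) * dH q (1, 0, 0) + Im (\<i> * fst (snd q)) * dH q (\<i>, 0, 0)),
     (2 * pi) *\<^sub>R cross3 (vector [dH q (0, 0, axis 1 1), dH q (0, 0, axis 2 1), dH q (0, 0, axis 3 1)]) (snd (snd (snd q))))"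

lemma smooth_hv: "smooth_field hv U"
proof -
  have D: "smooth_on (\<lambda>q. dH q v) U" for v
    unfolding dH_def by (rule smooth_on_frechet_derivative[OF smooth_HH])
  have bz: "bounded_linear (\<lambda>q :: real \<times> ambient. fst (snd q))"
    by (intro bounded_linear_compose[OF bounded_linear_fst] bounded_linear_snd)
  have bu: "bounded_linear (\<lambda>q :: real \<times> ambient. snd (snd (snd q)) $ i)" for i
    by (rule bounded_linear_compose[OF bounded_linear_u bounded_linear_snd])
  have Z: "smooth_on (\<lambda>q :: real \<times> ambient. Re (fst (snd q))) U" "smooth_on (\<lambda>q :: real \<times> ambient. Im (fst (snd q))) U"
    by (rule smooth_on_linear[OF openU bounded_linear_compose[OF bounded_linear_Re bz]]
        smooth_on_linear[OF openU bounded_linear_compose[OF bounded_linear_Im bz]])+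
  have u: "smooth_on (\<lambda>q :: real \<times> ambient. snd (snd (snd q)) $ i) U" for i
    by (rule smooth_on_linear[OF openU bu])
  note c = smooth_on_const[OF openU]
  have 1: "smooth_field (\<lambda>q. (2 * pi * dH q (0, 1, 0)) *\<^sub>R (\<i> * fst (snd q))) U"
    by (rule smooth_field_complex; simp; intro smooth_on_mult smooth_on_minus c D Z)
  have 2: "smooth_field (\<lambda>q. - 2 * pi * (Re (\<i> * fst (snd q)) * dH q (1, 0, 0) + Im (\<i> * fst (snd q)) * dH q (\<i>, 0, 0))) U"
    by (rule smooth_field_real; simp; intro smooth_on_mult smooth_on_add smooth_on_diff smooth_on_minus c D Z)
  have 3: "smooth_field (\<lambda>q. (2 * pi) *\<^sub>R cross3 (vector [dH q (0, 0, axis 1 1), dH q (0, 0, axis 2 1), dH q (0, 0, axis 3 1)]) (snd (snd (snd q)))) U"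
  proof (rule smooth_field_real3)
    fix i :: 3
    show "smooth_on (\<lambda>q. ((2 * pi) *\<^sub>R cross3 (vector [dH q (0, 0, axis 1 1), dH q (0, 0, axis 2 1), dH q (0, 0, axis 3 1)]) (snd (snd (snd q)))) $ i) U"
      using exhaust_3[of i] by (elim disjE; simp add: cross_components; intro smooth_on_mult smooth_on_diff c D u)
  qed
  show ?thesis unfolding hv_def[abs_def] by (intro smooth_field_Pair 1 2 3)
qed

lemma hv_eq:
  assumes "(t, z, p, u) \<in> U"
  shows "hv (t, z, p, u) = ((2 * pi * dH (t, z, p, u) (0, 1, 0)) *\<^sub>R (\<i> * z), - 2 * pi * dH (t, z, p, u) (\<i> * z, 0, 0),
     (2 * pi) *\<^sub>R cross3 (vector [dH (t, z, p, u) (0, 0, axis 1 1), dH (t, z, p, u) (0, 0, axis 2 1), dH (t, z, p, u) (0, 0, axis 3 1)]) u)"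
proof -
  have "(\<i> * z, 0, 0) = Re (\<i> * z) *\<^sub>R (1, 0, 0) + Im (\<i> * z) *\<^sub>R (\<i>, (0::real), (0::real^3))"
    by (simp add: complex_eq_iff)
  then have "dH (t, z, p, u) (\<i> * z, 0, 0) = Re (\<i> * z) * dH (t, z, p, u) (1, 0, 0) + Im (\<i> * z) * dH (t, z, p, u) (\<i>, 0, 0)"
    by (metis linear_add[OF linear_dH[OF assms]] linear_scale[OF linear_dH[OF assms]] real_scaleR_def)
  then show ?thesis by (simp add: hv_def)
qed

lemma in_U: "t \<in> {0..1} \<Longrightarrow> y \<in> TS1xS2 \<Longrightarrow> (t, y) \<in> U"
  using XU by auto

lemma ham_vector_hv:
  assumes t: "t \<in> {0..1}" and y: "y \<in> TS1xS2" and \<xi>: "is_ham_vector y (frechet_derivative (H t) (at y)) \<xi>"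
  shows "\<xi> = hv (t, y)"
proof -
  obtain z p u where e: "y = (z, p, u)" by (cases y)
  have U: "(t, z, p, u) \<in> U" using in_U[OF t y] by (simp add: e)
  show ?thesis
    unfolding e hv_eq[OF U]
    by (rule ham_vector_unique) (use \<xi> y linear_dH[OF U] frechet_H[OF U] in \<open>auto simp: e TS1xS2_def\<close>)
qed

lemma \<gamma>_sol:
  assumes "y \<in> TS1xS2" "t \<in> {0..1}"
  shows "((\<lambda>t. \<gamma> y t) has_vector_derivative hv (t, \<gamma> y t)) (at t within {0..1})"
    and "is_ham_vector (\<gamma> y t) (dH (t, \<gamma> y t)) (hv (t, \<gamma> y t))"
  using \<gamma>[OF assms] ham_vector_hv[OF assms(2) \<gamma>in[OF assms]] frechet_H[OF in_U[OF assms(2) \<gamma>in[OF assms]]] by auto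

text \<open>The momentum velocity is the derivative of the Hamiltonian along the circle through the
  point. That circle has constant momentum, so it stays in the region where the Hamiltonian
  vanishes.\<close>

lemma momentum_constant_far:
  assumes t: "t \<in> {0..1}" and y: "y \<in> TS1xS2" and far: "\<bar>fst (snd y)\<bar> > M"
  shows "fst (snd (hv (t, y))) = 0"
proof -
  obtain z p u where e: "y = (z, p, u)" by (cases y)
  have U: "(t, z, p, u) \<in> U" using in_U[OF t y] by (simp add: e)
  have n: "norm z = 1" "norm u = 1" using y by (auto simp: e TS1xS2_def)
  have c: "((\<lambda>s. (cis (1 * s) * z, p, u)) has_vector_derivative (1 *\<^sub>R (\<i> * cis (1 * 0)) * z, 0, 0)) (at 0)"
    by (intro has_vector_derivative_Pair has_vector_derivative_mult_left cis_has_vector_derivative has_vector_derivative_const)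
  have "((\<lambda>y. H t y) has_derivative dH (t, z, p, u)) (at (cis (1 * 0) * z, p, u))"
    using HH_has_derivative[OF U] by simp
  then have "((\<lambda>s. H t (cis (1 * s) * z, p, u)) has_vector_derivative dH (t, z, p, u) (\<i> * z, 0, 0)) (at 0)"
    using vector_derivative_diff_chain_within[OF c, of "H t" "dH (t, z, p, u)"]
    by (auto simp: o_def intro: has_derivative_at_withinI)
  moreover have "(\<lambda>s. H t (cis (1 * s) * z, p, u)) = (\<lambda>s. 0)"
    using M[OF t] far n by (auto simp: fun_eq_iff TS1xS2_def norm_mult e)
  ultimately have "((\<lambda>s. 0) has_vector_derivative dH (t, z, p, u) (\<i> * z, 0, 0)) (at (0::real))" by simp
  then have "dH (t, z, p, u) (\<i> * z, 0, 0) = 0"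
    using vector_derivative_unique_at[OF _ has_vector_derivative_const] by blast
  then show ?thesis unfolding e hv_eq[OF U] by simp
qed

definition G :: "real \<Rightarrow> real \<times> real \<Rightarrow> ambient" where
  "G t \<theta> = \<gamma> (torus_pt x \<theta>) t"

lemma torus_in: "torus_pt x \<theta> \<in> TS1xS2"
  using torus_pt_in[OF x] by (auto simp: toric_fibre_def)

lemma G_0: "G 0 \<theta> = torus_pt x \<theta>" and G_1: "G 1 \<theta> = \<phi> (torus_pt x \<theta>)"
  using \<gamma>01 torus_in by (auto simp: G_def)

lemma G_in: "t \<in> {0..1} \<Longrightarrow> G t \<theta> \<in> TS1xS2"
  using \<gamma>in torus_in by (simp add: G_def)

text \<open>The field is bounded on the compact part with momentum at most \<open>M\<close>, and
  beyond it the momentum does not change; so the momentum has bounded speed. This yields the compact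
  set required by \<open>flow_family\<close>.\<close>

lemma momentum_bounded: "\<exists>B. \<forall>t\<in>{0..1}. \<forall>\<theta>. \<bar>fst (snd (G t \<theta>))\<bar> \<le> B"
proof -
  let ?K = "{y \<in> TS1xS2. \<bar>fst (snd y)\<bar> \<le> M}"
  have "compact ({0..1::real} \<times> ?K)" by (intro compact_Times compact_momentum_bounded) simp
  moreover have "continuous_on ({0..1::real} \<times> ?K) hv"
    using smooth_field_continuous_on[OF smooth_hv] XU by (auto intro: continuous_on_subset)
  ultimately have "bounded (hv ` ({0..1::real} \<times> ?K))"
    using compact_continuous_image compact_imp_bounded by blast
  then obtain C where "\<forall>v \<in> hv ` ({0..1::real} \<times> ?K). norm v \<le> C" unfolding bounded_iff by blast
  then have C: "\<And>q. q \<in> {0..1::real} \<times> ?K \<Longrightarrow> norm (hv q) \<le> C" by blast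
  have le: "norm (fst (snd (hv (t, y)))) \<le> \<bar>C\<bar>" if "t \<in> {0..1}" "y \<in> TS1xS2" for t y
  proof (cases "\<bar>fst (snd y)\<bar> > M")
    case True
    then show ?thesis using momentum_constant_far that by simp
  next
    case False
    have "norm (fst (snd (hv (t, y)))) \<le> norm (hv (t, y))"
      using norm_fst_le[of "fst (snd (hv (t, y)))" "snd (snd (hv (t, y)))"] norm_snd_le[of "snd (hv (t, y))" "fst (hv (t, y))"] by simp
    also have "\<dots> \<le> C" by (rule C) (use False that in auto)
    finally show ?thesis by linarith
  qed
  have bl: "bounded_linear (\<lambda>y :: ambient. fst (snd y))" by (rule bounded_linear_p)
  have "\<bar>fst (snd (G t \<theta>))\<bar> \<le> \<bar>fst x\<bar> + \<bar>C\<bar>" if t: "t \<in> {0..1}" for t \<theta>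
  proof -
    have "norm (fst (snd (G t \<theta>)) - fst (snd (G 0 \<theta>))) \<le> \<bar>C\<bar> * norm (t - 0)"
    proof (rule vector_differentiable_bound[where S="{0..1}"])
      show "((\<lambda>t. fst (snd (G t \<theta>))) has_vector_derivative fst (snd (hv (s, G s \<theta>)))) (at s within {0..1})" if "s \<in> {0..1}" for s
        using bounded_linear.has_vector_derivative[OF bl \<gamma>_sol(1)[OF torus_in that]] by (simp add: G_def)
      show "norm (fst (snd (hv (s, G s \<theta>)))) \<le> \<bar>C\<bar>" if "s \<in> {0..1}" for s
        by (rule le[OF that G_in[OF that]])
    qed (use t in auto)
    also have "\<dots> \<le> \<bar>C\<bar>" using t mult_left_mono[of "norm (t - 0)" 1 "\<bar>C\<bar>"] by simp
    finally show ?thesis by (simp add: G_0 torus_pt_unit_circle)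
  qed
  then show ?thesis by blast
qed

definition B :: real where
  "B = (SOME B. \<forall>t\<in>{0..1}. \<forall>\<theta>. \<bar>fst (snd (G t \<theta>))\<bar> \<le> B)"

lemma B: "t \<in> {0..1} \<Longrightarrow> \<bar>fst (snd (G t \<theta>))\<bar> \<le> B"
  using someI_ex[OF momentum_bounded] unfolding B_def by blast

sublocale FF: flow_family hv U "{y \<in> TS1xS2. \<bar>fst (snd y)\<bar> \<le> B}" G
proof
  show "compact {y \<in> TS1xS2. \<bar>fst (snd y)\<bar> \<le> B}" by (rule compact_momentum_bounded)
  show "{0..1} \<times> {y \<in> TS1xS2. \<bar>fst (snd y)\<bar> \<le> B} \<subseteq> U" using XU by auto
  show "G t \<theta> \<in> {y \<in> TS1xS2. \<bar>fst (snd y)\<bar> \<le> B}" if "t \<in> {0..1}" for t \<theta> using B G_in that by simp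
  show "((\<lambda>t. G t \<theta>) has_vector_derivative hv (t, G t \<theta>)) (at t within {0..1})" if "t \<in> {0..1}" for t \<theta>
    using \<gamma>_sol(1)[OF torus_in that] by (simp add: G_def)
  show "continuous_on UNIV (G 0)"
    using torus_pt_continuous[OF x, of UNIV] by (simp add: G_0[abs_def] fun_eq_iff cong: continuous_on_cong)
qed (rule openU smooth_hv)+

definition extended_field :: "real \<times> ambient \<times> ambient \<times> ambient \<Rightarrow> ambient \<times> ambient \<times> ambient" where
  "extended_field q = (hv (fst q, fst (snd q)), frechet_derivative hv (at (fst q, fst (snd q))) (0, fst (snd (snd q))),
      frechet_derivative hv (at (fst q, fst (snd q))) (0, snd (snd (snd q))))"

text \<open>The functions \<open>W1\<close> and \<open>W2\<close> are the derivatives of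
  \<open>G\<close> in the two torus directions, and \<open>V1\<close> and \<open>V2\<close> those of
  the triple of \<open>G\<close>, \<open>W1\<close> and \<open>W2\<close>; the middle entry of
  \<open>V2\<close> and the last entry of \<open>V1\<close> are thus the mixed second derivatives of
  \<open>G\<close>.\<close>

theorem second_order_family:
  obtains W1 W2 V1 V2 M1 M2 where
    "\<And>\<theta>. W1 0 \<theta> = torus_d1 \<theta>" "\<And>\<theta>. W2 0 \<theta> = torus_d2 x \<theta>"
    "\<And>t \<theta>. t \<in> {0..1} \<Longrightarrow> ((\<lambda>t. W1 t \<theta>) has_vector_derivative FF.D t (G t \<theta>) (W1 t \<theta>)) (at t within {0..1})"
    "\<And>t \<theta>. t \<in> {0..1} \<Longrightarrow> ((\<lambda>t. W2 t \<theta>) has_vector_derivative FF.D t (G t \<theta>) (W2 t \<theta>)) (at t within {0..1})"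
    "\<And>\<theta>. C11 (\<lambda>t s. G t (\<theta> + s *\<^sub>R (1, 0))) (\<lambda>t s. hv (t, G t (\<theta> + s *\<^sub>R (1, 0))))
      (\<lambda>t s. W1 t (\<theta> + s *\<^sub>R (1, 0))) (\<lambda>t s. FF.D t (G t (\<theta> + s *\<^sub>R (1, 0))) (W1 t (\<theta> + s *\<^sub>R (1, 0))))"
    "\<And>\<theta>. C11 (\<lambda>t s. G t (\<theta> + s *\<^sub>R (0, 1))) (\<lambda>t s. hv (t, G t (\<theta> + s *\<^sub>R (0, 1))))
      (\<lambda>t s. W2 t (\<theta> + s *\<^sub>R (0, 1))) (\<lambda>t s. FF.D t (G t (\<theta> + s *\<^sub>R (0, 1))) (W2 t (\<theta> + s *\<^sub>R (0, 1))))"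
    "\<And>\<theta>. C11 (\<lambda>t s. (G t (\<theta> + s *\<^sub>R (1, 0)), W1 t (\<theta> + s *\<^sub>R (1, 0)), W2 t (\<theta> + s *\<^sub>R (1, 0))))
      (\<lambda>t s. extended_field (t, G t (\<theta> + s *\<^sub>R (1, 0)), W1 t (\<theta> + s *\<^sub>R (1, 0)), W2 t (\<theta> + s *\<^sub>R (1, 0))))
      (\<lambda>t s. V1 t (\<theta> + s *\<^sub>R (1, 0))) (\<lambda>t s. M1 t (\<theta> + s *\<^sub>R (1, 0)))"
    "\<And>\<theta>. C11 (\<lambda>t s. (G t (\<theta> + s *\<^sub>R (0, 1)), W1 t (\<theta> + s *\<^sub>R (0, 1)), W2 t (\<theta> + s *\<^sub>R (0, 1))))
      (\<lambda>t s. extended_field (t, G t (\<theta> + s *\<^sub>R (0, 1)), W1 t (\<theta> + s *\<^sub>R (0, 1)), W2 t (\<theta> + s *\<^sub>R (0, 1))))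
      (\<lambda>t s. V2 t (\<theta> + s *\<^sub>R (0, 1))) (\<lambda>t s. M2 t (\<theta> + s *\<^sub>R (0, 1)))"
    "continuous_on ({0..1} \<times> UNIV) (\<lambda>(t, \<theta>). (G t \<theta>, W1 t \<theta>, W2 t \<theta>))"
    "continuous_on ({0..1} \<times> UNIV) (\<lambda>(t, \<theta>). V1 t \<theta>)" "continuous_on ({0..1} \<times> UNIV) (\<lambda>(t, \<theta>). V2 t \<theta>)"
proof -
  let ?r = "\<bar>fibre_radius x\<bar>" and ?e1 = "(1, 0) :: real \<times> real" and ?e2 = "(0, 1) :: real \<times> real"
  \<comment> \<open>\<open>variation\<close> takes a single constant for the size of the initial
    variation and for the quadratic remainder. This one dominates both in both directions; the
    factor \<open>1 + ?r\<close> covers the direction scaled by the fibre radius.\<close>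
  let ?C = "(2 * pi + 2 * pi * (2 * pi) + (2 * pi)\<^sup>2 + (2 * pi) * (2 * pi)\<^sup>2) * (1 + ?r)"
  have nd1: "norm (torus_d1 \<theta>) = 2 * pi" "norm (torus_d2 x \<theta>) = ?r * (2 * pi)" for \<theta>
    unfolding torus_d1_def torus_d2_def norm_ambient norm_vec_of_0 by (simp_all add: norm_mult abs_mult)
  have r0: "0 \<le> ?r" by simp
  have mono: "a * h\<^sup>2 \<le> b * h\<^sup>2" if "a \<le> b" for a b h :: real
    using that by (intro mult_right_mono) auto
  have le1: "(2 * pi)\<^sup>2 \<le> ?C" "2 * pi \<le> ?C" "?r * (2 * pi)\<^sup>2 \<le> ?C" "?r * (2 * pi) \<le> ?C"
  proof -
    define A where "A = 2 * pi + 2 * pi * (2 * pi) + (2 * pi)\<^sup>2 + (2 * pi) * (2 * pi)\<^sup>2"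
    have A: "(2 * pi)\<^sup>2 \<le> A" "2 * pi \<le> A" "0 \<le> A" by (simp_all add: A_def)
    have "A \<le> A * (1 + ?r)" "?r * A \<le> A * (1 + ?r)" using A(3) by (simp_all add: algebra_simps)
    moreover have "?r * (2 * pi)\<^sup>2 \<le> ?r * A" "?r * (2 * pi) \<le> ?r * A" using A r0 by (intro mult_left_mono; simp)+
    ultimately show "(2 * pi)\<^sup>2 \<le> ?C" "2 * pi \<le> ?C" "?r * (2 * pi)\<^sup>2 \<le> ?C" "?r * (2 * pi) \<le> ?C"
      using A unfolding A_def[symmetric] by linarith+
  qed
  obtain W1 C1 where W1: "\<And>\<theta>. W1 0 \<theta> = torus_d1 \<theta>" "continuous_on ({0..1} \<times> UNIV) (\<lambda>(t, \<theta>). W1 t \<theta>)"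
    "\<And>t \<theta>. t \<in> {0..1} \<Longrightarrow> ((\<lambda>t. W1 t \<theta>) has_vector_derivative FF.D t (G t \<theta>) (W1 t \<theta>)) (at t within {0..1})"
    "\<And>t \<theta>. t \<in> {0..1} \<Longrightarrow> norm (W1 t \<theta>) \<le> C1"
    "\<And>t \<theta> h. t \<in> {0..1} \<Longrightarrow> \<bar>h\<bar> \<le> 1 \<Longrightarrow> norm (G t (\<theta> + h *\<^sub>R ?e1) - G t \<theta> - h *\<^sub>R W1 t \<theta>) \<le> C1 * h\<^sup>2"
  proof (rule FF.variation[of torus_d1 ?C ?e1])
    show "norm (torus_d1 \<theta>) \<le> ?C" for \<theta> using nd1(1) le1(2) by simp
    show "norm (G 0 (\<theta> + h *\<^sub>R ?e1) - G 0 \<theta> - h *\<^sub>R torus_d1 \<theta>) \<le> ?C * h\<^sup>2" for \<theta> h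
      using order_trans[OF torus_quotient1 mono[OF le1(1)]] by (simp only: G_0)
  qed blast
  obtain W2 C2 where W2: "\<And>\<theta>. W2 0 \<theta> = torus_d2 x \<theta>" "continuous_on ({0..1} \<times> UNIV) (\<lambda>(t, \<theta>). W2 t \<theta>)"
    "\<And>t \<theta>. t \<in> {0..1} \<Longrightarrow> ((\<lambda>t. W2 t \<theta>) has_vector_derivative FF.D t (G t \<theta>) (W2 t \<theta>)) (at t within {0..1})"
    "\<And>t \<theta>. t \<in> {0..1} \<Longrightarrow> norm (W2 t \<theta>) \<le> C2"
    "\<And>t \<theta> h. t \<in> {0..1} \<Longrightarrow> \<bar>h\<bar> \<le> 1 \<Longrightarrow> norm (G t (\<theta> + h *\<^sub>R ?e2) - G t \<theta> - h *\<^sub>R W2 t \<theta>) \<le> C2 * h\<^sup>2"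
  proof (rule FF.variation[of "torus_d2 x" ?C ?e2])
    show "norm (torus_d2 x \<theta>) \<le> ?C" for \<theta> using nd1(2) le1(4) by simp
    show "norm (G 0 (\<theta> + h *\<^sub>R ?e2) - G 0 \<theta> - h *\<^sub>R torus_d2 x \<theta>) \<le> ?C * h\<^sup>2" for \<theta> h
      using order_trans[OF torus_quotient2 mono[OF le1(3)]] by (simp only: G_0)
  qed blast
  interpret S: flow_family extended_field "{q. (fst q, fst (snd q)) \<in> U}"
    "{y \<in> TS1xS2. \<bar>fst (snd y)\<bar> \<le> B} \<times> cball 0 C1 \<times> cball 0 C2" "\<lambda>t \<theta>. (G t \<theta>, W1 t \<theta>, W2 t \<theta>)"
    using FF.second_variation[OF W1(2-4) W2(2-4)] by (simp only: extended_field_def[abs_def])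
  let ?d11 = "\<lambda>\<theta> :: real \<times> real. (- (2 * pi)\<^sup>2 *\<^sub>R unit_circle (fst \<theta>), 0, 0) :: ambient"
  let ?d22 = "\<lambda>\<theta> :: real \<times> real. (0, 0, vec_of (fibre_radius x *\<^sub>R (- (2 * pi)\<^sup>2 *\<^sub>R unit_circle (snd \<theta>))) 0) :: ambient"
  have nd2: "norm (?d11 \<theta>) = (2 * pi)\<^sup>2" "norm (?d22 \<theta>) = ?r * (2 * pi)\<^sup>2" for \<theta>
    unfolding norm_ambient norm_vec_of_0 by (simp_all add: abs_mult)
  have t3: "norm (a, b, c) \<le> norm a + norm b + norm c" for a b c :: ambient
    using norm_Pair_le_add[of a "(b, c)"] norm_Pair_le_add[of b c] by linarith
  have tup: "(a, b, c) - (a', b', c') - h *\<^sub>R (a'', b'', c'') = (a - a' - h *\<^sub>R a'', b - b' - h *\<^sub>R b'', c - c' - h *\<^sub>R c'')"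
    for a b c a' b' c' a'' b'' c'' :: ambient and h by simp
  \<comment> \<open>Summands: the first derivative of the circle, then its second derivative, which
    also bounds the first remainder, then the remainder of the derivative.\<close>
  let ?D1 = "2 * pi + (2 * pi)\<^sup>2 + (2 * pi) * (2 * pi)\<^sup>2"
  have D1: "0 \<le> ?D1" by simp
  obtain V1 E1 where V1: "continuous_on ({0..1} \<times> UNIV) (\<lambda>(t, \<theta>). V1 t \<theta>)"
    "\<And>t \<theta>. t \<in> {0..1} \<Longrightarrow> ((\<lambda>t. V1 t \<theta>) has_vector_derivative S.D t (G t \<theta>, W1 t \<theta>, W2 t \<theta>) (V1 t \<theta>)) (at t within {0..1})"
    "\<And>t \<theta> h. t \<in> {0..1} \<Longrightarrow> \<bar>h\<bar> \<le> 1 \<Longrightarrow> norm ((G t (\<theta> + h *\<^sub>R ?e1), W1 t (\<theta> + h *\<^sub>R ?e1), W2 t (\<theta> + h *\<^sub>R ?e1)) - (G t \<theta>, W1 t \<theta>, W2 t \<theta>) - h *\<^sub>R V1 t \<theta>) \<le> E1 * h\<^sup>2"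
  proof (rule S.variation[of "\<lambda>\<theta>. (torus_d1 \<theta>, ?d11 \<theta>, 0)" ?D1 ?e1])
    show "norm (torus_d1 \<theta>, ?d11 \<theta>, 0 :: ambient) \<le> ?D1" for \<theta>
    proof -
      have "norm (torus_d1 \<theta>, ?d11 \<theta>, 0 :: ambient) \<le> 2 * pi + (2 * pi)\<^sup>2 + 0"
        using t3[of "torus_d1 \<theta>" "?d11 \<theta>" 0] unfolding nd1 nd2 norm_zero .
      moreover have "0 \<le> (2 * pi) * (2 * pi)\<^sup>2" by simp
      ultimately show ?thesis by linarith
    qed
    show "norm ((G 0 (\<theta> + h *\<^sub>R ?e1), W1 0 (\<theta> + h *\<^sub>R ?e1), W2 0 (\<theta> + h *\<^sub>R ?e1)) - (G 0 \<theta>, W1 0 \<theta>, W2 0 \<theta>)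
        - h *\<^sub>R (torus_d1 \<theta>, ?d11 \<theta>, 0)) \<le> ?D1 * h\<^sup>2" for \<theta> h
    proof -
      have z: "torus_d2 x (\<theta> + h *\<^sub>R ?e1) - torus_d2 x \<theta> - h *\<^sub>R 0 = 0" by (simp add: torus_d2_def)
      have "norm ((G 0 (\<theta> + h *\<^sub>R ?e1), W1 0 (\<theta> + h *\<^sub>R ?e1), W2 0 (\<theta> + h *\<^sub>R ?e1)) - (G 0 \<theta>, W1 0 \<theta>, W2 0 \<theta>)
        - h *\<^sub>R (torus_d1 \<theta>, ?d11 \<theta>, 0)) \<le>
          norm (torus_pt x (\<theta> + h *\<^sub>R ?e1) - torus_pt x \<theta> - h *\<^sub>R torus_d1 \<theta>) + norm (torus_d1 (\<theta> + h *\<^sub>R ?e1) - torus_d1 \<theta> - h *\<^sub>R ?d11 \<theta>) + norm (0 :: ambient)"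
        unfolding G_0 W1(1) W2(1) tup z by (rule t3)
      also have "\<dots> \<le> (2 * pi)\<^sup>2 * h\<^sup>2 + (2 * pi) * (2 * pi)\<^sup>2 * h\<^sup>2 + 0"
        by (intro add_mono torus_quotient1 torus_d1_quotient) simp
      also have "\<dots> \<le> ?D1 * h\<^sup>2" by (simp add: algebra_simps)
      finally show ?thesis .
    qed
  qed blast
  obtain V2 E2 where V2: "continuous_on ({0..1} \<times> UNIV) (\<lambda>(t, \<theta>). V2 t \<theta>)"
    "\<And>t \<theta>. t \<in> {0..1} \<Longrightarrow> ((\<lambda>t. V2 t \<theta>) has_vector_derivative S.D t (G t \<theta>, W1 t \<theta>, W2 t \<theta>) (V2 t \<theta>)) (at t within {0..1})"
    "\<And>t \<theta> h. t \<in> {0..1} \<Longrightarrow> \<bar>h\<bar> \<le> 1 \<Longrightarrow> norm ((G t (\<theta> + h *\<^sub>R ?e2), W1 t (\<theta> + h *\<^sub>R ?e2), W2 t (\<theta> + h *\<^sub>R ?e2)) - (G t \<theta>, W1 t \<theta>, W2 t \<theta>) - h *\<^sub>R V2 t \<theta>) \<le> E2 * h\<^sup>2"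
  proof (rule S.variation[of "\<lambda>\<theta>. (torus_d2 x \<theta>, 0, ?d22 \<theta>)" "?r * ?D1" ?e2])
    show "norm (torus_d2 x \<theta>, 0 :: ambient, ?d22 \<theta>) \<le> ?r * ?D1" for \<theta>
    proof -
      have "norm (torus_d2 x \<theta>, 0 :: ambient, ?d22 \<theta>) \<le> ?r * (2 * pi) + 0 + ?r * (2 * pi)\<^sup>2"
        using t3[of "torus_d2 x \<theta>" 0 "?d22 \<theta>"] nd1(2)[of \<theta>] nd2(2)[of \<theta>] by simp
      also have "\<dots> = ?r * (2 * pi + (2 * pi)\<^sup>2)" by (simp add: algebra_simps)
      also have "\<dots> \<le> ?r * ?D1" by (intro mult_left_mono r0) simp
      finally show ?thesis .
    qed
    show "norm ((G 0 (\<theta> + h *\<^sub>R ?e2), W1 0 (\<theta> + h *\<^sub>R ?e2), W2 0 (\<theta> + h *\<^sub>R ?e2)) - (G 0 \<theta>, W1 0 \<theta>, W2 0 \<theta>)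
        - h *\<^sub>R (torus_d2 x \<theta>, 0, ?d22 \<theta>)) \<le> ?r * ?D1 * h\<^sup>2" for \<theta> h
    proof -
      have z: "torus_d1 (\<theta> + h *\<^sub>R ?e2) - torus_d1 \<theta> - h *\<^sub>R 0 = 0" by (simp add: torus_d1_def)
      have "norm ((G 0 (\<theta> + h *\<^sub>R ?e2), W1 0 (\<theta> + h *\<^sub>R ?e2), W2 0 (\<theta> + h *\<^sub>R ?e2)) - (G 0 \<theta>, W1 0 \<theta>, W2 0 \<theta>)
        - h *\<^sub>R (torus_d2 x \<theta>, 0, ?d22 \<theta>)) \<le>
          norm (torus_pt x (\<theta> + h *\<^sub>R ?e2) - torus_pt x \<theta> - h *\<^sub>R torus_d2 x \<theta>) + norm (0 :: ambient) + norm (torus_d2 x (\<theta> + h *\<^sub>R ?e2) - torus_d2 x \<theta> - h *\<^sub>R ?d22 \<theta>)"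
        unfolding G_0 W1(1) W2(1) tup z by (rule t3)
      also have "\<dots> \<le> ?r * (2 * pi)\<^sup>2 * h\<^sup>2 + 0 + ?r * ((2 * pi) * (2 * pi)\<^sup>2) * h\<^sup>2"
        by (intro add_mono torus_quotient2 torus_d2_quotient) simp
      also have "\<dots> = ?r * ((2 * pi)\<^sup>2 + (2 * pi) * (2 * pi)\<^sup>2) * h\<^sup>2" by (simp only: distrib_left distrib_right add_0_right)
      also have "\<dots> \<le> ?r * ?D1 * h\<^sup>2" by (intro mult_right_mono mult_left_mono r0) simp_all
      finally show ?thesis .
    qed
  qed blast
  have Yc: "continuous_on ({0..1} \<times> UNIV) (\<lambda>(t, \<theta>). (G t \<theta>, W1 t \<theta>, W2 t \<theta>))" by (rule S.G_continuous)
  show ?thesis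
    by (rule that[OF W1(1) W2(1) W1(3) W2(3) FF.C11_line[OF W1(2,3,5)] FF.C11_line[OF W2(2,3,5)] S.C11_line[OF V1] S.C11_line[OF V2] Yc V1(1) V2(1)])
qed

end

subsection \<open>The symplectic form along the family\<close>

lemma omega_eq: "omega y v w = dq (fst y) (fst v) * fst (snd w) - dq (fst y) (fst w) * fst (snd v) +
    (snd (snd y) \<bullet> cross3 (snd (snd v)) (snd (snd w))) / (2 * pi)"
  by (cases y; cases v; cases w) (simp add: omega_S2_def)

lemma omega_skew: "omega y w v = - omega y v w"
proof -
  have "cross3 (snd (snd w)) (snd (snd v)) = - cross3 (snd (snd v)) (snd (snd w))" by (rule cross_skew)
  then show ?thesis by (simp add: omega_eq)
qed

text \<open>All three vectors lie in the plane orthogonal to \<open>u\<close>.\<close>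

lemma tangent_triple_product:
  fixes u a b c :: "real^3"
  assumes u: "u \<bullet> u = 1" and o: "u \<bullet> a = 0" "u \<bullet> b = 0" "u \<bullet> c = 0"
  shows "a \<bullet> cross3 b c = 0"
proof -
  have "cross3 u (cross3 b c) = 0" using o by (simp add: Lagrange)
  then have "cross3 u (cross3 u (cross3 b c)) = 0" by simp
  then have "cross3 b c = (u \<bullet> cross3 b c) *\<^sub>R u" using u Lagrange[of u u "cross3 b c"] by simp
  then have "a \<bullet> cross3 b c = (u \<bullet> cross3 b c) * (a \<bullet> u)" by (metis inner_scaleR_right)
  then show ?thesis using o by (simp add: inner_commute)
qed

text \<open>Moving the base point contributes nothing: the extra terms pair tangent vectors of the
  circle by \<open>dq\<close>, or form a triple product of three tangent vectors of the sphere.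
  Along tangent vectors \<open>omega\<close> can thus be differentiated as if its coefficients were
  constant.\<close>

lemma omega_has_vector_derivative:
  assumes Y: "(Y has_vector_derivative Y') (at r within S)" and V: "(V has_vector_derivative V') (at r within S)"
    and W: "(W has_vector_derivative W') (at r within S)"
    and X: "Y r \<in> TS1xS2" and T: "Y' \<in> tangent_space (Y r)" "V r \<in> tangent_space (Y r)" "W r \<in> tangent_space (Y r)"
  shows "((\<lambda>r. omega (Y r) (V r) (W r)) has_vector_derivative omega (Y r) V' (W r) + omega (Y r) (V r) W') (at r within S)"
proof -
  note di = bounded_bilinear.has_vector_derivative
  note dd = bounded_linear.has_vector_derivative[OF bounded_linear_divide]
  note f = bounded_linear.has_vector_derivative[OF bounded_linear_fst]
  note s = bounded_linear.has_vector_derivative[OF bounded_linear_snd]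
  obtain z p u where y: "Y r = (z, p, u)" by (cases "Y r")
  have n: "norm z = 1" "norm u = 1" using X by (auto simp: y TS1xS2_def)
  have uu: "u \<bullet> u = 1" using n by (simp add: dot_square_norm)
  have t: "z \<bullet> fst Y' = 0" "z \<bullet> fst (V r) = 0" "z \<bullet> fst (W r) = 0"
    "u \<bullet> snd (snd Y') = 0" "u \<bullet> snd (snd (V r)) = 0" "u \<bullet> snd (snd (W r)) = 0"
    using T by (cases Y'; cases "V r"; cases "W r"; simp add: y)+
  have z0: "dq (fst Y') (fst (V r)) = 0" "dq (fst Y') (fst (W r)) = 0"
    using dq_tangent(1)[OF n(1) t(1,2)] dq_tangent(1)[OF n(1) t(1,3)] by auto
  have u0: "snd (snd Y') \<bullet> cross3 (snd (snd (V r))) (snd (snd (W r))) = 0"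
    by (rule tangent_triple_product[OF uu t(4,5,6)])
  have "((\<lambda>r. omega (Y r) (V r) (W r)) has_vector_derivative
     (dq (fst (Y r)) (fst (V r)) * fst (snd W') + (dq (fst (Y r)) (fst V') + dq (fst Y') (fst (V r))) * fst (snd (W r))) -
     (dq (fst (Y r)) (fst (W r)) * fst (snd V') + (dq (fst (Y r)) (fst W') + dq (fst Y') (fst (W r))) * fst (snd (V r))) +
     (snd (snd (Y r)) \<bullet> (cross3 (snd (snd (V r))) (snd (snd W')) + cross3 (snd (snd V')) (snd (snd (W r)))) +
      snd (snd Y') \<bullet> cross3 (snd (snd (V r))) (snd (snd (W r)))) / (2 * pi)) (at r within S)"
    unfolding omega_eq
    by (intro has_vector_derivative_add has_vector_derivative_diff dd di[OF bounded_bilinear_mult] di[OF dq_bilinear]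
        di[OF bounded_bilinear_inner] di[OF bounded_bilinear_cross3] f[OF Y] f[OF V] f[OF W] f[OF s[OF V]] f[OF s[OF W]]
        s[OF s[OF Y]] s[OF s[OF V]] s[OF s[OF W]])
  then show ?thesis
    unfolding z0 u0 by (rule has_vector_derivative_eq_rhs) (simp add: omega_eq inner_add_right add_divide_distrib algebra_simps)
qed

lemma curve_tangent:
  assumes c: "(c has_vector_derivative c') (at (s::real))" and X: "\<And>s. c s \<in> TS1xS2"
  shows "c' \<in> tangent_space (c s)"
proof -
  note f = bounded_linear.has_vector_derivative[OF bounded_linear_fst]
  note sn = bounded_linear.has_vector_derivative[OF bounded_linear_snd]
  have n: "fst (c s) \<bullet> fst (c s) = 1" "snd (snd (c s)) \<bullet> snd (snd (c s)) = 1" for s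
    using X[of s] by (cases "c s"; simp add: TS1xS2_def dot_square_norm)+
  have "((\<lambda>s. fst (c s) \<bullet> fst (c s)) has_vector_derivative fst (c s) \<bullet> fst c' + fst c' \<bullet> fst (c s)) (at s)"
    by (rule bounded_bilinear.has_vector_derivative[OF bounded_bilinear_inner f[OF c] f[OF c]])
  then have 1: "fst (c s) \<bullet> fst c' = 0"
    using vector_derivative_unique_at[OF _ has_vector_derivative_const[of 1]] unfolding n by (simp add: inner_commute) fastforce
  have "((\<lambda>s. snd (snd (c s)) \<bullet> snd (snd (c s))) has_vector_derivative snd (snd (c s)) \<bullet> snd (snd c') + snd (snd c') \<bullet> snd (snd (c s))) (at s)"
    by (rule bounded_bilinear.has_vector_derivative[OF bounded_bilinear_inner sn[OF sn[OF c]] sn[OF sn[OF c]]])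
  then have 2: "snd (snd (c s)) \<bullet> snd (snd c') = 0"
    using vector_derivative_unique_at[OF _ has_vector_derivative_const[of 1]] unfolding n by (simp add: inner_commute) fastforce
  show ?thesis using 1 2 by (cases "c s"; cases c') simp
qed

text \<open>The complex determinant of two tangent vectors, as a vector tangent to the sphere: the line
  bundle \<open>\<Lambda>\<^sup>2\<close> of the tangent bundle is identified with the tangent bundle of the sphere, on which
  the complex structure is the cross product with \<open>u\<close>. The determinant does not vanish on
  Lagrangian planes.\<close>

definition complex_det :: "ambient \<Rightarrow> ambient \<Rightarrow> ambient \<Rightarrow> real^3" where
  "complex_det y v w = dq (fst y) (fst v) *\<^sub>R snd (snd w) + fst (snd v) *\<^sub>R cross3 (snd (snd y)) (snd (snd w))
     - dq (fst y) (fst w) *\<^sub>R snd (snd v) - fst (snd w) *\<^sub>R cross3 (snd (snd y)) (snd (snd v))"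

text \<open>Pairing a vanishing determinant with \<open>u1\<close> and with
  \<open>cross3 u u1\<close> gives \<open>E1\<close> and \<open>E2\<close>. Together with the
  Lagrangian condition they force the area \<open>\<tau>\<close> of the sphere parts to vanish, and
  then the two vectors are proportional, against independence.\<close>

lemma complex_det_nonzero:
  assumes y: "y \<in> TS1xS2" and v: "v \<in> tangent_space y" and w: "w \<in> tangent_space y"
    and lag: "omega y v w = 0" and ind: "\<And>a b. a *\<^sub>R v + b *\<^sub>R w = 0 \<Longrightarrow> a = 0 \<and> b = 0"
  shows "complex_det y v w \<noteq> 0"
proof
  assume 0: "complex_det y v w = 0"
  obtain z p u where e: "y = (z, p, u)" by (cases y)
  obtain a1 p1 u1 where v_eq: "v = (a1, p1, u1)" by (cases v)
  obtain a2 p2 u2 where w_eq: "w = (a2, p2, u2)" by (cases w)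
  define q1 q2 where "q1 = dq z a1" and "q2 = dq z a2"
  have n: "norm z = 1" "u \<bullet> u = 1" using y by (auto simp: e TS1xS2_def dot_square_norm)
  have t: "z \<bullet> a1 = 0" "u \<bullet> u1 = 0" "z \<bullet> a2 = 0" "u \<bullet> u2 = 0" using v w by (auto simp: e v_eq w_eq)
  have a: "a1 = (2 * pi * q1) *\<^sub>R (\<i> * z)" "a2 = (2 * pi * q2) *\<^sub>R (\<i> * z)"
    using dq_tangent(2)[OF n(1) t(1) t(1)] dq_tangent(2)[OF n(1) t(3) t(3)] by (simp_all add: q1_def q2_def)
  define \<tau> where "\<tau> = u \<bullet> cross3 u1 u2"
  have lag': "q1 * p2 - q2 * p1 + \<tau> / (2 * pi) = 0"
    using lag by (simp add: e v_eq w_eq omega_eq q1_def q2_def \<tau>_def)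
  have det: "q1 *\<^sub>R u2 + p1 *\<^sub>R cross3 u u2 - q2 *\<^sub>R u1 - p2 *\<^sub>R cross3 u u1 = 0"
    using 0 by (simp add: complex_det_def e v_eq w_eq q1_def q2_def)
  define N where "N = u1 \<bullet> u1"
  define g where "g = u1 \<bullet> u2"
  have c1: "cross3 u u2 \<bullet> u1 = - \<tau>" "cross3 u u1 \<bullet> u2 = \<tau>"
    using cross_triple[of u u2 u1] cross_triple[of u u1 u2] cross_skew[of u2 u1] by (simp_all add: \<tau>_def inner_commute)
  have c2: "cross3 u u2 \<bullet> cross3 u u1 = g"
    using cross_triple[of u u2 "cross3 u u1"] t n by (simp add: Lagrange inner_diff_left inner_diff_right g_def inner_commute)
  have c3: "cross3 u u1 \<bullet> cross3 u u1 = N"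
    using cross_triple[of u u1 "cross3 u u1"] t n by (simp add: Lagrange inner_diff_left inner_diff_right N_def inner_commute)
  have E1: "q1 * g - p1 * \<tau> - q2 * N = 0"
  proof -
    have "(q1 *\<^sub>R u2 + p1 *\<^sub>R cross3 u u2 - q2 *\<^sub>R u1 - p2 *\<^sub>R cross3 u u1) \<bullet> u1 = q1 * g - p1 * \<tau> - q2 * N"
      by (simp add: inner_diff_left inner_add_left c1 dot_cross_self g_def N_def inner_commute[of u2 u1])
    then show ?thesis by (simp add: det)
  qed
  have E2: "q1 * \<tau> + p1 * g - p2 * N = 0"
  proof -
    have "(q1 *\<^sub>R u2 + p1 *\<^sub>R cross3 u u2 - q2 *\<^sub>R u1 - p2 *\<^sub>R cross3 u u1) \<bullet> cross3 u u1 = q1 * \<tau> + p1 * g - p2 * N"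
      using c1(2) by (simp add: inner_diff_left inner_add_left c2 c3 dot_cross_self inner_commute[of u2] inner_commute[of u1])
    then show ?thesis by (simp add: det)
  qed
  have N0: "N \<ge> 0" by (simp add: N_def)
  \<comment> \<open>Eliminating \<open>g\<close> from \<open>E1\<close> and \<open>E2\<close>
    relates \<open>\<tau>\<close> to \<open>q1 * p2 - q2 * p1\<close>, which the Lagrangian
    condition equates with \<open>- \<tau> / (2 * pi)\<close>. The second factor is a positive
    multiple of a squared length of \<open>v\<close> and hence not zero.\<close>
  have "\<tau> * (q1\<^sup>2 + p1\<^sup>2 + N / (2 * pi)) = 0"
  proof -
    have "\<tau> * (q1\<^sup>2 + p1\<^sup>2) = N * (q1 * p2 - q2 * p1)"
    proof -
      have "q1 * (q1 * \<tau> + p1 * g - p2 * N) - p1 * (q1 * g - p1 * \<tau> - q2 * N) = 0" using E1 E2 by simp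
      then show ?thesis by (simp add: power2_eq_square algebra_simps)
    qed
    moreover have lq: "q1 * p2 - q2 * p1 = - (\<tau> / (2 * pi))" using lag' by simp
    ultimately have "\<tau> * (q1\<^sup>2 + p1\<^sup>2) = N * (- (\<tau> / (2 * pi)))" by (simp only: lq)
    then show ?thesis by (simp add: distrib_left mult.commute)
  qed
  moreover have "v \<noteq> 0" using ind[of 1 0] by auto
  have pos: "q1\<^sup>2 + p1\<^sup>2 + N / (2 * pi) > 0"
  proof (rule ccontr)
    assume "\<not> ?thesis"
    moreover have "0 \<le> q1\<^sup>2" "0 \<le> p1\<^sup>2" "0 \<le> N / (2 * pi)" using N0 by simp_all
    ultimately have "q1\<^sup>2 = 0" "p1\<^sup>2 = 0" "N / (2 * pi) = 0" by linarith+
    then have "q1 = 0" "p1 = 0" "u1 = 0" by (simp_all add: N_def)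
    then show False using \<open>v \<noteq> 0\<close> a by (simp add: v_eq zero_prod_def)
  qed
  ultimately have \<tau>: "\<tau> = 0" by auto
  then have qp: "q1 * p2 = q2 * p1" using lag' by simp
  show False
  proof (cases "u1 = 0")
    case True
    then have d: "q1 *\<^sub>R u2 + p1 *\<^sub>R cross3 u u2 = 0" using det by simp
    have "(q1 *\<^sub>R u2 + p1 *\<^sub>R cross3 u u2) \<bullet> u2 = q1 * (u2 \<bullet> u2)"
      by (simp add: inner_add_left dot_cross_self)
    moreover have "(q1 *\<^sub>R u2 + p1 *\<^sub>R cross3 u u2) \<bullet> cross3 u u2 = p1 * (u2 \<bullet> u2)"
    proof -
      have "cross3 u u2 \<bullet> cross3 u u2 = u2 \<bullet> u2"
        using cross_triple[of u u2 "cross3 u u2"] t n by (simp add: Lagrange inner_diff_left inner_diff_right inner_commute)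
      then show ?thesis by (simp add: inner_add_left dot_cross_self)
    qed
    ultimately have "q1 * (u2 \<bullet> u2) = 0" "p1 * (u2 \<bullet> u2) = 0" using d by simp_all
    moreover have "q1 \<noteq> 0 \<or> p1 \<noteq> 0" using pos True by (auto simp: N_def)
    ultimately have "u2 = 0" by auto
    then have "q2 *\<^sub>R v + (- q1) *\<^sub>R w = 0" "p2 *\<^sub>R v + (- p1) *\<^sub>R w = 0"
      using True qp by (simp_all add: v_eq w_eq a zero_prod_def mult.commute mult.left_commute)
    then show False using ind[of q2 "- q1"] ind[of p2 "- p1"] \<open>q1 \<noteq> 0 \<or> p1 \<noteq> 0\<close> by auto
  next
    case False
    then have N: "N \<noteq> 0" by (simp add: N_def)
    have "N *\<^sub>R u2 = g *\<^sub>R u1"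
    proof -
      have x: "cross3 u1 u2 = 0"
      proof -
        have "cross3 u (cross3 u1 u2) = 0" using t by (simp add: Lagrange)
        then have "cross3 u (cross3 u (cross3 u1 u2)) = 0" by simp
        then have "(u \<bullet> cross3 u1 u2) *\<^sub>R u = cross3 u1 u2" using n Lagrange[of u u "cross3 u1 u2"] by simp
        then show ?thesis using \<tau> by (simp add: \<tau>_def)
      qed
      then have "cross3 u1 (cross3 u1 u2) = 0" by simp
      then show ?thesis by (simp add: Lagrange N_def g_def)
    qed
    moreover have "N * q2 = g * q1" "N * p2 = g * p1" using E1 E2 \<tau> by (simp_all add: mult.commute)
    ultimately have "g *\<^sub>R v + (- N) *\<^sub>R w = 0"
      by (simp add: v_eq w_eq a zero_prod_def mult.commute mult.left_commute)
    then show False using ind[of g "- N"] N by simp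
  qed
qed

subsection \<open>Lifts of loops\<close>

lemma integer_valued_constant:
  fixes f :: "'a::topological_space \<Rightarrow> real"
  assumes "connected S" "continuous_on S f" "\<And>s. s \<in> S \<Longrightarrow> f s \<in> \<int>" "s \<in> S" "t \<in> S"
  shows "f s = f t"
proof -
  have "f constant_on S"
  proof (rule continuous_discrete_range_constant[OF assms(1,2)])
    fix r assume r: "r \<in> S"
    show "\<exists>e>0. \<forall>y. y \<in> S \<and> f y \<noteq> f r \<longrightarrow> e \<le> norm (f y - f r)"
    proof (intro exI[of _ 1] conjI allI impI)
      fix y assume y: "y \<in> S \<and> f y \<noteq> f r"
      then have "f y - f r \<in> \<int>" using assms(3) r by (intro Ints_diff) auto
      then show "1 \<le> norm (f y - f r)" using y Ints_nonzero_abs_ge1[of "f y - f r"] by simp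
    qed simp
  qed
  then show ?thesis using assms(4,5) by (auto simp: constant_on_def)
qed

lemma unit_circle_eq_iff: "unit_circle a = unit_circle b \<longleftrightarrow> a - b \<in> \<int>"
proof -
  have "unit_circle a = unit_circle b \<longleftrightarrow> cos (2 * pi * a) = cos (2 * pi * b) \<and> sin (2 * pi * a) = sin (2 * pi * b)"
    by (auto simp: unit_circle_def complex_eq_iff)
  also have "\<dots> \<longleftrightarrow> (\<exists>n::int. 2 * pi * a = 2 * pi * b + 2 * pi * of_int n)"
    using sin_cos_eq_iff[of "2 * pi * a" "2 * pi * b"] by auto
  also have "\<dots> \<longleftrightarrow> (\<exists>n::int. a - b = of_int n)"
  proof -
    have "2 * pi * a = 2 * pi * b + 2 * pi * of_int n \<longleftrightarrow> a - b = of_int n" for n :: int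
    proof -
      have "2 * pi * a = 2 * pi * b + 2 * pi * of_int n \<longleftrightarrow> 2 * pi * a = 2 * pi * (b + of_int n)" by (simp only: distrib_left)
      also have "\<dots> \<longleftrightarrow> a = b + of_int n" by simp
      finally show ?thesis by auto
    qed
    then show ?thesis by simp
  qed
  also have "\<dots> \<longleftrightarrow> a - b \<in> \<int>" by (auto elim: Ints_cases)
  finally show ?thesis .
qed

lemma inner_norm_derivative:
  fixes f :: "real \<Rightarrow> 'a::real_inner"
  assumes "(f has_vector_derivative f') (at s)" "\<And>s. norm (f s) = 1"
  shows "f s \<bullet> f' = 0"
proof -
  have "((\<lambda>s. f s \<bullet> f s) has_vector_derivative f s \<bullet> f' + f' \<bullet> f s) (at s)"
    by (rule bounded_bilinear.has_vector_derivative[OF bounded_bilinear_inner assms(1) assms(1)])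
  moreover have "(\<lambda>s. f s \<bullet> f s) = (\<lambda>s. 1)" using assms(2) by (simp add: dot_square_norm)
  ultimately have "((\<lambda>s. 1) has_vector_derivative f s \<bullet> f' + f' \<bullet> f s) (at s)" by simp
  then have "f s \<bullet> f' + f' \<bullet> f s = 0"
    using vector_derivative_unique_at has_vector_derivative_const by blast
  then show ?thesis by (simp add: inner_commute)
qed

text \<open>The continuous lift \<open>\<alpha>\<close> and the integral of the angular speed both
  describe the argument of \<open>\<zeta>\<close>, so their difference is integer-valued after
  subtracting the initial value, and therefore constant.\<close>

lemma lift_has_integral:
  assumes d: "\<And>s. (\<zeta> has_vector_derivative \<zeta>' s) (at s)" and c: "continuous_on {0..1} \<zeta>'"
    and \<alpha>: "continuous_on {0..1} \<alpha>" "\<And>s. \<zeta> s = unit_circle (\<alpha> s)"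
  shows "((\<lambda>s. dq (\<zeta> s) (\<zeta>' s)) has_integral (\<alpha> 1 - \<alpha> 0)) {0..1}"
proof -
  define k where "k s = dq (\<zeta> s) (\<zeta>' s)" for s
  have n: "norm (\<zeta> s) = 1" for s by (simp add: \<alpha>(2))
  have \<zeta>c: "continuous_on S \<zeta>" for S
    using d has_vector_derivative_continuous continuous_at_imp_continuous_on by blast
  have kc: "continuous_on {0..1} k"
    unfolding k_def by (intro bounded_bilinear.continuous_on[OF dq_bilinear] \<zeta>c c)
  define I where "I s = integral {0..s} k" for s
  have Id: "(I has_vector_derivative k s) (at s within {0..1})" if "s \<in> {0..1}" for s
    unfolding I_def by (rule integral_has_vector_derivative[OF kc that])
  \<comment> \<open>Undoing the accumulated angle \<open>I\<close> leaves a curve with zero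
    derivative.\<close>
  define J where "J s = \<zeta> s * unit_circle (- I s)" for s
  have "(J has_vector_derivative 0) (at s within {0..1})" if s: "s \<in> {0..1}" for s
  proof -
    have "((\<lambda>s. - I s) has_vector_derivative - k s) (at s within {0..1})"
      using has_vector_derivative_minus[OF Id[OF s]] .
    from vector_diff_chain_within[OF this unit_circle_deriv]
    have "((\<lambda>s. unit_circle (- I s)) has_vector_derivative (- k s) *\<^sub>R ((2 * pi) *\<^sub>R (\<i> * unit_circle (- I s)))) (at s within {0..1})"
      by (simp add: o_def)
    from has_vector_derivative_mult[OF has_vector_derivative_at_within[OF d] this]
    have "(J has_vector_derivative \<zeta> s * ((- k s) *\<^sub>R ((2 * pi) *\<^sub>R (\<i> * unit_circle (- I s)))) + \<zeta>' s * unit_circle (- I s)) (at s within {0..1})"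
      by (simp add: J_def[abs_def])
    moreover have "\<zeta>' s = (2 * pi * k s) *\<^sub>R (\<i> * \<zeta> s)"
      unfolding k_def by (rule dq_tangent(2)[OF n]) (rule inner_norm_derivative[OF d n])+
    moreover have "\<zeta> s * ((- k s) *\<^sub>R ((2 * pi) *\<^sub>R (\<i> * unit_circle (- I s)))) + ((2 * pi * k s) *\<^sub>R (\<i> * \<zeta> s)) * unit_circle (- I s) = 0"
      by (simp add: scaleR_conv_of_real algebra_simps)
    ultimately show ?thesis by simp
  qed
  then obtain K where K: "\<And>s. s \<in> {0..1} \<Longrightarrow> J s = K"
    using has_vector_derivative_zero_constant[of "{0..1}" J] by auto
  have I0: "I 0 = 0" by (simp add: I_def)
  have key: "\<alpha> s - \<alpha> 0 - I s \<in> \<int>" if s: "s \<in> {0..1}" for s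
  proof -
    have "J s = J 0" using K[OF s] K[of 0] by simp
    then have "unit_circle (\<alpha> s - I s) = unit_circle (\<alpha> 0)"
      unfolding J_def \<alpha>(2) unit_circle_def I0 by (simp add: cis_mult right_diff_distrib)
    then show ?thesis by (simp add: unit_circle_eq_iff algebra_simps)
  qed
  have "continuous_on {0..1} I" using Id has_vector_derivative_continuous continuous_on_eq_continuous_within by blast
  then have "\<alpha> 1 - \<alpha> 0 - I 1 = \<alpha> 0 - \<alpha> 0 - I 0"
    by (intro integer_valued_constant[of "{0..1}" "\<lambda>s. \<alpha> s - \<alpha> 0 - I s"] key continuous_intros \<alpha>(1)) auto
  then have "integral {0..1} k = \<alpha> 1 - \<alpha> 0" by (simp add: I0) (simp add: I_def)
  moreover have "k integrable_on {0..1}" by (rule integrable_continuous_real[OF kc])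
  ultimately have "(k has_integral (\<alpha> 1 - \<alpha> 0)) {0..1}" using integrable_integral by metis
  then show ?thesis by (simp add: k_def[abs_def])
qed

text \<open>A horizontal vector tangent to the sphere at a point off the poles is tangent to the
  circle of latitude.\<close>

lemma horizontal_tangent:
  assumes u: "u = vec_of (r *\<^sub>R unit_circle b) h" "r > 0" and a: "u \<bullet> a = 0" "a $ 3 = 0"
  obtains \<kappa> where "a = \<kappa> *\<^sub>R vec_of (\<i> * unit_circle b) 0"
proof -
  let ?a = "Complex (a $ 1) (a $ 2)"
  have "r * (unit_circle b \<bullet> ?a) = 0" using a by (simp add: u inner_vec_def sum_3 inner_complex_def algebra_simps)
  then have "unit_circle b \<bullet> ?a = 0" using u by simp
  from dq_tangent(2)[OF norm_unit_circle this this]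
  have "?a = (2 * pi * dq (unit_circle b) ?a) *\<^sub>R (\<i> * unit_circle b)" .
  then have "a = (2 * pi * dq (unit_circle b) ?a) *\<^sub>R vec_of (\<i> * unit_circle b) 0"
    using a(2) by (intro real3_eqI) (simp_all add: complex_eq_iff)
  then show ?thesis by (rule that)
qed

text \<open>On a toric fibre \<open>w\<close> is the unit tangent of the circle of latitude up to a
  sign. The connection form then equals the height \<open>h\<close> times the angular speed, and the
  sign enters only squared, so the action is linear in the displacement of the lift.\<close>

lemma end_action:
  assumes z: "\<And>s. (z has_vector_derivative zs s) (at s)" "continuous_on {0..1} zs"
    and u: "\<And>s. (u has_vector_derivative us s) (at s)" "continuous_on {0..1} us"
    and w: "\<And>s. (w has_vector_derivative ws s) (at s)" "\<And>s. norm (w s) = 1"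
    and \<alpha>: "continuous_on UNIV \<alpha>" "\<And>s. z s = unit_circle (\<alpha> s)"
    and \<beta>: "continuous_on UNIV \<beta>" "\<And>s. u s = vec_of (r *\<^sub>R unit_circle (\<beta> s)) h" and r: "r > 0"
    and ws: "\<And>s. \<exists>\<sigma>. w s = \<sigma> *\<^sub>R vec_of (\<i> * unit_circle (\<beta> s)) 0"
  shows "integral {0..1} (\<lambda>s. p * dq (z s) (zs s) + ws s \<bullet> cross3 (u s) (w s) / (2 * pi)) = p * (\<alpha> 1 - \<alpha> 0) + h * (\<beta> 1 - \<beta> 0)"
    and "\<exists>\<sigma>. \<sigma> \<in> {1, - 1} \<and> (\<forall>s. w s = \<sigma> *\<^sub>R vec_of (\<i> * unit_circle (\<beta> s)) 0)"
    and "integral {0..1} (\<lambda>s. dq (z s) (zs s)) = \<alpha> 1 - \<alpha> 0"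
proof -
  let ?\<zeta> = "\<lambda>s. unit_circle (\<beta> s)"
  have dir: "vec_of (\<i> * ?\<zeta> s) 0 \<bullet> vec_of (\<i> * ?\<zeta> s) 0 = 1" for s
    by (simp add: dot_square_norm norm_mult)
  define \<sigma> where "\<sigma> s = w s \<bullet> vec_of (\<i> * ?\<zeta> s) 0" for s
  have w_eq: "w s = \<sigma> s *\<^sub>R vec_of (\<i> * ?\<zeta> s) 0" for s
    using ws[of s] dir[of s] by (auto simp: \<sigma>_def)
  have \<sigma>1: "\<bar>\<sigma> s\<bar> = 1" for s
  proof -
    have "norm (w s) = \<bar>\<sigma> s\<bar>" by (subst w_eq) (simp add: norm_mult)
    then show ?thesis using w(2) by simp
  qed
  have wc: "continuous_on UNIV w"
    by (intro continuous_at_imp_continuous_on ballI has_vector_derivative_continuous[OF w(1)])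
  have vecc: "continuous_on S (\<lambda>s. vec_of (f s) 0)" if "continuous_on S f" for S :: "real set" and f
    unfolding vec_of_def by (intro continuous_vector3[where x="(0, 0)"] continuous_intros that) simp_all
  have \<zeta>c: "continuous_on UNIV ?\<zeta>"
    unfolding unit_circle_def by (intro continuous_intros continuous_on_cis \<beta>(1))
  have \<sigma>c: "continuous_on UNIV \<sigma>"
    unfolding \<sigma>_def by (intro continuous_intros wc vecc \<zeta>c)
  \<comment> \<open>A continuous function with values in \<open>{1, - 1}\<close> is
    constant.\<close>
  have \<sigma>const: "\<sigma> s = \<sigma> 0" for s
    proof (rule integer_valued_constant[OF _ \<sigma>c])
    fix s have "\<sigma> s = 1 \<or> \<sigma> s = - 1" using \<sigma>1[of s] by linarith
    then show "\<sigma> s \<in> \<int>" by auto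
  qed auto
  show "\<exists>\<sigma>. \<sigma> \<in> {1, - 1} \<and> (\<forall>s. w s = \<sigma> *\<^sub>R vec_of (\<i> * ?\<zeta> s) 0)"
  proof (intro exI conjI allI)
    show "\<sigma> 0 \<in> {1, - 1}" using \<sigma>1[of 0] by (auto simp: abs_if split: if_splits)
    show "w s = \<sigma> 0 *\<^sub>R vec_of (\<i> * ?\<zeta> s) 0" for s using w_eq[of s] \<sigma>const[of s] by simp
  qed
  define \<zeta>' where "\<zeta>' s = (1 / r) *\<^sub>R Complex (us s $ 1) (us s $ 2)" for s
  have \<zeta>_eq: "?\<zeta> s = (1 / r) *\<^sub>R Complex (u s $ 1) (u s $ 2)" for s
    using r by (simp add: \<beta>(2) complex_eq_iff)
  have bl: "bounded_linear (\<lambda>u :: real^3. (1 / r) *\<^sub>R Complex (u $ 1) (u $ 2))"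
  proof -
    have "bounded_linear (\<lambda>u :: real^3. (1 / r) *\<^sub>R (of_real (u $ 1) + \<i> * of_real (u $ 2)))"
      by (intro bounded_linear_compose[OF bounded_linear_scaleR_right] bounded_linear_add bounded_linear_compose[OF bounded_linear_of_real]
          bounded_linear_compose[OF bounded_linear_mult_right] bounded_linear_vec_nth)
    then show ?thesis by (simp add: Complex_eq)
  qed
  have \<zeta>d: "(?\<zeta> has_vector_derivative \<zeta>' s) (at s)" for s
    unfolding \<zeta>_eq \<zeta>'_def by (rule bounded_linear.has_vector_derivative[OF bl u(1)])
  have \<zeta>'c: "continuous_on {0..1} \<zeta>'"
    unfolding \<zeta>'_def by (rule bounded_linear.continuous_on[OF bl u(2)])
  have i2: "((\<lambda>s. dq (?\<zeta> s) (\<zeta>' s)) has_integral (\<beta> 1 - \<beta> 0)) {0..1}"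
    by (rule lift_has_integral[OF \<zeta>d \<zeta>'c continuous_on_subset[OF \<beta>(1)]]) auto
  have i1: "((\<lambda>s. dq (z s) (zs s)) has_integral (\<alpha> 1 - \<alpha> 0)) {0..1}"
    by (rule lift_has_integral[OF z continuous_on_subset[OF \<alpha>(1)] \<alpha>(2)]) auto
  then show "integral {0..1} (\<lambda>s. dq (z s) (zs s)) = \<alpha> 1 - \<alpha> 0" by (rule integral_unique)
  have ws_eq: "ws s = \<sigma> 0 *\<^sub>R vec_of (\<i> * \<zeta>' s) 0" for s
  proof -
    have "((\<lambda>s. \<sigma> 0 *\<^sub>R vec_of (\<i> * ?\<zeta> s) 0) has_vector_derivative \<sigma> 0 *\<^sub>R vec_of (\<i> * \<zeta>' s) 0) (at s)"
      by (intro bounded_linear.has_vector_derivative[OF bounded_linear_scaleR_right] has_vector_derivative_vec_of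
          has_vector_derivative_mult_right \<zeta>d has_vector_derivative_const)
    moreover have "(\<lambda>s. \<sigma> 0 *\<^sub>R vec_of (\<i> * ?\<zeta> s) 0) = w"
    proof
      fix s show "\<sigma> 0 *\<^sub>R vec_of (\<i> * ?\<zeta> s) 0 = w s" using w_eq[of s] \<sigma>const[of s] by simp
    qed
    ultimately show ?thesis using vector_derivative_unique_at[OF w(1)] by metis
  qed
  have "ws s \<bullet> cross3 (u s) (w s) / (2 * pi) = h * dq (?\<zeta> s) (\<zeta>' s)" for s
  proof -
    have "ws s \<bullet> cross3 (u s) (w s) = (\<sigma> 0)\<^sup>2 * (vec_of (\<i> * \<zeta>' s) 0 \<bullet> cross3 (u s) (vec_of (\<i> * ?\<zeta> s) 0))"
      unfolding ws_eq w_eq[of s] \<sigma>const[of s] by (simp add: cross_mult_right power2_eq_square)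
    also have "(\<sigma> 0)\<^sup>2 = 1" using \<sigma>1[of 0] by (metis power2_abs power_one)
    also have "vec_of (\<i> * \<zeta>' s) 0 \<bullet> cross3 (u s) (vec_of (\<i> * ?\<zeta> s) 0) = h * ((\<i> * ?\<zeta> s) \<bullet> \<zeta>' s)"
      by (simp add: \<beta>(2) inner_vec_def sum_3 cross_components inner_complex_def algebra_simps)
    finally show ?thesis by (simp add: dq_def)
  qed
  moreover have "((\<lambda>s. p * dq (z s) (zs s) + h * dq (?\<zeta> s) (\<zeta>' s)) has_integral (p * (\<alpha> 1 - \<alpha> 0) + h * (\<beta> 1 - \<beta> 0))) {0..1}"
    by (intro has_integral_add has_integral_mult_right i1 i2)
  ultimately show "integral {0..1} (\<lambda>s. p * dq (z s) (zs s) + ws s \<bullet> cross3 (u s) (w s) / (2 * pi)) = p * (\<alpha> 1 - \<alpha> 0) + h * (\<beta> 1 - \<beta> 0)"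
    by (simp add: integral_unique)
qed

text \<open>The null vector \<open>c = w + i (u \<times> w)\<close> in coordinates in which the null cone reads \<open>h\<^sup>2 = f g\<close>.\<close>

definition frame_null :: "real^3 \<Rightarrow> real^3 \<Rightarrow> complex \<times> complex \<times> complex" where
  "frame_null u w = (let n = cross3 u w; c = \<lambda>j. Complex (w $ j) (n $ j)
     in ((c 1 - \<i> * c 2) / 2, - (c 1 + \<i> * c 2) / 2, - c 3 / 2))"

text \<open>Orthonormality of \<open>w\<close> and \<open>cross3 u w\<close> says that the complex
  vector \<open>c\<close> has vanishing sum of squares. If the first two entries were zero then
  \<open>c\<close> would be zero, against \<open>w\<close> having length one.\<close>

lemma frame_null_in:
  assumes "u \<bullet> u = 1" "w \<bullet> w = 1" "u \<bullet> w = 0"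
  shows "frame_null u w \<in> null_cone"
proof -
  define n where "n = cross3 u w"
  define c where "c j = Complex (w $ j) (n $ j)" for j
  note fi = frame_inner[OF assms n_def]
  have sq: "(c 1)\<^sup>2 + (c 2)\<^sup>2 + (c 3)\<^sup>2 = 0"
  proof -
    have "(w $ 1)\<^sup>2 + (w $ 2)\<^sup>2 + (w $ 3)\<^sup>2 = (n $ 1)\<^sup>2 + (n $ 2)\<^sup>2 + (n $ 3)\<^sup>2"
      using assms(2) fi(1) by (simp add: inner_vec_def sum_3 power2_eq_square)
    moreover have "2 * (w $ 1 * n $ 1) + 2 * (w $ 2 * n $ 2) + 2 * (w $ 3 * n $ 3) = 0"
      using fi(3) by (simp add: inner_vec_def sum_3)
    moreover have "w $ 1 * n $ 1 + w $ 2 * n $ 2 + w $ 3 * n $ 3 = 0"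
      using fi(3) by (simp add: inner_vec_def sum_3)
    ultimately show ?thesis by (simp add: c_def complex_eq_iff power2_eq_square algebra_simps)
  qed
  have "frame_null u w = ((c 1 - \<i> * c 2) / 2, - (c 1 + \<i> * c 2) / 2, - c 3 / 2)"
    by (simp add: frame_null_def Let_def c_def n_def)
  moreover have "(- c 3 / 2)\<^sup>2 = (c 1 - \<i> * c 2) / 2 * (- (c 1 + \<i> * c 2) / 2)"
  proof -
    have e: "(c 3)\<^sup>2 = - ((c 1)\<^sup>2 + (c 2)\<^sup>2)" using sq by (simp add: add_eq_0_iff)
    have p: "(c 1 - \<i> * c 2) * (- (c 1 + \<i> * c 2)) = - ((c 1)\<^sup>2 + (c 2)\<^sup>2)"
      by (simp add: power2_eq_square algebra_simps)
    have "(- c 3 / 2)\<^sup>2 = (c 3)\<^sup>2 / 4" by (simp add: power2_eq_square)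
    also have "\<dots> = ((c 1 - \<i> * c 2) * (- (c 1 + \<i> * c 2))) / 4" by (simp only: e p)
    also have "\<dots> = (c 1 - \<i> * c 2) / 2 * (- (c 1 + \<i> * c 2) / 2)" by (simp only: times_divide_times_eq) simp
    finally show ?thesis .
  qed
  moreover have "((c 1 - \<i> * c 2) / 2, - (c 1 + \<i> * c 2) / 2) \<noteq> (0, 0)"
  proof
    assume "((c 1 - \<i> * c 2) / 2, - (c 1 + \<i> * c 2) / 2) = (0, 0)"
    then have h: "(c 1 - \<i> * c 2) / 2 = 0 \<and> - (c 1 + \<i> * c 2) / 2 = 0" by (simp only: prod.inject)
    have d1: "c 1 - \<i> * c 2 = 0" using conjunct1[OF h] by (metis divide_eq_0_iff zero_neq_numeral)
    have d2: "c 1 + \<i> * c 2 = 0" using conjunct2[OF h] by (metis divide_eq_0_iff neg_equal_0_iff_equal zero_neq_numeral)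
    have "2 * c 1 = (c 1 - \<i> * c 2) + (c 1 + \<i> * c 2)" by simp
    also have "\<dots> = 0" by (simp only: d1 d2 add_0_right)
    finally have c1: "c 1 = 0" by (metis mult_eq_0_iff zero_neq_numeral)
    have c2: "c 2 = 0" using d2 by (simp only: c1) simp
    have c3: "c 3 = 0" using sq by (simp add: c1 c2)
    have "w $ 1 = 0" "w $ 2 = 0" "w $ 3 = 0" using c1 c2 c3 by (simp_all add: c_def complex_eq_iff)
    then show False using assms(2) by (simp add: inner_vec_def sum_3)
  qed
  moreover have "h\<^sup>2 = f * g \<Longrightarrow> (f, g) \<noteq> (0, 0) \<Longrightarrow> (f, g, h) \<in> null_cone" for f g h
    by (simp add: null_cone_def)
  ultimately show ?thesis by (simp only: not_False_eq_True)
qed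

text \<open>Along a circle of latitude the frame rotates about the vertical axis, and in the
  coordinates of the cone this rotation is diagonal with factors
  \<open>cis (- (2 * pi * b))\<close>, \<open>cis (2 * pi * b)\<close> and one, the form required by
  \<open>homotopy_parity\<close>.\<close>

lemma frame_null_end:
  fixes \<sigma> h r b :: real
  defines "E \<equiv> unit_circle b"
  shows "frame_null (vec_of (r *\<^sub>R E) h) (\<sigma> *\<^sub>R vec_of (\<i> * E) 0) =
    (cis (- (2 * pi * b)) * (- \<i> * \<sigma> * (1 + h) / 2), cis (2 * pi * b) * (- \<i> * \<sigma> * (1 - h) / 2), - \<i> * r * \<sigma> / 2)"
proof -
  have E: "E = cis (2 * pi * b)" by (simp add: E_def unit_circle_def)
  have "(cos (2 * pi * b))\<^sup>2 + (sin (2 * pi * b))\<^sup>2 = 1" by simp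
  then have n: "Re E * Re E + Im E * Im E = 1" by (simp only: E cis.sel power2_eq_square)
  have c3: "r * Re E * (\<sigma> * Re E) + r * Im E * (\<sigma> * Im E) = r * \<sigma>"
  proof -
    have "r * Re E * (\<sigma> * Re E) + r * Im E * (\<sigma> * Im E) = r * \<sigma> * (Re E * Re E + Im E * Im E)" by (simp add: algebra_simps)
    then show ?thesis by (simp add: n)
  qed
  have m: "cis (- (2 * pi * b)) = cnj E" "cis (2 * pi * b) = E" by (simp_all add: E cis_cnj)
  show ?thesis
    unfolding m frame_null_def Let_def
    using c3 by (simp add: cross_components complex_eq_iff field_simps)
qed

lemma frame_null_continuous:
  assumes "continuous_on S u" "continuous_on S w"
  shows "continuous_on S (\<lambda>s. frame_null (u s) (w s))"
proof -
  have n: "continuous_on S (\<lambda>s. cross3 (u s) (w s))"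
    by (rule bounded_bilinear.continuous_on[OF bounded_bilinear_cross3 assms])
  show ?thesis
    unfolding frame_null_def Let_def Complex_eq by (intro continuous_intros assms n) auto
qed

subsection \<open>Normalized families\<close>

lemma mem_int_lattice: "k \<in> int_lattice \<longleftrightarrow> fst k \<in> \<int> \<and> snd k \<in> \<int>"
proof -
  \<comment> \<open>The defining equation is exported with the hypothesis on the second coordinate
    of \<open>x\<close>; the point \<open>(0, 0)\<close> discharges it.\<close>
  have e: "int_lattice = \<int> \<times> \<int>" by (rule int_lattice_def[of "(0, 0)"]) simp
  show ?thesis unfolding e mem_Times_iff ..
qed

lemma add_zero_pair [simp]: "(\<theta> :: real \<times> real) + (0, 0) = \<theta>"
  by (simp add: prod_eq_iff)

text \<open>The reciprocal norm is the power \<open>- 1 / 2\<close> of the squared norm, which stays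
  in the positive reals. The leading factor \<open>1\<close> keeps both differentiations instances
  of the same rule \<open>d\<close>.\<close>

lemma C11_normalize:
  fixes v :: "real \<Rightarrow> real \<Rightarrow> 'a::real_inner"
  assumes v: "C11 v vt vs vm" and nz: "\<And>t s. t \<in> {0..1} \<Longrightarrow> v t s \<noteq> 0"
  shows "\<exists>wt ws wm. C11 (\<lambda>t s. v t s /\<^sub>R norm (v t s)) wt ws wm"
proof -
  note n = C11_bilinear[OF bounded_bilinear_inner v v]
  have d: "((\<lambda>r. c * r powr a) has_real_derivative (c * a) * r powr (a - 1)) (at r)" if "r > 0" for c a r :: real
    using DERIV_cmult[OF has_real_derivative_powr[OF that, of a], of c] by (simp add: mult.assoc)
  note g = C11_real_compose[OF n, where V="{0<..}" and g="\<lambda>r. 1 * r powr (- 1 / 2)" and g'="\<lambda>r. (1 * (- 1 / 2)) * r powr (- 1 / 2 - 1)"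
      and g''="\<lambda>r. ((1 * (- 1 / 2)) * (- 1 / 2 - 1)) * r powr (- 1 / 2 - 1 - 1)"]
  have "\<exists>wt ws wm. C11 (\<lambda>t s. 1 * (v t s \<bullet> v t s) powr (- 1 / 2)) wt ws wm"
    by (rule exI, rule exI, rule exI, rule g) (use nz d[of _ 1 "- 1 / 2"] d[of _ "1 * (- 1 / 2)" "- 1 / 2 - 1"] in \<open>auto intro!: continuous_intros\<close>)
  then obtain rt rs rm where r: "C11 (\<lambda>t s. 1 * (v t s \<bullet> v t s) powr (- 1 / 2)) rt rs rm" by blast
  have "1 * (y \<bullet> y) powr (- 1 / 2) = inverse (norm y)" for y :: 'a
    by (simp add: powr_minus powr_half_sqrt norm_eq_sqrt_inner flip: minus_divide_left)
  then show ?thesis using C11_bilinear[OF bounded_bilinear_scaleR r v] by auto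
qed

section \<open>Lagrangian property and frame along a Hamiltonian isotopy\<close>

locale ham_second = ham_setup +
  fixes W1 W2 V1 V2 M1 M2
  assumes W0: "\<And>\<theta>. W1 0 \<theta> = torus_d1 \<theta>" "\<And>\<theta>. W2 0 \<theta> = torus_d2 x \<theta>"
    and W1_sol: "\<And>t \<theta>. t \<in> {0..1} \<Longrightarrow> ((\<lambda>t. W1 t \<theta>) has_vector_derivative FF.D t (G t \<theta>) (W1 t \<theta>)) (at t within {0..1})"
    and W2_sol: "\<And>t \<theta>. t \<in> {0..1} \<Longrightarrow> ((\<lambda>t. W2 t \<theta>) has_vector_derivative FF.D t (G t \<theta>) (W2 t \<theta>)) (at t within {0..1})"
    and line1: "\<And>\<theta>. C11 (\<lambda>t s. G t (\<theta> + s *\<^sub>R (1, 0))) (\<lambda>t s. hv (t, G t (\<theta> + s *\<^sub>R (1, 0))))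
      (\<lambda>t s. W1 t (\<theta> + s *\<^sub>R (1, 0))) (\<lambda>t s. FF.D t (G t (\<theta> + s *\<^sub>R (1, 0))) (W1 t (\<theta> + s *\<^sub>R (1, 0))))"
    and line2: "\<And>\<theta>. C11 (\<lambda>t s. G t (\<theta> + s *\<^sub>R (0, 1))) (\<lambda>t s. hv (t, G t (\<theta> + s *\<^sub>R (0, 1))))
      (\<lambda>t s. W2 t (\<theta> + s *\<^sub>R (0, 1))) (\<lambda>t s. FF.D t (G t (\<theta> + s *\<^sub>R (0, 1))) (W2 t (\<theta> + s *\<^sub>R (0, 1))))"
    and triple1: "\<And>\<theta>. C11 (\<lambda>t s. (G t (\<theta> + s *\<^sub>R (1, 0)), W1 t (\<theta> + s *\<^sub>R (1, 0)), W2 t (\<theta> + s *\<^sub>R (1, 0))))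
      (\<lambda>t s. extended_field (t, G t (\<theta> + s *\<^sub>R (1, 0)), W1 t (\<theta> + s *\<^sub>R (1, 0)), W2 t (\<theta> + s *\<^sub>R (1, 0))))
      (\<lambda>t s. V1 t (\<theta> + s *\<^sub>R (1, 0))) (\<lambda>t s. M1 t (\<theta> + s *\<^sub>R (1, 0)))"
    and triple2: "\<And>\<theta>. C11 (\<lambda>t s. (G t (\<theta> + s *\<^sub>R (0, 1)), W1 t (\<theta> + s *\<^sub>R (0, 1)), W2 t (\<theta> + s *\<^sub>R (0, 1))))
      (\<lambda>t s. extended_field (t, G t (\<theta> + s *\<^sub>R (0, 1)), W1 t (\<theta> + s *\<^sub>R (0, 1)), W2 t (\<theta> + s *\<^sub>R (0, 1))))
      (\<lambda>t s. V2 t (\<theta> + s *\<^sub>R (0, 1))) (\<lambda>t s. M2 t (\<theta> + s *\<^sub>R (0, 1)))"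
    and GW_cont: "continuous_on ({0..1} \<times> UNIV) (\<lambda>(t, \<theta>). (G t \<theta>, W1 t \<theta>, W2 t \<theta>))"
    and V1_cont: "continuous_on ({0..1} \<times> UNIV) (\<lambda>(t, \<theta>). V1 t \<theta>)"
begin

lemma in_K: "t \<in> {0..1} \<Longrightarrow> G t \<theta> \<in> {y \<in> TS1xS2. \<bar>fst (snd y)\<bar> \<le> B}"
  by (rule FF.inK)

lemma G_line_deriv:
  assumes "t \<in> {0..1}"
  shows "((\<lambda>s. G t (\<theta> + s *\<^sub>R (1, 0))) has_vector_derivative W1 t (\<theta> + s *\<^sub>R (1, 0))) (at s)"
    and "((\<lambda>s. G t (\<theta> + s *\<^sub>R (0, 1))) has_vector_derivative W2 t (\<theta> + s *\<^sub>R (0, 1))) (at s)"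
  by (rule C11_deriv(2)[OF line1 assms], rule C11_deriv(2)[OF line2 assms])

lemma partial_derivs:
  assumes t: "t \<in> {0..1}"
  shows "((\<lambda>a. G t (a, b)) has_vector_derivative W1 t (a, b)) (at a)"
    "((\<lambda>b. G t (a, b)) has_vector_derivative W2 t (a, b)) (at b)"
    "((\<lambda>a. hv (t, G t (a, b))) has_vector_derivative FF.D t (G t (a, b)) (W1 t (a, b))) (at a)"
    "((\<lambda>b. hv (t, G t (a, b))) has_vector_derivative FF.D t (G t (a, b)) (W2 t (a, b))) (at b)"
    "((\<lambda>a. (G t (a, b), W1 t (a, b), W2 t (a, b))) has_vector_derivative V1 t (a, b)) (at a)"
    "((\<lambda>b. (G t (a, b), W1 t (a, b), W2 t (a, b))) has_vector_derivative V2 t (a, b)) (at b)"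
  using C11_deriv(2,3)[OF line1 t, of "(0, b)" a] C11_deriv(2,3)[OF line2 t, of "(a, 0)" b]
    C11_deriv(2)[OF triple1 t, of "(0, b)" a] C11_deriv(2)[OF triple2 t, of "(a, 0)" b] by simp_all

lemma tangent:
  assumes t: "t \<in> {0..1}"
  shows "W1 t \<theta> \<in> tangent_space (G t \<theta>)" "W2 t \<theta> \<in> tangent_space (G t \<theta>)"
  using curve_tangent[OF G_line_deriv(1)[OF t, of \<theta> 0]] curve_tangent[OF G_line_deriv(2)[OF t, of \<theta> 0]] G_in[OF t] by simp_all

lemma ham_vector_G:
  assumes t: "t \<in> {0..1}"
  shows "hv (t, G t \<theta>) \<in> tangent_space (G t \<theta>)"
    "w \<in> tangent_space (G t \<theta>) \<Longrightarrow> omega (G t \<theta>) (hv (t, G t \<theta>)) w = dH (t, G t \<theta>) w"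
  using \<gamma>_sol(2)[OF torus_in t, of \<theta>] by (simp_all add: is_ham_vector_def G_def)

text \<open>Both sides are mixed second derivatives of \<open>G t\<close> in the two torus
  directions.\<close>

lemma mixed_symmetric:
  assumes t: "t \<in> {0..1}"
  shows "fst (snd (V2 t (a, b))) = snd (snd (V1 t (a, b)))"
proof (rule mixed_partials[where f="\<lambda>a b. G t (a, b)"])
  note f = bounded_linear.has_vector_derivative[OF bounded_linear_fst]
  note sn = bounded_linear.has_vector_derivative[OF bounded_linear_snd]
  fix a b
  show "((\<lambda>a. G t (a, b)) has_vector_derivative W1 t (a, b)) (at a)" "((\<lambda>b. G t (a, b)) has_vector_derivative W2 t (a, b)) (at b)"
    by (rule partial_derivs[OF t])+
  show "((\<lambda>b. W1 t (a, b)) has_vector_derivative fst (snd (V2 t (a, b)))) (at b)"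
    using f[OF sn[OF partial_derivs(6)[OF t]]] by simp
  show "((\<lambda>a. W2 t (a, b)) has_vector_derivative snd (snd (V1 t (a, b)))) (at a)"
    using sn[OF sn[OF partial_derivs(5)[OF t]]] by simp
next
  have "continuous_on UNIV (\<lambda>q :: real \<times> real. (\<lambda>(t, \<theta>). V1 t \<theta>) (t, q))"
    by (rule continuous_on_compose2[OF V1_cont]) (use t in \<open>auto intro!: continuous_intros\<close>)
  then show "continuous_on UNIV (\<lambda>q. snd (snd (V1 t (fst q, snd q))))" by (auto intro!: continuous_intros)
qed

text \<open>Equality of the mixed partial derivatives of the Hamiltonian pulled back to the torus.
  Its first derivatives are \<open>omega\<close> of the Hamiltonian vector with \<open>W1\<close>
  and \<open>W2\<close>; after one more differentiation the terms with second derivatives of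
  \<open>G\<close> cancel by \<open>mixed_symmetric\<close>.\<close>

lemma hamiltonian_second_derivative:
  assumes t: "t \<in> {0..1}"
  shows "omega (G t \<theta>) (FF.D t (G t \<theta>) (W1 t \<theta>)) (W2 t \<theta>) = omega (G t \<theta>) (FF.D t (G t \<theta>) (W2 t \<theta>)) (W1 t \<theta>)"
proof -
  note f = bounded_linear.has_vector_derivative[OF bounded_linear_fst]
  note sn = bounded_linear.has_vector_derivative[OF bounded_linear_snd]
  let ?D = "\<lambda>a b. FF.D t (G t (a, b))"
  define f1 where "f1 a b = omega (G t (a, b)) (hv (t, G t (a, b))) (W1 t (a, b))" for a b
  define f2 where "f2 a b = omega (G t (a, b)) (hv (t, G t (a, b))) (W2 t (a, b))" for a b
  define f12 where "f12 a b = omega (G t (a, b)) (?D a b (W2 t (a, b))) (W1 t (a, b)) +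
    omega (G t (a, b)) (hv (t, G t (a, b))) (fst (snd (V2 t (a, b))))" for a b
  define f21 where "f21 a b = omega (G t (a, b)) (?D a b (W1 t (a, b))) (W2 t (a, b)) +
    omega (G t (a, b)) (hv (t, G t (a, b))) (snd (snd (V1 t (a, b))))" for a b
  have H: "((\<lambda>s. H t (c s)) has_vector_derivative dH (t, c s) c') (at s)"
    if c: "(c has_vector_derivative c') (at s)" and X: "c s \<in> TS1xS2" for c c' and s :: real
    using vector_derivative_diff_chain_within[OF c has_derivative_at_withinI[OF HH_has_derivative[OF in_U[OF t X]]]]
    by (simp add: o_def)
  have "f12 a b = f21 a b" for a b
  proof (rule mixed_partials[where f="\<lambda>a b. H t (G t (a, b))" and ?f12.0=f12 and ?f21.0=f21 and ?f1.0=f1 and ?f2.0=f2])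
    fix a b
    show "((\<lambda>a. H t (G t (a, b))) has_vector_derivative f1 a b) (at a)"
      using H[OF partial_derivs(1)[OF t, of b a] G_in[OF t]] ham_vector_G(2)[OF t tangent(1)[OF t]] by (simp add: f1_def)
    show "((\<lambda>b. H t (G t (a, b))) has_vector_derivative f2 a b) (at b)"
      using H[OF partial_derivs(2)[OF t, of a b] G_in[OF t]] ham_vector_G(2)[OF t tangent(2)[OF t]] by (simp add: f2_def)
    show "((\<lambda>b. f1 a b) has_vector_derivative f12 a b) (at b)"
      unfolding f1_def f12_def
    proof (rule omega_has_vector_derivative[where Y="\<lambda>b. G t (a, b)" and V="\<lambda>b. hv (t, G t (a, b))" and W="\<lambda>b. W1 t (a, b)"])
      show "((\<lambda>b. W1 t (a, b)) has_vector_derivative fst (snd (V2 t (a, b)))) (at b)"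
        using f[OF sn[OF partial_derivs(6)[OF t]]] by simp
    qed (rule partial_derivs[OF t] G_in[OF t] ham_vector_G(1)[OF t] tangent[OF t])+
    show "((\<lambda>a. f2 a b) has_vector_derivative f21 a b) (at a)"
      unfolding f2_def f21_def
    proof (rule omega_has_vector_derivative[where Y="\<lambda>a. G t (a, b)" and V="\<lambda>a. hv (t, G t (a, b))" and W="\<lambda>a. W2 t (a, b)"])
      show "((\<lambda>a. W2 t (a, b)) has_vector_derivative snd (snd (V1 t (a, b)))) (at a)"
        using sn[OF sn[OF partial_derivs(5)[OF t]]] by simp
    qed (rule partial_derivs[OF t] G_in[OF t] ham_vector_G(1)[OF t] tangent[OF t])+
  next
    have GW: "continuous_on UNIV (\<lambda>q :: real \<times> real. (\<lambda>(t, \<theta>). (G t \<theta>, W1 t \<theta>, W2 t \<theta>)) (t, q))"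
      by (rule continuous_on_compose2[OF GW_cont]) (use t in \<open>auto intro!: continuous_intros\<close>)
    have V: "continuous_on UNIV (\<lambda>q :: real \<times> real. (\<lambda>(t, \<theta>). V1 t \<theta>) (t, q))"
      by (rule continuous_on_compose2[OF V1_cont]) (use t in \<open>auto intro!: continuous_intros\<close>)
    have c: "continuous_on UNIV (G t)" "continuous_on UNIV (W1 t)" "continuous_on UNIV (W2 t)" "continuous_on UNIV (V1 t)"
      using continuous_on_fst[OF GW] continuous_on_fst[OF continuous_on_snd[OF GW]] continuous_on_snd[OF continuous_on_snd[OF GW]] V
      by simp_all
    have F: "continuous_on UNIV (\<lambda>q. hv (t, G t q))"
      by (rule continuous_on_compose2[OF FF.continuous_on_F]) (use t in_K[OF t] in \<open>auto intro!: continuous_intros c\<close>)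
    have D: "continuous_on UNIV (\<lambda>q. (\<lambda>(x, h). FF.D (fst x) (snd x) h) ((t, G t q), W1 t q))"
      by (rule continuous_on_compose2[OF FF.continuous_on_D]) (use t in_K[OF t] in \<open>auto intro!: continuous_intros c\<close>)
    have D': "continuous_on UNIV (\<lambda>q. FF.D t (G t q) (W1 t q))" using D by simp
    have om: "continuous_on UNIV (\<lambda>q. omega (Y q) (V q) (W q))"
      if "continuous_on UNIV Y" "continuous_on UNIV V" "continuous_on UNIV W" for Y V W :: "real \<times> real \<Rightarrow> ambient"
      unfolding omega_eq
      by (intro continuous_intros that bounded_bilinear.continuous_on[OF dq_bilinear] bounded_bilinear.continuous_on[OF bounded_bilinear_cross3]) auto
    show "continuous_on UNIV (\<lambda>q. f21 (fst q) (snd q))"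
      unfolding f21_def prod.collapse by (intro continuous_on_add om c F D' continuous_on_snd)
  qed
  from this[of "fst \<theta>" "snd \<theta>"] show ?thesis using mixed_symmetric[OF t, of "fst \<theta>" "snd \<theta>"] by (simp add: f12_def f21_def)
qed

text \<open>By \<open>hamiltonian_second_derivative\<close> the time derivative vanishes. At time
  zero the first vector has only a circle component and the second only a sphere component.\<close>

lemma lagrangian:
  assumes t: "t \<in> {0..1}"
  shows "omega (G t \<theta>) (W1 t \<theta>) (W2 t \<theta>) = 0"
proof -
  have d: "((\<lambda>t. omega (G t \<theta>) (W1 t \<theta>) (W2 t \<theta>)) has_vector_derivative 0) (at t within {0..1})" if t: "t \<in> {0..1}" for t
  proof -
    have "omega (G t \<theta>) (FF.D t (G t \<theta>) (W1 t \<theta>)) (W2 t \<theta>) + omega (G t \<theta>) (W1 t \<theta>) (FF.D t (G t \<theta>) (W2 t \<theta>)) = 0"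
      using hamiltonian_second_derivative[OF t, of \<theta>] omega_skew[of "G t \<theta>" "W1 t \<theta>" "FF.D t (G t \<theta>) (W2 t \<theta>)"] by simp
    then show ?thesis
      using omega_has_vector_derivative[OF FF.sol[OF t, of \<theta>] W1_sol[OF t, of \<theta>] W2_sol[OF t, of \<theta>]
          G_in[OF t] ham_vector_G(1)[OF t] tangent[OF t]] by simp
  qed
  obtain c where c: "\<And>t. t \<in> {0..1} \<Longrightarrow> omega (G t \<theta>) (W1 t \<theta>) (W2 t \<theta>) = c"
    using has_vector_derivative_zero_constant[of "{0..1}" "\<lambda>t. omega (G t \<theta>) (W1 t \<theta>) (W2 t \<theta>)"] d by auto
  have "omega (G 0 \<theta>) (W1 0 \<theta>) (W2 0 \<theta>) = 0"
    by (simp add: W0 omega_eq torus_d1_def torus_d2_def dq_def)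
  then show ?thesis using c[OF t] c[of 0] by simp
qed

text \<open>A linear combination of the variations solves the linearized equation, so if it vanishes
  at time \<open>t\<close> it vanishes at time zero, where the vectors are tangent to different
  factors.\<close>

lemma independent:
  assumes t: "t \<in> {0..1}" and z: "a *\<^sub>R W1 t \<theta> + b *\<^sub>R W2 t \<theta> = 0"
  shows "a = 0 \<and> b = 0"
proof -
  have "a *\<^sub>R W1 0 \<theta> + b *\<^sub>R W2 0 \<theta> = 0"
  proof (rule FF.variation_zero_backward[where W="\<lambda>t. a *\<^sub>R W1 t \<theta> + b *\<^sub>R W2 t \<theta>" and t=t and \<theta>=\<theta>])
    show "t \<in> {0..1}" "a *\<^sub>R W1 t \<theta> + b *\<^sub>R W2 t \<theta> = 0" by fact+
    fix t :: real assume t: "t \<in> {0..1}"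
    have l: "FF.D t (G t \<theta>) (a *\<^sub>R W1 t \<theta> + b *\<^sub>R W2 t \<theta>) = a *\<^sub>R FF.D t (G t \<theta>) (W1 t \<theta>) + b *\<^sub>R FF.D t (G t \<theta>) (W2 t \<theta>)"
      using FF.linear_D[OF t in_K[OF t]] by (simp add: linear_add linear_scale)
    show "((\<lambda>t. a *\<^sub>R W1 t \<theta> + b *\<^sub>R W2 t \<theta>) has_vector_derivative FF.D t (G t \<theta>) (a *\<^sub>R W1 t \<theta> + b *\<^sub>R W2 t \<theta>)) (at t within {0..1})"
      unfolding l by (intro has_vector_derivative_add bounded_linear.has_vector_derivative[OF bounded_linear_scaleR_right] W1_sol W2_sol t)
  qed
  then have 1: "a *\<^sub>R ((2 * pi) *\<^sub>R (\<i> * unit_circle (fst \<theta>))) = 0"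
    and 2: "b *\<^sub>R vec_of (fibre_radius x *\<^sub>R ((2 * pi) *\<^sub>R (\<i> * unit_circle (snd \<theta>)))) 0 = 0"
    by (simp_all add: W0 torus_d1_def torus_d2_def prod_eq_iff)
  have "norm (a *\<^sub>R ((2 * pi) *\<^sub>R (\<i> * unit_circle (fst \<theta>)))) = 0" using 1 by (simp only: norm_zero)
  moreover have "norm (b *\<^sub>R vec_of (fibre_radius x *\<^sub>R ((2 * pi) *\<^sub>R (\<i> * unit_circle (snd \<theta>)))) 0) = 0" using 2 by (simp only: norm_zero)
  ultimately show ?thesis using fibre_radius(1)[OF x] by (simp add: norm_mult)
qed

lemma periodic:
  assumes t: "t \<in> {0..1}" and k: "k \<in> int_lattice"
  shows "G t (\<theta> + k) = G t \<theta>" "W1 t (\<theta> + k) = W1 t \<theta>" "W2 t (\<theta> + k) = W2 t \<theta>"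
proof -
  have G: "G t (\<theta> + k) = G t \<theta>" for \<theta>
    using torus_pt_lattice[OF x k, of \<theta>] by (simp add: G_def add.commute)
  have e: "G t (\<theta> + k + s *\<^sub>R e) = G t (\<theta> + s *\<^sub>R e)" for s e
    using G[of "\<theta> + s *\<^sub>R e"] by (simp add: add_ac)
  show "G t (\<theta> + k) = G t \<theta>" by (rule G)
  show "W1 t (\<theta> + k) = W1 t \<theta>"
    using vector_derivative_unique_at[OF G_line_deriv(1)[OF t, of "\<theta> + k" 0, unfolded e] G_line_deriv(1)[OF t, of \<theta> 0]] by simp
  show "W2 t (\<theta> + k) = W2 t \<theta>"
    using vector_derivative_unique_at[OF G_line_deriv(2)[OF t, of "\<theta> + k" 0, unfolded e] G_line_deriv(2)[OF t, of \<theta> 0]] by simp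
qed

definition frame :: "real \<Rightarrow> real \<times> real \<Rightarrow> real^3" where
  "frame t \<theta> = complex_det (G t \<theta>) (W1 t \<theta>) (W2 t \<theta>) /\<^sub>R norm (complex_det (G t \<theta>) (W1 t \<theta>) (W2 t \<theta>))"

lemma complex_det_frame_nonzero: "t \<in> {0..1} \<Longrightarrow> complex_det (G t \<theta>) (W1 t \<theta>) (W2 t \<theta>) \<noteq> 0"
  by (rule complex_det_nonzero[OF G_in tangent lagrangian independent])

lemma norm_frame: "t \<in> {0..1} \<Longrightarrow> norm (frame t \<theta>) = 1"
  using complex_det_frame_nonzero by (simp add: frame_def)

lemma frame_orthogonal:
  assumes t: "t \<in> {0..1}"
  shows "snd (snd (G t \<theta>)) \<bullet> frame t \<theta> = 0"
proof -
  have o: "snd (snd (G t \<theta>)) \<bullet> snd (snd (W1 t \<theta>)) = 0" "snd (snd (G t \<theta>)) \<bullet> snd (snd (W2 t \<theta>)) = 0"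
    using tangent[OF t, of \<theta>] by (cases "G t \<theta>"; cases "W1 t \<theta>"; cases "W2 t \<theta>"; simp)+
  show ?thesis by (simp add: frame_def complex_det_def inner_add_right inner_diff_right o dot_cross_self)
qed

text \<open>The determinant is assembled from the triple of \<open>G\<close>, \<open>W1\<close> and
  \<open>W2\<close> by bilinear operations. Here the second variation enters: differentiating the
  frame along a loop differentiates \<open>W1\<close> and \<open>W2\<close>.\<close>

lemma frame_C11:
  assumes "e = (1, 0) \<or> e = (0, 1)"
  shows "\<exists>wt ws wm. C11 (\<lambda>t s. frame t (\<theta> + s *\<^sub>R e)) wt ws wm"
proof -
  obtain Y Yt Ys Ym where Y: "C11 Y Yt Ys Ym" and e: "Y = (\<lambda>t s. (G t (\<theta> + s *\<^sub>R e), W1 t (\<theta> + s *\<^sub>R e), W2 t (\<theta> + s *\<^sub>R e)))"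
    using triple1[of \<theta>] triple2[of \<theta>] assms by blast
  note f = C11_linear[OF bounded_linear_fst] and sn = C11_linear[OF bounded_linear_snd]
  note S = C11_bilinear[OF bounded_bilinear_scaleR] and Q = C11_bilinear[OF dq_bilinear] and X = C11_bilinear[OF bounded_bilinear_cross3]
  note z = f[OF f[OF Y]] and u = sn[OF sn[OF f[OF Y]]]
  note a1 = f[OF f[OF sn[OF Y]]] and p1 = f[OF sn[OF f[OF sn[OF Y]]]] and u1 = sn[OF sn[OF f[OF sn[OF Y]]]]
  note a2 = f[OF sn[OF sn[OF Y]]] and p2 = f[OF sn[OF sn[OF sn[OF Y]]]] and u2 = sn[OF sn[OF sn[OF sn[OF Y]]]]
  note d = C11_diff[OF C11_diff[OF C11_add[OF S[OF Q[OF z a1] u2] S[OF p1 X[OF u u2]]] S[OF Q[OF z a2] u1]] S[OF p2 X[OF u u1]]]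
  have "\<exists>vt vs vm. C11 (\<lambda>t s. complex_det (fst (Y t s)) (fst (snd (Y t s))) (snd (snd (Y t s)))) vt vs vm"
    unfolding complex_det_def by (rule exI, rule exI, rule exI, rule d)
  then obtain vt vs vm where "C11 (\<lambda>t s. complex_det (fst (Y t s)) (fst (snd (Y t s))) (snd (snd (Y t s)))) vt vs vm" by blast
  from C11_normalize[OF this] show ?thesis
    using complex_det_frame_nonzero by (simp add: e frame_def)
qed

text \<open>When the torus is a toric fibre, momentum and height are constant along it, so its
  tangent vectors have no momentum part and horizontal sphere parts. The determinant is then
  horizontal, and orthogonality to \<open>u\<close> fixes its direction.\<close>

lemma frame_end:
  assumes t: "t \<in> {0..1}" and y: "\<bar>snd y\<bar> < 1" and im: "\<And>\<theta>. G t \<theta> \<in> toric_fibre y"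
    and b: "snd (snd (G t \<theta>)) = vec_of (fibre_radius y *\<^sub>R unit_circle b) h"
  shows "\<exists>\<sigma>. frame t \<theta> = \<sigma> *\<^sub>R vec_of (\<i> * unit_circle b) 0"
proof -
  have m: "fst (snd (G t \<theta>)) = fst y" "snd (snd (G t \<theta>)) $ 3 = snd y" for \<theta>
    using im[of \<theta>] by (cases "G t \<theta>"; cases y; auto simp: toric_fibre_def)+
  have c: "fst (snd c') = 0 \<and> snd (snd c') $ 3 = 0"
    if "((\<lambda>s. G t (\<theta> + s *\<^sub>R e)) has_vector_derivative c') (at (0::real))" for e c'
  proof -
    have "((\<lambda>s. fst (snd (G t (\<theta> + s *\<^sub>R e)))) has_vector_derivative fst (snd c')) (at 0)"
      by (intro bounded_linear.has_vector_derivative[OF bounded_linear_fst] bounded_linear.has_vector_derivative[OF bounded_linear_snd] that)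
    moreover have "((\<lambda>s. snd (snd (G t (\<theta> + s *\<^sub>R e))) $ 3) has_vector_derivative snd (snd c') $ 3) (at 0)"
      by (intro bounded_linear.has_vector_derivative[OF bounded_linear_vec_nth] bounded_linear.has_vector_derivative[OF bounded_linear_snd] that)
    ultimately show ?thesis
      unfolding m using vector_derivative_unique_at[OF _ has_vector_derivative_const] by blast
  qed
  have 1: "fst (snd (W1 t \<theta>)) = 0" "snd (snd (W1 t \<theta>)) $ 3 = 0" "fst (snd (W2 t \<theta>)) = 0" "snd (snd (W2 t \<theta>)) $ 3 = 0"
    using c[OF G_line_deriv(1)[OF t, of \<theta> 0]] c[OF G_line_deriv(2)[OF t, of \<theta> 0]] by simp_all
  have "frame t \<theta> $ 3 = 0" by (simp add: frame_def complex_det_def 1)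
  from horizontal_tangent[OF b fibre_radius(1)[OF y] frame_orthogonal[OF t] this] show ?thesis by blast
qed

end

subsection \<open>The action, winding and spin constraints on loops\<close>

lemma strip_continuous_slice:
  assumes "strip_continuous f" "t \<in> {0..1}"
  shows "continuous_on S (f t)"
proof -
  have "continuous_on S (\<lambda>s. (\<lambda>x. f (fst x) (snd x)) (t, s))"
    by (rule continuous_on_compose2[OF assms(1)[unfolded strip_continuous_def]]) (use assms(2) in \<open>auto intro!: continuous_intros\<close>)
  then show ?thesis by simp
qed

context ham_second
begin

text \<open>The lift \<open>F\<close> describes the image in the fibre over \<open>y\<close> of the
  basic loop \<open>e\<close>. Winding number, action and frame class are evaluated on
  \<open>e\<close> at time zero and on \<open>F\<close> at time one.\<close>

lemma loop_invariants:
  fixes e :: "real \<times> real" and F :: "real \<Rightarrow> real \<times> real" and b :: int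
  assumes e: "e = (1, 0) \<or> e = (0, 1)" and y: "\<bar>snd y\<bar> < 1" and im: "\<phi> ` toric_fibre x \<subseteq> toric_fibre y"
    and F: "continuous_on UNIV F" "\<And>s. \<phi> (torus_pt x (s *\<^sub>R e)) = torus_pt y (F s)"
    and b: "snd (F 1) - snd (F 0) = of_int b"
  shows "fst (F 1) - fst (F 0) = fst e"
    and "fst y * fst e + snd y * of_int b = fst x * fst e + snd x * snd e"
    and "even b \<longleftrightarrow> snd e = 0"
proof -
  note f = C11_linear[OF bounded_linear_fst] and sn = C11_linear[OF bounded_linear_snd]
  have "\<exists>W Wm. C11 (\<lambda>t s. G t (s *\<^sub>R e)) (\<lambda>t s. hv (t, G t (s *\<^sub>R e))) W Wm"
    using e line1[of 0] line2[of 0] unfolding add_0 by blast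
  then obtain W Wm where C: "C11 (\<lambda>t s. G t (s *\<^sub>R e)) (\<lambda>t s. hv (t, G t (s *\<^sub>R e))) W Wm" by blast
  obtain wt ws wm where w: "C11 (\<lambda>t s. frame t (s *\<^sub>R e)) wt ws wm"
    using frame_C11[OF e, of 0] by auto
  have k: "e \<in> int_lattice" using e by (auto simp: mem_int_lattice)
  have per: "G t e = G t 0" "frame t e = frame t 0" if "t \<in> {0..1}" for t
    using periodic[OF that k, of 0] by (simp_all add: frame_def)
  have tan: "W t s \<in> tangent_space (G t (s *\<^sub>R e))" if "t \<in> {0..1}" for t s
    using curve_tangent[OF C11_deriv(2)[OF C that] G_in[OF that]] .
  have norms: "norm (fst (G t \<theta>)) = 1" "norm (snd (snd (G t \<theta>))) = 1" if "t \<in> {0..1}" for t \<theta>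
    using G_in[OF that, of \<theta>] by (cases "G t \<theta>"; simp add: TS1xS2_def)+
  interpret L: framed_loop_family
    "\<lambda>t s. fst (G t (s *\<^sub>R e))" "\<lambda>t s. fst (hv (t, G t (s *\<^sub>R e)))" "\<lambda>t s. fst (W t s)" "\<lambda>t s. fst (Wm t s)"
    "\<lambda>t s. fst (snd (G t (s *\<^sub>R e)))" "\<lambda>t s. fst (snd (hv (t, G t (s *\<^sub>R e))))" "\<lambda>t s. fst (snd (W t s))" "\<lambda>t s. fst (snd (Wm t s))"
    "\<lambda>t s. snd (snd (G t (s *\<^sub>R e)))" "\<lambda>t s. snd (snd (hv (t, G t (s *\<^sub>R e))))" "\<lambda>t s. snd (snd (W t s))" "\<lambda>t s. snd (snd (Wm t s))"
    "\<lambda>t s. frame t (s *\<^sub>R e)" wt ws wm "\<lambda>t s. H t (G t (s *\<^sub>R e))"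
  proof
    fix t s :: real assume t: "t \<in> {0..1}"
    show "((\<lambda>s. H t (G t (s *\<^sub>R e))) has_vector_derivative
       omega (fst (G t (s *\<^sub>R e)), fst (snd (G t (s *\<^sub>R e))), snd (snd (G t (s *\<^sub>R e))))
         (fst (hv (t, G t (s *\<^sub>R e))), fst (snd (hv (t, G t (s *\<^sub>R e)))), snd (snd (hv (t, G t (s *\<^sub>R e)))))
         (fst (W t s), fst (snd (W t s)), snd (snd (W t s)))) (at s)"
      using vector_derivative_diff_chain_within[OF C11_deriv(2)[OF C t]
          has_derivative_at_withinI[OF HH_has_derivative[OF in_U[OF t G_in[OF t]]]]] ham_vector_G(2)[OF t tan[OF t]]
      by (simp add: o_def)
  qed (use per norms norm_frame frame_orthogonal in \<open>auto simp: dot_square_norm intro!: f sn C w\<close>)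
  \<comment> \<open>Stated for a general time and fibre, to be used at time zero with the fibre over
    \<open>x\<close> and at time one with the fibre over \<open>y\<close>.\<close>
  have E: "integral {0..1} (\<lambda>s. fst (snd (G i (s *\<^sub>R e))) * dq (fst (G i (s *\<^sub>R e))) (fst (W i s)) +
        ws i s \<bullet> cross3 (snd (snd (G i (s *\<^sub>R e)))) (frame i (s *\<^sub>R e)) / (2 * pi)) =
        fst y * (fst (Fi 1) - fst (Fi 0)) + snd y * (snd (Fi 1) - snd (Fi 0))"
      "\<exists>\<sigma>. \<sigma> \<in> {1, - 1} \<and> (\<forall>s. frame i (s *\<^sub>R e) = \<sigma> *\<^sub>R vec_of (\<i> * unit_circle (snd (Fi s))) 0)"
      "integral {0..1} (\<lambda>s. dq (fst (G i (s *\<^sub>R e))) (fst (W i s))) = fst (Fi 1) - fst (Fi 0)"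
    if i: "i \<in> {0..1}" and y: "\<bar>snd y\<bar> < 1" and Fi: "continuous_on UNIV Fi" "\<And>s. G i (s *\<^sub>R e) = torus_pt y (Fi s)"
      and im: "\<And>\<theta>. G i \<theta> \<in> toric_fibre y" for i y Fi
  proof -
    have p: "fst (snd (G i (s *\<^sub>R e))) = fst y" for s by (simp add: Fi(2) torus_pt_unit_circle)
    note A = end_action[where z="\<lambda>s. fst (G i (s *\<^sub>R e))" and zs="\<lambda>s. fst (W i s)" and u="\<lambda>s. snd (snd (G i (s *\<^sub>R e)))"
        and us="\<lambda>s. snd (snd (W i s))" and w="\<lambda>s. frame i (s *\<^sub>R e)" and ws="\<lambda>s. ws i s" and \<alpha>="\<lambda>s. fst (Fi s)"
        and \<beta>="\<lambda>s. snd (Fi s)" and r="fibre_radius y" and h="snd y"]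
    have 1: "((\<lambda>s. fst (G i (s *\<^sub>R e))) has_vector_derivative fst (W i s)) (at s)" for s
      by (rule C11_deriv(2)[OF f[OF C] i])
    have 2: "continuous_on {0..1} (\<lambda>s. fst (W i s))" by (rule strip_continuous_slice[OF C11_cont(3)[OF f[OF C]] i])
    have 3: "((\<lambda>s. snd (snd (G i (s *\<^sub>R e)))) has_vector_derivative snd (snd (W i s))) (at s)" for s
      by (rule C11_deriv(2)[OF sn[OF sn[OF C]] i])
    have 4: "continuous_on {0..1} (\<lambda>s. snd (snd (W i s)))" by (rule strip_continuous_slice[OF C11_cont(3)[OF sn[OF sn[OF C]]] i])
    have 5: "((\<lambda>s. frame i (s *\<^sub>R e)) has_vector_derivative ws i s) (at s)" for s by (rule C11_deriv(2)[OF w i])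
    have 6: "norm (frame i (s *\<^sub>R e)) = 1" for s by (rule norm_frame[OF i])
    have 7: "continuous_on UNIV (\<lambda>s. fst (Fi s))" "continuous_on UNIV (\<lambda>s. snd (Fi s))" by (intro continuous_intros Fi(1))+
    have 8: "fst (G i (s *\<^sub>R e)) = unit_circle (fst (Fi s))"
      "snd (snd (G i (s *\<^sub>R e))) = vec_of (fibre_radius y *\<^sub>R unit_circle (snd (Fi s))) (snd y)" for s
      by (simp_all add: Fi(2) torus_pt_unit_circle)
    have 9: "\<exists>\<sigma>. frame i (s *\<^sub>R e) = \<sigma> *\<^sub>R vec_of (\<i> * unit_circle (snd (Fi s))) 0" for s
      by (rule frame_end[OF i y im 8(2)])
    show "integral {0..1} (\<lambda>s. fst (snd (G i (s *\<^sub>R e))) * dq (fst (G i (s *\<^sub>R e))) (fst (W i s)) +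
        ws i s \<bullet> cross3 (snd (snd (G i (s *\<^sub>R e)))) (frame i (s *\<^sub>R e)) / (2 * pi)) =
        fst y * (fst (Fi 1) - fst (Fi 0)) + snd y * (snd (Fi 1) - snd (Fi 0))"
      "\<exists>\<sigma>. \<sigma> \<in> {1, - 1} \<and> (\<forall>s. frame i (s *\<^sub>R e) = \<sigma> *\<^sub>R vec_of (\<i> * unit_circle (snd (Fi s))) 0)"
      "integral {0..1} (\<lambda>s. dq (fst (G i (s *\<^sub>R e))) (fst (W i s))) = fst (Fi 1) - fst (Fi 0)"
      unfolding p by (rule A[OF 1 2 3 4 5 6 7(1) 8(1) 7(2) 8(2) fibre_radius(1)[OF y] 9])+
  qed
  have F0: "continuous_on UNIV (\<lambda>s. s *\<^sub>R e)" "\<And>s. G 0 (s *\<^sub>R e) = torus_pt x (s *\<^sub>R e)" "\<And>\<theta>. G 0 \<theta> \<in> toric_fibre x"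
    by (intro continuous_intros) (simp_all add: G_0 torus_pt_in[OF x])
  have F1: "\<And>s. G 1 (s *\<^sub>R e) = torus_pt y (F s)" "\<And>\<theta>. G 1 \<theta> \<in> toric_fibre y"
    using F(2) im torus_pt_in[OF x] by (auto simp: G_1)
  note E0 = E[of 0 x "\<lambda>s. s *\<^sub>R e", OF _ x F0] and E1 = E[of 1 y F, OF _ y F(1) F1]
  show w1: "fst (F 1) - fst (F 0) = fst e"
    using L.winding_constant E0(3) E1(3) by simp
  show "fst y * fst e + snd y * of_int b = fst x * fst e + snd x * snd e"
    using L.action_constant E0(1) E1(1) by (simp add: w1 b)
  obtain \<sigma>0 where \<sigma>0: "frame 0 (s *\<^sub>R e) = \<sigma>0 *\<^sub>R vec_of (\<i> * unit_circle (snd (s *\<^sub>R e))) 0" for s using E0(2) by auto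
  obtain \<sigma>1 where \<sigma>1: "frame 1 (s *\<^sub>R e) = \<sigma>1 *\<^sub>R vec_of (\<i> * unit_circle (snd (F s))) 0" for s using E1(2) by auto
  define Z where "Z q = frame_null (snd (snd (G (fst q) (snd q *\<^sub>R e)))) (frame (fst q) (snd q *\<^sub>R e))" for q
  \<comment> \<open>Passes from the angle measured absolutely to the angle relative to the start of
    the loop.\<close>
  have turn: "(cis (- (2 * pi * c)) * A, cis (2 * pi * c) * B', C') =
      (case (cis (- (2 * pi * c0)) * A, cis (2 * pi * c0) * B', C') of (f, g, h) \<Rightarrow>
        (cis (- (2 * pi * (c - c0))) * f, cis (2 * pi * (c - c0)) * g, h))" for c c0 and A B' C' :: complex
    by (simp add: cis_mult algebra_simps flip: mult.assoc)
  \<comment> \<open>Number of turns of the frame along the initial loop: none for the circle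
    direction, one for the sphere direction.\<close>
  define b0 :: int where "b0 = (if snd e = 0 then 0 else 1)"
  have "even b0 \<longleftrightarrow> even b"
  proof (rule homotopy_parity[where Z=Z and ?\<phi>0.0="\<lambda>s. 2 * pi * (snd (s *\<^sub>R e) - snd ((0::real) *\<^sub>R e))" and ?\<phi>1.0="\<lambda>s. 2 * pi * (snd (F s) - snd (F 0))"])
    have c: "continuous_on ({0..1} \<times> {0..1}) (\<lambda>q. snd (snd (G (fst q) (snd q *\<^sub>R e))))"
      "continuous_on ({0..1} \<times> {0..1}) (\<lambda>q. frame (fst q) (snd q *\<^sub>R e))"
      using C11_cont(1)[OF sn[OF sn[OF C]]] C11_cont(1)[OF w] unfolding strip_continuous_def
      by (auto elim: continuous_on_subset)
    show "continuous_on ({0..1} \<times> {0..1}) Z" unfolding Z_def by (rule frame_null_continuous[OF c])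
    show "Z q \<in> null_cone" if "q \<in> {0..1} \<times> {0..1}" for q
    proof -
      have q: "fst q \<in> {0..1}" using that by auto
      show ?thesis
        unfolding Z_def by (rule frame_null_in) (simp_all add: dot_square_norm norms[OF q] norm_frame[OF q] frame_orthogonal[OF q])
    qed
    show "Z (t, 1) = Z (t, 0)" if "t \<in> {0..1}" for t using per[OF that] by (simp add: Z_def)
    show "continuous_on {0..1} (\<lambda>s. 2 * pi * (snd (s *\<^sub>R e) - snd ((0::real) *\<^sub>R e)))" by (intro continuous_intros)
    show "continuous_on {0..1} (\<lambda>s. 2 * pi * (snd (F s) - snd (F 0)))"
      by (intro continuous_intros continuous_on_subset[OF F(1)]) auto
    show "2 * pi * (snd ((1::real) *\<^sub>R e) - snd ((0::real) *\<^sub>R e)) = 2 * pi * of_int b0"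
      using e by (auto simp: b0_def)
    have Z0: "Z (0, s) = (cis (- (2 * pi * snd (s *\<^sub>R e))) * (- \<i> * \<sigma>0 * (1 + snd x) / 2),
        cis (2 * pi * snd (s *\<^sub>R e)) * (- \<i> * \<sigma>0 * (1 - snd x) / 2), - \<i> * fibre_radius x * \<sigma>0 / 2)" for s
      unfolding Z_def fst_conv snd_conv \<sigma>0 F0(2) torus_pt_unit_circle by (rule frame_null_end)
    show "Z (0, s) = (case Z (0, 0) of (f, g, h) \<Rightarrow> (cis (- (2 * pi * (snd (s *\<^sub>R e) - snd ((0::real) *\<^sub>R e)))) * f,
        cis (2 * pi * (snd (s *\<^sub>R e) - snd ((0::real) *\<^sub>R e))) * g, h))" for s
      unfolding Z0 by (rule turn)
    have Z1: "Z (1, s) = (cis (- (2 * pi * snd (F s))) * (- \<i> * \<sigma>1 * (1 + snd y) / 2),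
        cis (2 * pi * snd (F s)) * (- \<i> * \<sigma>1 * (1 - snd y) / 2), - \<i> * fibre_radius y * \<sigma>1 / 2)" for s
      unfolding Z_def fst_conv snd_conv \<sigma>1 F1(1) torus_pt_unit_circle by (rule frame_null_end)
    show "Z (1, s) = (case Z (1, 0) of (f, g, h) \<Rightarrow> (cis (- (2 * pi * (snd (F s) - snd (F 0)))) * f,
        cis (2 * pi * (snd (F s) - snd (F 0))) * g, h))" for s
      unfolding Z1 by (rule turn)
  qed (simp_all add: b)
  then show "even b \<longleftrightarrow> snd e = 0" by (simp add: b0_def split: if_splits)
qed

end

subsection \<open>Constraints on Hamiltonian diffeomorphisms between fibres\<close>

lemma compact_toric_fibre: "compact (toric_fibre y)"
proof -
  have "closed {v :: ambient. fst (snd v) = fst y \<and> snd (snd v) $ 3 = snd y}"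
    by (intro closed_Collect_conj closed_Collect_eq continuous_intros)
  moreover have "toric_fibre y = {v \<in> TS1xS2. \<bar>fst (snd v)\<bar> \<le> \<bar>fst y\<bar>} \<inter> {v. fst (snd v) = fst y \<and> snd (snd v) $ 3 = snd y}"
    by (cases y) (auto simp: toric_fibre_def)
  ultimately show ?thesis using compact_Int_closed[OF compact_momentum_bounded] by simp
qed

text \<open>The displacement of a lift over a period is a continuous function with values in the
  lattice, hence constant.\<close>

lemma lift_periods:
  assumes F: "continuous_on UNIV (F :: real \<times> real \<Rightarrow> real \<times> real)" and y: "\<bar>snd y\<bar> < 1"
    and per: "\<And>\<theta>. torus_pt y (F (\<theta> + k)) = torus_pt y (F \<theta>)"
  shows "F (\<theta> + k) - F \<theta> \<in> int_lattice" "F (\<theta> + k) - F \<theta> = F k - F 0"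
proof -
  have i: "fst (F (\<theta> + k) - F \<theta>) \<in> \<int>" "snd (F (\<theta> + k) - F \<theta>) \<in> \<int>" for \<theta>
    using per[of \<theta>] by (simp_all add: torus_pt_eq_iff[OF y])
  then show "F (\<theta> + k) - F \<theta> \<in> int_lattice" by (simp add: mem_int_lattice)
  have c: "continuous_on UNIV (\<lambda>\<theta>. F (\<theta> + k) - F \<theta>)"
    by (intro continuous_intros F continuous_on_compose2[OF F]) auto
  have "fst (F (\<theta> + k) - F \<theta>) = fst (F (0 + k) - F 0)"
    by (rule integer_valued_constant[of UNIV "\<lambda>\<theta>. fst (F (\<theta> + k) - F \<theta>)", OF connected_UNIV continuous_on_fst[OF c] i(1)]) simp_all
  moreover have "snd (F (\<theta> + k) - F \<theta>) = snd (F (0 + k) - F 0)"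
    by (rule integer_valued_constant[of UNIV "\<lambda>\<theta>. snd (F (\<theta> + k) - F \<theta>)", OF connected_UNIV continuous_on_snd[OF c] i(2)]) simp_all
  ultimately show "F (\<theta> + k) - F \<theta> = F k - F 0" by (simp add: prod_eq_iff)
qed

lemma integer_period_additive:
  fixes P :: "'a::real_vector \<Rightarrow> 'b::real_vector"
  assumes per: "\<And>\<theta>. P (\<theta> + k) - P \<theta> = c"
  shows "P (\<theta> + of_int n *\<^sub>R k) - P \<theta> = of_int n *\<^sub>R c"
proof (induction n rule: int_induct[where k=0])
  case base then show ?case by simp
next
  case (step1 n)
  have "P (\<theta> + of_int (n + 1) *\<^sub>R k) - P \<theta> = (P ((\<theta> + of_int n *\<^sub>R k) + k) - P (\<theta> + of_int n *\<^sub>R k)) + (P (\<theta> + of_int n *\<^sub>R k) - P \<theta>)"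
    by (simp add: scaleR_add_left add_ac)
  then show ?case by (simp only: per step1) (simp add: scaleR_add_left)
next
  case (step2 n)
  have e: "\<theta> + of_int (n - 1) *\<^sub>R k + k = \<theta> + of_int n *\<^sub>R k" by (simp add: scaleR_diff_left add_ac)
  have "P (\<theta> + of_int (n - 1) *\<^sub>R k) - P \<theta> = (P (\<theta> + of_int n *\<^sub>R k) - P \<theta>) - (P ((\<theta> + of_int (n - 1) *\<^sub>R k) + k) - P (\<theta> + of_int (n - 1) *\<^sub>R k))"
    unfolding e by simp
  then show ?case by (simp only: per step2) (simp add: scaleR_diff_left)
qed

context ham_second
begin

text \<open>Gronwall bounds the distance at time one by a multiple of the distance at time zero, so
  the restriction to the fibre is Lipschitz.\<close>

lemma continuous_on_fibre: "continuous_on (toric_fibre x) \<phi>"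
proof -
  obtain E where E: "\<And>t \<theta> \<theta>'. t \<in> {0..1} \<Longrightarrow> norm (G t \<theta> - G t \<theta>') \<le> E * norm (G 0 \<theta> - G 0 \<theta>')"
    using FF.G_lipschitz by blast
  have "norm (\<phi> a - \<phi> b) \<le> max E 0 * norm (a - b)" if ab: "a \<in> toric_fibre x" "b \<in> toric_fibre x" for a b
  proof -
    obtain \<theta> \<theta>' where "a = torus_pt x \<theta>" "b = torus_pt x \<theta>'" using torus_pt_surj[OF x] ab by metis
    then have "norm (\<phi> a - \<phi> b) \<le> E * norm (a - b)" using E[of 1 \<theta> \<theta>'] by (simp add: G_1 G_0)
    also have "\<dots> \<le> max E 0 * norm (a - b)" by (intro mult_right_mono) auto
    finally show ?thesis .
  qed
  then have "(max E 0)-lipschitz_on (toric_fibre x) \<phi>"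
    by (intro lipschitz_onI) (simp_all add: dist_norm)
  then show ?thesis by (rule lipschitz_on_continuous_on)
qed

lemma inj_on_fibre: "inj_on \<phi> (toric_fibre x)"
proof (rule inj_onI)
  fix a b assume ab: "a \<in> toric_fibre x" "b \<in> toric_fibre x" "\<phi> a = \<phi> b"
  obtain \<theta> \<theta>' where e: "a = torus_pt x \<theta>" "b = torus_pt x \<theta>'" using torus_pt_surj[OF x] ab by metis
  then have "G 1 \<theta> = G 1 \<theta>'" using ab(3) by (simp add: G_1)
  then show "a = b" using FF.G_injective[of 1 \<theta> \<theta>'] by (simp add: e G_0)
qed

text \<open>The invariants of the two basic loops give everything except that \<open>d\<close> is a
  unit; parity alone leaves any odd number, and the action gives no bound when the heights vanish.
  Invertibility on the fibre supplies the rest through a lift \<open>P\<close> of the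
  inverse.\<close>

theorem fibre_constraint:
  assumes y: "\<bar>snd y\<bar> < 1" and im: "\<phi> ` toric_fibre x = toric_fibre y"
  shows "\<exists>(l::int) (d::int) F1 F2. d \<in> {1, - 1} \<and> even l \<and> snd x = of_int d * snd y \<and> fst x = fst y + of_int l * snd y \<and>
    continuous_on {0..1} F1 \<and> continuous_on {0..1} F2 \<and>
    (\<forall>s. \<phi> (torus_pt x (s, 0)) = torus_pt y (F1 s)) \<and> (\<forall>s. \<phi> (torus_pt x (0, s)) = torus_pt y (F2 s)) \<and>
    F1 1 - F1 (0::real) = (1, of_int l) \<and> F2 1 - F2 (0::real) = (0, of_int d)"
proof -
  have ct: "contractible (UNIV :: (real \<times> real) set)" by (rule convex_imp_contractible[OF convex_UNIV])
  have "continuous_on UNIV (\<lambda>\<theta>. \<phi> (torus_pt x \<theta>))"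
    by (rule continuous_on_compose2[OF continuous_on_fibre torus_pt_continuous[OF x]]) (use torus_pt_in[OF x] in auto)
  then obtain F where F: "continuous_on UNIV F" "\<And>\<theta>. torus_pt y (F \<theta>) = \<phi> (torus_pt x \<theta>)"
    using torus_pt_lift[OF y _ ct] im torus_pt_in[OF x] by (metis UNIV_I imageI)
  let ?\<psi> = "the_inv_into (toric_fibre x) \<phi>"
  have \<psi>c: "continuous_on (toric_fibre y) ?\<psi>"
    using continuous_on_inv_into[OF continuous_on_fibre compact_toric_fibre inj_on_fibre] by (simp add: im)
  have \<psi>in: "?\<psi> (torus_pt y \<theta>) \<in> toric_fibre x" for \<theta>
    by (rule the_inv_into_into[OF inj_on_fibre _ subset_refl]) (simp add: im torus_pt_in[OF y])
  have \<psi>T: "continuous_on UNIV (\<lambda>\<theta>. ?\<psi> (torus_pt y \<theta>))"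
    by (rule continuous_on_compose2[OF \<psi>c torus_pt_continuous[OF y]]) (use torus_pt_in[OF y] in auto)
  obtain P where P: "continuous_on UNIV P" "\<And>\<theta>. torus_pt x (P \<theta>) = ?\<psi> (torus_pt y \<theta>)"
    using torus_pt_lift[OF x \<psi>T ct \<psi>in] by auto
  have PF: "torus_pt x (P (F \<theta>)) = torus_pt x \<theta>" for \<theta>
    using the_inv_into_f_f[OF inj_on_fibre torus_pt_in[OF x, of \<theta>]] by (simp add: P(2) F(2))
  have perx: "torus_pt x (\<theta> + k) = torus_pt x \<theta>" and pery: "torus_pt y (\<theta> + k) = torus_pt y \<theta>" if "k \<in> int_lattice" for \<theta> k
    using torus_pt_lattice[OF x that, of \<theta>] torus_pt_lattice[OF y that, of \<theta>] by (simp_all add: add.commute)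
  have k1: "(1, 0) \<in> int_lattice" and k2: "(0, 1) \<in> int_lattice" by (simp_all add: mem_int_lattice)
  have lF: "F k - F 0 \<in> int_lattice" if "k \<in> int_lattice" for k
    using lift_periods(1)[OF F(1) y, of k 0] perx[OF that] by (simp add: F(2))
  obtain l :: int where l: "snd (F (1, 0)) - snd (F 0) = of_int l"
    using lF[OF k1] by (auto simp: mem_int_lattice elim: Ints_cases)
  obtain d :: int where d: "snd (F (0, 1)) - snd (F 0) = of_int d"
    using lF[OF k2] by (auto simp: mem_int_lattice elim: Ints_cases)
  have Fc: "continuous_on UNIV (\<lambda>s. F (s *\<^sub>R e))" for e
    by (rule continuous_on_compose2[OF F(1)]) (auto intro!: continuous_intros)
  have z: "F (0, 0) = F 0" by (simp only: zero_prod_def)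
  have A: "fst (F (1, 0)) - fst (F 0) = 1" "fst y + snd y * of_int l = fst x" "even l"
    using loop_invariants[where e="(1, 0)" and b=l, OF _ y _ Fc[of "(1, 0)"]] F(2) im l by (simp_all add: z)
  have B: "fst (F (0, 1)) - fst (F 0) = 0" "snd y * of_int d = snd x" "odd d"
    using loop_invariants[where e="(0, 1)" and b=d, OF _ y _ Fc[of "(0, 1)"]] F(2) im d by (simp_all add: z)
  have F01: "F (0, 1) = F 0 + of_int d *\<^sub>R (0, 1)"
    using B(1) d by (simp add: prod_eq_iff)
  \<comment> \<open>The displacement of the inverse lift over the second period; composing it with
    \<open>F\<close> multiplies it by \<open>d\<close>.\<close>
  define c where "c = P (0, 1) - P 0"
  have Pper: "P (\<theta> + (0, 1)) - P \<theta> = c" for \<theta>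
    unfolding c_def by (rule lift_periods(2)[OF P(1) x]) (simp only: P(2) pery[OF k2])
  have ci: "snd c \<in> \<int>"
    using lift_periods(1)[OF P(1) x, of "(0, 1)" 0] pery[OF k2] by (simp add: P(2) c_def mem_int_lattice)
  have "P (F (0, 1)) - P (F 0) = of_int d *\<^sub>R c"
    unfolding F01 by (rule integer_period_additive[of P "(0, 1)" c, OF Pper])
  \<comment> \<open>The map \<open>P\<close> after \<open>F\<close> is a lift of the identity, so it
    differs from the identity by a continuous lattice-valued function, which is constant.\<close>
  moreover have "P (F (0, 1)) - P (F 0) = (0, 1)"
  proof -
    let ?g = "\<lambda>\<theta>. P (F \<theta>) - \<theta>"
    have gc: "continuous_on UNIV ?g"
      by (intro continuous_intros continuous_on_compose2[OF P(1) F(1)]) auto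
    have gi: "fst (?g \<theta>) \<in> \<int>" "snd (?g \<theta>) \<in> \<int>" for \<theta>
      using PF[of \<theta>] by (simp_all add: torus_pt_eq_iff[OF x])
    have "fst (?g (0, 1)) = fst (?g 0)"
      by (rule integer_valued_constant[of UNIV "\<lambda>\<theta>. fst (?g \<theta>)", OF connected_UNIV continuous_on_fst[OF gc] gi(1)]) simp_all
    moreover have "snd (?g (0, 1)) = snd (?g 0)"
      by (rule integer_valued_constant[of UNIV "\<lambda>\<theta>. snd (?g \<theta>)", OF connected_UNIV continuous_on_snd[OF gc] gi(2)]) simp_all
    ultimately show ?thesis by (simp add: prod_eq_iff)
  qed
  ultimately have "of_int d * snd c = 1" by (metis snd_conv snd_scaleR real_scaleR_def)
  moreover obtain m :: int where m: "snd c = of_int m" using ci by (auto elim: Ints_cases)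
  ultimately have "d * m = 1" by (metis of_int_1 of_int_eq_iff of_int_mult)
  then have dd: "d \<in> {1, - 1}" using zmult_eq_1_iff[of d m] by auto
  show ?thesis
  proof (intro exI conjI allI)
    show "continuous_on {0..1} (\<lambda>s. F (s *\<^sub>R (1, 0)))" "continuous_on {0..1} (\<lambda>s. F (s *\<^sub>R (0, 1)))"
      by (rule continuous_on_subset[OF Fc subset_UNIV])+
    show "d \<in> {1, - 1}" by (rule dd)
    show "even l" by (rule A(3))
    show "snd x = of_int d * snd y" using B(2) by (simp add: mult.commute)
    show "fst x = fst y + of_int l * snd y" using A(2) by (simp add: mult.commute)
    show "F ((1::real) *\<^sub>R (1, 0)) - F ((0::real) *\<^sub>R (1, 0)) = (1, of_int l)" using A(1) l by (simp add: prod_eq_iff z)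
    show "F ((1::real) *\<^sub>R (0, 1)) - F ((0::real) *\<^sub>R (0, 1)) = (0, of_int d)" using B(1) d by (simp add: prod_eq_iff z)
  qed (simp_all add: F(2))
qed

end

text \<open>Unpacks \<open>hamiltonian_diffeo\<close>: one integral curve is chosen per point, a
  norm bound of the compact support bounds the momentum, and \<open>second_order_family\<close>
  supplies the variations.\<close>

theorem hamiltonian_fibre_constraint:
  assumes \<phi>: "hamiltonian_diffeo \<phi>" and x: "\<bar>snd x\<bar> < 1" and y: "\<bar>snd y\<bar> < 1" and im: "\<phi> ` toric_fibre x = toric_fibre y"
  shows "continuous_on (toric_fibre x) \<phi> \<and>
    (\<exists>(l::int) (d::int) F1 F2. d \<in> {1, - 1} \<and> even l \<and> snd x = of_int d * snd y \<and> fst x = fst y + of_int l * snd y \<and>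
    continuous_on {0..1} F1 \<and> continuous_on {0..1} F2 \<and>
    (\<forall>s. \<phi> (torus_pt x (s, 0)) = torus_pt y (F1 s)) \<and> (\<forall>s. \<phi> (torus_pt x (0, s)) = torus_pt y (F2 s)) \<and>
    F1 1 - F1 (0::real) = (1, of_int l) \<and> F2 1 - F2 (0::real) = (0, of_int d))"
proof -
  obtain H where H: "admissible_hamiltonian H" and flow: "\<forall>x\<in>TS1xS2. \<exists>\<gamma>. \<gamma> 0 = x \<and> \<gamma> 1 = \<phi> x \<and>
         (\<forall>t\<in>{0..1}. \<gamma> t \<in> TS1xS2 \<and>
           (\<exists>\<xi>. is_ham_vector (\<gamma> t) (frechet_derivative (H t) (at (\<gamma> t))) \<xi> \<and>
                (\<gamma> has_vector_derivative \<xi>) (at t within {0..1})))"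
    using \<phi> unfolding hamiltonian_diffeo_def by blast
  obtain U K where U: "{0..1} \<times> TS1xS2 \<subseteq> U" "smooth_on (\<lambda>(t, y). H t y) U"
    and K: "compact K" "\<forall>t\<in>{0..1}. \<forall>y\<in>TS1xS2 - K. H t y = 0"
    using H unfolding admissible_hamiltonian_def by blast
  obtain M where M: "\<And>v. v \<in> K \<Longrightarrow> norm v \<le> M"
    using compact_imp_bounded[OF K(1)] unfolding bounded_iff by blast
  have far: "H t v = 0" if "t \<in> {0..1}" "v \<in> TS1xS2" "\<bar>fst (snd v)\<bar> > M" for t v
  proof -
    have "\<bar>fst (snd v)\<bar> \<le> norm v" 
      using norm_fst_le[of "fst (snd v)" "snd (snd v)"] norm_snd_le[of "snd v" "fst v"] by simp
    then have "\<not> norm v \<le> M" using that(3) by linarith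
    then have "v \<notin> K" using M by blast
    then show ?thesis using K(2) that by blast
  qed
  obtain \<gamma> where \<gamma>: "\<forall>x\<in>TS1xS2. \<gamma> x 0 = x \<and> \<gamma> x 1 = \<phi> x \<and>
         (\<forall>t\<in>{0..1}. \<gamma> x t \<in> TS1xS2 \<and>
           (\<exists>\<xi>. is_ham_vector (\<gamma> x t) (frechet_derivative (H t) (at (\<gamma> x t))) \<xi> \<and>
                (\<gamma> x has_vector_derivative \<xi>) (at t within {0..1})))"
    using bchoice[OF flow] by blast
  interpret S: ham_setup H \<phi> U x \<gamma> M
    by unfold_locales (use U far x \<gamma> in auto)
  from S.second_order_family obtain W1 W2 V1 V2 M1 M2 where "ham_second H \<phi> U x \<gamma> M W1 W2 V1 V2 M1 M2"
    by (rule S.second_order_family) (rule that, unfold_locales)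
  then interpret ham_second H \<phi> U x \<gamma> M W1 W2 V1 V2 M1 M2 .
  show ?thesis using continuous_on_fibre fibre_constraint[OF y im] by blast
qed

subsection \<open>Realization and classification\<close>

lemma mem_interior_Delta: "x \<in> interior Delta \<longleftrightarrow> \<bar>snd x\<bar> < 1"
  by (cases x) (auto simp: Delta_def interior_Times)

text \<open>Every half turn reverses the height. The sign \<open>- 1\<close> therefore takes a
  single half turn, the sign \<open>1\<close> a composition of two.\<close>

lemma realization:
  fixes k s :: int
  assumes s: "s \<in> {1, - 1}"
  shows "\<exists>\<phi>. hamiltonian_diffeo \<phi> \<and> (\<forall>a b. \<phi> (torus_pt (x1, x2) (a, b)) =
    torus_pt (x1 + 2 * of_int k * x2, of_int s * x2) (a, of_int s * (b - 2 * of_int k * a)))"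
proof (cases "s = 1")
  case True
  \<comment> \<open>The first half turn has \<open>k = 0\<close> and only reverses the height. The
    second is taken with \<open>- k\<close> because it starts at height \<open>- x2\<close>, so its
    conserved quantity is \<open>x1 + of_int k * x2\<close>; each cutoff radius is the absolute
    value of that quantity, which puts the fibre on the plateau.\<close>
  define \<phi>1 where "\<phi>1 = turn_flow 0 \<bar>x1\<bar> 1"
  define \<phi>2 where "\<phi>2 = turn_flow (- k) \<bar>x1 + of_int k * x2\<bar> 1"
  have "\<phi>1 (torus_pt (x1, x2) (a, b)) = torus_pt (x1, - x2) (a, - b)" for a b
    using turn_flow_torus_pt[of x1 0 x2 "\<bar>x1\<bar>" a b] by (simp add: \<phi>1_def)
  moreover have "\<phi>2 (torus_pt (x1, - x2) (a, - b)) = torus_pt (x1 + 2 * of_int k * x2, x2) (a, b - 2 * of_int k * a)" for a b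
    using turn_flow_torus_pt[of x1 "- k" "- x2" "\<bar>x1 + of_int k * x2\<bar>" a "- b"] by (simp add: \<phi>2_def)
  ultimately have "\<forall>a b. (\<phi>2 \<circ> \<phi>1) (torus_pt (x1, x2) (a, b)) =
      torus_pt (x1 + 2 * of_int k * x2, of_int s * x2) (a, of_int s * (b - 2 * of_int k * a))"
    by (simp add: True)
  moreover have "hamiltonian_diffeo (\<phi>2 \<circ> \<phi>1)"
    unfolding \<phi>1_def \<phi>2_def by (rule hamiltonian_diffeo_compose[OF autonomous_diffeo_turn autonomous_diffeo_turn])
  ultimately show ?thesis by blast
next
  case False
  then have s: "s = - 1" using s by simp
  have "\<forall>a b. turn_flow k \<bar>x1 + of_int k * x2\<bar> 1 (torus_pt (x1, x2) (a, b)) =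
      torus_pt (x1 + 2 * of_int k * x2, of_int s * x2) (a, of_int s * (b - 2 * of_int k * a))"
    by (simp add: turn_flow_torus_pt s)
  then show ?thesis using hamiltonian_diffeo_autonomous[OF autonomous_diffeo_turn] by blast
qed

lemma toric_fibre_image:
  assumes x: "\<bar>snd x\<bar> < 1" and y: "\<bar>snd y\<bar> < 1" and s: "s \<in> {1, - 1 :: int}"
    and \<phi>: "\<And>a b. \<phi> (torus_pt x (a, b)) = torus_pt y (a, of_int s * (b - 2 * of_int k * a))"
  shows "\<phi> ` toric_fibre x = toric_fibre y"
proof -
  have "\<phi> ` range (torus_pt x) = range (torus_pt y)"
  proof
    show "\<phi> ` range (torus_pt x) \<subseteq> range (torus_pt y)" using \<phi> by auto
    have "torus_pt y (a, b) = \<phi> (torus_pt x (a, of_int s * b + 2 * of_int k * a))" for a b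
      using s by (auto simp: \<phi>)
    then show "range (torus_pt y) \<subseteq> \<phi> ` range (torus_pt x)" by auto
  qed
  then show ?thesis by (simp only: torus_pt_image[OF x] torus_pt_image[OF y])
qed

theorem frakH_eq:
  assumes "\<bar>x2\<bar> < 1"
  shows "frakH (x1, x2) = {(x1 + 2 * of_int k * x2, s * x2) | (k::int) s. s \<in> {1, -1}}"
proof
  show "frakH (x1, x2) \<subseteq> {(x1 + 2 * of_int k * x2, s * x2) | (k::int) s. s \<in> {1, -1}}"
  proof
    fix y assume "y \<in> frakH (x1, x2)"
    then obtain \<phi> where y: "\<bar>snd y\<bar> < 1" and \<phi>: "hamiltonian_diffeo \<phi>" "\<phi> ` toric_fibre (x1, x2) = toric_fibre y"
      by (auto simp: frakH_def mem_interior_Delta fibre_equiv_def)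
    obtain l d :: int where d: "d \<in> {1, - 1}" and l: "even l" and e: "x2 = of_int d * snd y" "x1 = fst y + of_int l * snd y"
      using hamiltonian_fibre_constraint[OF \<phi>(1) _ y \<phi>(2)] assms by auto
    obtain m where m: "l = 2 * m" using l by blast
    \<comment> \<open>Solved for \<open>y\<close>: as \<open>d\<close> is its own inverse, the
      height of \<open>y\<close> is \<open>d * x2\<close>, and subtracting \<open>2 * m\<close>
      times it from \<open>x1\<close> gives the witness \<open>- m * d\<close>.\<close>
    have "y = (x1 + 2 * of_int (- m * d) * x2, of_int d * x2)"
      using d by (auto simp: e m prod_eq_iff)
    moreover have "of_int d \<in> {1, - 1 :: real}" using d by auto
    ultimately show "y \<in> {(x1 + 2 * of_int k * x2, s * x2) | (k::int) s. s \<in> {1, -1}}" by blast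
  qed
  show "{(x1 + 2 * of_int k * x2, s * x2) | (k::int) s. s \<in> {1, -1}} \<subseteq> frakH (x1, x2)"
  proof
    fix y assume "y \<in> {(x1 + 2 * of_int k * x2, s * x2) | (k::int) s. s \<in> {1, -1}}"
    then obtain k :: int and r :: real where r: "r \<in> {1, - 1}" and y: "y = (x1 + 2 * of_int k * x2, r * x2)" by blast
    obtain s :: int where s: "s \<in> {1, - 1}" "r = of_int s"
      using r by (metis insert_iff of_int_1 of_int_minus singletonD)
    obtain \<phi> where \<phi>: "hamiltonian_diffeo \<phi>"
      "\<And>a b. \<phi> (torus_pt (x1, x2) (a, b)) = torus_pt y (a, of_int s * (b - 2 * of_int k * a))"
      using realization[OF s(1), of x1 x2 k] by (auto simp: y s(2))
    have sy: "\<bar>snd y\<bar> < 1" using assms r by (auto simp: y)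
    then have "\<phi> ` toric_fibre (x1, x2) = toric_fibre y"
      using toric_fibre_image[OF _ sy s(1) \<phi>(2)] assms by simp
    then show "y \<in> frakH (x1, x2)"
      using \<phi>(1) sy by (auto simp: frakH_def mem_interior_Delta fibre_equiv_def)
  qed
qed

lemma hom_induced_shear:
  fixes l d :: int
  assumes x: "\<bar>snd x\<bar> < 1" and c: "continuous_on (toric_fibre x) \<phi>" and im: "\<phi> ` toric_fibre x = toric_fibre x"
    and F1: "continuous_on {0..1} F1" "\<And>s. \<phi> (torus_pt x (s, 0)) = torus_pt x (F1 s)" "F1 1 - F1 0 = (1, of_int l)"
    and F2: "continuous_on {0..1} F2" "\<And>s. \<phi> (torus_pt x (0, s)) = torus_pt x (F2 s)" "F2 1 - F2 0 = (0, of_int d)"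
  shows "restrict (hom_induced 1 (top_of_set (toric_fibre x)) {} (top_of_set (toric_fibre x)) {} \<phi>) (carrier (H1 (toric_fibre x))) =
    matrix_on_H1 x (vector [vector [1, 0], vector [l, d]])"
  by (rule hom_induced_toric_fibre[OF x c _ F1(1,2) F2(1,2)]) (simp_all add: im F1(3) F2(3))

lemma monodromy_cases:
  assumes x: "\<bar>snd x\<bar> < 1" and \<phi>: "hamiltonian_diffeo \<phi>" "\<phi> ` toric_fibre x = toric_fibre x"
  obtains l d :: int where "d \<in> {1, - 1}" "even l" "snd x = of_int d * snd x" "of_int l * snd x = 0"
    "restrict (hom_induced 1 (top_of_set (toric_fibre x)) {} (top_of_set (toric_fibre x)) {} \<phi>) (carrier (H1 (toric_fibre x))) =
      matrix_on_H1 x (vector [vector [1, 0], vector [l, d]])"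
proof -
  obtain l d :: int and F1 F2 where c: "continuous_on (toric_fibre x) \<phi>" and d: "d \<in> {1, - 1}" "even l" "snd x = of_int d * snd x"
    "fst x = fst x + of_int l * snd x" and F: "continuous_on {0..1} F1" "continuous_on {0..1} F2"
    "\<And>s. \<phi> (torus_pt x (s, 0)) = torus_pt x (F1 s)" "\<And>s. \<phi> (torus_pt x (0, s)) = torus_pt x (F2 s)"
    "F1 1 - F1 (0::real) = (1, of_int l)" "F2 1 - F2 (0::real) = (0, of_int d)"
    using hamiltonian_fibre_constraint[OF \<phi>(1) x x \<phi>(2)] by blast
  show ?thesis
    by (rule that[OF d(1,2,3) _ hom_induced_shear[OF x c \<phi>(2) F(1,3,5,2,4,6)]]) (use d(4) in linarith)
qed

theorem ham_monodromy_trivial: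
  assumes x: "\<bar>snd x\<bar> < 1" and x0: "snd x \<noteq> 0"
  shows "ham_monodromy (toric_fibre x) = {\<one>\<^bsub>AutoGroup (H1 (toric_fibre x))\<^esub>}"
proof -
  have one: "restrict (hom_induced 1 (top_of_set (toric_fibre x)) {} (top_of_set (toric_fibre x)) {} \<phi>) (carrier (H1 (toric_fibre x))) =
      \<one>\<^bsub>AutoGroup (H1 (toric_fibre x))\<^esub>"
    if \<phi>: "hamiltonian_diffeo \<phi>" "\<phi> ` toric_fibre x = toric_fibre x" for \<phi>
  proof (rule monodromy_cases[OF x \<phi>])
    fix l d :: int
    assume d: "d \<in> {1, - 1}" "snd x = of_int d * snd x" and l: "of_int l * snd x = 0"
      and r: "restrict (hom_induced 1 (top_of_set (toric_fibre x)) {} (top_of_set (toric_fibre x)) {} \<phi>) (carrier (H1 (toric_fibre x))) =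
        matrix_on_H1 x (vector [vector [1, 0], vector [l, d]])"
    \<comment> \<open>Here the action decides: for nonzero height,
      \<open>of_int l * snd x = 0\<close> and \<open>snd x = of_int d * snd x\<close> determine both
      entries.\<close>
    have "l = 0" "d = 1" using d l x0 by auto
    then have "vector [vector [1, 0], vector [l, d]] = (mat 1 :: int^2^2)"
      by (simp add: vec_eq_iff forall_2 mat_def)
    then show ?thesis using r matrix_on_H1_id[OF x] by simp
  qed
  have "hamiltonian_diffeo (\<lambda>y. y)" by (rule hamiltonian_diffeo_autonomous[OF autonomous_diffeo_id])
  moreover have "(\<lambda>y. y) ` toric_fibre x = toric_fibre x" by simp
  ultimately have "\<one>\<^bsub>AutoGroup (H1 (toric_fibre x))\<^esub> \<in> ham_monodromy (toric_fibre x)"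
    unfolding ham_monodromy_def by (intro CollectI exI[of _ "\<lambda>y. y"] conjI one[symmetric])
  moreover have "g = \<one>\<^bsub>AutoGroup (H1 (toric_fibre x))\<^esub>" if g: "g \<in> ham_monodromy (toric_fibre x)" for g
  proof -
    obtain \<phi> where "hamiltonian_diffeo \<phi>" "\<phi> ` toric_fibre x = toric_fibre x"
      and e: "g = restrict (hom_induced 1 (top_of_set (toric_fibre x)) {} (top_of_set (toric_fibre x)) {} \<phi>) (carrier (H1 (toric_fibre x)))"
      using g unfolding ham_monodromy_def by blast
    from one[OF this(1,2)] show ?thesis by (simp only: e)
  qed
  ultimately show ?thesis by blast
qed

text \<open>At height zero the momentum shift \<open>2 * k * x2\<close> vanishes, so all the
  half-turn maps preserve the fibre; evenness of the lower left entry is the only restriction left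
  besides the sign.\<close>

theorem ham_monodromy_zero:
  "ham_monodromy (toric_fibre (x1, 0)) = {matrix_on_H1 (x1, 0) (vector [vector [1, 0], vector [2 * k, s]]) | k s. s \<in> {1, -1}}"
proof
  have x: "\<bar>snd (x1, 0::real)\<bar> < 1" by simp
  show "ham_monodromy (toric_fibre (x1, 0)) \<subseteq> {matrix_on_H1 (x1, 0) (vector [vector [1, 0], vector [2 * k, s]]) | k s. s \<in> {1, -1}}"
  proof
    fix g assume "g \<in> ham_monodromy (toric_fibre (x1, 0))"
    then obtain \<phi> where \<phi>: "hamiltonian_diffeo \<phi>" "\<phi> ` toric_fibre (x1, 0) = toric_fibre (x1, 0)"
      and g: "g = restrict (hom_induced 1 (top_of_set (toric_fibre (x1, 0))) {} (top_of_set (toric_fibre (x1, 0))) {} \<phi>)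
        (carrier (H1 (toric_fibre (x1, 0))))"
      unfolding ham_monodromy_def by blast
    show "g \<in> {matrix_on_H1 (x1, 0) (vector [vector [1, 0], vector [2 * k, s]]) | k s. s \<in> {1, -1}}"
    proof (rule monodromy_cases[OF x \<phi>])
      fix l d :: int
      assume d: "d \<in> {1, - 1}" and "even l"
        and r: "restrict (hom_induced 1 (top_of_set (toric_fibre (x1, 0))) {} (top_of_set (toric_fibre (x1, 0))) {} \<phi>)
          (carrier (H1 (toric_fibre (x1, 0)))) = matrix_on_H1 (x1, 0) (vector [vector [1, 0], vector [l, d]])"
      obtain k where "l = 2 * k" using \<open>even l\<close> by blast
      then show ?thesis using d unfolding g r by blast
    qed
  qed
  show "{matrix_on_H1 (x1, 0) (vector [vector [1, 0], vector [2 * k, s]]) | k s. s \<in> {1, -1}} \<subseteq> ham_monodromy (toric_fibre (x1, 0))"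
  proof
    fix g assume "g \<in> {matrix_on_H1 (x1, 0) (vector [vector [1, 0], vector [2 * k, s]]) | k s. s \<in> {1, -1}}"
    then obtain k s :: int where s: "s \<in> {1, - 1}" and g: "g = matrix_on_H1 (x1, 0) (vector [vector [1, 0], vector [2 * k, s]])" by blast
    \<comment> \<open>The parameter \<open>- k * s\<close> is chosen because
      \<open>realization\<close> multiplies the shear by the sign afterwards; as \<open>s\<close>
      squares to one, the entry becomes \<open>2 * k\<close>.\<close>
    obtain \<phi> where \<phi>: "hamiltonian_diffeo \<phi>"
      "\<And>a b. \<phi> (torus_pt (x1, 0) (a, b)) = torus_pt (x1, 0) (a, of_int s * (b - 2 * of_int (- k * s) * a))"
      using realization[OF s, of x1 0 "- k * s"] by auto
    have im: "\<phi> ` toric_fibre (x1, 0) = toric_fibre (x1, 0)"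
      by (rule toric_fibre_image[OF x x s \<phi>(2)])
    have c: "continuous_on (toric_fibre (x1, 0)) \<phi>"
      using hamiltonian_fibre_constraint[OF \<phi>(1) x x im] by blast
    have "restrict (hom_induced 1 (top_of_set (toric_fibre (x1, 0))) {} (top_of_set (toric_fibre (x1, 0))) {} \<phi>)
        (carrier (H1 (toric_fibre (x1, 0)))) = matrix_on_H1 (x1, 0) (vector [vector [1, 0], vector [2 * k, s]])"
    proof (rule hom_induced_shear[OF x c im])
      show "continuous_on {0..1} (\<lambda>a::real. (a, 2 * of_int k * a))" "continuous_on {0..1} (\<lambda>b::real. (0::real, of_int s * b))"
        by (intro continuous_intros)+
      show "\<phi> (torus_pt (x1, 0) (a, 0)) = torus_pt (x1, 0) (a, 2 * of_int k * a)" for a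
        using s by (auto simp: \<phi>(2))
      show "\<phi> (torus_pt (x1, 0) (0, b)) = torus_pt (x1, 0) (0, of_int s * b)" for b
        by (simp add: \<phi>(2))
    qed simp_all
    from this[symmetric] show "g \<in> ham_monodromy (toric_fibre (x1, 0))"
      unfolding ham_monodromy_def g by (intro CollectI exI[of _ \<phi>] conjI \<phi>(1) im)
  qed
qed

theorem proposition5p9:
  shows "(\<forall>x1 x2. (x1, x2) \<in> interior Delta \<longrightarrow>
            frakH (x1, x2) = {(x1 + 2 * of_int k * x2, s * x2) | (k::int) s. s \<in> {1, -1}}) \<and>
         (\<forall>x1 x2. (x1, x2) \<in> interior Delta \<longrightarrow> x2 \<noteq> 0 \<longrightarrow>
            ham_monodromy (toric_fibre (x1, x2)) =
              {\<one>\<^bsub>AutoGroup (H1 (toric_fibre (x1, x2)))\<^esub>}) \<and>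
         (\<forall>x1. ham_monodromy (toric_fibre (x1, 0)) =
            {matrix_on_H1 (x1, 0) (vector [vector [1, 0], vector [2 * k, s]]) | k s. s \<in> {1, -1}})"
proof (intro conjI allI impI)
  fix x1 x2 :: real assume x: "(x1, x2) \<in> interior Delta"
  then show "frakH (x1, x2) = {(x1 + 2 * of_int k * x2, s * x2) | (k::int) s. s \<in> {1, -1}}"
    by (intro frakH_eq) (simp add: mem_interior_Delta)
  show "ham_monodromy (toric_fibre (x1, x2)) = {\<one>\<^bsub>AutoGroup (H1 (toric_fibre (x1, x2)))\<^esub>}" if "x2 \<noteq> 0"
    by (rule ham_monodromy_trivial) (use x that in \<open>simp_all add: mem_interior_Delta\<close>)
qed (rule ham_monodromy_zero)

end
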